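(* The problem $\#\mathrm{EdgInj}(\mathcal{H})$ is $\#\mathrm{W}[1]$-complete if $\mathcal{H}$ is the class of all paths or the class of all cycles.
   Context: Graphs are undirected, simple and loop-free. A homomorphism from $H$ to $G$ is a map $\varphi:V(H)\to V(G)$ with $\{\varphi(u),\varphi(v)\}\in E(G)$ for all $\{u,v\}\in E(H)$; it is edge-injective if distinct edges of $H$ are mapped to distinct edges of $G$. $\#\mathrm{EdgInj}(\mathcal{H})$ is the problem: given $H\in\mathcal{H}$ and a graph $G$, compute the number of edge-injective homomorphisms from $H$ to $G$; the parameter is $|V(H)|$. $\#\mathrm{W}[1]$-hardness is with respect to fpt Turing reductions from counting $k$-cliques. *)

theory Defs
  imports "HOL-Library.FuncSet" "HOL-Library.Log_Nat"
begin

section \<open>Graphs, paths, cycles, edge-injective homomorphisms\<close>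

record 'a graph =
  verts :: "'a set"
  edges :: "'a set set"

definition simple_graph :: "'a graph \<Rightarrow> bool" where
  "simple_graph G \<longleftrightarrow> finite (verts G) \<and>
     edges G \<subseteq> {{u, v} |u v. u \<in> verts G \<and> v \<in> verts G \<and> u \<noteq> v}"

definition is_path :: "'a graph \<Rightarrow> bool" where
  "is_path G \<longleftrightarrow> (\<exists>xs. xs \<noteq> [] \<and> distinct xs \<and> verts G = set xs \<and>
     edges G = {{xs ! i, xs ! Suc i} |i. Suc i < length xs})"

definition is_cycle :: "'a graph \<Rightarrow> bool" where
  "is_cycle G \<longleftrightarrow> (\<exists>xs. 3 \<le> length xs \<and> distinct xs \<and> verts G = set xs \<and>
     edges G = {{xs ! i, xs ! (Suc i mod length xs)} |i. i < length xs})"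

definition homs :: "'a graph \<Rightarrow> 'b graph \<Rightarrow> ('a \<Rightarrow> 'b) set" where
  "homs H G = {\<phi> \<in> verts H \<rightarrow>\<^sub>E verts G. \<forall>u v. {u, v} \<in> edges H \<longrightarrow> {\<phi> u, \<phi> v} \<in> edges G}"

definition edge_inj_homs :: "'a graph \<Rightarrow> 'b graph \<Rightarrow> ('a \<Rightarrow> 'b) set" where
  "edge_inj_homs H G = {\<phi> \<in> homs H G. inj_on (\<lambda>e. \<phi> ` e) (edges H)}"

definition cliques :: "nat \<Rightarrow> 'a graph \<Rightarrow> 'a set set" where
  "cliques k G = {S. S \<subseteq> verts G \<and> card S = k \<and> (\<forall>u\<in>S. \<forall>v\<in>S. u \<noteq> v \<longrightarrow> {u, v} \<in> edges G)}"


section \<open>Machine model\<close>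

text \<open>
  Programs are imperative while-programs over binary trees with natural numbers at the leaves.
  Every evaluation step is charged the full size (in bits, for numbers) of the value it produces;
  in particular, copying a variable costs the size of its content. All primitives
  are polynomial-time computable in the sizes of their arguments and results, and
  a work tape is simulated by a pair of stacks, so running times agree with those of multi-tape
  Turing machines (with oracles) up to polynomial factors.
\<close>

datatype val = Atom nat | Node val val

text \<open>\<open>floorlog 2 n\<close> is the number of binary digits of \<open>n\<close> (and \<open>0\<close> for \<open>n = 0\<close>).\<close>

primrec vsize :: "val \<Rightarrow> nat" where
  "vsize (Atom n) = 1 + floorlog 2 n"
| "vsize (Node a b) = 1 + vsize a + vsize b"

datatype expr =
    Var nat
  | Const nat
  | MkNode expr expr
  | Left expr
  | Right expr
  | IsNode expr
  | Eq expr expr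
  | Less expr expr
  | Add expr expr
  | Sub expr expr
  | Mul expr expr
  | Div expr expr

type_synonym state = "nat \<Rightarrow> val"

text \<open>
  Operations applied to a value of the wrong shape return or use the default \<open>0\<close>. \<open>Eq\<close> compares
  whole trees, \<open>Sub\<close> is truncated, and division by \<open>0\<close> gives \<open>0\<close>.
\<close>

primrec the_num :: "val \<Rightarrow> nat" where
  "the_num (Atom n) = n"
| "the_num (Node a b) = 0"

primrec left_of :: "val \<Rightarrow> val" where
  "left_of (Atom n) = Atom 0"
| "left_of (Node a b) = a"

primrec right_of :: "val \<Rightarrow> val" where
  "right_of (Atom n) = Atom 0"
| "right_of (Node a b) = b"

primrec is_node :: "val \<Rightarrow> bool" where
  "is_node (Atom n) = False"
| "is_node (Node a b) = True"

primrec eval :: "expr \<Rightarrow> state \<Rightarrow> val" where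
  "eval (Var x) s = s x"
| "eval (Const n) s = Atom n"
| "eval (MkNode a b) s = Node (eval a s) (eval b s)"
| "eval (Left a) s = left_of (eval a s)"
| "eval (Right a) s = right_of (eval a s)"
| "eval (IsNode a) s = Atom (of_bool (is_node (eval a s)))"
| "eval (Eq a b) s = Atom (of_bool (eval a s = eval b s))"
| "eval (Less a b) s = Atom (of_bool (the_num (eval a s) < the_num (eval b s)))"
| "eval (Add a b) s = Atom (the_num (eval a s) + the_num (eval b s))"
| "eval (Sub a b) s = Atom (the_num (eval a s) - the_num (eval b s))"
| "eval (Mul a b) s = Atom (the_num (eval a s) * the_num (eval b s))"
| "eval (Div a b) s = Atom (the_num (eval a s) div the_num (eval b s))"

primrec cost :: "expr \<Rightarrow> state \<Rightarrow> nat" where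
  "cost (Var x) s = vsize (eval (Var x) s)"
| "cost (Const n) s = vsize (eval (Const n) s)"
| "cost (MkNode a b) s = cost a s + cost b s + vsize (eval (MkNode a b) s)"
| "cost (Left a) s = cost a s + vsize (eval (Left a) s)"
| "cost (Right a) s = cost a s + vsize (eval (Right a) s)"
| "cost (IsNode a) s = cost a s + vsize (eval (IsNode a) s)"
| "cost (Eq a b) s = cost a s + cost b s + vsize (eval (Eq a b) s)"
| "cost (Less a b) s = cost a s + cost b s + vsize (eval (Less a b) s)"
| "cost (Add a b) s = cost a s + cost b s + vsize (eval (Add a b) s)"
| "cost (Sub a b) s = cost a s + cost b s + vsize (eval (Sub a b) s)"
| "cost (Mul a b) s = cost a s + cost b s + vsize (eval (Mul a b) s)"
| "cost (Div a b) s = cost a s + cost b s + vsize (eval (Div a b) s)"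

datatype com =
    Skip
  | Assign nat expr
  | Query nat expr
  | Seq com com
  | If expr com com
  | While expr com

text \<open>
  \<open>exec \<O> c s t s'\<close>: with query access to \<open>\<O>\<close>, program \<open>c\<close> started in \<open>s\<close> halts in \<open>s'\<close> after time \<open>t\<close>.
  \<open>\<O> q a\<close> means that the query \<open>q\<close> is answered by \<open>a\<close>. A query without an answer
  has no successor state, so a halting run only ever asks queries in the domain of \<open>\<O>\<close>.
  A test succeeds if its value differs from \<open>0\<close>.
\<close>

inductive exec :: "(val \<Rightarrow> val \<Rightarrow> bool) \<Rightarrow> com \<Rightarrow> state \<Rightarrow> nat \<Rightarrow> state \<Rightarrow> bool" for \<O> where
  Skip: "exec \<O> Skip s 1 s"
| Assign: "exec \<O> (Assign x e) s (1 + cost e s) (s(x := eval e s))"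
| Query: "\<O> (eval e s) a \<Longrightarrow> exec \<O> (Query x e) s (1 + cost e s + vsize a) (s(x := a))"
| Seq: "exec \<O> c1 s1 t1 s2 \<Longrightarrow> exec \<O> c2 s2 t2 s3 \<Longrightarrow> exec \<O> (Seq c1 c2) s1 (1 + t1 + t2) s3"
| IfTrue: "eval e s \<noteq> Atom 0 \<Longrightarrow> exec \<O> c1 s t s' \<Longrightarrow> exec \<O> (If e c1 c2) s (1 + cost e s + t) s'"
| IfFalse: "eval e s = Atom 0 \<Longrightarrow> exec \<O> c2 s t s' \<Longrightarrow> exec \<O> (If e c1 c2) s (1 + cost e s + t) s'"
| WhileFalse: "eval e s = Atom 0 \<Longrightarrow> exec \<O> (While e c) s (1 + cost e s) s"
| WhileTrue: "eval e s1 \<noteq> Atom 0 \<Longrightarrow> exec \<O> c s1 t1 s2 \<Longrightarrow> exec \<O> (While e c) s2 t2 s3 \<Longrightarrow>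
    exec \<O> (While e c) s1 (1 + cost e s1 + t1 + t2) s3"

inductive_cases SkipE: "exec \<O> Skip s t s'"
inductive_cases AssignE: "exec \<O> (Assign x e) s t s'"
inductive_cases QueryE: "exec \<O> (Query x e) s t s'"
inductive_cases SeqE: "exec \<O> (Seq c1 c2) s t s'"
inductive_cases IfE: "exec \<O> (If e c1 c2) s t s'"
inductive_cases WhileE: "exec \<O> (While e c) s t s'"

lemma exec_deterministic:
  assumes "exec \<O> c s t s'" "exec \<O> c s u s''"
    and "\<And>q a b. \<O> q a \<Longrightarrow> \<O> q b \<Longrightarrow> a = b"
  shows "t = u \<and> s' = s''"
  using assms(1,2)
proof (induction arbitrary: u s'' rule: exec.induct)
  case (Skip s)
  from Skip show ?case by (rule SkipE) simp
next
  case (Assign x e s)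
  from Assign show ?case by (rule AssignE) simp
next
  case (Query e s a x)
  from Query(2) show ?case by (rule QueryE) (use Query(1) assms(3) in auto)
next
  case (Seq c1 s1 t1 s2 c2 t2 s3)
  from Seq(5) obtain u1 u2 r where u: "u = Suc (u1 + u2)"
    and "exec \<O> c1 s1 u1 r" and r: "exec \<O> c2 r u2 s''"
    by (rule SeqE) simp
  then have "t1 = u1" "s2 = r" using Seq(3) by blast+
  then show ?case using u r Seq(4)[of u2 s''] by simp
next
  case (IfTrue e s c1 t s' c2)
  from IfTrue(4) show ?case by (rule IfE) (use IfTrue(1,3) in auto)
next
  case (IfFalse e s c2 t s' c1)
  from IfFalse(4) show ?case by (rule IfE) (use IfFalse(1,3) in auto)
next
  case (WhileFalse e s c)
  from WhileFalse(2) show ?case by (rule WhileE) (use WhileFalse(1) in auto)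
next
  case (WhileTrue e s1 c t1 s2 t2 s3)
  from WhileTrue(6) obtain u1 u2 r where u: "u = Suc (cost e s1 + u1 + u2)"
    and "exec \<O> c s1 u1 r" and r: "exec \<O> (While e c) r u2 s''"
    by (rule WhileE) (use WhileTrue(1) in simp)
  then have "t1 = u1" "s2 = r" using WhileTrue(4) by blast+
  then show ?case using u r WhileTrue(5)[of u2 s''] by simp
qed

text \<open>Variable \<open>0\<close> holds the input and, at the end, the output; all other variables start as \<open>0\<close>.\<close>

definition runs :: "(val \<Rightarrow> val \<Rightarrow> bool) \<Rightarrow> com \<Rightarrow> val \<Rightarrow> val \<Rightarrow> nat \<Rightarrow> bool" where
  "runs \<O> p v w t \<longleftrightarrow> (\<exists>s'. exec \<O> p ((\<lambda>_. Atom 0)(0 := v)) t s' \<and> s' 0 = w)"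

definition no_oracle :: "val \<Rightarrow> val \<Rightarrow> bool" where
  "no_oracle q a = False"

definition computable :: "(nat \<Rightarrow> nat) \<Rightarrow> bool" where
  "computable f \<longleftrightarrow> (\<exists>p. \<forall>n. \<exists>t. runs no_oracle p (Atom n) (Atom (f n)) t)"


section \<open>Parameterized counting problems\<close>

text \<open>
  Problems are given on their valid instances: algorithms need only be correct on valid
  instances, and oracles may only be asked for valid instances.
\<close>

record 'i counting_problem =
  instances :: "'i set"
  encode :: "'i \<Rightarrow> val"
  param :: "'i \<Rightarrow> nat"
  solution :: "'i \<Rightarrow> nat"

definition oracle_for :: "'i counting_problem \<Rightarrow> nat \<Rightarrow> val \<Rightarrow> val \<Rightarrow> bool" where
  "oracle_for B m q a \<longleftrightarrow>
     (\<exists>y\<in>instances B. param B y \<le> m \<and> q = encode B y \<and> a = Atom (solution B y))"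

text \<open>
  The running time is at most \<open>f(k) \<cdot> n ^ c\<close>, and all queries have parameter at
  most \<open>g(k)\<close>; the latter is enforced by running the program with \<open>oracle_for B (g k)\<close>.
\<close>

definition fpt_turing_reducible :: "'i counting_problem \<Rightarrow> 'j counting_problem \<Rightarrow> bool" where
  "fpt_turing_reducible A B \<longleftrightarrow>
     (\<exists>p f g c. computable f \<and> computable g \<and>
       (\<forall>x\<in>instances A. \<exists>t \<le> f (param A x) * vsize (encode A x) ^ c.
          runs (oracle_for B (g (param A x))) p (encode A x) (Atom (solution A x)) t))"

definition fpt_parsimonious_reducible :: "'i counting_problem \<Rightarrow> 'j counting_problem \<Rightarrow> bool" where
  "fpt_parsimonious_reducible A B \<longleftrightarrow>
     (\<exists>p f g c. computable f \<and> computable g \<and>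
       (\<forall>x\<in>instances A. \<exists>y\<in>instances B.
          param B y \<le> g (param A x) \<and> solution B y = solution A x \<and>
          (\<exists>t \<le> f (param A x) * vsize (encode A x) ^ c.
             runs no_oracle p (encode A x) (encode B y) t)))"


section \<open>The problems\<close>

text \<open>Input graphs have vertex set \<open>{0..<n}\<close> and are given by their adjacency matrix.\<close>

definition input_graph :: "nat graph \<Rightarrow> bool" where
  "input_graph G \<longleftrightarrow> simple_graph G \<and> (\<exists>n. verts G = {0..<n})"

definition encode_list :: "val list \<Rightarrow> val" where
  "encode_list vs = foldr Node vs (Atom 0)"

definition encode_graph :: "nat graph \<Rightarrow> val" where
  "encode_graph G = (let n = card (verts G) in
     encode_list (map (\<lambda>i. encode_list (map (\<lambda>j. Atom (of_bool ({i, j} \<in> edges G))) [0..<n])) [0..<n]))"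

definition count_cliques :: "(nat graph \<times> nat) counting_problem" where
  "count_cliques = \<lparr>
     instances = {(G, k). input_graph G},
     encode = (\<lambda>(G, k). Node (encode_graph G) (Atom k)),
     param = (\<lambda>(G, k). k),
     solution = (\<lambda>(G, k). card (cliques k G))\<rparr>"

definition count_edge_inj :: "nat graph set \<Rightarrow> (nat graph \<times> nat graph) counting_problem" where
  "count_edge_inj \<H> = \<lparr>
     instances = {(H, G). H \<in> \<H> \<and> input_graph H \<and> input_graph G},
     encode = (\<lambda>(H, G). Node (encode_graph H) (encode_graph G)),
     param = (\<lambda>(H, G). card (verts H)),
     solution = (\<lambda>(H, G). card (edge_inj_homs H G))\<rparr>"

lemma inj_encode_list: "inj encode_list"
proof (rule injI)
  fix xs ys assume "encode_list xs = encode_list ys"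
  then show "xs = ys"
  proof (induction xs arbitrary: ys)
    case Nil
    then show ?case by (cases ys) (auto simp: encode_list_def)
  next
    case (Cons x xs)
    then show ?case by (cases ys) (auto simp: encode_list_def)
  qed
qed

lemma inj_on_encode_graph: "inj_on encode_graph {G. input_graph G}"
proof (rule inj_onI, clarify)
  fix G H assume G: "input_graph G" and H: "input_graph H"
    and eq: "encode_graph G = encode_graph H"
  obtain n m where n: "verts G = {0..<n}" and m: "verts H = {0..<m}"
    using G H by (auto simp: input_graph_def)
  let ?row = "\<lambda>G n i. encode_list (map (\<lambda>j. Atom (of_bool ({i, j} \<in> edges G))) [0..<n])"
  have rows: "map (?row G n) [0..<n] = map (?row H m) [0..<m]"
    using eq n m inj_encode_list by (simp add: encode_graph_def Let_def inj_eq)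
  have nm: "n = m"
    using arg_cong[OF rows, of length] by simp
  have same: "{i, j} \<in> edges G \<longleftrightarrow> {i, j} \<in> edges H" if "i < n" "j < n" for i j
  proof -
    have "?row G n i = ?row H n i"
      using rows that nm by (simp add: list_eq_iff_nth_eq)
    then have "map (\<lambda>j. Atom (of_bool ({i, j} \<in> edges G))) [0..<n] =
        map (\<lambda>j. Atom (of_bool ({i, j} \<in> edges H))) [0..<n]"
      using inj_encode_list by (simp only: inj_eq)
    then show ?thesis
      using that by (auto simp: list_eq_iff_nth_eq of_bool_def split: if_splits)
  qed
  have "e \<in> edges G \<longleftrightarrow> e \<in> edges H" for e
  proof (cases "\<exists>i j. i < n \<and> j < n \<and> e = {i, j}")
    case True
    then show ?thesis using same by blast
  next
    case False
    have "edges G \<subseteq> {{u, v} |u v. u < n \<and> v < n \<and> u \<noteq> v}"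
      "edges H \<subseteq> {{u, v} |u v. u < n \<and> v < n \<and> u \<noteq> v}"
      using G H n m nm by (simp_all add: input_graph_def simple_graph_def)
    then have "e \<notin> edges G" "e \<notin> edges H"
      using False by blast+
    then show ?thesis by simp
  qed
  then have "edges G = edges H" by blast
  then show "G = H" using n m nm by (simp add: graph.equality)
qed

text \<open>
  \<open>#W[1]\<close> is the closure of counting \<open>k\<close>-cliques under parsimonious fpt reductions, whereas
  hardness is with respect to the weaker fpt Turing reductions.
\<close>

definition in_sharp_W1 :: "'i counting_problem \<Rightarrow> bool" where
  "in_sharp_W1 A \<longleftrightarrow> fpt_parsimonious_reducible A count_cliques"

definition sharp_W1_hard :: "'i counting_problem \<Rightarrow> bool" where
  "sharp_W1_hard A \<longleftrightarrow> fpt_turing_reducible count_cliques A"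

definition sharp_W1_complete :: "'i counting_problem \<Rightarrow> bool" where
  "sharp_W1_complete A \<longleftrightarrow> in_sharp_W1 A \<and> sharp_W1_hard A"

end

(*
  Membership: an edge-injective homomorphism from H to G amounts to a consistent choice of the
  images of all pairs of vertices of H, hence to a clique in a compatibility graph whose parts are
  indexed by these pairs.

  Hardness: colour the vertices of G x [k] by their second component and let b run through the
  walks of length m in this graph, using only colours of a set S of vertex and edge colours. Blow up
  every vertex into q copies and replace every edge between copies by q paths of length two. Up to
  reversal, an edge-injective homomorphism from the path (or cycle) on 2m vertices is such a walk b
  together with a labelling of its m + 1 positions and m steps by [q], where steps through the same
  blown-up edge differ in some label. Inclusion-exclusion over S keeps the walks that visit all
  colours. For a fixed b, inclusion-exclusion over the coinciding steps makes the number of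
  labellings a polynomial in q, in which only exponents of at least the number of vertices plus the
  number of edges visited by b occur; for walks with all colours this is at least
  d = k + (k choose 2), with equality exactly if b lives on a single k-clique. The coefficient of
  q^d is isolated by the identity SUM q. (-1)^q (J choose q) q^e = 0 for e < J. For a walk on a
  clique it is 0 or has the sign (-1)^(m - (k choose 2)), as in a product of falling factorials, so
  nothing cancels; a tour through all triangles at a fixed vertex shows that it is not always 0. So
  the alternating sum of the oracle answers is a nonzero constant times the number of k-cliques, and
  the constant is eliminated by evaluating the same sum for the complete graph on k vertices.
*)

theory Submission
  imports Defs "HOL-Computational_Algebra.Polynomial" "HOL-Library.Nat_Bijection"
begin

text \<open>For each k a single pattern is queried, so all freedom lies in the host: the colour set
  S and the number q of copies. Simple graphs have no parallel edges, which forces the subdivision;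
  the labels that parallel edges put on steps are what controls signs. A set T of coincidences
  attains the least exponent only if it connects all steps through a common edge, and then the
  gluing of positions no longer depends on T. So the coefficient is governed by a condition on the
  walk alone (\<open>rigid\<close>): either no T qualifies, or exactly those T do that occur in a
  product of falling factorials, whose sign depends only on the numbers of steps and of visited
  edges. The tour is closed, hence one walk serves both paths and cycles. Programs compute with
  natural numbers, so an alternating sum is only evaluated up to sign; this suffices because the
  sums for G and for the complete graph share one constant and only their quotient is taken.
  Functional terms compiled to while programs reduce every running time to a bound on loop counts
  and on the sizes of intermediate values.\<close>

section \<open>Generated equivalence relations and functions constant on their classes\<close>

definition symcl :: "('a \<times> 'a) set \<Rightarrow> ('a \<times> 'a) set" where
  "symcl R = (R \<union> R\<inverse>)\<^sup>*"

text \<open>\<open>symcl R\<close> is the equivalence relation generated by \<open>R\<close> on the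
  whole type. For \<open>R \<subseteq> A \<times> A\<close>, this is the number of connected
  components of the graph with vertices \<open>A\<close> and edges \<open>R\<close>.\<close>

definition ncl :: "'a set \<Rightarrow> ('a \<times> 'a) set \<Rightarrow> nat" where
  "ncl A R = card (A // (symcl R \<inter> A \<times> A))"

lemma symcl_refl [simp]: "(x, x) \<in> symcl R"
  by (simp add: symcl_def)

lemma symcl_sym: "(x, y) \<in> symcl R \<Longrightarrow> (y, x) \<in> symcl R"
proof -
  have "sym (symcl R)" unfolding symcl_def by (intro sym_rtrancl symI) auto
  then show "(x, y) \<in> symcl R \<Longrightarrow> (y, x) \<in> symcl R" by (rule symD)
qed

lemma symcl_trans: "(x, y) \<in> symcl R \<Longrightarrow> (y, z) \<in> symcl R \<Longrightarrow> (x, z) \<in> symcl R"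
  unfolding symcl_def by (rule rtrancl_trans)

lemma symcl_base: "(x, y) \<in> R \<Longrightarrow> (x, y) \<in> symcl R"
  unfolding symcl_def by auto

lemma symcl_induct [consumes 1, case_names refl step]:
  assumes "(x, y) \<in> symcl R" "P x"
    "\<And>y z. (x, y) \<in> symcl R \<Longrightarrow> (y, z) \<in> R \<or> (z, y) \<in> R \<Longrightarrow> P y \<Longrightarrow> P z"
  shows "P y"
  using assms(1) unfolding symcl_def
  by (induction rule: rtrancl_induct) (use assms(2,3) in \<open>auto simp: symcl_def\<close>)

lemma symcl_least:
  assumes "R \<subseteq> symcl S" "(x, y) \<in> symcl R"
  shows "(x, y) \<in> symcl S"
  using assms(2)
proof (induction rule: symcl_induct)
  case (step y z)
  have "(y, z) \<in> symcl S"
    using step(2) by (elim disjE) (rule subsetD[OF assms(1)], assumption, rule symcl_sym,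
      rule subsetD[OF assms(1)], assumption)
  then show ?case by (rule symcl_trans[OF step(3)])
qed auto

lemma symcl_mono:
  assumes "R \<subseteq> S" "(x, y) \<in> symcl R"
  shows "(x, y) \<in> symcl S"
proof (rule symcl_least[OF _ assms(2)])
  show "R \<subseteq> symcl S" by (rule subrelI, rule symcl_base, rule subsetD[OF assms(1)])
qed

lemma symcl_respects:
  assumes "\<forall>(x, y) \<in> R. f x = f y" "(x, y) \<in> symcl R"
  shows "f x = f y"
  using assms(2) by (induction rule: symcl_induct) (use assms(1) in auto)

lemma equiv_symcl: "equiv A (symcl R \<inter> A \<times> A)"
  by (intro equivI refl_onI symI transI) (auto intro: symcl_sym symcl_trans)

text \<open>A function that agrees along \<open>R\<close> is constant on components, so it amounts
  to a free choice of one value per component.\<close>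

lemma card_respecting:
  assumes A: "finite A" and R: "R \<subseteq> A \<times> A"
  shows "card {f \<in> A \<rightarrow>\<^sub>E {..<q}. \<forall>(x, y) \<in> R. f x = f y} = q ^ ncl A R"
proof -
  let ?E = "symcl R \<inter> A \<times> A"
  let ?\<Phi> = "\<lambda>g. \<lambda>x\<in>A. g (?E `` {x})"
  note eq = equiv_symcl[of A R]
  have "bij_betw ?\<Phi> (A // ?E \<rightarrow>\<^sub>E {..<q}) {f \<in> A \<rightarrow>\<^sub>E {..<q}. \<forall>(x, y) \<in> R. f x = f y}"
  proof (rule bij_betw_imageI)
    show "inj_on ?\<Phi> (A // ?E \<rightarrow>\<^sub>E {..<q})"
    proof (rule inj_onI)
      fix g h assume gh: "g \<in> A // ?E \<rightarrow>\<^sub>E {..<q}" "h \<in> A // ?E \<rightarrow>\<^sub>E {..<q}" "?\<Phi> g = ?\<Phi> h"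
      show "g = h"
      proof (rule PiE_ext[OF gh(1,2)])
        fix C assume "C \<in> A // ?E"
        then obtain x where "x \<in> A" "C = ?E `` {x}" by (rule quotientE)
        then show "g C = h C" using fun_cong[OF gh(3), of x] by simp
      qed
    qed
    show "?\<Phi> ` (A // ?E \<rightarrow>\<^sub>E {..<q}) = {f \<in> A \<rightarrow>\<^sub>E {..<q}. \<forall>(x, y) \<in> R. f x = f y}"
    proof (intro equalityI subsetI)
      fix f assume "f \<in> ?\<Phi> ` (A // ?E \<rightarrow>\<^sub>E {..<q})"
      then obtain g where g: "g \<in> A // ?E \<rightarrow>\<^sub>E {..<q}" "f = ?\<Phi> g" by blast
      have "?E `` {x} = ?E `` {y}" if "(x, y) \<in> R" for x y
        using that R symcl_base[OF that] by (intro equiv_class_eq[OF eq]) auto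
      then show "f \<in> {f \<in> A \<rightarrow>\<^sub>E {..<q}. \<forall>(x, y) \<in> R. f x = f y}"
        using g R by (auto simp: quotientI PiE_iff)
    next
      fix f assume f: "f \<in> {f \<in> A \<rightarrow>\<^sub>E {..<q}. \<forall>(x, y) \<in> R. f x = f y}"
      let ?g = "\<lambda>C \<in> A // ?E. f (SOME x. x \<in> C)"
      have some: "(SOME y. y \<in> C) \<in> C" if C: "C \<in> A // ?E" for C
        using in_quotient_imp_non_empty[OF eq C] by (simp add: some_in_eq)
      have "f (SOME y. y \<in> ?E `` {x}) = f x" if "x \<in> A" for x
      proof -
        have "(SOME y. y \<in> ?E `` {x}) \<in> ?E `` {x}" using that by (intro some quotientI)
        then have "(x, SOME y. y \<in> ?E `` {x}) \<in> symcl R" by blast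
        then show ?thesis using symcl_respects[of R f] f by (metis (no_types, lifting) mem_Collect_eq)
      qed
      then have "f = ?\<Phi> ?g" using f by (auto simp: PiE_iff extensional_def quotientI)
      moreover have "?g \<in> A // ?E \<rightarrow>\<^sub>E {..<q}"
      proof (rule restrict_PiE_iff[THEN iffD2], rule ballI)
        fix C assume C: "C \<in> A // ?E"
        then have "(SOME y. y \<in> C) \<in> A" using some in_quotient_imp_subset[OF eq C] by blast
        then show "f (SOME y. y \<in> C) \<in> {..<q}" using f by blast
      qed
      ultimately show "f \<in> ?\<Phi> ` (A // ?E \<rightarrow>\<^sub>E {..<q})" by blast
    qed
  qed
  then have "card {f \<in> A \<rightarrow>\<^sub>E {..<q}. \<forall>(x, y) \<in> R. f x = f y} = card (A // ?E \<rightarrow>\<^sub>E {..<q})"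
    by (simp add: bij_betw_same_card)
  also have "\<dots> = q ^ ncl A R"
    using finite_quotient[OF A, of ?E] by (simp add: card_PiE ncl_def)
  finally show ?thesis .
qed

lemma ncl_le: "finite A \<Longrightarrow> ncl A R \<le> card A"
proof -
  have "A // (symcl R \<inter> A \<times> A) = (\<lambda>x. (symcl R \<inter> A \<times> A) `` {x}) ` A"
    by (auto simp: quotient_def)
  then show "finite A \<Longrightarrow> ?thesis" by (simp add: ncl_def card_image_le)
qed

text \<open>An invariant \<open>g\<close> of \<open>R\<close> factors through the classes. The
  induced map onto the image of \<open>A\<close> is surjective, which gives the inequality; equality
  means that it is injective, so that equal values of \<open>g\<close> occur only inside one
  class.\<close>

lemma ncl_ge:
  assumes A: "finite A" and g: "\<forall>(x, y) \<in> R. g x = g y"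
  shows "card (g ` A) \<le> ncl A R"
    and "ncl A R = card (g ` A) \<longleftrightarrow> (\<forall>x\<in>A. \<forall>y\<in>A. g x = g y \<longrightarrow> (x, y) \<in> symcl R)"
proof -
  let ?E = "symcl R \<inter> A \<times> A"
  let ?h = "\<lambda>C. the_elem (g ` C)"
  have h: "?h (?E `` {x}) = g x" if "x \<in> A" for x
  proof -
    have "x \<in> ?E `` {x}" using that by simp
    moreover have "\<forall>y \<in> ?E `` {x}. g y = g x" using symcl_respects[OF g] by (metis IntD1 Image_singleton_iff)
    ultimately have "g ` (?E `` {x}) = {g x}" by blast
    then show ?thesis by simp
  qed
  have im: "?h ` (A // ?E) = g ` A"
  proof (intro equalityI subsetI)
    fix z assume "z \<in> ?h ` (A // ?E)"
    then obtain C where "C \<in> A // ?E" "z = ?h C" by blast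
    then obtain x where "x \<in> A" "C = ?E `` {x}" by (auto elim: quotientE)
    then show "z \<in> g ` A" using h \<open>z = ?h C\<close> by auto
  next
    fix z assume "z \<in> g ` A"
    then obtain x where "x \<in> A" "z = g x" by blast
    then show "z \<in> ?h ` (A // ?E)" using h quotientI[of x A ?E] by (metis image_eqI)
  qed
  have fin: "finite (A // ?E)" by (rule finite_quotient[OF A]) auto
  show "card (g ` A) \<le> ncl A R" unfolding ncl_def im[symmetric] by (rule card_image_le[OF fin])
  have "ncl A R = card (g ` A) \<longleftrightarrow> inj_on ?h (A // ?E)"
    unfolding ncl_def im[symmetric] using eq_card_imp_inj_on[OF fin, of ?h] card_image[of ?h "A // ?E"]
    by metis
  also have "\<dots> \<longleftrightarrow> (\<forall>x\<in>A. \<forall>y\<in>A. g x = g y \<longrightarrow> ?E `` {x} = ?E `` {y})"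
    using h by (auto simp: inj_on_def quotient_def)
  also have "\<dots> \<longleftrightarrow> (\<forall>x\<in>A. \<forall>y\<in>A. g x = g y \<longrightarrow> (x, y) \<in> symcl R)"
    using eq_equiv_class_iff[OF equiv_symcl[of A R]] by auto
  finally show "ncl A R = card (g ` A) \<longleftrightarrow> (\<forall>x\<in>A. \<forall>y\<in>A. g x = g y \<longrightarrow> (x, y) \<in> symcl R)" .
qed

section \<open>Inclusion-exclusion and alternating binomial sums\<close>

lemma sum_Pow_alternating:
  "finite S \<Longrightarrow> (\<Sum>T\<in>Pow S. (-1) ^ card T) = (if S = {} then 1 else 0 :: int)"
proof (induction S rule: finite_induct)
  case (insert x S)
  have "inj_on (insert x) (Pow S)"
    using insert.hyps by (intro inj_onI) (metis Pow_iff insert_ident subsetD)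
  then have "(\<Sum>T\<in>insert x ` Pow S. (-1) ^ card T) = (\<Sum>T\<in>Pow S. (-1) ^ card (insert x T) :: int)"
    by (simp add: sum.reindex)
  also have "\<dots> = (\<Sum>T\<in>Pow S. - ((-1) ^ card T))"
    using insert.hyps by (intro sum.cong) (auto simp: card_insert_if finite_subset)
  finally have "(\<Sum>T\<in>insert x ` Pow S. (-1) ^ card T) = - (\<Sum>T\<in>Pow S. (-1) ^ card T :: int)"
    by (simp add: sum_negf)
  moreover have "Pow S \<inter> insert x ` Pow S = {}" using insert.hyps by auto
  ultimately show ?case using insert.hyps by (simp add: Pow_insert sum.union_disjoint)
qed simp

text \<open>After exchanging the sums, \<open>f\<close> contributes the alternating sum over all
  subsets of the set of properties that it has, which vanishes unless that set is empty.\<close>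

lemma inclusion_exclusion_none:
  assumes "finite X" "finite B"
  shows "int (card {f \<in> X. \<forall>t\<in>B. \<not> Q t f}) = (\<Sum>T\<in>Pow B. (-1) ^ card T * int (card {f \<in> X. \<forall>t\<in>T. Q t f}))"
proof -
  have "(\<Sum>T\<in>Pow B. (-1) ^ card T * int (card {f \<in> X. \<forall>t\<in>T. Q t f})) =
      (\<Sum>T\<in>Pow B. \<Sum>f\<in>X. if \<forall>t\<in>T. Q t f then (-1) ^ card T else 0)"
    using assms by (intro sum.cong refl) (simp add: sum.If_cases Int_def mult.commute)
  also have "\<dots> = (\<Sum>f\<in>X. \<Sum>T\<in>Pow B. if \<forall>t\<in>T. Q t f then (-1) ^ card T else 0)" by (rule sum.swap)
  also have "\<dots> = (\<Sum>f\<in>X. \<Sum>T\<in>Pow {t \<in> B. Q t f}. (-1) ^ card T)"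
    using assms by (intro sum.cong refl sum.mono_neutral_cong_right) auto
  also have "\<dots> = (\<Sum>f\<in>X. if {t \<in> B. Q t f} = {} then 1 else 0)"
    using assms by (intro sum.cong refl sum_Pow_alternating) auto
  also have "\<dots> = int (card {f \<in> X. {t \<in> B. Q t f} = {}})" using assms by (simp add: sum.If_cases Int_def)
  also have "{f \<in> X. {t \<in> B. Q t f} = {}} = {f \<in> X. \<forall>t\<in>B. \<not> Q t f}" by auto
  finally show ?thesis ..
qed

text \<open>Complements turn the supersets of \<open>c\<close> into the subsets of
  \<open>C - c\<close>. This extracts the walks that use every colour.\<close>

lemma sum_supersets_alternating:
  assumes "finite C" "c \<subseteq> C"
  shows "(\<Sum>S | S \<subseteq> C \<and> c \<subseteq> S. (-1) ^ card (C - S)) = (if c = C then 1 else 0 :: int)"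
proof -
  have "(\<Sum>S | S \<subseteq> C \<and> c \<subseteq> S. (-1) ^ card (C - S)) = (\<Sum>T\<in>Pow (C - c). (-1) ^ card T :: int)"
    using assms by (intro sum.reindex_bij_witness[of _ "\<lambda>T. C - T" "\<lambda>S. C - S"]) (auto simp: double_diff)
  also have "\<dots> = (if C - c = {} then 1 else 0)" using assms by (intro sum_Pow_alternating) auto
  finally show ?thesis using assms by auto
qed

text \<open>The \<open>J\<close>-th finite difference of a polynomial of degree below
  \<open>J\<close> vanishes. In the induction, absorbing one factor \<open>Suc r\<close> into the
  binomial coefficient lowers \<open>J\<close>, and expanding the remaining power of
  \<open>Suc r\<close> leaves exponents to which the induction hypothesis applies.\<close>

lemma sum_choose_alternating_power:
  "e < J \<Longrightarrow> (\<Sum>q\<le>J. (-1) ^ q * int (J choose q) * int q ^ e) = 0"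
proof (induction J arbitrary: e)
  case (Suc J)
  show ?case
  proof (cases e)
    case 0
    then show ?thesis using choose_alternating_sum[of "Suc J", where 'a = int] by simp
  next
    case (Suc e')
    have "(\<Sum>q\<le>Suc J. (-1) ^ q * int (Suc J choose q) * int q ^ e) =
        (\<Sum>r\<le>J. (-1) ^ Suc r * int (Suc J choose Suc r) * int (Suc r) ^ e)"
      by (simp add: sum.atMost_Suc_shift Suc del: binomial_Suc_Suc sum.atMost_Suc)
    also have "\<dots> = (\<Sum>r\<le>J. - int (Suc J) * ((-1) ^ r * int (J choose r) * int (Suc r) ^ e'))"
    proof (rule sum.cong[OF refl])
      fix r
      have "int (Suc J choose Suc r) * int (Suc r) = int (Suc J) * int (J choose r)"
        by (metis Suc_times_binomial mult.commute of_nat_mult)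
      then show "(-1) ^ Suc r * int (Suc J choose Suc r) * int (Suc r) ^ e =
          - int (Suc J) * ((-1) ^ r * int (J choose r) * int (Suc r) ^ e')"
        unfolding Suc power_Suc by (simp add: mult_ac del: of_nat_Suc binomial_Suc_Suc)
    qed
    also have "\<dots> = - int (Suc J) * (\<Sum>r\<le>J. (-1) ^ r * int (J choose r) * int (Suc r) ^ e')"
      by (simp only: sum_distrib_left)
    also have "(\<Sum>r\<le>J. (-1) ^ r * int (J choose r) * int (Suc r) ^ e') =
        (\<Sum>r\<le>J. \<Sum>i\<le>e'. int (e' choose i) * ((-1) ^ r * int (J choose r) * int r ^ i))"
    proof (rule sum.cong[OF refl])
      fix r
      have "int (Suc r) ^ e' = (\<Sum>i\<le>e'. int (e' choose i) * int r ^ i)"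
        using binomial_ring[of "int r" 1 e'] by (simp add: add.commute)
      then show "(-1) ^ r * int (J choose r) * int (Suc r) ^ e' =
          (\<Sum>i\<le>e'. int (e' choose i) * ((-1) ^ r * int (J choose r) * int r ^ i))"
        by (simp add: sum_distrib_left mult_ac del: of_nat_Suc)
    qed
    also have "\<dots> = (\<Sum>i\<le>e'. int (e' choose i) * (\<Sum>r\<le>J. (-1) ^ r * int (J choose r) * int r ^ i))"
      by (subst sum.swap) (simp add: sum_distrib_left)
    also have "\<dots> = 0" using Suc.IH Suc.prems Suc by (intro sum.neutral) auto
    finally show ?thesis by simp
  qed
qed simp

text \<open>The term for \<open>q = 0\<close> is \<open>0 ^ e\<close>, which is 1 exactly for
  \<open>e = 0\<close>. Moving it to the other side turns the vanishing sum into a detector of the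
  exponent 0 that evaluates only at positive \<open>q\<close>.\<close>

lemma sum_choose_alternating_shift:
  assumes "e < J"
  shows "(\<Sum>q=1..J. (-1) ^ (q - 1) * int (J choose q) * int q ^ e) = (if e = 0 then 1 else 0)"
proof -
  have "{..J} = insert 0 {1..J}" by auto
  then have "0 = 0 ^ e + (\<Sum>q=1..J. (-1) ^ q * int (J choose q) * int q ^ e)"
    using sum_choose_alternating_power[OF assms] by simp
  also have "(\<Sum>q=1..J. (-1) ^ q * int (J choose q) * int q ^ e) =
      - (\<Sum>q=1..J. (-1) ^ (q - 1) * int (J choose q) * int q ^ e)"
    unfolding sum_negf[symmetric]
  proof (rule sum.cong[OF refl])
    fix q assume "q \<in> {1..J}"
    then obtain r where "q = Suc r" by (cases q) auto
    then show "(-1) ^ q * int (J choose q) * int q ^ e = - ((-1) ^ (q - 1) * int (J choose q) * int q ^ e)"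
      by simp
  qed
  finally show ?thesis by (cases e) auto
qed

section \<open>Labelled walks\<close>

text \<open>The positions of a walk of length \<open>m\<close> are the slots \<open>Inl 0, \<dots>, Inl m\<close>, its steps the slots
  \<open>Inr 0, \<dots>, Inr (m - 1)\<close>. Positions are labelled by copies of a vertex, steps by parallel edges.
  For two steps through the same edge, \<open>link\<close> lists the equations that make the labelled steps equal.\<close>

definition slots :: "nat \<Rightarrow> (nat + nat) set" where
  "slots m = Inl ` {..m} \<union> Inr ` {..<m}"

definition coinc :: "(nat \<Rightarrow> 'a) \<Rightarrow> nat \<Rightarrow> (nat \<times> nat) set" where
  "coinc b m = {(i, j). i < j \<and> j < m \<and> {b i, b (Suc i)} = {b j, b (Suc j)}}"

definition link :: "(nat \<Rightarrow> 'a) \<Rightarrow> nat \<times> nat \<Rightarrow> ((nat + nat) \<times> (nat + nat)) set" where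
  "link b p = insert (Inr (fst p), Inr (snd p))
     {(Inl x, Inl y) |x y. x \<in> {fst p, Suc (fst p)} \<and> y \<in> {snd p, Suc (snd p)} \<and> b x = b y}"

definition closing :: "nat \<Rightarrow> bool \<Rightarrow> ((nat + nat) \<times> (nat + nat)) set" where
  "closing m cyc = (if cyc then {(Inl m, Inl 0)} else {})"

definition glue :: "(nat \<Rightarrow> 'a) \<Rightarrow> nat \<Rightarrow> bool \<Rightarrow> (nat \<times> nat) set \<Rightarrow> ((nat + nat) \<times> (nat + nat)) set" where
  "glue b m cyc T = closing m cyc \<union> (\<Union>p\<in>T. link b p)"

definition labels :: "(nat \<Rightarrow> 'a) \<Rightarrow> nat \<Rightarrow> bool \<Rightarrow> nat \<Rightarrow> (nat + nat \<Rightarrow> nat) set" where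
  "labels b m cyc q = {f \<in> slots m \<rightarrow>\<^sub>E {..<q}. (\<forall>(x, y) \<in> closing m cyc. f x = f y) \<and>
     (\<forall>p \<in> coinc b m. \<not> (\<forall>(x, y) \<in> link b p. f x = f y))}"

text \<open>The exponent of \<open>q\<close> with which \<open>T\<close> enters the
  inclusion-exclusion over coincidences: one free label per component of the slots.\<close>

definition rk :: "(nat \<Rightarrow> 'a) \<Rightarrow> nat \<Rightarrow> bool \<Rightarrow> (nat \<times> nat) set \<Rightarrow> nat" where
  "rk b m cyc T = ncl (slots m) (glue b m cyc T)"

definition nverts :: "(nat \<Rightarrow> 'a) \<Rightarrow> nat \<Rightarrow> nat" where
  "nverts b m = card (b ` {..m})"

definition nedges :: "(nat \<Rightarrow> 'a) \<Rightarrow> nat \<Rightarrow> nat" where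
  "nedges b m = card ((\<lambda>i. {b i, b (Suc i)}) ` {..<m})"

text \<open>The coefficient of \<open>q ^ d\<close> in the number of labellings with labels below \<open>q\<close>.\<close>

definition coef :: "(nat \<Rightarrow> 'a) \<Rightarrow> nat \<Rightarrow> bool \<Rightarrow> nat \<Rightarrow> int" where
  "coef b m cyc d = (\<Sum>T | T \<subseteq> coinc b m \<and> rk b m cyc T = d. (-1) ^ card T)"

lemma finite_slots [simp]: "finite (slots m)"
  by (simp add: slots_def)

lemma card_slots: "card (slots m) = 2 * m + 1"
  unfolding slots_def by (subst card_Un_disjoint) (auto simp: card_image)

lemma finite_coinc [simp]: "finite (coinc b m)"
  by (rule finite_subset[of _ "{..m} \<times> {..m}"]) (auto simp: coinc_def)

lemma glue_subset: "T \<subseteq> coinc b m \<Longrightarrow> glue b m cyc T \<subseteq> slots m \<times> slots m"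
  by (auto simp: glue_def closing_def link_def coinc_def slots_def split: if_splits)

text \<open>The closing equation is a constraint on the base set and holds in every term; only the
  equations of coinciding steps are subject to inclusion-exclusion.\<close>

lemma card_labels:
  "int (card (labels b m cyc q)) = (\<Sum>T\<in>Pow (coinc b m). (-1) ^ card T * int q ^ rk b m cyc T)"
proof -
  let ?X = "{f \<in> slots m \<rightarrow>\<^sub>E {..<q}. \<forall>(x, y) \<in> closing m cyc. f x = f y}"
  have X: "finite ?X" by (rule finite_subset[of _ "slots m \<rightarrow>\<^sub>E {..<q}"]) (auto intro: finite_PiE)
  have "labels b m cyc q = {f \<in> ?X. \<forall>p \<in> coinc b m. \<not> (\<forall>(x, y) \<in> link b p. f x = f y)}"
    by (auto simp: labels_def)
  then have "int (card (labels b m cyc q)) =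
      (\<Sum>T\<in>Pow (coinc b m). (-1) ^ card T * int (card {f \<in> ?X. \<forall>p\<in>T. \<forall>(x, y) \<in> link b p. f x = f y}))"
    by (simp only: inclusion_exclusion_none[OF X finite_coinc])
  also have "\<dots> = (\<Sum>T\<in>Pow (coinc b m). (-1) ^ card T * int q ^ rk b m cyc T)"
  proof (rule sum.cong[OF refl])
    fix T assume "T \<in> Pow (coinc b m)"
    then have "glue b m cyc T \<subseteq> slots m \<times> slots m" by (intro glue_subset) auto
    then have "card {f \<in> slots m \<rightarrow>\<^sub>E {..<q}. \<forall>(x, y) \<in> glue b m cyc T. f x = f y} = q ^ rk b m cyc T"
      unfolding rk_def by (intro card_respecting) auto
    moreover have "{f \<in> ?X. \<forall>p\<in>T. \<forall>(x, y) \<in> link b p. f x = f y} =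
        {f \<in> slots m \<rightarrow>\<^sub>E {..<q}. \<forall>(x, y) \<in> glue b m cyc T. f x = f y}"
      unfolding glue_def by blast
    ultimately show "(-1) ^ card T * int (card {f \<in> ?X. \<forall>p\<in>T. \<forall>(x, y) \<in> link b p. f x = f y}) =
        (-1) ^ card T * int q ^ rk b m cyc T" by simp
  qed
  finally show ?thesis .
qed

text \<open>Sends a slot to the vertex or edge that it visits. It is an invariant of every
  \<open>glue\<close>, so \<open>ncl_ge\<close> bounds \<open>rk\<close> below by the number of
  visited vertices plus visited edges and describes the case of equality.\<close>

definition proj :: "(nat \<Rightarrow> 'a) \<Rightarrow> nat + nat \<Rightarrow> 'a + 'a set" where
  "proj b z = (case z of Inl x \<Rightarrow> Inl (b x) | Inr i \<Rightarrow> Inr {b i, b (Suc i)})"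

lemma proj_simps [simp]: "proj b (Inl x) = Inl (b x)" "proj b (Inr i) = Inr {b i, b (Suc i)}"
  by (simp_all add: proj_def)

lemma card_proj: "card (proj b ` slots m) = nverts b m + nedges b m"
proof -
  have "proj b ` slots m = Inl ` (b ` {..m}) \<union> Inr ` ((\<lambda>i. {b i, b (Suc i)}) ` {..<m})"
    by (simp add: slots_def image_Un image_image)
  also have "card \<dots> = card (Inl ` (b ` {..m}) :: ('a + 'a set) set) +
      card (Inr ` ((\<lambda>i. {b i, b (Suc i)}) ` {..<m}) :: ('a + 'a set) set)"
    by (intro card_Un_disjoint) auto
  also have "\<dots> = nverts b m + nedges b m"
    by (simp add: card_image nverts_def nedges_def)
  finally show ?thesis .
qed

lemma proj_glue:
  assumes "T \<subseteq> coinc b m" "cyc \<longrightarrow> b m = b 0"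
  shows "\<forall>(x, y) \<in> glue b m cyc T. proj b x = proj b y"
  using assms by (fastforce simp: glue_def closing_def link_def coinc_def split: if_splits)

lemma rk_ge:
  assumes "T \<subseteq> coinc b m" "cyc \<longrightarrow> b m = b 0"
  shows "nverts b m + nedges b m \<le> rk b m cyc T"
  using ncl_ge(1)[OF finite_slots proj_glue[OF assms]] by (simp add: card_proj rk_def)

lemma rk_eq:
  assumes "T \<subseteq> coinc b m" "cyc \<longrightarrow> b m = b 0"
  shows "rk b m cyc T = nverts b m + nedges b m \<longleftrightarrow>
    (\<forall>x\<in>slots m. \<forall>y\<in>slots m. proj b x = proj b y \<longrightarrow> (x, y) \<in> symcl (glue b m cyc T))"
  using ncl_ge(2)[OF finite_slots proj_glue[OF assms]] by (simp add: card_proj rk_def)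

lemma rk_le: "rk b m cyc T \<le> 2 * m + 1"
  using ncl_le[OF finite_slots, of m] by (simp add: rk_def card_slots)

text \<open>Weighting by \<open>(Z div q) ^ d\<close> divides out \<open>q ^ d\<close>; all other powers of \<open>q\<close> that occur are between
  \<open>1\<close> and \<open>J - 1\<close> after the division, and are annihilated by the alternating binomial sum.\<close>

lemma coef_extraction:
  assumes d: "d \<le> nverts b m + nedges b m" and cyc: "cyc \<longrightarrow> b m = b 0" and J: "J = 2 * m + 2"
    and Z: "\<And>q. 1 \<le> q \<Longrightarrow> q \<le> J \<Longrightarrow> q dvd Z"
  shows "(\<Sum>q=1..J. (-1) ^ (q - 1) * int (J choose q) * int (Z div q) ^ d * int (card (labels b m cyc q))) =
    int Z ^ d * coef b m cyc d"
proof -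
  have "(\<Sum>q=1..J. (-1) ^ (q - 1) * int (J choose q) * int (Z div q) ^ d * int (card (labels b m cyc q))) =
    (\<Sum>q=1..J. \<Sum>T\<in>Pow (coinc b m). int Z ^ d * (-1) ^ card T *
      ((-1) ^ (q - 1) * int (J choose q) * int q ^ (rk b m cyc T - d)))"
  proof (rule sum.cong[OF refl])
    fix q assume q: "q \<in> {1..J}"
    have "int (Z div q) ^ d * int q ^ rk b m cyc T = int Z ^ d * int q ^ (rk b m cyc T - d)"
      if "T \<in> Pow (coinc b m)" for T
    proof -
      have "d \<le> rk b m cyc T" using rk_ge[of T b m cyc] that d cyc by auto
      then have "int q ^ rk b m cyc T = int q ^ d * int q ^ (rk b m cyc T - d)"
        by (simp flip: power_add)
      moreover have "int (Z div q) * int q = int Z"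
        using Z[of q] q by (metis atLeastAtMost_iff dvd_div_mult_self of_nat_mult)
      ultimately show ?thesis by (metis mult.assoc power_mult_distrib)
    qed
    then show "(-1) ^ (q - 1) * int (J choose q) * int (Z div q) ^ d * int (card (labels b m cyc q)) =
      (\<Sum>T\<in>Pow (coinc b m). int Z ^ d * (-1) ^ card T *
        ((-1) ^ (q - 1) * int (J choose q) * int q ^ (rk b m cyc T - d)))"
      unfolding card_labels sum_distrib_left by (intro sum.cong) (auto simp: mult_ac)
  qed
  also have "\<dots> = (\<Sum>T\<in>Pow (coinc b m). \<Sum>q=1..J. int Z ^ d * (-1) ^ card T *
      ((-1) ^ (q - 1) * int (J choose q) * int q ^ (rk b m cyc T - d)))" by (rule sum.swap)
  also have "\<dots> = (\<Sum>T\<in>Pow (coinc b m). int Z ^ d * (if rk b m cyc T = d then (-1) ^ card T else 0))"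
  proof (rule sum.cong[OF refl])
    fix T assume T: "T \<in> Pow (coinc b m)"
    have "d \<le> rk b m cyc T" using rk_ge[of T b m cyc] T d cyc by auto
    \<comment> \<open>There are \<open>2 * m + 1\<close> slots, hence the choice
      \<open>J = 2 * m + 2\<close>.\<close>
    moreover have "rk b m cyc T - d < J" using rk_le[of b m cyc T] J by simp
    ultimately show "(\<Sum>q=1..J. int Z ^ d * (-1) ^ card T *
        ((-1) ^ (q - 1) * int (J choose q) * int q ^ (rk b m cyc T - d))) =
      int Z ^ d * (if rk b m cyc T = d then (-1) ^ card T else 0)"
      by (simp only: sum_choose_alternating_shift flip: sum_distrib_left) auto
  qed
  also have "\<dots> = int Z ^ d * coef b m cyc d"
    by (simp add: coef_def sum_distrib_left[symmetric] sum.If_cases Int_def Pow_def)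
  finally show ?thesis .
qed

lemma coef_eq_0:
  assumes "d < nverts b m + nedges b m" "cyc \<longrightarrow> b m = b 0"
  shows "coef b m cyc d = 0"
proof -
  have "rk b m cyc T \<noteq> d" if "T \<subseteq> coinc b m" for T using rk_ge[OF that assms(2)] assms(1) by linarith
  then have "{T. T \<subseteq> coinc b m \<and> rk b m cyc T = d} = {}" by blast
  then show ?thesis unfolding coef_def by (simp only: sum.empty)
qed

lemma coinc_cong:
  assumes "\<And>x y. x \<le> m \<Longrightarrow> y \<le> m \<Longrightarrow> b x = b y \<longleftrightarrow> w x = w y"
  shows "coinc b m = coinc w m"
  unfolding coinc_def using assms by (auto simp: doubleton_eq_iff)

lemma glue_cong:
  assumes eq: "\<And>x y. x \<le> m \<Longrightarrow> y \<le> m \<Longrightarrow> b x = b y \<longleftrightarrow> w x = w y" and T: "T \<subseteq> coinc b m"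
  shows "glue b m cyc T = glue w m cyc T"
proof -
  have "link b p = link w p" if "p \<in> coinc b m" for p
    using that eq by (cases p) (fastforce simp: link_def coinc_def)
  then show ?thesis
    using T unfolding glue_def by (intro arg_cong2[of _ _ _ _ "(\<union>)"] SUP_cong refl) auto
qed

text \<open>The coefficient depends only on which positions carry equal vertices. This lets a walk
  on a clique be replaced by its sequence of colours.\<close>

lemma coef_cong:
  assumes eq: "\<And>x y. x \<le> m \<Longrightarrow> y \<le> m \<Longrightarrow> b x = b y \<longleftrightarrow> w x = w y"
  shows "coef b m cyc d = coef w m cyc d"
proof -
  have c: "coinc b m = coinc w m" using eq by (rule coinc_cong)
  have "glue b m cyc T = glue w m cyc T" if "T \<subseteq> coinc w m" for T
    by (rule glue_cong[OF eq]) (use that c in auto)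
  then have "{T. T \<subseteq> coinc b m \<and> rk b m cyc T = d} = {T. T \<subseteq> coinc w m \<and> rk w m cyc T = d}"
    unfolding rk_def c by (intro Collect_cong conj_cong) auto
  then show ?thesis unfolding coef_def by simp
qed

section \<open>Proper colourings of disjoint cliques and the sign of the lowest coefficient\<close>

text \<open>The graph coloured here is a disjoint union of cliques, the fibres of \<open>h\<close>.
  A proper colouring of \<open>A\<close> is injective on the fibre of \<open>a\<close>, so exactly
  that many colours are forbidden for \<open>a\<close>. If a colouring of \<open>A\<close> exists,
  this number is at most \<open>t\<close>; otherwise both sides are 0.\<close>

lemma proper_colourings_step:
  fixes h :: "'a \<Rightarrow> 'b"
  defines "P \<equiv> \<lambda>A t. {c \<in> A \<rightarrow>\<^sub>E {..<t}. \<forall>i\<in>A. \<forall>j\<in>A. i \<noteq> j \<and> h i = h j \<longrightarrow> c i \<noteq> (c j :: nat)}"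
  assumes A: "finite A" "a \<notin> A"
  shows "int (card (P (insert a A) t)) = int (card (P A t)) * (int t - int (card {i \<in> A. h i = h a}))"
proof -
  let ?F = "{i \<in> A. h i = h a}"
  let ?S = "SIGMA c:P A t. {..<t} - c ` ?F"
  have "P A t \<subseteq> A \<rightarrow>\<^sub>E {..<t}" unfolding P_def by blast
  then have fin: "finite (P A t)" by (rule finite_subset) (simp add: finite_PiE A)
  have "bij_betw (\<lambda>(c, v). c(a := v)) ?S (P (insert a A) t)"
  proof (rule bij_betw_imageI)
    show "inj_on (\<lambda>(c, v). c(a := v)) ?S"
    proof (rule inj_onI, clarify)
      fix c v c' v'
      assume c: "c \<in> P A t" "c' \<in> P A t" and eq: "c(a := v) = c'(a := v')"
      have "c x = c' x" for x
      proof (cases "x = a")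
        case True
        then have "c x = undefined" "c' x = undefined" using c A by (auto simp: P_def PiE_iff extensional_def)
        then show ?thesis by simp
      next
        case False
        then show ?thesis using fun_cong[OF eq, of x] by simp
      qed
      then show "c = c' \<and> v = v'" using fun_cong[OF eq, of a] by auto
    qed
    show "(\<lambda>(c, v). c(a := v)) ` ?S = P (insert a A) t"
    proof (intro equalityI subsetI)
      fix c assume "c \<in> (\<lambda>(c, v). c(a := v)) ` ?S"
      then obtain c0 v where c0: "c0 \<in> P A t" "v < t" "v \<notin> c0 ` ?F" "c = c0(a := v)" by auto
      show "c \<in> P (insert a A) t"
        unfolding P_def
      proof (intro CollectI conjI ballI impI)
        show "c \<in> insert a A \<rightarrow>\<^sub>E {..<t}" using c0 by (auto simp: P_def PiE_iff extensional_def)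
        fix i j assume "i \<in> insert a A" "j \<in> insert a A" "i \<noteq> j \<and> h i = h j"
        then show "c i \<noteq> c j" using c0 by (cases "i = a"; cases "j = a") (auto simp: P_def image_iff)
      qed
    next
      fix c assume c: "c \<in> P (insert a A) t"
      let ?c = "restrict c A"
      have "?c \<in> P A t" using c by (auto simp: P_def PiE_iff)
      moreover have "c a < t" using c by (auto simp: P_def PiE_iff)
      moreover have "c a \<notin> ?c ` ?F"
      proof
        assume "c a \<in> ?c ` ?F"
        then obtain i where "i \<in> A" "h i = h a" "c a = c i" by auto
        then show False using c A by (auto simp: P_def)
      qed
      moreover have "c = ?c(a := c a)"
      proof
        fix x show "c x = (?c(a := c a)) x"
          using c by (cases "x = a"; cases "x \<in> A") (auto simp: P_def PiE_iff extensional_def)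
      qed
      ultimately have "(?c, c a) \<in> ?S" "c = (\<lambda>(c, v). c(a := v)) (?c, c a)" by auto
      then show "c \<in> (\<lambda>(c, v). c(a := v)) ` ?S" by (rule rev_image_eqI)
    qed
  qed
  then have "card (P (insert a A) t) = card ?S" by (simp add: bij_betw_same_card)
  also have "\<dots> = (\<Sum>c\<in>P A t. card ({..<t} - c ` ?F))" using fin A by (intro card_SigmaI) auto
  finally have "int (card (P (insert a A) t)) = (\<Sum>c\<in>P A t. int (card ({..<t} - c ` ?F)))" by simp
  also have "\<dots> = (\<Sum>c\<in>P A t. int t - int (card ?F))"
  proof (rule sum.cong[OF refl])
    fix c assume c: "c \<in> P A t"
    then have sub: "c ` ?F \<subseteq> {..<t}" by (auto simp: P_def PiE_iff)
    have "inj_on c ?F" using c by (auto simp: P_def inj_on_def) metis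
    then have "card (c ` ?F) = card ?F" by (rule card_image)
    moreover have "card (c ` ?F) \<le> t" using card_mono[OF _ sub] by simp
    moreover have "card ({..<t} - c ` ?F) = t - card (c ` ?F)"
      using sub A by (subst card_Diff_subset) auto
    ultimately show "int (card ({..<t} - c ` ?F)) = int t - int (card ?F)" by simp
  qed
  finally show ?thesis by simp
qed

text \<open>The count is a product of falling factorials. The first element of each fibre
  contributes a factor \<open>t\<close>, every further one a factor \<open>t - n\<close> with
  \<open>n > 0\<close>. At 0 each of these further factors is negative, which gives the sign of
  \<open>poly r 0\<close>.\<close>

lemma proper_colourings:
  fixes h :: "'a \<Rightarrow> 'b"
  assumes "finite A"
  shows "\<exists>r :: int poly.
    (\<forall>t. int (card {c \<in> A \<rightarrow>\<^sub>E {..<t}. \<forall>i\<in>A. \<forall>j\<in>A. i \<noteq> j \<and> h i = h j \<longrightarrow> c i \<noteq> (c j :: nat)}) =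
      int t ^ card (h ` A) * poly r (int t)) \<and>
    0 < (-1) ^ (card A - card (h ` A)) * poly r 0"
  using assms
proof (induction A rule: finite_induct)
  case empty
  then show ?case by (intro exI[of _ 1]) simp
next
  case (insert a A)
  then obtain r :: "int poly" where
    r: "\<And>t. int (card {c \<in> A \<rightarrow>\<^sub>E {..<t}. \<forall>i\<in>A. \<forall>j\<in>A. i \<noteq> j \<and> h i = h j \<longrightarrow> c i \<noteq> (c j :: nat)}) =
        int t ^ card (h ` A) * poly r (int t)"
    and s: "0 < (-1) ^ (card A - card (h ` A)) * poly r 0" by blast
  let ?n = "card {i \<in> A. h i = h a}"
  note step = proper_colourings_step[OF insert.hyps, where h = h, unfolded r]
  show ?case
  proof (cases "h a \<in> h ` A")
    case False
    then have "{i \<in> A. h i = h a} = {}" by (auto simp: image_iff)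
    then have n: "?n = 0" by (simp only: card.empty)
    have c: "card (h ` insert a A) = Suc (card (h ` A))" "card (insert a A) = Suc (card A)"
      using False insert.hyps by simp_all
    show ?thesis unfolding step n c using s by (intro exI[of _ r]) simp
  next
    case True
    then have n: "0 < ?n" using insert.hyps by (auto simp: card_gt_0_iff)
    have c: "card (h ` insert a A) = card (h ` A)" using True by (simp add: insert_absorb)
    have "card (insert a A) - card (h ` A) = Suc (card A - card (h ` A))"
      using insert.hyps card_image_le[of A h] by (simp add: Suc_diff_le)
    then have "0 < (-1) ^ (card (insert a A) - card (h ` A)) * poly ([:- int ?n, 1:] * r) 0"
      using s n by (simp add: mult_less_0_iff mult.assoc[symmetric] zero_less_mult_iff)
    then show ?thesis unfolding step c by (intro exI[of _ "[:- int ?n, 1:] * r"]) (simp add: algebra_simps)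
  qed
qed

lemma int_poly_eqI:
  fixes p q :: "int poly"
  assumes "\<And>t :: nat. poly p (int t) = poly q (int t)"
  shows "p = q"
proof (rule ccontr)
  assume "p \<noteq> q"
  then have "finite {x. poly (p - q) x = 0}" by (intro poly_roots_finite) simp
  moreover have "range int \<subseteq> {x. poly (p - q) x = 0}" using assms by auto
  ultimately have "finite (range int)" by (rule rev_finite_subset)
  then show False using finite_imageD[OF _ inj_of_nat] by blast
qed

text \<open>The left-hand sum is the lowest coefficient of a product of falling factorials, one for every edge
  of \<open>w\<close>: labellings of the steps in which steps through the same edge are pairwise different.\<close>

lemma steps_coef_sign:
  "0 < (-1) ^ (m - nedges w m) * (\<Sum>T | T \<subseteq> coinc w m \<and> ncl {..<m} T = nedges w m. (-1) ^ card T :: int)"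
proof -
  let ?E = "nedges w m" and ?h = "\<lambda>i. {w i, w (Suc i)}"
  obtain r :: "int poly" where
    r: "\<And>t. int (card {c \<in> {..<m} \<rightarrow>\<^sub>E {..<t}. \<forall>i\<in>{..<m}. \<forall>j\<in>{..<m}. i \<noteq> j \<and> ?h i = ?h j \<longrightarrow> c i \<noteq> (c j :: nat)}) =
      int t ^ ?E * poly r (int t)"
    and s: "0 < (-1) ^ (m - ?E) * poly r 0"
    using proper_colourings[of "{..<m}" ?h] by (auto simp: nedges_def)
  \<comment> \<open>\<open>?p\<close> is the number of the same colourings, expanded by
    inclusion-exclusion instead of as a product. Comparing the coefficients of degree
    \<open>?E\<close> gives the claim.\<close>
  let ?p = "\<Sum>T\<in>Pow (coinc w m). monom ((-1) ^ card T :: int) (ncl {..<m} T)"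
  have "?p = monom 1 ?E * r"
  proof (rule int_poly_eqI)
    fix t :: nat
    have "{c \<in> {..<m} \<rightarrow>\<^sub>E {..<t}. \<forall>i\<in>{..<m}. \<forall>j\<in>{..<m}. i \<noteq> j \<and> ?h i = ?h j \<longrightarrow> c i \<noteq> c j} =
      {c \<in> {..<m} \<rightarrow>\<^sub>E {..<t}. \<forall>p\<in>coinc w m. \<not> c (fst p) = c (snd p)}"
    proof (intro Collect_cong conj_cong refl iffI ballI impI)
      fix c p assume "\<forall>i\<in>{..<m}. \<forall>j\<in>{..<m}. i \<noteq> j \<and> ?h i = ?h j \<longrightarrow> c i \<noteq> c j" "p \<in> coinc w m"
      then show "c (fst p) \<noteq> c (snd p)" by (fastforce simp: coinc_def)
    next
      fix c i j assume c: "\<forall>p\<in>coinc w m. c (fst p) \<noteq> c (snd p)"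
        and ij: "i \<in> {..<m}" "j \<in> {..<m}" "i \<noteq> j \<and> ?h i = ?h j"
      have "(i, j) \<in> coinc w m \<or> (j, i) \<in> coinc w m" using ij by (auto simp: coinc_def)
      then show "c i \<noteq> c j" using c by force
    qed
    then have "int t ^ ?E * poly r (int t) =
      int (card {c \<in> {..<m} \<rightarrow>\<^sub>E {..<t}. \<forall>p\<in>coinc w m. \<not> c (fst p) = c (snd p)})"
      using r[of t] by simp
    also have "\<dots> = (\<Sum>T\<in>Pow (coinc w m). (-1) ^ card T *
        int (card {c \<in> {..<m} \<rightarrow>\<^sub>E {..<t}. \<forall>p\<in>T. c (fst p) = c (snd p)}))"
      by (rule inclusion_exclusion_none) (auto intro: finite_PiE)
    also have "\<dots> = (\<Sum>T\<in>Pow (coinc w m). (-1) ^ card T * int t ^ ncl {..<m} T)"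
    proof (rule sum.cong[OF refl])
      fix T assume "T \<in> Pow (coinc w m)"
      then have "T \<subseteq> {..<m} \<times> {..<m}" by (auto simp: coinc_def)
      then have "card {c \<in> {..<m} \<rightarrow>\<^sub>E {..<t}. \<forall>(x, y)\<in>T. c x = c y} = t ^ ncl {..<m} T"
        by (intro card_respecting) auto
      then show "(-1) ^ card T * int (card {c \<in> {..<m} \<rightarrow>\<^sub>E {..<t}. \<forall>p\<in>T. c (fst p) = c (snd p)}) =
          (-1) ^ card T * int t ^ ncl {..<m} T"
        by (simp add: case_prod_beta)
    qed
    also have "\<dots> = poly ?p (int t)" by (simp add: poly_sum poly_monom)
    finally show "poly ?p (int t) = poly (monom 1 ?E * r) (int t)" by (simp add: poly_monom)
  qed
  then have "coeff ?p ?E = poly r 0" by (simp add: coeff_monom_mult poly_0_coeff_0)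
  moreover have "coeff ?p ?E = (\<Sum>T | T \<subseteq> coinc w m \<and> ncl {..<m} T = ?E. (-1) ^ card T)"
    by (simp add: coeff_sum sum.If_cases Int_def Pow_def)
  ultimately show ?thesis using s by simp
qed

text \<open>If gluing all coinciding steps does not identify all visits of each vertex, no set of
  coincidences attains the least number of classes.\<close>

definition rigid :: "(nat \<Rightarrow> 'a) \<Rightarrow> nat \<Rightarrow> bool \<Rightarrow> bool" where
  "rigid w m cyc \<longleftrightarrow>
     (\<forall>x\<le>m. \<forall>y\<le>m. w x = w y \<longrightarrow> (Inl x, Inl y) \<in> symcl (glue w m cyc (coinc w m)))"

text \<open>Neither \<open>link\<close> nor \<open>closing\<close> relates a step slot to a position
  slot, and the only pairs of step slots are those of \<open>T\<close>.\<close>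

lemma symcl_glue_steps:
  assumes "(Inr i, z) \<in> symcl (glue w m cyc T)"
  shows "\<exists>j. z = Inr j \<and> (i, j) \<in> symcl T"
  using assms
proof (induction rule: symcl_induct)
  case (step y z)
  then obtain j where j: "y = Inr j" "(i, j) \<in> symcl T" by blast
  then obtain j' where "z = Inr j'" "(j, j') \<in> T \<or> (j', j) \<in> T"
    using step(2) by (auto simp: glue_def link_def closing_def split: if_splits)
  then show ?case using symcl_trans[OF j(2)] symcl_base symcl_sym by metis
qed auto

text \<open>Along a chain of coincidences all steps traverse one edge, and endpoints at the same
  vertex are linked from each step to the next. The chain of length 0 relies on the two endpoints of
  a step being different vertices.\<close>

lemma symcl_steps_glue:
  assumes T: "T \<subseteq> coinc w m" and w: "\<forall>i<m. w i \<noteq> w (Suc i)" and i: "i < m"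
    and ij: "(i, j) \<in> symcl T"
  shows "j < m \<and> {w i, w (Suc i)} = {w j, w (Suc j)} \<and> (Inr i, Inr j) \<in> symcl (glue w m cyc T) \<and>
    (\<forall>x\<in>{i, Suc i}. \<forall>y\<in>{j, Suc j}. w x = w y \<longrightarrow> (Inl x, Inl y) \<in> symcl (glue w m cyc T))"
  using ij
proof (induction rule: symcl_induct)
  case refl
  then show ?case using w i by auto
next
  case (step j l)
  let ?R = "symcl (glue w m cyc T)"
  have jl: "{w j, w (Suc j)} = {w l, w (Suc l)}" "l < m"
    using step(2) T by (auto simp: coinc_def)
  have link: "(y, z) \<in> ?R" if "p \<in> T" "(y, z) \<in> link w p" for p y z
    using that by (intro symcl_base) (auto simp: glue_def)
  have 1: "(Inr j, Inr l) \<in> ?R"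
    using step(2) link[of "(j, l)" "Inr j" "Inr l"] link[of "(l, j)" "Inr l" "Inr j"] symcl_sym[of "Inr l" "Inr j"]
    by (auto simp: link_def)
  have 2: "(Inl x, Inl y) \<in> ?R" if "x \<in> {j, Suc j}" "y \<in> {l, Suc l}" "w x = w y" for x y
    using step(2) that link[of "(j, l)" "Inl x" "Inl y"] link[of "(l, j)" "Inl y" "Inl x"]
      symcl_sym[of "Inl y" "Inl x"]
    by (auto simp: link_def)
  show ?case
  proof (intro conjI ballI impI)
    show "l < m" "{w i, w (Suc i)} = {w l, w (Suc l)}" using jl step by auto
    show "(Inr i, Inr l) \<in> ?R" by (rule symcl_trans[OF _ 1]) (use step(3) in blast)
    fix x y assume x: "x \<in> {i, Suc i}" and y: "y \<in> {l, Suc l}" and xy: "w x = w y"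
    \<comment> \<open>The intermediate step \<open>j\<close> traverses the same edge, so one of its
      endpoints \<open>z\<close> lies at the vertex \<open>w y\<close>; \<open>x\<close> and
      \<open>y\<close> are connected through it.\<close>
    have "w y \<in> {w l, w (Suc l)}" using y by (elim insertE emptyE) simp_all
    then have "w y \<in> {w j, w (Suc j)}" by (simp only: jl(1))
    then have "w j = w y \<or> w (Suc j) = w y" by (simp add: eq_commute)
    then obtain z where z: "z \<in> {j, Suc j}" "w z = w y" by blast
    have "(Inl x, Inl z) \<in> ?R" using step(3) x z xy by auto
    then show "(Inl x, Inl y) \<in> ?R" by (rule symcl_trans) (rule 2[OF z(1) y z(2)])
  qed
qed

text \<open>Minimal rank means that all slots with equal \<open>proj\<close> are glued. For step
  slots this is a condition on the classes of \<open>T\<close> alone. Once it holds,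
  \<open>T\<close> generates the same gluing as the set of all coincidences, so the condition on
  position slots involves only the walk.\<close>

lemma rk_eq_rigid:
  assumes T: "T \<subseteq> coinc w m" and w: "\<forall>i<m. w i \<noteq> w (Suc i)" and cyc: "cyc \<longrightarrow> w m = w 0"
  shows "rk w m cyc T = nverts w m + nedges w m \<longleftrightarrow> rigid w m cyc \<and> ncl {..<m} T = nedges w m"
proof -
  let ?R = "glue w m cyc T" and ?h = "\<lambda>i. {w i, w (Suc i)}"
  have h: "\<forall>(x, y)\<in>T. ?h x = ?h y" using T by (auto simp: coinc_def)
  have ncl: "ncl {..<m} T = nedges w m \<longleftrightarrow>
      (\<forall>i\<in>{..<m}. \<forall>j\<in>{..<m}. ?h i = ?h j \<longrightarrow> (i, j) \<in> symcl T)"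
    unfolding nedges_def by (rule ncl_ge(2)[OF _ h]) simp
  show ?thesis
  proof
    assume "rk w m cyc T = nverts w m + nedges w m"
    then have R: "\<And>x y. x \<in> slots m \<Longrightarrow> y \<in> slots m \<Longrightarrow> proj w x = proj w y \<Longrightarrow> (x, y) \<in> symcl ?R"
      using rk_eq[OF T cyc] by blast
    have "glue w m cyc T \<subseteq> glue w m cyc (coinc w m)" using T by (auto simp: glue_def)
    then have "rigid w m cyc"
      unfolding rigid_def
    proof (intro allI impI)
      fix x y assume "x \<le> m" "y \<le> m" "w x = w y"
      then have "(Inl x, Inl y) \<in> symcl ?R" by (intro R) (auto simp: slots_def)
      then show "(Inl x, Inl y) \<in> symcl (glue w m cyc (coinc w m))"
        by (rule symcl_mono[OF \<open>?R \<subseteq> glue w m cyc (coinc w m)\<close>])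
    qed
    moreover have "(i, j) \<in> symcl T" if "i < m" "j < m" "?h i = ?h j" for i j
      using symcl_glue_steps[of i "Inr j" w m cyc T] R[of "Inr i" "Inr j"] that by (auto simp: slots_def)
    ultimately show "rigid w m cyc \<and> ncl {..<m} T = nedges w m" using ncl by auto
  next
    assume rig: "rigid w m cyc \<and> ncl {..<m} T = nedges w m"
    have steps: "(i, j) \<in> symcl T" if "i < m" "j < m" "?h i = ?h j" for i j
      using rig ncl that by auto
    \<comment> \<open>As \<open>T\<close> connects all steps through a common edge, every link of a
      coincidence outside \<open>T\<close> is implied by a chain inside \<open>T\<close>.\<close>
    have "glue w m cyc (coinc w m) \<subseteq> symcl ?R"
    proof (rule subrelI)
      fix x y assume xy: "(x, y) \<in> glue w m cyc (coinc w m)"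
      show "(x, y) \<in> symcl ?R"
      proof (cases "(x, y) \<in> closing m cyc")
        case True
        then show ?thesis by (intro symcl_base) (simp add: glue_def)
      next
        case False
        then obtain i j where ij: "(i, j) \<in> coinc w m" "(x, y) \<in> link w (i, j)"
          using xy by (auto simp: glue_def)
        then have "i < m" "(i, j) \<in> symcl T" using steps[of i j] by (auto simp: coinc_def)
        from symcl_steps_glue[OF T w this] show ?thesis using ij(2) by (auto simp: link_def)
      qed
    qed
    note sub = this
    have "(Inl x, Inl y) \<in> symcl ?R" if "x \<le> m" "y \<le> m" "w x = w y" for x y
    proof (rule symcl_least[OF sub])
      show "(Inl x, Inl y) \<in> symcl (glue w m cyc (coinc w m))" using rig that unfolding rigid_def by blast
    qed
    moreover have "(Inr i, Inr j) \<in> symcl ?R" if "i < m" "j < m" "?h i = ?h j" for i j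
      using symcl_steps_glue[OF T w that(1) steps[OF that]] by blast
    ultimately show "rk w m cyc T = nverts w m + nedges w m"
      unfolding rk_eq[OF T cyc] by (auto simp: slots_def)
  qed
qed

text \<open>By \<open>rk_eq_rigid\<close> the sets of minimal rank are either all those summed in
  \<open>steps_coef_sign\<close> or none, and the walk alone decides which.\<close>

lemma coef_sign:
  assumes w: "\<forall>i<m. w i \<noteq> w (Suc i)" and cyc: "cyc \<longrightarrow> w m = w 0" and d: "d = nverts w m + nedges w m"
  shows "if rigid w m cyc then 0 < (-1) ^ (m - nedges w m) * coef w m cyc d else coef w m cyc d = 0"
proof -
  have "{T. T \<subseteq> coinc w m \<and> rk w m cyc T = d} =
      (if rigid w m cyc then {T. T \<subseteq> coinc w m \<and> ncl {..<m} T = nedges w m} else {})"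
    unfolding d using rk_eq_rigid[OF _ w cyc] by auto
  then show ?thesis unfolding coef_def using steps_coef_sign[of m w] by (auto simp only: sum.empty split: if_splits)
qed

section \<open>Rigid walks and the tour\<close>

text \<open>Call the edge between 0 and \<open>i\<close> a spoke; \<open>inc x i\<close> says that
  position \<open>x\<close> is an end of a traversal of this spoke. All traversals of one spoke are
  glued. Every visit of \<open>i > 0\<close> belongs to a traversal of its spoke, so these visits
  form one class. Visits of 0 may belong to different spokes; the passages
  \<open>i, 0, Suc i\<close> given by \<open>chain\<close> join the classes of neighbouring
  spokes.\<close>

lemma rigid_if_spokes:
  assumes spoke: "\<And>x. x \<le> m \<Longrightarrow> w x \<noteq> (0 :: nat) \<Longrightarrow> (x < m \<and> w (Suc x) = 0) \<or> (0 < x \<and> w (x - 1) = 0)"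
    and w: "\<forall>i<m. w i \<noteq> w (Suc i)" "\<forall>x\<le>m. w x < k" and m: "0 < m"
    and chain: "\<And>i. 1 \<le> i \<Longrightarrow> Suc i < k \<Longrightarrow> \<exists>x. Suc (Suc x) \<le> m \<and> w x = i \<and> w (Suc x) = 0 \<and> w (Suc (Suc x)) = Suc i"
  shows "rigid w m cyc"
proof -
  let ?R = "symcl (glue w m cyc (coinc w m))"
  define inc where "inc x i \<longleftrightarrow> (\<exists>s<m. (x = s \<or> x = Suc s) \<and> {w s, w (Suc s)} = {0, i})" for x i
  have same: "(Inl x, Inl y) \<in> ?R" if "inc x i" "inc y i" "w x = w y" for x y i
  proof -
    obtain s t where s: "s < m" "x = s \<or> x = Suc s" "{w s, w (Suc s)} = {0, i}"
      and t: "t < m" "y = t \<or> y = Suc t" "{w t, w (Suc t)} = {0, i}"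
      using \<open>inc x i\<close> \<open>inc y i\<close> unfolding inc_def by blast
    consider "s = t" | "s < t" | "t < s" by linarith
    then show ?thesis
    proof cases
      case 1
      then have "x = y" using s t w(1) that(3) by auto
      then show ?thesis by simp
    next
      case 2
      then have "(s, t) \<in> coinc w m" using s t by (auto simp: coinc_def)
      then have "link w (s, t) \<subseteq> glue w m cyc (coinc w m)" by (auto simp: glue_def)
      moreover have "(Inl x, Inl y) \<in> link w (s, t)" using s t that(3) by (auto simp: link_def)
      ultimately show ?thesis by (intro symcl_base) blast
    next
      case 3
      then have "(t, s) \<in> coinc w m" using s t by (auto simp: coinc_def)
      then have "link w (t, s) \<subseteq> glue w m cyc (coinc w m)" by (auto simp: glue_def)
      moreover have "(Inl y, Inl x) \<in> link w (t, s)" using s t that(3) by (auto simp: link_def)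
      ultimately show ?thesis by (intro symcl_sym[OF symcl_base]) blast
    qed
  qed
  have incE: "inc x (w x)" if x: "x \<le> m" "w x \<noteq> 0" for x
    using spoke[OF x]
  proof (elim disjE)
    assume "x < m \<and> w (Suc x) = 0"
    then show ?thesis unfolding inc_def by (intro exI[of _ x]) auto
  next
    assume "0 < x \<and> w (x - 1) = 0"
    then show ?thesis unfolding inc_def using x by (intro exI[of _ "x - 1"]) auto
  qed
  have inc0: "\<exists>i. 1 \<le> i \<and> i < k \<and> inc x i" if x: "x \<le> m" "w x = 0" for x
  proof (cases "x < m")
    case True
    then have "inc x (w (Suc x))" unfolding inc_def using x by (intro exI[of _ x]) auto
    moreover have "w (Suc x) \<noteq> 0" "w (Suc x) < k" using w True x by (metis, auto)
    ultimately show ?thesis by (intro exI[of _ "w (Suc x)"]) auto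
  next
    case False
    then have xm: "x = m" "m = Suc (m - 1)" using x m by auto
    then have "inc x (w (m - 1))" unfolding inc_def using x by (intro exI[of _ "m - 1"]) auto
    moreover have "w (m - 1) \<noteq> 0" "w (m - 1) < k" using w(1)[rule_format, of "m - 1"] w(2) xm x by auto
    ultimately show ?thesis by (intro exI[of _ "w (m - 1)"]) auto
  qed
  have up: "(Inl x, Inl y) \<in> ?R"
    if up: "w x = 0" "w y = 0" "inc x i" "inc y (i + n)" "1 \<le> i" "i + n < k" for x y i n
    using up(2,4,6)
  proof (induction n arbitrary: y)
    case 0
    then show ?case using same up by auto
  next
    case (Suc n)
    \<comment> \<open>Position \<open>Suc z\<close> is a visit of 0 between the spokes
      \<open>i + n\<close> and \<open>Suc (i + n)\<close>, so it belongs to both and extends the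
      chain by one spoke.\<close>
    obtain z where z: "Suc (Suc z) \<le> m" "w z = i + n" "w (Suc z) = 0" "w (Suc (Suc z)) = Suc (i + n)"
      using chain[of "i + n"] up(5) Suc.prems by auto
    have "inc (Suc z) (i + n)" unfolding inc_def using z by (intro exI[of _ z]) auto
    moreover have "inc (Suc z) (i + Suc n)" unfolding inc_def using z by (intro exI[of _ "Suc z"]) auto
    ultimately show ?case
      using Suc.IH[of "Suc z"] same[of "Suc z" "i + Suc n" y] Suc.prems z up symcl_trans[of "Inl x" "Inl (Suc z)"] by simp
  qed
  show ?thesis
    unfolding rigid_def
  proof (intro allI impI)
    fix x y assume x: "x \<le> m" and y: "y \<le> m" and xy: "w x = w y"
    show "(Inl x, Inl y) \<in> ?R"
    proof (cases "w x = 0")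
      case False
      moreover have "inc y (w x)" using incE[OF y] xy False by simp
      ultimately show ?thesis using same incE[OF x] xy by blast
    next
      case True
      then obtain i j where i: "1 \<le> i" "i < k" "inc x i" and j: "1 \<le> j" "j < k" "inc y j"
        using inc0[OF x] inc0[OF y] xy by auto
      show ?thesis
      proof (cases "i \<le> j")
        case True
        then show ?thesis using up[of x y i "j - i"] i j xy \<open>w x = 0\<close> by auto
      next
        case False
        then have "(Inl y, Inl x) \<in> ?R" using up[of y x j "i - j"] i j xy \<open>w x = 0\<close> by auto
        then show ?thesis by (rule symcl_sym)
      qed
    qed
  qed
qed

text \<open>The tour first visits every vertex \<open>i > 0\<close> from \<open>0\<close>, which ties all visits of \<open>0\<close>
  together, and then runs through the triangles \<open>0, i, j\<close>.\<close>

definition tour_blocks :: "nat \<Rightarrow> nat list list" where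
  "tour_blocks k = map (\<lambda>i. [0, i]) [1..<k] @
     concat (map (\<lambda>i. map (\<lambda>j. [0, i, j]) (filter (\<lambda>j. j \<noteq> i) [1..<k])) [1..<k])"

definition tour :: "nat \<Rightarrow> nat list" where
  "tour k = concat (tour_blocks k) @ [0]"

text \<open>The number of steps: two for every spoke block and three for every ordered pair of
  distinct vertices other than 0. The final 0 of the list adds a position but no step block.\<close>

definition tour_len :: "nat \<Rightarrow> nat" where
  "tour_len k = 2 * (k - 1) + 3 * ((k - 1) * (k - 2))"

lemma tour_block_cases:
  "b \<in> set (tour_blocks k) \<Longrightarrow>
    (\<exists>i. 1 \<le> i \<and> i < k \<and> b = [0, i]) \<or> (\<exists>i j. 1 \<le> i \<and> i < k \<and> 1 \<le> j \<and> j < k \<and> i \<noteq> j \<and> b = [0, i, j])"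
  by (auto simp: tour_blocks_def)

lemma length_concat_concat: "length (concat (concat xss)) = sum_list (map (\<lambda>xs. length (concat xs)) xss)"
  by (induction xss) auto

lemma length_tour: "length (tour k) = Suc (tour_len k)"
proof -
  have f: "length (filter (\<lambda>j. j \<noteq> i) [1..<k]) = k - 2" if "i \<in> set [1..<k]" for i
  proof -
    have "length (filter (\<lambda>j. j \<noteq> i) [1..<k]) = card ({1..<k} - {i})"
      by (subst distinct_card[symmetric]) (auto intro!: arg_cong[of _ _ card])
    then show ?thesis using that by simp
  qed
  have "length (concat (map (\<lambda>i. [0, i]) [1..<k])) = 2 * (k - 1)"
    by (simp add: length_concat comp_def sum_list_triv)
  moreover have "length (concat (concat (map (\<lambda>i. map (\<lambda>j. [0, i, j]) (filter (\<lambda>j. j \<noteq> i) [1..<k])) [1..<k]))) =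
      3 * ((k - 1) * (k - 2))"
  proof -
    have "length (concat (concat (map (\<lambda>i. map (\<lambda>j. [0, i, j]) (filter (\<lambda>j. j \<noteq> i) [1..<k])) [1..<k]))) =
      sum_list (map (\<lambda>i. 3 * length (filter (\<lambda>j. j \<noteq> i) [1..<k])) [1..<k])"
      unfolding length_concat_concat map_map comp_def
      by (intro arg_cong[of _ _ sum_list] map_cong) (simp_all add: length_concat comp_def sum_list_triv)
    also have "\<dots> = sum_list (map (\<lambda>i. 3 * (k - 2)) [1..<k])"
      using f by (intro arg_cong[of _ _ sum_list] map_cong) auto
    finally show ?thesis by (simp add: sum_list_triv)
  qed
  ultimately show ?thesis by (simp add: tour_def tour_blocks_def tour_len_def)
qed

text \<open>The properties that \<open>rigid_if_spokes\<close> asks for, strengthened to an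
  invariant under prepending a block: since the rest starts with 0, the last vertex of the new block
  is followed by 0.\<close>

definition good_tour :: "nat \<Rightarrow> nat list \<Rightarrow> bool" where
  "good_tour k l \<longleftrightarrow> l \<noteq> [] \<and> l ! 0 = 0 \<and> last l = 0 \<and> (\<forall>x<length l. l ! x < k) \<and>
     (\<forall>x. Suc x < length l \<longrightarrow> l ! x \<noteq> l ! Suc x) \<and>
     (\<forall>x<length l. l ! x \<noteq> 0 \<longrightarrow> (Suc x < length l \<and> l ! Suc x = 0) \<or> (0 < x \<and> l ! (x - 1) = 0))"

lemma good_tour_2: "1 \<le> i \<Longrightarrow> i < k \<Longrightarrow> good_tour k l \<Longrightarrow> good_tour k (0 # i # l)"
  unfolding good_tour_def by (auto simp: nth_Cons less_Suc_eq_0_disj split: nat.splits)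

lemma good_tour_3:
  "1 \<le> i \<Longrightarrow> i < k \<Longrightarrow> 1 \<le> j \<Longrightarrow> j < k \<Longrightarrow> i \<noteq> j \<Longrightarrow> good_tour k l \<Longrightarrow> good_tour k (0 # i # j # l)"
  unfolding good_tour_def by (auto simp: nth_Cons less_Suc_eq_0_disj split: nat.splits)

lemma good_tour: "1 \<le> k \<Longrightarrow> good_tour k (tour k)"
proof -
  assume k: "1 \<le> k"
  have "set bs \<subseteq> set (tour_blocks k) \<Longrightarrow> good_tour k (concat bs @ [0])" for bs
  proof (induction bs)
    case Nil
    then show ?case using k by (simp add: good_tour_def)
  next
    case (Cons b bs)
    then have "b \<in> set (tour_blocks k)" by simp
    from tour_block_cases[OF this] show ?case
      using Cons good_tour_2 good_tour_3 by auto
  qed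
  then show ?thesis unfolding tour_def by blast
qed

lemma tour_step:
  assumes "i < k" "j < k" "i \<noteq> j"
  shows "\<exists>x<tour_len k. {tour k ! x, tour k ! Suc x} = {i, j}"
proof -
  have *: "\<exists>x<tour_len k. {tour k ! x, tour k ! Suc x} = {a, b}" if "tour k = us @ [a, b] @ vs" for us vs a b
    using that length_tour[of k]
    by (intro exI[of _ "length us"]) (auto simp: nth_append)
  have block: "\<exists>us vs. tour k = us @ b @ vs" if "b \<in> set (tour_blocks k)" for b
  proof -
    from split_list[OF that] obtain us vs where "tour_blocks k = us @ b # vs" by blast
    then show ?thesis unfolding tour_def by (intro exI[of _ "concat us"] exI[of _ "concat vs @ [0]"]) simp
  qed
  consider "i = 0" "1 \<le> j" | "j = 0" "1 \<le> i" | "1 \<le> i" "1 \<le> j" using assms by linarith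
  then show ?thesis
  proof cases
    case 1
    then have "[0, j] \<in> set (tour_blocks k)" using assms by (auto simp: tour_blocks_def)
    then obtain us vs where "tour k = us @ [0, j] @ vs" using block by blast
    then show ?thesis unfolding 1 by (rule *)
  next
    case 2
    then have "[0, i] \<in> set (tour_blocks k)" using assms by (auto simp: tour_blocks_def)
    then obtain us vs where "tour k = us @ [0, i] @ vs" using block by blast
    then show ?thesis unfolding 2 insert_commute[of i 0] by (rule *)
  next
    case 3
    then have "[0, i, j] \<in> set (tour_blocks k)" using assms by (auto simp: tour_blocks_def)
    then obtain us vs where "tour k = us @ [0, i, j] @ vs" using block by blast
    then have "tour k = (us @ [0]) @ [i, j] @ vs" by simp
    then show ?thesis by (rule *)
  qed
qed

lemma tour_chain:
  assumes "1 \<le> i" "Suc i < k"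
  shows "\<exists>x. Suc (Suc x) \<le> tour_len k \<and> tour k ! x = i \<and> tour k ! Suc x = 0 \<and> tour k ! Suc (Suc x) = Suc i"
proof -
  have "[1..<k] = [1..<i] @ [i..<k]" using assms upt_add_eq_append[of 1 i "k - i"] by simp
  also have "[i..<k] = [i, Suc i] @ [Suc (Suc i)..<k]"
    using assms upt_conv_Cons[of i k] upt_conv_Cons[of "Suc i" k] by (simp del: upt.simps)
  finally have "[1..<k] = [1..<i] @ [i, Suc i] @ [Suc (Suc i)..<k]" .
  note split = this
  have "map (\<lambda>i. [0, i]) [1..<k] = map (\<lambda>i. [0, i]) [1..<i] @ [[0, i], [0, Suc i]] @
      map (\<lambda>i. [0, i]) [Suc (Suc i)..<k]"
    unfolding split by (simp only: map_append list.map)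
  then have "tour k = concat (map (\<lambda>i. [0, i]) [1..<i]) @ [0, i, 0, Suc i] @
      (concat (map (\<lambda>i. [0, i]) [Suc (Suc i)..<k]) @
      concat (concat (map (\<lambda>i. map (\<lambda>j. [0, i, j]) (filter (\<lambda>j. j \<noteq> i) [1..<k])) [1..<k])) @ [0])"
    by (simp only: tour_def tour_blocks_def concat_append concat.simps append.assoc append.simps)
  then obtain us vs where "tour k = us @ [0, i, 0, Suc i] @ vs" by blast
  then show ?thesis using length_tour[of k]
    by (intro exI[of _ "Suc (length us)"]) (auto simp: nth_append)
qed

lemma rigid_tour:
  assumes "2 \<le> k"
  shows "rigid (\<lambda>x. tour k ! x) (tour_len k) cyc"
proof (rule rigid_if_spokes)
  have g: "good_tour k (tour k)" using good_tour assms by simp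
  show "(x < tour_len k \<and> tour k ! Suc x = 0) \<or> (0 < x \<and> tour k ! (x - 1) = 0)"
    if "x \<le> tour_len k" "tour k ! x \<noteq> 0" for x
    using g that unfolding good_tour_def length_tour by auto
  show "\<forall>i<tour_len k. tour k ! i \<noteq> tour k ! Suc i" "\<forall>x\<le>tour_len k. tour k ! x < k"
    using g unfolding good_tour_def length_tour by auto
  show "0 < tour_len k" using assms by (simp add: tour_len_def)
qed (rule tour_chain)

section \<open>Walks through all colours\<close>

text \<open>The vertex colour \<open>i\<close> is coded by \<open>i * k + i\<close>, the two orders of an edge colour by \<open>i * k + j\<close> and
  \<open>j * k + i\<close>. The number \<open>v * k + i\<close> stands for the vertex \<open>v\<close> with colour \<open>i\<close>.\<close>

definition cols :: "nat \<Rightarrow> nat \<Rightarrow> nat \<Rightarrow> nat set" where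
  "cols k i j = {i * k + i, j * k + j, i * k + j, j * k + i}"

definition adj_cols :: "(nat \<Rightarrow> nat \<Rightarrow> bool) \<Rightarrow> nat \<Rightarrow> nat set \<Rightarrow> nat \<Rightarrow> nat \<Rightarrow> bool" where
  "adj_cols E k S \<beta> \<gamma> \<longleftrightarrow>
     \<beta> mod k \<noteq> \<gamma> mod k \<and> cols k (\<beta> mod k) (\<gamma> mod k) \<subseteq> S \<and> E (\<beta> div k) (\<gamma> div k)"

definition bwalks :: "(nat \<Rightarrow> nat \<Rightarrow> bool) \<Rightarrow> nat \<Rightarrow> nat \<Rightarrow> nat \<Rightarrow> bool \<Rightarrow> nat set \<Rightarrow> (nat \<Rightarrow> nat) set" where
  "bwalks E n k m cyc S = {b \<in> {..m} \<rightarrow>\<^sub>E {..<n * k}.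
     (\<forall>i<m. adj_cols E k S (b i) (b (Suc i))) \<and> (cyc \<longrightarrow> b m = b 0)}"

definition wcols :: "nat \<Rightarrow> nat \<Rightarrow> (nat \<Rightarrow> nat) \<Rightarrow> nat set" where
  "wcols k m w = (\<Union>i<m. cols k (w i mod k) (w (Suc i) mod k))"

definition full_walks :: "(nat \<Rightarrow> nat \<Rightarrow> bool) \<Rightarrow> nat \<Rightarrow> nat \<Rightarrow> nat \<Rightarrow> bool \<Rightarrow> (nat \<Rightarrow> nat) set" where
  "full_walks E n k m cyc = {b \<in> bwalks E n k m cyc {..<k * k}. wcols k m b = {..<k * k}}"

definition colour_walks :: "nat \<Rightarrow> nat \<Rightarrow> bool \<Rightarrow> (nat \<Rightarrow> nat) set" where
  "colour_walks k m cyc = {w \<in> {..m} \<rightarrow>\<^sub>E {..<k}.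
     (\<forall>i<m. w i \<noteq> w (Suc i)) \<and> (cyc \<longrightarrow> w m = w 0) \<and> wcols k m w = {..<k * k}}"

definition ordered_cliques :: "(nat \<Rightarrow> nat \<Rightarrow> bool) \<Rightarrow> nat \<Rightarrow> nat \<Rightarrow> (nat \<Rightarrow> nat) set" where
  "ordered_cliques E n k = {v \<in> {..<k} \<rightarrow>\<^sub>E {..<n}. \<forall>i<k. \<forall>j<k. i \<noteq> j \<longrightarrow> E (v i) (v j)}"

lemma finite_bwalks [simp]: "finite (bwalks E n k m cyc S)"
  unfolding bwalks_def by (rule finite_subset[of _ "{..m} \<rightarrow>\<^sub>E {..<n * k}"]) (blast, simp add: finite_PiE)

lemma finite_full_walks [simp]: "finite (full_walks E n k m cyc)"
  unfolding full_walks_def by simp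

lemma finite_colour_walks [simp]: "finite (colour_walks k m cyc)"
  unfolding colour_walks_def by (rule finite_subset[of _ "{..m} \<rightarrow>\<^sub>E {..<k}"]) (blast, simp add: finite_PiE)

lemma pair_code_inj:
  assumes "i * k + j = i' * k + j'" "j < k" "j' < (k :: nat)"
  shows "i = i'" "j = j'"
proof -
  have "(i * k + j) div k = i" "(i' * k + j') div k = i'" "(i * k + j) mod k = j" "(i' * k + j') mod k = j'"
    using assms(2,3) by simp_all
  then show "i = i'" "j = j'" using assms(1) by metis+
qed

lemma cols_subset: "i < k \<Longrightarrow> j < k \<Longrightarrow> cols k i j \<subseteq> {..<k * k}"
proof -
  assume ij: "i < k" "j < k"
  have "a * k + c < k * k" if "a < k" "c < k" for a c
  proof -
    have "a * k + c < Suc a * k" using that by simp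
    also have "\<dots> \<le> k * k" using that by (intro mult_right_mono) auto
    finally show ?thesis .
  qed
  then show ?thesis using ij by (auto simp: cols_def)
qed

text \<open>Only edge colours have to be checked: a step contributes the colours of its two ends as
  well, and with at least two colours every vertex colour belongs to some pair. The reduction
  \<open>mod k\<close> lets the statement serve for coloured walks in \<open>G\<close> and for walks
  on the colours themselves.\<close>

lemma wcols_full_iff:
  assumes k: "2 \<le> k"
  shows "wcols k m w = {..<k * k} \<longleftrightarrow>
    (\<forall>i<k. \<forall>j<k. i \<noteq> j \<longrightarrow> (\<exists>x<m. {w x mod k, w (Suc x) mod k} = {i, j}))" (is "?L \<longleftrightarrow> ?R")
proof
  assume L: ?L
  show ?R
  proof (intro allI impI)
    fix i j assume ij: "i < k" "j < k" "i \<noteq> j"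
    have "i * k + j \<in> cols k i j" by (simp add: cols_def)
    then have "i * k + j \<in> wcols k m w" using cols_subset[of i k j] ij L by blast
    then obtain x where x: "x < m" "i * k + j \<in> cols k (w x mod k) (w (Suc x) mod k)"
      by (auto simp: wcols_def)
    have lt: "w x mod k < k" "w (Suc x) mod k < k" using k by auto
    have inj: "i = c \<and> j = e" if "i * k + j = c * k + e" "e < k" for c e
      using pair_code_inj[OF that(1) ij(2) that(2)] by blast
    have "i = w x mod k \<and> j = w (Suc x) mod k \<or> i = w (Suc x) mod k \<and> j = w x mod k"
      using x(2) ij(3) inj[OF _ lt(1), of "w x mod k"] inj[OF _ lt(1), of "w (Suc x) mod k"]
        inj[OF _ lt(2), of "w x mod k"] inj[OF _ lt(2), of "w (Suc x) mod k"]
      unfolding cols_def insert_iff empty_iff by blast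
    then have "{w x mod k, w (Suc x) mod k} = {i, j}" by (elim disjE conjE) (simp_all add: insert_commute)
    then show "\<exists>x<m. {w x mod k, w (Suc x) mod k} = {i, j}" using x by blast
  qed
next
  assume R: ?R
  have sub: "cols k i j \<subseteq> wcols k m w" if ij: "i < k" "j < k" "i \<noteq> j" for i j
  proof -
    obtain x where x: "x < m" "{w x mod k, w (Suc x) mod k} = {i, j}" using R ij by blast
    have "cols k (w x mod k) (w (Suc x) mod k) = cols k i j"
      using x(2) by (auto simp: doubleton_eq_iff cols_def)
    then show ?thesis using x(1) by (auto simp: wcols_def)
  qed
  show ?L
  proof (intro equalityI subsetI)
    fix z assume "z \<in> wcols k m w"
    then obtain x where x: "z \<in> cols k (w x mod k) (w (Suc x) mod k)" unfolding wcols_def by blast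
    have "cols k (w x mod k) (w (Suc x) mod k) \<subseteq> {..<k * k}" by (rule cols_subset) (use k in auto)
    then show "z \<in> {..<k * k}" using x by (rule subsetD)
  next
    fix z assume "z \<in> {..<k * k}"
    then have ij: "z div k < k" "z mod k < k" "z = (z div k) * k + z mod k"
      using k by (auto simp: less_mult_imp_div_less)
    \<comment> \<open>If \<open>z\<close> codes a vertex colour, any other colour can be its
      partner; 0 or 1 will do. If it codes an edge colour, the partner is the second colour of the
      pair.\<close>
    obtain j where j: "j < k" "z div k \<noteq> j" "z mod k \<noteq> z div k \<longrightarrow> j = z mod k"
    proof (cases "z mod k = z div k")
      case True
      have "(if z div k = 0 then 1 else 0) < k" "z div k \<noteq> (if z div k = 0 then 1 else 0)" using k by auto
      then show ?thesis using that True by blast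
    next
      case False
      then show ?thesis using that ij by metis
    qed
    have "z \<in> cols k (z div k) j"
      using ij(3) j(3) by (cases "z mod k = z div k") (auto simp: cols_def)
    then show "z \<in> wcols k m w" using sub[OF ij(1) j(1,2)] by blast
  qed
qed

lemma wcols_fullD:
  assumes "2 \<le> k" "wcols k m w = {..<k * k}" "i < k" "j < k" "i \<noteq> j"
  shows "\<exists>x<m. {w x mod k, w (Suc x) mod k} = {i, j}"
  using assms(2)[unfolded wcols_full_iff[OF assms(1)], rule_format, OF assms(3-5)] .

lemma full_nverts:
  assumes k: "2 \<le> k" and f: "wcols k m w = {..<k * k}"
  shows "(\<lambda>b. b mod k) ` w ` {..m} = {..<k}" "k \<le> nverts w m"
proof -
  show 1: "(\<lambda>b. b mod k) ` w ` {..m} = {..<k}"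
  proof (intro equalityI subsetI)
    fix i assume "i \<in> {..<k}"
    moreover define j where "j = (if i = 0 then 1 else 0 :: nat)"
    ultimately have "i < k" "j < k" "i \<noteq> j" using k by auto
    then obtain x where x: "x < m" "{w x mod k, w (Suc x) mod k} = {i, j}"
      using wcols_fullD[OF k f, of i j] by blast
    then have "w x mod k = i \<or> w (Suc x) mod k = i" by (auto simp: doubleton_eq_iff)
    then show "i \<in> (\<lambda>b. b mod k) ` w ` {..m}" using x(1) by (auto simp: image_iff intro: bexI[of _ x] bexI[of _ "Suc x"])
  qed (use k in auto)
  have "card ((\<lambda>b. b mod k) ` w ` {..m}) \<le> card (w ` {..m})" by (intro card_image_le) auto
  then show "k \<le> nverts w m" unfolding 1 nverts_def by simp
qed

text \<open>Reduction \<open>mod k\<close> maps the traversed edges onto all pairs of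
  colours.\<close>

lemma full_nedges:
  assumes k: "2 \<le> k" and f: "wcols k m w = {..<k * k}"
  shows "k choose 2 \<le> nedges w m"
proof -
  let ?P = "{e. e \<subseteq> {..<k} \<and> card e = 2}"
  let ?g = "\<lambda>e. (\<lambda>b. b mod k) ` e"
  have "?P \<subseteq> ?g ` (\<lambda>i. {w i, w (Suc i)}) ` {..<m}"
  proof
    fix e assume "e \<in> ?P"
    then obtain i j where e: "e = {i, j}" "i \<noteq> j" "i < k" "j < k" by (auto simp: card_2_iff)
    then obtain x where x: "x < m" "{w x mod k, w (Suc x) mod k} = {i, j}"
      using wcols_fullD[OF k f, of i j] by blast
    have "e = ?g {w x, w (Suc x)}" using x(2) e(1) by simp
    moreover have "{w x, w (Suc x)} \<in> (\<lambda>i. {w i, w (Suc i)}) ` {..<m}" using x(1) by blast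
    ultimately show "e \<in> ?g ` (\<lambda>i. {w i, w (Suc i)}) ` {..<m}" by (rule image_eqI)
  qed
  then have "card ?P \<le> card (?g ` (\<lambda>i. {w i, w (Suc i)}) ` {..<m})" by (intro card_mono) auto
  also have "\<dots> \<le> nedges w m" unfolding nedges_def by (intro card_image_le) auto
  finally show ?thesis using n_subsets[of "{..<k}" 2] by simp
qed

lemma colour_walk_counts:
  assumes k: "2 \<le> k" and w: "w \<in> colour_walks k m cyc"
  shows "nverts w m = k" "nedges w m = k choose 2"
proof -
  have f: "wcols k m w = {..<k * k}" and lt: "\<And>x. x \<le> m \<Longrightarrow> w x < k" and ne: "\<And>i. i < m \<Longrightarrow> w i \<noteq> w (Suc i)"
    using w by (auto simp: colour_walks_def PiE_iff)
  have "w ` {..m} \<subseteq> {..<k}" using lt by auto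
  from card_mono[OF finite_lessThan this] have "nverts w m \<le> k" by (simp add: nverts_def)
  then show "nverts w m = k" using full_nverts[OF k f] by simp
  have "(\<lambda>i. {w i, w (Suc i)}) ` {..<m} \<subseteq> {e. e \<subseteq> {..<k} \<and> card e = 2}" using lt ne by auto
  then have "nedges w m \<le> card {e. e \<subseteq> {..<k} \<and> card e = 2}" unfolding nedges_def by (intro card_mono) auto
  then show "nedges w m = k choose 2" using full_nedges[OF k f] n_subsets[of "{..<k}" 2] by simp
qed

text \<open>A walk is allowed for \<open>S\<close> exactly if all its colours lie in
  \<open>S\<close>. After exchanging the sums, each walk is weighted by the alternating sum over the
  supersets of its colour set.\<close>

lemma sum_bwalks_alternating:
  "(\<Sum>S\<in>Pow {..<k * k}. (-1) ^ card ({..<k * k} - S) * (\<Sum>b\<in>bwalks E n k m cyc S. F b)) =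
    (\<Sum>b\<in>full_walks E n k m cyc. F b :: int)"
proof -
  let ?C = "{..<k * k}"
  have sub: "bwalks E n k m cyc S = {b \<in> bwalks E n k m cyc ?C. wcols k m b \<subseteq> S}" if "S \<subseteq> ?C" for S
    using that by (auto simp: bwalks_def adj_cols_def wcols_def)
  have "(\<Sum>S\<in>Pow ?C. (-1) ^ card (?C - S) * (\<Sum>b\<in>bwalks E n k m cyc S. F b)) =
    (\<Sum>S\<in>Pow ?C. \<Sum>b\<in>bwalks E n k m cyc ?C. if wcols k m b \<subseteq> S then (-1) ^ card (?C - S) * F b else 0)"
  proof (rule sum.cong[OF refl])
    fix S assume "S \<in> Pow ?C"
    then show "(-1) ^ card (?C - S) * (\<Sum>b\<in>bwalks E n k m cyc S. F b) =
        (\<Sum>b\<in>bwalks E n k m cyc ?C. if wcols k m b \<subseteq> S then (-1) ^ card (?C - S) * F b else 0)"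
      by (subst sub) (simp_all add: sum_distrib_left sum.If_cases Int_def)
  qed
  also have "\<dots> = (\<Sum>b\<in>bwalks E n k m cyc ?C. \<Sum>S\<in>Pow ?C. if wcols k m b \<subseteq> S then (-1) ^ card (?C - S) * F b else 0)"
    by (rule sum.swap)
  also have "\<dots> = (\<Sum>b\<in>bwalks E n k m cyc ?C. if wcols k m b = ?C then F b else 0)"
  proof (rule sum.cong[OF refl])
    fix b assume b: "b \<in> bwalks E n k m cyc ?C"
    then have "wcols k m b \<subseteq> ?C" by (auto simp: bwalks_def adj_cols_def wcols_def)
    then have "(\<Sum>S | S \<subseteq> ?C \<and> wcols k m b \<subseteq> S. (-1) ^ card (?C - S)) = (if wcols k m b = ?C then 1 else 0 :: int)"
      by (intro sum_supersets_alternating) auto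
    moreover have "(\<Sum>S\<in>Pow ?C. if wcols k m b \<subseteq> S then (-1) ^ card (?C - S) * F b else 0) =
        (\<Sum>S | S \<subseteq> ?C \<and> wcols k m b \<subseteq> S. (-1) ^ card (?C - S)) * F b"
      by (simp add: sum_distrib_right sum.If_cases Int_def Pow_def)
    ultimately show "(\<Sum>S\<in>Pow ?C. if wcols k m b \<subseteq> S then (-1) ^ card (?C - S) * F b else 0) =
        (if wcols k m b = ?C then F b else 0)" by simp
  qed
  also have "\<dots> = (\<Sum>b\<in>full_walks E n k m cyc. F b)"
    by (simp add: full_walks_def sum.If_cases Int_def)
  finally show ?thesis .
qed

text \<open>If only \<open>k\<close> vertices are visited and all \<open>k\<close> colours occur,
  each colour belongs to exactly one visited vertex. So the walk consists of its colour sequence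
  \<open>w\<close> and an assignment \<open>v\<close> of vertices to colours. Every pair of colours
  is traversed, in one direction at least, hence \<open>v\<close> enumerates a clique by symmetry of
  \<open>E\<close>.\<close>

lemma collapsed_walks:
  assumes k: "2 \<le> k" and sym: "\<And>u v. E u v \<Longrightarrow> E v u"
  shows "bij_betw (\<lambda>(v, w). \<lambda>x\<in>{..m}. v (w x) * k + w x) (ordered_cliques E n k \<times> colour_walks k m cyc)
    {b \<in> full_walks E n k m cyc. nverts b m = k}"
proof (rule bij_betw_imageI)
  let ?\<Phi> = "\<lambda>(v, w). \<lambda>x\<in>{..m}. v (w x) * k + w x"
  have onto: "\<exists>x\<le>m. w x = i" if "w \<in> colour_walks k m cyc" "i < k" for w i
  proof -
    have "(\<lambda>b. b mod k) ` w ` {..m} = {..<k}" using that full_nverts(1)[OF k] by (auto simp: colour_walks_def)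
    then have "i \<in> (\<lambda>b. b mod k) ` w ` {..m}" using that by simp
    then obtain x where "x \<le> m" "w x mod k = i" by auto
    moreover have "w x < k" using that \<open>x \<le> m\<close> by (auto simp: colour_walks_def PiE_iff)
    ultimately show ?thesis by auto
  qed
  show "inj_on ?\<Phi> (ordered_cliques E n k \<times> colour_walks k m cyc)"
  proof (rule inj_onI, clarify)
    fix v w v' w'
    assume v: "v \<in> ordered_cliques E n k" "v' \<in> ordered_cliques E n k"
      and w: "w \<in> colour_walks k m cyc" "w' \<in> colour_walks k m cyc"
      and eq: "(\<lambda>x\<in>{..m}. v (w x) * k + w x) = (\<lambda>x\<in>{..m}. v' (w' x) * k + w' x)"
    have e: "v (w x) = v' (w' x)" "w x = w' x" if "x \<le> m" for x
    proof -
      have "v (w x) * k + w x = v' (w' x) * k + w' x" using fun_cong[OF eq, of x] that by simp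
      moreover have "w x < k" "w' x < k" using w that by (auto simp: colour_walks_def PiE_iff)
      ultimately show "v (w x) = v' (w' x)" "w x = w' x" by (auto dest: pair_code_inj)
    qed
    have "w = w'"
      by (rule PiE_ext[of w "{..m}" "\<lambda>_. {..<k}"]) (use w e in \<open>auto simp: colour_walks_def\<close>)
    moreover have "v = v'"
    proof (rule PiE_ext[of v "{..<k}" "\<lambda>_. {..<n}"])
      fix i assume "i \<in> {..<k}"
      then obtain x where "x \<le> m" "w x = i" using onto[OF w(1)] by auto
      then show "v i = v' i" using e[of x] by simp
    qed (use v in \<open>auto simp: ordered_cliques_def\<close>)
    ultimately show "v = v' \<and> w = w'" by simp
  qed
  show "?\<Phi> ` (ordered_cliques E n k \<times> colour_walks k m cyc) = {b \<in> full_walks E n k m cyc. nverts b m = k}"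
  proof (intro equalityI subsetI)
    fix b assume "b \<in> ?\<Phi> ` (ordered_cliques E n k \<times> colour_walks k m cyc)"
    then obtain v w where v: "v \<in> ordered_cliques E n k" and w: "w \<in> colour_walks k m cyc"
      and b: "b = (\<lambda>x\<in>{..m}. v (w x) * k + w x)" by auto
    have wk: "w x < k" if "x \<le> m" for x using w that by (auto simp: colour_walks_def PiE_iff)
    have vn: "v i < n" if "i < k" for i using v that by (auto simp: ordered_cliques_def PiE_iff)
    have bmod: "b x mod k = w x" "b x div k = v (w x)" if "x \<le> m" for x
      using wk[OF that] that by (simp_all add: b)
    have lt: "b x < n * k" if "x \<le> m" for x
    proof -
      have "b x < Suc (v (w x)) * k" using wk[OF that] that by (simp add: b)
      also have "\<dots> \<le> n * k" using vn[OF wk[OF that]] by (intro mult_right_mono) auto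
      finally show ?thesis .
    qed
    have wc: "wcols k m b = wcols k m w"
      unfolding wcols_def using bmod wk by (intro SUP_cong refl) auto
    have "b \<in> bwalks E n k m cyc {..<k * k}"
      unfolding bwalks_def
    proof (intro CollectI conjI allI impI)
      show "b \<in> {..m} \<rightarrow>\<^sub>E {..<n * k}" using lt by (auto simp: b)
      show "b m = b 0" if cyc using w that by (simp add: b colour_walks_def)
      fix i assume i: "i < m"
      have "w i \<noteq> w (Suc i)" using w i by (auto simp: colour_walks_def)
      then show "adj_cols E k {..<k * k} (b i) (b (Suc i))"
        unfolding adj_cols_def using i bmod wk cols_subset v by (auto simp: ordered_cliques_def)
    qed
    moreover have "wcols k m b = {..<k * k}" unfolding wc using w by (simp add: colour_walks_def)
    moreover have "nverts b m = k"
    proof -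
      have "b ` {..m} = (\<lambda>i. v i * k + i) ` w ` {..m}" by (auto simp: b)
      moreover have "w ` {..m} = {..<k}" using onto[OF w] wk by force
      moreover have "inj_on (\<lambda>i. v i * k + i) {..<k}" by (auto intro!: inj_onI dest: pair_code_inj)
      ultimately show ?thesis by (simp add: nverts_def card_image)
    qed
    ultimately show "b \<in> {b \<in> full_walks E n k m cyc. nverts b m = k}" by (simp add: full_walks_def)
  next
    fix b assume "b \<in> {b \<in> full_walks E n k m cyc. nverts b m = k}"
    then have b: "b \<in> bwalks E n k m cyc {..<k * k}" "wcols k m b = {..<k * k}" "nverts b m = k"
      by (auto simp: full_walks_def)
    let ?w = "\<lambda>x\<in>{..m}. b x mod k"
    have im: "(\<lambda>b. b mod k) ` b ` {..m} = {..<k}" by (rule full_nverts(1)[OF k b(2)])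
    have inj: "inj_on (\<lambda>b. b mod k) (b ` {..m})"
      by (rule eq_card_imp_inj_on) (use im b(3) in \<open>auto simp: nverts_def\<close>)
    \<comment> \<open>The unique visited vertex of a given colour.\<close>
    let ?u = "inv_into (b ` {..m}) (\<lambda>b. b mod k)"
    let ?v = "\<lambda>i\<in>{..<k}. ?u i div k"
    have u: "?u (b x mod k) = b x" if "x \<le> m" for x
      using inj that by (intro inv_into_f_f) auto
    have lt: "b x < n * k" if "x \<le> m" for x using b(1) that by (auto simp: bwalks_def PiE_iff)
    have mk: "x mod k < k" for x using k by simp
    have wc: "wcols k m ?w = wcols k m b" unfolding wcols_def by (intro SUP_cong refl) auto
    have w: "?w \<in> colour_walks k m cyc"
      unfolding colour_walks_def
    proof (intro CollectI conjI allI impI)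
      show "?w \<in> {..m} \<rightarrow>\<^sub>E {..<k}" using mk by auto
      show "?w i \<noteq> ?w (Suc i)" if "i < m" for i using b(1) that by (auto simp: bwalks_def adj_cols_def)
      show "?w m = ?w 0" if cyc using b(1) that by (auto simp: bwalks_def)
      show "wcols k m ?w = {..<k * k}" using wc b(2) by simp
    qed
    have v: "?v \<in> ordered_cliques E n k"
      unfolding ordered_cliques_def
    proof (intro CollectI conjI allI impI)
      have "?u i \<in> b ` {..m}" if "i < k" for i using that im by (intro inv_into_into) auto
      then have "?u i < n * k" if "i < k" for i using that lt by fastforce
      then have "?u i div k < n" if "i < k" for i using that by (intro less_mult_imp_div_less) blast
      then show "?v \<in> {..<k} \<rightarrow>\<^sub>E {..<n}" by (intro restrict_PiE_iff[THEN iffD2] ballI) simp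
      fix i j assume ij: "i < k" "j < k" "i \<noteq> j"
      obtain x where x: "x < m" "{b x mod k, b (Suc x) mod k} = {i, j}"
        using wcols_fullD[OF k b(2) ij] by blast
      have "E (b x div k) (b (Suc x) div k)" using b(1) x(1) by (auto simp: bwalks_def adj_cols_def)
      moreover have "?v (b x mod k) = b x div k" "?v (b (Suc x) mod k) = b (Suc x) div k"
        using u[of x] u[of "Suc x"] x(1) mk by simp_all
      ultimately have "E (?v (b x mod k)) (?v (b (Suc x) mod k))" by (simp only:)
      note e = this
      have "b x mod k = i \<and> b (Suc x) mod k = j \<or> b x mod k = j \<and> b (Suc x) mod k = i"
        using x(2) by (simp add: doubleton_eq_iff)
      then show "E (?v i) (?v j)" using e sym[OF e] by (elim disjE conjE) (simp_all only:)
    qed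
    have "b = ?\<Phi> (?v, ?w)"
    proof
      fix x show "b x = ?\<Phi> (?v, ?w) x"
        using b(1) u[of x] mk by (cases "x \<le> m") (auto simp: bwalks_def PiE_iff extensional_def)
    qed
    then show "b \<in> ?\<Phi> ` (ordered_cliques E n k \<times> colour_walks k m cyc)" using v w by blast
  qed
qed

text \<open>Full walks on more than \<open>k\<close> vertices have only larger exponents and drop
  out. On the others the coefficient sees only the colour walk, so the choice of the clique splits
  off as a factor.\<close>

lemma sum_coef_full_walks:
  assumes k: "2 \<le> k" and sym: "\<And>u v. E u v \<Longrightarrow> E v u"
  shows "(\<Sum>b\<in>full_walks E n k m cyc. coef b m cyc (k + (k choose 2))) =
    int (card (ordered_cliques E n k)) * (\<Sum>w\<in>colour_walks k m cyc. coef w m cyc (k + (k choose 2)))"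
proof -
  let ?d = "k + (k choose 2)"
  let ?\<Phi> = "\<lambda>(v, w). \<lambda>x\<in>{..m}. v (w x) * k + w x"
  have "(\<Sum>b\<in>full_walks E n k m cyc. coef b m cyc ?d) =
    (\<Sum>b\<in>{b \<in> full_walks E n k m cyc. nverts b m = k}. coef b m cyc ?d)"
  proof (rule sum.mono_neutral_right)
    show "\<forall>b\<in>full_walks E n k m cyc - {b \<in> full_walks E n k m cyc. nverts b m = k}. coef b m cyc ?d = 0"
    proof
      fix b assume b: "b \<in> full_walks E n k m cyc - {b \<in> full_walks E n k m cyc. nverts b m = k}"
      then have f: "wcols k m b = {..<k * k}" and cyc: "cyc \<longrightarrow> b m = b 0"
        by (auto simp: full_walks_def bwalks_def)
      have "nverts b m \<noteq> k" using b by blast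
      then have "?d < nverts b m + nedges b m" using full_nverts(2)[OF k f] full_nedges[OF k f] by linarith
      then show "coef b m cyc ?d = 0" using cyc by (rule coef_eq_0)
    qed
  qed auto
  also have "\<dots> = (\<Sum>p\<in>ordered_cliques E n k \<times> colour_walks k m cyc. coef (?\<Phi> p) m cyc ?d)"
    using sum.reindex_bij_betw[OF collapsed_walks[OF k sym, where n = n and m = m and cyc = cyc],
        where g = "\<lambda>b. coef b m cyc ?d"] by simp
  also have "\<dots> = (\<Sum>p\<in>ordered_cliques E n k \<times> colour_walks k m cyc. coef (snd p) m cyc ?d)"
  proof (rule sum.cong[OF refl], clarify)
    fix v w assume w: "w \<in> colour_walks k m cyc"
    then have "\<And>x. x \<le> m \<Longrightarrow> w x < k" by (auto simp: colour_walks_def PiE_iff)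
    note lt = this
    have "coef (\<lambda>x\<in>{..m}. v (w x) * k + w x) m cyc ?d = coef w m cyc ?d"
    proof (rule coef_cong)
      fix x y assume xy: "x \<le> m" "y \<le> m"
      have "w x = w y" if "v (w x) * k + w x = v (w y) * k + w y"
        by (rule pair_code_inj(2)[OF that lt[OF xy(1)] lt[OF xy(2)]])
      then show "(\<lambda>x\<in>{..m}. v (w x) * k + w x) x = (\<lambda>x\<in>{..m}. v (w x) * k + w x) y \<longleftrightarrow> w x = w y"
        using xy by auto
    qed
    then show "coef (\<lambda>x\<in>{..m}. v (w x) * k + w x) m cyc ?d = coef (snd (v, w)) m cyc ?d" by simp
  qed
  also have "\<dots> = (\<Sum>v\<in>ordered_cliques E n k. \<Sum>w\<in>colour_walks k m cyc. coef w m cyc ?d)"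
    unfolding sum.cartesian_product by (rule sum.cong) auto
  finally show ?thesis by simp
qed

text \<open>All walks in this sum visit the same number of edges, so the sign in
  \<open>coef_sign\<close> is the same for all of them. The tour is rigid and closed, which yields a
  nonzero term for either value of \<open>cyc\<close>.\<close>

lemma sum_coef_colour_walks_nonzero:
  assumes k: "2 \<le> k" and m: "m = tour_len k"
  shows "(\<Sum>w\<in>colour_walks k m cyc. coef w m cyc (k + (k choose 2))) \<noteq> 0"
proof -
  let ?d = "k + (k choose 2)" and ?s = "(-1) ^ (m - (k choose 2)) :: int"
  have sign: "if rigid w m cyc then 0 < ?s * coef w m cyc ?d else coef w m cyc ?d = 0"
    if "w \<in> colour_walks k m cyc" for w
    using coef_sign[of m w cyc ?d] that colour_walk_counts[OF k that] by (auto simp: colour_walks_def)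
  define w where "w = (\<lambda>x\<in>{..m}. tour k ! x)"
  have g: "good_tour k (tour k)" using good_tour k by simp
  have w: "w \<in> colour_walks k m cyc"
    unfolding colour_walks_def
  proof (intro CollectI conjI allI impI)
    have lt: "tour k ! x < k" if "x \<le> m" for x
      using g that unfolding good_tour_def length_tour m by auto
    then show "w \<in> {..m} \<rightarrow>\<^sub>E {..<k}" by (auto simp: w_def)
    show "w i \<noteq> w (Suc i)" if "i < m" for i
      using g that unfolding good_tour_def length_tour m by (auto simp: w_def m)
    have "last (tour k) = tour k ! m"
      using g by (subst last_conv_nth) (auto simp: good_tour_def length_tour m)
    then show "w m = w 0" using g unfolding good_tour_def by (simp add: w_def)
    have "\<exists>x<m. {w x mod k, w (Suc x) mod k} = {i, j}" if ij: "i < k" "j < k" "i \<noteq> j" for i j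
    proof -
      obtain x where "x < m" "{tour k ! x, tour k ! Suc x} = {i, j}" using tour_step[OF ij] m by blast
      moreover have "tour k ! x < k" "tour k ! Suc x < k" using lt \<open>x < m\<close> by auto
      ultimately have "x < m \<and> {w x mod k, w (Suc x) mod k} = {i, j}" by (simp add: w_def)
      then show ?thesis ..
    qed
    then show "wcols k m w = {..<k * k}" unfolding wcols_full_iff[OF k] by simp
  qed
  have eq: "\<And>x y. x \<le> m \<Longrightarrow> y \<le> m \<Longrightarrow> w x = w y \<longleftrightarrow> tour k ! x = tour k ! y"
    by (simp add: w_def)
  have c: "coinc w m = coinc (\<lambda>x. tour k ! x) m" by (rule coinc_cong[OF eq])
  have ge: "glue w m cyc (coinc w m) = glue (\<lambda>x. tour k ! x) m cyc (coinc (\<lambda>x. tour k ! x) m)"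
  proof -
    have "glue w m cyc (coinc w m) = glue (\<lambda>x. tour k ! x) m cyc (coinc w m)"
      by (rule glue_cong[OF _ subset_refl]) (rule eq)
    then show ?thesis by (simp add: c)
  qed
  have "rigid w m cyc"
    using rigid_tour[OF k, of cyc] eq unfolding m[symmetric] rigid_def ge by simp
  then have "0 < ?s * coef w m cyc ?d" using sign[OF w] by simp
  also have "\<dots> \<le> (\<Sum>w\<in>colour_walks k m cyc. ?s * coef w m cyc ?d)"
  proof (rule member_le_sum[OF w])
    show "0 \<le> ?s * coef u m cyc ?d" if "u \<in> colour_walks k m cyc - {w}" for u
      using sign[of u] that by (cases "rigid u m cyc") auto
  qed simp
  also have "\<dots> = ?s * (\<Sum>w\<in>colour_walks k m cyc. coef w m cyc ?d)" by (simp add: sum_distrib_left)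
  finally show ?thesis by auto
qed

text \<open>The induction counts injections from an initial segment of length \<open>j\<close>. It
  is stated as a product with \<open>fact (k - j)\<close> to avoid a division.\<close>

lemma card_bijections:
  assumes "finite A" "card A = k"
  shows "card {v \<in> {..<k} \<rightarrow>\<^sub>E A. inj_on v {..<k}} = fact k"
proof -
  have "card {v \<in> {..<j} \<rightarrow>\<^sub>E A. inj_on v {..<j}} * fact (k - j) = fact k" if "j \<le> k" for j
    using that
  proof (induction j)
    case 0
    have "{v \<in> {..<0 :: nat} \<rightarrow>\<^sub>E A. inj_on v {..<0}} = {\<lambda>_. undefined}" by auto
    then show ?case by simp
  next
    case (Suc j)
    let ?I = "\<lambda>j. {v \<in> {..<j} \<rightarrow>\<^sub>E A. inj_on v {..<j :: nat}}"
    let ?S = "SIGMA v:?I j. A - v ` {..<j}"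
    have fin: "finite (?I j)"
      by (rule finite_subset[of _ "{..<j} \<rightarrow>\<^sub>E A"]) (blast, simp add: finite_PiE assms)
    have "bij_betw (\<lambda>(v, a). v(j := a)) ?S (?I (Suc j))"
    proof (rule bij_betw_imageI)
      show "inj_on (\<lambda>(v, a). v(j := a)) ?S"
      proof (rule inj_onI, clarify)
        fix v a v' a' assume v: "v \<in> {..<j} \<rightarrow>\<^sub>E A" "v' \<in> {..<j} \<rightarrow>\<^sub>E A" and eq: "v(j := a) = v'(j := a')"
        have "v x = v' x" for x
          using v fun_cong[OF eq, of x] by (cases "x = j") (auto simp: PiE_iff extensional_def)
        then show "v = v' \<and> a = a'" using fun_cong[OF eq, of j] by auto
      qed
      show "(\<lambda>(v, a). v(j := a)) ` ?S = ?I (Suc j)"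
      proof (intro equalityI subsetI)
        fix v assume "v \<in> (\<lambda>(v, a). v(j := a)) ` ?S"
        then show "v \<in> ?I (Suc j)"
          by (auto simp: PiE_iff extensional_def lessThan_Suc inj_on_def image_iff)
      next
        fix v assume v: "v \<in> ?I (Suc j)"
        let ?v = "restrict v {..<j}"
        have "?v \<in> ?I j" using v by (auto simp: PiE_iff inj_on_def)
        moreover have "v j \<in> A - ?v ` {..<j}"
        proof
          show "v j \<in> A" using v by (auto simp: PiE_iff)
          show "v j \<notin> ?v ` {..<j}"
          proof
            assume "v j \<in> ?v ` {..<j}"
            then obtain x where "x < j" "v j = v x" by auto
            moreover have "inj_on v {..<Suc j}" using v by blast
            ultimately show False by (auto dest!: inj_onD)
          qed
        qed
        moreover have "v = ?v(j := v j)"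
        proof
          fix x show "v x = (?v(j := v j)) x"
            using v by (cases "x < j"; cases "x = j") (auto simp: PiE_iff extensional_def)
        qed
        ultimately have "(?v, v j) \<in> ?S" "v = (\<lambda>(v, a). v(j := a)) (?v, v j)" by auto
        then show "v \<in> (\<lambda>(v, a). v(j := a)) ` ?S" by (rule rev_image_eqI)
      qed
    qed
    then have "card (?I (Suc j)) = card ?S" by (simp add: bij_betw_same_card)
    also have "\<dots> = (\<Sum>v\<in>?I j. card (A - v ` {..<j}))" using fin assms by (intro card_SigmaI) auto
    also have "\<dots> = (\<Sum>v\<in>?I j. k - j)"
    proof (rule sum.cong[OF refl])
      fix v assume v: "v \<in> ?I j"
      then have "card (v ` {..<j}) = j" by (simp add: card_image)
      moreover have "v ` {..<j} \<subseteq> A" using v by auto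
      ultimately show "card (A - v ` {..<j}) = k - j" using assms by (simp add: card_Diff_subset finite_subset)
    qed
    finally have "card (?I (Suc j)) = card (?I j) * (k - j)" by simp
    moreover have "fact (k - j) = (k - j) * (fact (k - Suc j) :: nat)"
      using Suc.prems by (simp add: Suc_diff_Suc[symmetric] fact_reduce del: Suc_diff_Suc)
    ultimately show ?case using Suc by (simp add: mult.assoc)
  qed
  from this[of k] show ?thesis by simp
qed

text \<open>Since no edge is a singleton, adjacent values are distinct, so an ordered clique is one
  of the \<open>fact k\<close> orderings of its image.\<close>

lemma card_ordered_cliques:
  assumes fin: "finite (verts G)" and V: "verts G = {0..<n}" and irr: "\<And>u. {u} \<notin> edges G"
  shows "card (ordered_cliques (\<lambda>u v. {u, v} \<in> edges G) n k) = fact k * card (cliques k G)"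
proof -
  let ?E = "\<lambda>u v. {u, v} \<in> edges G"
  let ?F = "\<lambda>A. {v \<in> {..<k} \<rightarrow>\<^sub>E A. inj_on v {..<k}}"
  have finC: "finite (cliques k G)" using fin by (auto simp: cliques_def intro: finite_subset[of _ "Pow (verts G)"])
  have A: "finite A" "card A = k" if "A \<in> cliques k G" for A
    using that fin by (auto simp: cliques_def intro: finite_subset)
  have im: "v ` {..<k} = A" if "A \<in> cliques k G" "v \<in> ?F A" for A v
    using that A[OF that(1)] by (intro card_subset_eq) (auto simp: card_image)
  have "ordered_cliques ?E n k = (\<Union>A\<in>cliques k G. ?F A)"
  proof (intro equalityI subsetI)
    fix v assume v: "v \<in> ordered_cliques ?E n k"
    have inj: "inj_on v {..<k}"
    proof (rule inj_onI, rule ccontr)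
      fix i j assume ij: "i \<in> {..<k}" "j \<in> {..<k}" "v i = v j" "i \<noteq> j"
      then have "{v i, v j} \<in> edges G" using v unfolding ordered_cliques_def by blast
      then show False using ij irr by simp
    qed
    moreover have "v ` {..<k} \<in> cliques k G"
      using v inj V by (auto simp: cliques_def ordered_cliques_def card_image PiE_iff)
    moreover have "v \<in> {..<k} \<rightarrow>\<^sub>E v ` {..<k}" using v by (auto simp: ordered_cliques_def PiE_iff)
    ultimately show "v \<in> (\<Union>A\<in>cliques k G. ?F A)" by blast
  next
    fix v assume "v \<in> (\<Union>A\<in>cliques k G. ?F A)"
    then obtain A where A: "A \<in> cliques k G" "v \<in> {..<k} \<rightarrow>\<^sub>E A" "inj_on v {..<k}" by blast
    show "v \<in> ordered_cliques ?E n k"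
      unfolding ordered_cliques_def
    proof (intro CollectI conjI allI impI)
      show "v \<in> {..<k} \<rightarrow>\<^sub>E {..<n}" using A V by (auto simp: cliques_def PiE_iff)
      fix i j assume ij: "i < k" "j < k" "i \<noteq> j"
      then have "v i \<noteq> v j" "v i \<in> A" "v j \<in> A" using A by (auto simp: inj_on_def PiE_iff)
      then show "{v i, v j} \<in> edges G" using A(1) by (auto simp: cliques_def)
    qed
  qed
  also have "card \<dots> = (\<Sum>A\<in>cliques k G. card (?F A))"
  proof (rule card_UN_disjoint[OF finC])
    show "\<forall>A\<in>cliques k G. finite (?F A)"
    proof
      fix B assume "B \<in> cliques k G"
      then show "finite (?F B)"
        using A(1) by (intro finite_subset[of "?F B" "{..<k} \<rightarrow>\<^sub>E B"]) (blast, simp add: finite_PiE)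
    qed
    show "\<forall>A\<in>cliques k G. \<forall>B\<in>cliques k G. A \<noteq> B \<longrightarrow> ?F A \<inter> ?F B = {}"
    proof (intro ballI impI equals0I)
      fix A B v assume AB: "A \<in> cliques k G" "B \<in> cliques k G" "A \<noteq> B" and v: "v \<in> ?F A \<inter> ?F B"
      have "v ` {..<k} = A" by (rule im[OF AB(1)]) (use v in blast)
      moreover have "v ` {..<k} = B" by (rule im[OF AB(2)]) (use v in blast)
      ultimately show False using AB(3) by simp
    qed
  qed
  also have "\<dots> = (\<Sum>A\<in>cliques k G. fact k)" using A by (intro sum.cong refl card_bijections) auto
  finally show ?thesis by simp
qed

section \<open>Edge-injective homomorphisms into subdivided graphs\<close>

text \<open>With an even number of vertices, exactly one end of the pattern lands on a midpoint of
  the host. Started at an original vertex, the pattern stops at the midpoint of the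
  \<open>m\<close>-th step, which still determines the last vertex of the walk; in the cyclic case
  the closing edge is the second half of that step.\<close>

definition pattern :: "nat \<Rightarrow> bool \<Rightarrow> nat graph" where
  "pattern m cyc = \<lparr>verts = {0..<2 * m},
     edges = {{i, Suc i} |i. Suc i < 2 * m} \<union> (if cyc then {{2 * m - 1, 0}} else {})\<rparr>"

lemma pattern_simps [simp]:
  "verts (pattern m cyc) = {0..<2 * m}"
  "edges (pattern m cyc) = {{i, Suc i} |i. Suc i < 2 * m} \<union> (if cyc then {{2 * m - 1, 0}} else {})"
  by (simp_all add: pattern_def)

lemma is_path_pattern: "1 \<le> m \<Longrightarrow> is_path (pattern m False)"
proof -
  assume m: "1 \<le> m"
  let ?xs = "[0..<2 * m]"
  have "{{?xs ! i, ?xs ! Suc i} |i. Suc i < length ?xs} = {{i, Suc i} |i. Suc i < 2 * m}"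
    by (rule Collect_cong, rule ex_cong1) (auto simp: nth_append)
  then show ?thesis unfolding is_path_def using m by (intro exI[of _ ?xs]) simp
qed

lemma is_cycle_pattern:
  assumes "2 \<le> m"
  shows "is_cycle (pattern m True)"
proof -
  let ?xs = "[0..<2 * m]"
  have "{{?xs ! i, ?xs ! (Suc i mod length ?xs)} |i. i < length ?xs} =
      {{i, Suc i} |i. Suc i < 2 * m} \<union> {{2 * m - 1, 0}}"
  proof (intro equalityI subsetI)
    fix e assume "e \<in> {{?xs ! i, ?xs ! (Suc i mod length ?xs)} |i. i < length ?xs}"
    then obtain i where i: "i < 2 * m" "e = {i, Suc i mod (2 * m)}" using assms by auto
    then show "e \<in> {{i, Suc i} |i. Suc i < 2 * m} \<union> {{2 * m - 1, 0}}"
    proof (cases "Suc i = 2 * m")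
      case True
      then have "i = 2 * m - 1" by simp
      then show ?thesis using i True by simp
    next
      case False
      then show ?thesis using i by auto
    qed
  next
    fix e assume "e \<in> {{i, Suc i} |i. Suc i < 2 * m} \<union> {{2 * m - 1, 0}}"
    then consider i where "Suc i < 2 * m" "e = {i, Suc i}" | "e = {2 * m - 1, 0}" by blast
    then show "e \<in> {{?xs ! i, ?xs ! (Suc i mod length ?xs)} |i. i < length ?xs}"
    proof cases
      case 1
      then show ?thesis by (intro CollectI exI[of _ i]) auto
    next
      case 2
      then show ?thesis using assms by (intro CollectI exI[of _ "2 * m - 1"]) auto
    qed
  qed
  then show ?thesis
    unfolding is_cycle_def using assms by (intro exI[of _ ?xs]) auto
qed

lemma input_graph_pattern: "1 \<le> m \<Longrightarrow> input_graph (pattern m cyc)"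
  unfolding input_graph_def simple_graph_def
proof (intro conjI)
  assume m: "1 \<le> m"
  show "edges (pattern m cyc) \<subseteq> {{u, v} |u v. u \<in> verts (pattern m cyc) \<and> v \<in> verts (pattern m cyc) \<and> u \<noteq> v}"
  proof
    fix e assume "e \<in> edges (pattern m cyc)"
    then consider i where "Suc i < 2 * m" "e = {i, Suc i}" | "e = {2 * m - 1, 0}" by (auto split: if_splits)
    then show "e \<in> {{u, v} |u v. u \<in> verts (pattern m cyc) \<and> v \<in> verts (pattern m cyc) \<and> u \<noteq> v}"
    proof cases
      case 1
      then show ?thesis by (intro CollectI exI[of _ i] exI[of _ "Suc i"]) auto
    next
      case 2
      then show ?thesis using m by (intro CollectI exI[of _ "2 * m - 1"] exI[of _ 0]) auto
    qed
  qed
qed auto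

lemma pattern_edge_cases:
  "e \<in> edges (pattern m cyc) \<Longrightarrow> (\<exists>i. Suc i < 2 * m \<and> e = {i, Suc i}) \<or> cyc \<and> e = {2 * m - 1, 0}"
  by (cases cyc) auto

lemma edge_inj_pattern_iff:
  assumes m: "2 \<le> m"
  shows "\<phi> \<in> edge_inj_homs (pattern m cyc) X \<longleftrightarrow> \<phi> \<in> {0..<2 * m} \<rightarrow>\<^sub>E verts X \<and>
    (\<forall>i. Suc i < 2 * m \<longrightarrow> {\<phi> i, \<phi> (Suc i)} \<in> edges X) \<and>
    (\<forall>i j. i < j \<and> Suc j < 2 * m \<longrightarrow> {\<phi> i, \<phi> (Suc i)} \<noteq> {\<phi> j, \<phi> (Suc j)}) \<and>
    (cyc \<longrightarrow> {\<phi> (2 * m - 1), \<phi> 0} \<in> edges X \<and>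
      (\<forall>i. Suc i < 2 * m \<longrightarrow> {\<phi> i, \<phi> (Suc i)} \<noteq> {\<phi> (2 * m - 1), \<phi> 0}))" (is "?L \<longleftrightarrow> ?R")
proof
  assume L: ?L
  then have P: "\<phi> \<in> {0..<2 * m} \<rightarrow>\<^sub>E verts X"
    and hom: "\<And>u v. {u, v} \<in> edges (pattern m cyc) \<Longrightarrow> {\<phi> u, \<phi> v} \<in> edges X"
    and inj: "inj_on (\<lambda>e. \<phi> ` e) (edges (pattern m cyc))"
    by (auto simp: edge_inj_homs_def homs_def)
  have e: "{i, Suc i} \<in> edges (pattern m cyc)" if "Suc i < 2 * m" for i using that by auto
  have c: "{2 * m - 1, 0} \<in> edges (pattern m cyc)" if cyc using that by auto
  have ne: "{i, Suc i} \<noteq> {j, Suc j}" if "i < j" for i j using that by (auto simp: doubleton_eq_iff)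
  have nc: "{i, Suc i} \<noteq> {2 * m - 1, 0}" if "Suc i < 2 * m" for i using that m by (auto simp: doubleton_eq_iff)
  have 1: "{\<phi> i, \<phi> (Suc i)} \<noteq> {\<phi> j, \<phi> (Suc j)}" if "i < j" "Suc j < 2 * m" for i j
    using inj_onD[OF inj _ e[of i] e[of j]] ne[OF that(1)] that by auto
  have 2: "{\<phi> i, \<phi> (Suc i)} \<noteq> {\<phi> (2 * m - 1), \<phi> 0}" if cyc "Suc i < 2 * m" for i
    using inj_onD[OF inj _ e[OF that(2)] c[OF that(1)]] nc[OF that(2)] by auto
  show ?R using P hom e c 1 2 by blast
next
  assume R: ?R
  have hom: "{\<phi> u, \<phi> v} \<in> edges X" if uv: "{u, v} \<in> edges (pattern m cyc)" for u v
  proof -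
    consider i where "Suc i < 2 * m" "{u, v} = {i, Suc i}" | "{u, v} = {2 * m - 1, 0}" cyc
      using pattern_edge_cases[OF uv] by metis
    then show ?thesis
    proof cases
      case 1
      then have "{\<phi> u, \<phi> v} = {\<phi> i, \<phi> (Suc i)}" by (auto simp: doubleton_eq_iff)
      then show ?thesis using R 1 by simp
    next
      case 2
      then have "{\<phi> u, \<phi> v} = {\<phi> (2 * m - 1), \<phi> 0}" by (auto simp: doubleton_eq_iff)
      then show ?thesis using R 2 by simp
    qed
  qed
  have inj: "e = e'" if e: "e \<in> edges (pattern m cyc)" "e' \<in> edges (pattern m cyc)" "\<phi> ` e = \<phi> ` e'" for e e'
  proof -
    have step: "i = j" if "Suc i < 2 * m" "Suc j < 2 * m" "{\<phi> i, \<phi> (Suc i)} = {\<phi> j, \<phi> (Suc j)}" for i j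
      using R that by (metis linorder_neqE_nat)
    from pattern_edge_cases[OF e(1)] pattern_edge_cases[OF e(2)] show ?thesis
    proof (elim disjE exE conjE)
      fix i j assume "Suc i < 2 * m" "e = {i, Suc i}" "Suc j < 2 * m" "e' = {j, Suc j}"
      then show ?thesis using step[of i j] e(3) by auto
    next
      fix i assume i: "Suc i < 2 * m" and c: cyc and e': "e = {i, Suc i}" "e' = {2 * m - 1, 0}"
      have "{\<phi> i, \<phi> (Suc i)} = {\<phi> (2 * m - 1), \<phi> 0}" using e(3) unfolding e' image_insert image_empty .
      then show ?thesis using R i c by simp
    next
      fix i assume i: "Suc i < 2 * m" and c: cyc and e': "e = {2 * m - 1, 0}" "e' = {i, Suc i}"
      have "{\<phi> (2 * m - 1), \<phi> 0} = {\<phi> i, \<phi> (Suc i)}" using e(3) unfolding e' image_insert image_empty .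
      then have "{\<phi> i, \<phi> (Suc i)} = {\<phi> (2 * m - 1), \<phi> 0}" ..
      then show ?thesis using R i c by simp
    qed simp
  qed
  show ?L
    unfolding edge_inj_homs_def homs_def
    using R hom inj by (auto intro!: inj_onI simp del: pattern_simps(2))
qed

locale subdivision =
  fixes h q :: nat and A :: "nat \<Rightarrow> nat \<Rightarrow> bool"
  assumes A_sym: "A x y \<Longrightarrow> A y x" and A_irrefl: "\<not> A x x"
begin

text \<open>Vertices below \<open>h\<close> are those of the graph \<open>A\<close>. The vertex \<open>h + (x * h + y) * q + c\<close> is the midpoint of
  the \<open>c\<close>-th path between \<open>x\<close> and \<open>y\<close> if \<open>x < y\<close> are adjacent, and isolated otherwise.\<close>

definition lo :: "nat \<Rightarrow> nat" where "lo w = (w - h) div q div h"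
definition hi :: "nat \<Rightarrow> nat" where "hi w = (w - h) div q mod h"
definition lab :: "nat \<Rightarrow> nat" where "lab w = (w - h) mod q"

definition inc :: "nat \<Rightarrow> nat \<Rightarrow> bool" where
  "inc z w \<longleftrightarrow> z < h \<and> h \<le> w \<and> lo w < hi w \<and> A (lo w) (hi w) \<and> (z = lo w \<or> z = hi w)"

definition size :: nat where "size = h + h * h * q"

definition host :: "nat graph" where
  "host = \<lparr>verts = {0..<size}, edges = {{z, w} |z w. z < size \<and> w < size \<and> inc z w}\<rparr>"

definition code :: "nat \<Rightarrow> nat \<Rightarrow> nat \<Rightarrow> nat" where
  "code x y c = h + ((min x y * h + max x y) * q + c)"

text \<open>Trails with \<open>m\<close> steps, closed if \<open>cyc\<close>, in the multigraph that
  has \<open>q\<close> parallel copies of every edge of \<open>A\<close>; \<open>c\<close> names the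
  copies.\<close>

definition trails :: "nat \<Rightarrow> bool \<Rightarrow> ((nat \<Rightarrow> nat) \<times> (nat \<Rightarrow> nat)) set" where
  "trails m cyc = {(x, c). x \<in> {..m} \<rightarrow>\<^sub>E {..<h} \<and> c \<in> {..<m} \<rightarrow>\<^sub>E {..<q} \<and>
     (\<forall>i<m. A (x i) (x (Suc i))) \<and> (cyc \<longrightarrow> x m = x 0) \<and>
     (\<forall>i j. i < j \<and> j < m \<longrightarrow> \<not> ({x i, x (Suc i)} = {x j, x (Suc j)} \<and> c i = c j))}"

lemma edges_host: "{z, w} \<in> edges host \<longleftrightarrow> z < size \<and> w < size \<and> (inc z w \<or> inc w z)"
  by (auto simp: host_def doubleton_eq_iff)

lemma code_simps:
  assumes "x < h" "y < h" "c < q"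
  shows "lo (code x y c) = min x y" "hi (code x y c) = max x y" "lab (code x y c) = c"
    "h \<le> code x y c" "code x y c < size"
proof -
  have q: "0 < q" and m: "max x y < h" "min x y < h" using assms by auto
  have 1: "((min x y * h + max x y) * q + c) div q = min x y * h + max x y" using assms q by simp
  show "lo (code x y c) = min x y" "hi (code x y c) = max x y" "lab (code x y c) = c" "h \<le> code x y c"
    using assms m 1 by (simp_all add: lo_def hi_def lab_def code_def)
  have "min x y * h + max x y < Suc (min x y) * h" using m by simp
  also have "\<dots> \<le> h * h" using m by (intro mult_right_mono) auto
  finally have "Suc (min x y * h + max x y) * q \<le> h * h * q" by (intro mult_right_mono) auto
  then show "code x y c < size" using assms by (simp add: code_def size_def)
qed

lemma code_lo_hi:
  assumes "h \<le> w" "w < size" "lo w < hi w"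
  shows "code (lo w) (hi w) (lab w) = w" "lo w < h" "hi w < h" "lab w < q"
proof -
  have u: "w - h < h * h * q" using assms by (simp add: size_def)
  then have q: "0 < q" "0 < h" by (auto intro: Nat.gr0I)
  then show "hi w < h" "lab w < q" by (simp_all add: hi_def lab_def)
  then show "lo w < h" using assms(3) by simp
  show "code (lo w) (hi w) (lab w) = w"
    using assms unfolding code_def by (simp add: lo_def hi_def lab_def)
qed

lemma inc_code:
  assumes "x < h" "y < h" "c < q" "A x y"
  shows "inc z (code x y c) \<longleftrightarrow> z = x \<or> z = y"
proof -
  have "x \<noteq> y" using assms(4) A_irrefl by blast
  then have "min x y < max x y" "A (min x y) (max x y)"
    using assms(4) A_sym[OF assms(4)] by (auto simp: min_def max_def)
  then show ?thesis unfolding inc_def code_simps[OF assms(1-3)]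
    using assms code_simps(4)[OF assms(1-3)] by (auto simp: min_def max_def)
qed

lemma code_eq_iff:
  assumes "x < h" "y < h" "c < q" "x' < h" "y' < h" "c' < q"
  shows "code x y c = code x' y' c' \<longleftrightarrow> {x, y} = {x', y'} \<and> c = c'"
proof
  assume "code x y c = code x' y' c'"
  then have "min x y = min x' y'" "max x y = max x' y'" "c = c'"
    using code_simps[OF assms(1-3)] code_simps[OF assms(4-6)] by metis+
  then show "{x, y} = {x', y'} \<and> c = c'" by (auto simp: min_def max_def doubleton_eq_iff split: if_splits)
next
  assume "{x, y} = {x', y'} \<and> c = c'"
  then show "code x y c = code x' y' c'" by (auto simp: code_def doubleton_eq_iff min.commute max.commute)
qed

lemma input_graph_host: "input_graph host"
  unfolding input_graph_def simple_graph_def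
proof (intro conjI)
  show "edges host \<subseteq> {{u, v} |u v. u \<in> verts host \<and> v \<in> verts host \<and> u \<noteq> v}"
  proof
    fix e assume "e \<in> edges host"
    then obtain z w where "e = {z, w}" "z < size" "w < size" "inc z w" by (auto simp: host_def)
    then show "e \<in> {{u, v} |u v. u \<in> verts host \<and> v \<in> verts host \<and> u \<noteq> v}"
      by (intro CollectI exI[of _ z] exI[of _ w]) (auto simp: host_def inc_def)
  qed
qed (auto simp: host_def)

text \<open>The host is bipartite between original vertices and midpoints.\<close>

lemma hom_parity:
  assumes \<phi>: "\<phi> \<in> edge_inj_homs (pattern m cyc) host" and m: "2 \<le> m"
  shows "i < 2 * m \<Longrightarrow> \<phi> i < h \<longleftrightarrow> (even i \<longleftrightarrow> \<phi> 0 < h)"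
proof (induction i)
  case (Suc i)
  have "{\<phi> i, \<phi> (Suc i)} \<in> edges host" using \<phi>[unfolded edge_inj_pattern_iff[OF m]] Suc.prems by simp
  then have "\<phi> i < h \<longleftrightarrow> \<not> \<phi> (Suc i) < h" unfolding edges_host by (auto simp: inc_def)
  then show ?case using Suc by auto
qed simp

text \<open>Reversal of the pattern exchanges its even and odd positions.\<close>

lemma card_homs_two:
  assumes m: "2 \<le> m"
  shows "card (edge_inj_homs (pattern m cyc) host) = 2 * card {\<phi> \<in> edge_inj_homs (pattern m cyc) host. \<phi> 0 < h}"
proof -
  let ?H = "edge_inj_homs (pattern m cyc) host"
  let ?M = "{\<phi> \<in> ?H. \<phi> 0 < h}" and ?M' = "{\<phi> \<in> ?H. \<not> \<phi> 0 < h}"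
  let ?r = "\<lambda>\<phi>. \<lambda>i\<in>{0..<2 * m}. \<phi> (2 * m - 1 - i)"
  have fin: "finite ?H"
  proof (rule finite_subset)
    show "?H \<subseteq> {0..<2 * m} \<rightarrow>\<^sub>E verts host" unfolding edge_inj_homs_def homs_def by auto
    show "finite ({0..<2 * m} \<rightarrow>\<^sub>E verts host)" by (simp add: finite_PiE host_def)
  qed
  have rH: "?r \<phi> \<in> ?H" if \<phi>: "\<phi> \<in> ?H" for \<phi>
  proof -
    note R = \<phi>[unfolded edge_inj_pattern_iff[OF m]]
    have s: "{?r \<phi> i, ?r \<phi> (Suc i)} = {\<phi> (2 * m - 1 - Suc i), \<phi> (Suc (2 * m - 1 - Suc i))}" if "Suc i < 2 * m" for i
    proof -
      have "2 * m - 1 - i = Suc (2 * m - 1 - Suc i)" using that by simp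
      then show ?thesis using that by (simp add: insert_commute)
    qed
    have c: "{?r \<phi> (2 * m - 1), ?r \<phi> 0} = {\<phi> (2 * m - 1), \<phi> 0}" using m by (simp add: insert_commute)
    show ?thesis
      unfolding edge_inj_pattern_iff[OF m]
    proof (intro conjI allI impI)
      show "?r \<phi> \<in> {0..<2 * m} \<rightarrow>\<^sub>E verts host" using R by (auto simp: PiE_iff)
      show "{?r \<phi> i, ?r \<phi> (Suc i)} \<in> edges host" if "Suc i < 2 * m" for i
        unfolding s[OF that] using R that by simp
      show "{?r \<phi> i, ?r \<phi> (Suc i)} \<noteq> {?r \<phi> j, ?r \<phi> (Suc j)}" if "i < j \<and> Suc j < 2 * m" for i j
      proof -
        have "{?r \<phi> i, ?r \<phi> (Suc i)} = {\<phi> (2 * m - 1 - Suc i), \<phi> (Suc (2 * m - 1 - Suc i))}"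
          "{?r \<phi> j, ?r \<phi> (Suc j)} = {\<phi> (2 * m - 1 - Suc j), \<phi> (Suc (2 * m - 1 - Suc j))}"
          using s[of i] s[of j] that by auto
        moreover have "2 * m - 1 - Suc j < 2 * m - 1 - Suc i" "Suc (2 * m - 1 - Suc i) < 2 * m" using that by auto
        ultimately show ?thesis using R by metis
      qed
      show "{?r \<phi> (2 * m - 1), ?r \<phi> 0} \<in> edges host" if cyc unfolding c using R that by blast
      show "{?r \<phi> i, ?r \<phi> (Suc i)} \<noteq> {?r \<phi> (2 * m - 1), ?r \<phi> 0}" if cyc "Suc i < 2 * m" for i
        unfolding c s[OF that(2)] using R that by simp
    qed
  qed
  have rr: "?r (?r \<phi>) = \<phi>" if "\<phi> \<in> ?H" for \<phi>
  proof
    fix i show "?r (?r \<phi>) i = \<phi> i"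
      using that m by (cases "i < 2 * m") (auto simp: edge_inj_homs_def homs_def PiE_iff extensional_def)
  qed
  have r0: "?r \<phi> 0 < h \<longleftrightarrow> \<not> \<phi> 0 < h" if "\<phi> \<in> ?H" for \<phi>
    using hom_parity[OF that m, of "2 * m - 1"] m by auto
  have "bij_betw ?r ?M ?M'"
    by (rule bij_betw_byWitness[of _ ?r]) (use rH rr r0 in auto)
  then have "card ?M' = card ?M" by (simp add: bij_betw_same_card)
  moreover have "?H = ?M \<union> ?M'" by blast
  moreover have "card (?M \<union> ?M') = card ?M + card ?M'" using fin by (intro card_Un_disjoint) auto
  ultimately show ?thesis by simp
qed

definition hom_of :: "nat \<Rightarrow> (nat \<Rightarrow> nat) \<times> (nat \<Rightarrow> nat) \<Rightarrow> nat \<Rightarrow> nat" where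
  "hom_of m p = (\<lambda>i\<in>{0..<2 * m}. let j = i div 2 in
     if even i then fst p j else code (fst p j) (fst p (Suc j)) (snd p j))"

lemma hom_of_simps:
  "j < m \<Longrightarrow> hom_of m (x, c) (2 * j) = x j"
  "j < m \<Longrightarrow> hom_of m (x, c) (Suc (2 * j)) = code (x j) (x (Suc j)) (c j)"
  by (simp_all add: hom_of_def)

text \<open>Two pattern edges with the same image share their midpoint, so they come from steps with
  the same edge and label, that is, from the same step. The two halves of one step have different
  original endpoints because \<open>A\<close> is irreflexive.\<close>

lemma hom_of_mem:
  assumes m: "2 \<le> m" and t: "(x, c) \<in> trails m cyc"
  shows "hom_of m (x, c) \<in> {\<phi> \<in> edge_inj_homs (pattern m cyc) host. \<phi> 0 < h}"
proof -
  let ?\<phi> = "hom_of m (x, c)"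
  have x: "\<And>i. i \<le> m \<Longrightarrow> x i < h" and c: "\<And>i. i < m \<Longrightarrow> c i < q" and A: "\<And>i. i < m \<Longrightarrow> A (x i) (x (Suc i))"
    and cl: "cyc \<Longrightarrow> x m = x 0"
    and ne: "\<And>i j. i < j \<Longrightarrow> j < m \<Longrightarrow> \<not> ({x i, x (Suc i)} = {x j, x (Suc j)} \<and> c i = c j)"
    using t by (auto simp: trails_def PiE_iff)
  have hs: "h \<le> size" by (simp add: size_def)
  define s where "s j = code (x j) (x (Suc j)) (c j)" for j
  have s: "h \<le> s j" "s j < size" "inc z (s j) \<longleftrightarrow> z = x j \<or> z = x (Suc j)" if "j < m" for j z
    unfolding s_def using code_simps[of "x j" "x (Suc j)" "c j"] inc_code[of "x j" "x (Suc j)" "c j"] x c A that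
    by auto
  have s_inj: "i = j" if "i < m" "j < m" "s i = s j" for i j
  proof -
    have "{x i, x (Suc i)} = {x j, x (Suc j)} \<and> c i = c j"
      using that(3) unfolding s_def by (subst (asm) code_eq_iff) (use x c that in auto)
    then show ?thesis using ne[of i j] ne[of j i] that by (metis linorder_neqE_nat)
  qed
  have ev: "?\<phi> (2 * j) = x j" "?\<phi> (Suc (2 * j)) = s j" if "j < m" for j
    using that by (simp_all add: hom_of_simps s_def)
  have step: "\<exists>j<m. Suc i = 2 * j + 1 \<and> {?\<phi> i, ?\<phi> (Suc i)} = {x j, s j} \<or>
      Suc i = 2 * j + 2 \<and> {?\<phi> i, ?\<phi> (Suc i)} = {x (Suc j), s j}" if "Suc i < 2 * m" for i
  proof (cases "even i")
    case True
    then obtain j where "i = 2 * j" by blast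
    then show ?thesis using ev[of j] that by (intro exI[of _ j]) auto
  next
    case False
    then obtain j where j: "i = Suc (2 * j)" by (metis oddE Suc_eq_plus1)
    then show ?thesis using ev(2)[of j] ev(1)[of "Suc j"] that by (intro exI[of _ j]) (auto simp: insert_commute)
  qed
  have xs: "x i \<noteq> s j" "x (Suc i) \<noteq> s j" if "i < m" "j < m" for i j
    using x[of i] x[of "Suc i"] s(1)[of j] that by auto
  have xx: "x i \<noteq> x (Suc i)" if "i < m" for i using A[OF that] A_irrefl by metis
  have "2 * m - 1 = Suc (2 * (m - 1))" using m by simp
  then have last: "?\<phi> (2 * m - 1) = s (m - 1)" using ev(2)[of "m - 1"] m by (simp only:)
  have zero: "?\<phi> 0 = x 0" using ev(1)[of 0] m by simp
  have "?\<phi> \<in> edge_inj_homs (pattern m cyc) host"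
    unfolding edge_inj_pattern_iff[OF m]
  proof (intro conjI allI impI)
    show "?\<phi> \<in> {0..<2 * m} \<rightarrow>\<^sub>E verts host"
    proof (rule PiE_I)
      fix i assume i: "i \<in> {0..<2 * m}"
      show "?\<phi> i \<in> verts host"
      proof (cases "even i")
        case True
        then obtain j where "i = 2 * j" by blast
        then show ?thesis using i ev(1)[of j] x[of j] hs by (auto simp: host_def)
      next
        case False
        then obtain j where "i = Suc (2 * j)" by (metis oddE Suc_eq_plus1)
        then show ?thesis using i ev(2)[of j] s(2)[of j] by (auto simp: host_def)
      qed
    qed (auto simp: hom_of_def)
    show "{?\<phi> i, ?\<phi> (Suc i)} \<in> edges host" if i: "Suc i < 2 * m" for i
    proof -
      obtain j where "j < m" "{?\<phi> i, ?\<phi> (Suc i)} = {x j, s j} \<or> {?\<phi> i, ?\<phi> (Suc i)} = {x (Suc j), s j}"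
        using step[OF i] by blast
      moreover have "{x j, s j} \<in> edges host" "{x (Suc j), s j} \<in> edges host"
        unfolding edges_host using s(2,3)[OF \<open>j < m\<close>] x[of j] x[of "Suc j"] \<open>j < m\<close> hs by auto
      ultimately show ?thesis by metis
    qed
    show "{?\<phi> i, ?\<phi> (Suc i)} \<noteq> {?\<phi> j, ?\<phi> (Suc j)}" if ij: "i < j \<and> Suc j < 2 * m" for i j
    proof
      assume eq: "{?\<phi> i, ?\<phi> (Suc i)} = {?\<phi> j, ?\<phi> (Suc j)}"
      obtain a where a: "a < m" "Suc i = 2 * a + 1 \<and> {?\<phi> i, ?\<phi> (Suc i)} = {x a, s a} \<or>
        Suc i = 2 * a + 2 \<and> {?\<phi> i, ?\<phi> (Suc i)} = {x (Suc a), s a}" using step[of i] ij by auto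
      obtain b where b: "b < m" "Suc j = 2 * b + 1 \<and> {?\<phi> j, ?\<phi> (Suc j)} = {x b, s b} \<or>
        Suc j = 2 * b + 2 \<and> {?\<phi> j, ?\<phi> (Suc j)} = {x (Suc b), s b}" using step[of j] ij by auto
      have "s a = s b"
        using a(2) b(2) eq xs[OF a(1) b(1)] xs[OF b(1) a(1)] by (elim disjE conjE) (simp_all add: doubleton_eq_iff, auto)
      then have "a = b" using s_inj a b by blast
      then have "Suc i = 2 * a + 1" "Suc j = 2 * a + 2" using a(2) b(2) ij by auto
      then have "{x a, s a} = {x (Suc a), s a}" using a(2) b(2) eq \<open>a = b\<close> by auto
      then show False using xx[OF a(1)] xs[OF a(1) a(1)] by (simp add: doubleton_eq_iff)
    qed
    have ms: "m - 1 < m" "Suc (m - 1) = m" using m by auto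
    show "{?\<phi> (2 * m - 1), ?\<phi> 0} \<in> edges host" if cyc
      unfolding last zero edges_host using s(2,3)[OF ms(1)] x[of 0] cl[OF that] ms(2) hs by auto
    show "{?\<phi> i, ?\<phi> (Suc i)} \<noteq> {?\<phi> (2 * m - 1), ?\<phi> 0}" if cyc and i: "Suc i < 2 * m" for i
    proof
      assume eq: "{?\<phi> i, ?\<phi> (Suc i)} = {?\<phi> (2 * m - 1), ?\<phi> 0}"
      obtain a where a: "a < m" "Suc i = 2 * a + 1 \<and> {?\<phi> i, ?\<phi> (Suc i)} = {x a, s a} \<or>
        Suc i = 2 * a + 2 \<and> {?\<phi> i, ?\<phi> (Suc i)} = {x (Suc a), s a}" using step[OF i] by auto
      \<comment> \<open>This makes the closing edge the second half of the step
        \<open>m - 1\<close>.\<close>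
      have x0: "x 0 = x m" using cl[OF \<open>cyc\<close>] by simp
      have "x a \<noteq> s (m - 1)" "x (Suc a) \<noteq> s (m - 1)" "x m \<noteq> s a"
        using xs[OF a(1) ms(1)] xs(2)[OF ms(1) a(1)] ms(2) by auto
      then have sa: "s a = s (m - 1)" and xa: "Suc i = 2 * a + 1 \<and> x a = x m \<or> Suc i = 2 * a + 2 \<and> x (Suc a) = x m"
        using a(2) eq unfolding last zero x0 by (auto simp: doubleton_eq_iff)
      have "a = m - 1" using s_inj[OF a(1) ms(1) sa] .
      then show False using xa i xx[OF ms(1)] ms by auto
    qed
  qed
  moreover have "?\<phi> 0 < h" using zero x[of 0] by simp
  ultimately show ?thesis by blast
qed

text \<open>A midpoint has only two neighbours. Edge-injectivity forbids leaving it the way it was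
  entered, so the image proceeds to the other neighbour and traces a walk in
  \<open>A\<close>.\<close>

lemma hom_of_onto:
  assumes m: "2 \<le> m" and \<phi>: "\<phi> \<in> edge_inj_homs (pattern m cyc) host" and \<phi>0: "\<phi> 0 < h"
  shows "\<exists>p \<in> trails m cyc. \<phi> = hom_of m p"
proof -
  note R = \<phi>[unfolded edge_inj_pattern_iff[OF m]]
  define s where "s j = \<phi> (Suc (2 * j))" for j
  \<comment> \<open>No pattern vertex follows the last midpoint; \<open>x m\<close> is set to the
    neighbour of that midpoint other than the one it was entered from.\<close>
  define x where "x = (\<lambda>j\<in>{..m}. if j < m then \<phi> (2 * j)
    else if \<phi> (2 * (m - 1)) = lo (s (m - 1)) then hi (s (m - 1)) else lo (s (m - 1)))"
  define c where "c = (\<lambda>j\<in>{..<m}. lab (s j))"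
  have ms: "m - 1 < m" "Suc (m - 1) = m" "2 * m - 1 = Suc (2 * (m - 1))" using m by auto
  have par: "\<phi> i < h \<longleftrightarrow> even i" if "i < 2 * m" for i using hom_parity[OF \<phi> m that] \<phi>0 by simp
  have xj: "x j = \<phi> (2 * j)" if "j < m" for j using that by (simp add: x_def)
  have sh: "h \<le> s j" if "j < m" for j using par[of "Suc (2 * j)"] that unfolding s_def by auto
  have edge: "{\<phi> i, \<phi> (Suc i)} \<in> edges host" if "Suc i < 2 * m" for i using R that by blast
  have inc1: "inc (x j) (s j)" "s j < size" if "j < m" for j
    using edge[of "2 * j"] that sh[OF that] xj[OF that] unfolding edges_host s_def by (auto simp: inc_def)
  have lh: "lo (s j) < hi (s j)" "A (lo (s j)) (hi (s j))" "x j = lo (s j) \<or> x j = hi (s j)" if "j < m" for j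
    using inc1[OF that] by (auto simp: inc_def)
  have inc2: "inc (x (Suc j)) (s j)" if "Suc j < m" for j
    using edge[of "Suc (2 * j)"] that sh[of j] xj[OF that] unfolding edges_host s_def by (auto simp: inc_def)
  have ends: "{x j, x (Suc j)} = {lo (s j), hi (s j)}" if j: "j < m" for j
  proof (cases "Suc j < m")
    case True
    have "{\<phi> (2 * j), \<phi> (Suc (2 * j))} \<noteq> {\<phi> (Suc (2 * j)), \<phi> (Suc (Suc (2 * j)))}" using R True by simp
    then have "x j \<noteq> x (Suc j)" using xj[OF j] xj[OF True] by (auto simp: insert_commute)
    moreover have "x (Suc j) = lo (s j) \<or> x (Suc j) = hi (s j)" using inc2[OF True] by (simp add: inc_def)
    ultimately show ?thesis using lh(3)[OF j] by auto
  next
    case False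
    then have "j = m - 1" "Suc j = m" using j by auto
    then show ?thesis using lh(3)[OF j] xj[OF j] by (auto simp: x_def)
  qed
  have sc: "s j = code (x j) (x (Suc j)) (c j)" if j: "j < m" for j
  proof -
    have "code (lo (s j)) (hi (s j)) (lab (s j)) = s j" by (rule code_lo_hi) (use sh inc1 lh j in auto)
    moreover have "code (x j) (x (Suc j)) (c j) = code (lo (s j)) (hi (s j)) (lab (s j))"
      using ends[OF j] j by (auto simp: c_def code_def doubleton_eq_iff min.commute max.commute)
    ultimately show ?thesis by simp
  qed
  have bounds: "lo (s j) < h" "hi (s j) < h" "lab (s j) < q" if "j < m" for j
    using code_lo_hi[of "s j"] sh inc1 lh that by auto
  have xh: "x j < h" if "j \<le> m" for j
  proof (cases "j < m")
    case True
    then show ?thesis using xj par[of "2 * j"] by simp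
  next
    case False
    then have "x j \<in> {lo (s (m - 1)), hi (s (m - 1))}" using ends[OF ms(1)] that ms(2) by auto
    then show ?thesis using bounds[OF ms(1)] by auto
  qed
  have "(x, c) \<in> trails m cyc"
    unfolding trails_def
  proof (intro CollectI case_prodI conjI allI impI)
    show "x \<in> {..m} \<rightarrow>\<^sub>E {..<h}" using xh by (auto simp: x_def)
    show "c \<in> {..<m} \<rightarrow>\<^sub>E {..<q}" using bounds by (auto simp: c_def)
    show "A (x i) (x (Suc i))" if "i < m" for i
      using ends[OF that] lh(2)[OF that] A_sym by (auto simp: doubleton_eq_iff)
    show "x m = x 0" if cyc
    proof -
      have z: "x 0 = \<phi> 0" using xj[of 0] m by simp
      have s: "s (m - 1) = \<phi> (2 * m - 1)" unfolding s_def ms(3) ..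
      have "{\<phi> (2 * m - 1), \<phi> 0} \<in> edges host" using R that by blast
      then have "inc (x 0) (s (m - 1))" using sh[OF ms(1)] unfolding edges_host s z by (auto simp: inc_def)
      then have "x 0 \<in> {lo (s (m - 1)), hi (s (m - 1))}" by (simp add: inc_def)
      then have "x 0 \<in> {x (m - 1), x m}" using ends[OF ms(1)] unfolding ms(2) by (simp only:)
      moreover have "{\<phi> (2 * (m - 1)), \<phi> (Suc (2 * (m - 1)))} \<noteq> {\<phi> (2 * m - 1), \<phi> 0}"
        using R that m by simp
      then have "\<phi> 0 \<noteq> \<phi> (2 * (m - 1))" unfolding ms(3)[symmetric] by (metis insert_commute)
      then have "x 0 \<noteq> x (m - 1)" unfolding z xj[OF ms(1)] .
      ultimately show ?thesis by simp
    qed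
    show "\<not> ({x i, x (Suc i)} = {x j, x (Suc j)} \<and> c i = c j)" if ij: "i < j \<and> j < m" for i j
    proof
      assume eq: "{x i, x (Suc i)} = {x j, x (Suc j)} \<and> c i = c j"
      have "s i = s j"
        using sc[of i] sc[of j] ij eq by (auto simp: code_def doubleton_eq_iff min.commute max.commute)
      \<comment> \<open>On a second visit of the same midpoint, the edge used to enter would be one
        of the two edges already used by the first visit.\<close>
      have d1: "{\<phi> (2 * i), \<phi> (Suc (2 * i))} \<noteq> {\<phi> (2 * j), \<phi> (Suc (2 * j))}" using R ij by simp
      have d2: "{\<phi> (Suc (2 * i)), \<phi> (Suc (Suc (2 * i)))} \<noteq> {\<phi> (2 * j), \<phi> (Suc (2 * j))}" using R ij by simp
      have i: "i < m" "Suc i < m" "j < m" using ij by auto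
      have "x j \<noteq> x i" using d1 \<open>s i = s j\<close> xj i unfolding s_def by auto
      moreover have "x j \<noteq> x (Suc i)" using d2 \<open>s i = s j\<close> xj i unfolding s_def by (auto simp: insert_commute)
      ultimately show False using eq by (auto simp: doubleton_eq_iff)
    qed
  qed
  moreover have "\<phi> = hom_of m (x, c)"
  proof
    fix i show "\<phi> i = hom_of m (x, c) i"
    proof (cases "i < 2 * m")
      case True
      show ?thesis
      proof (cases "even i")
        case even: True
        then obtain j where "i = 2 * j" by blast
        then show ?thesis using True xj[of j] hom_of_simps(1)[of j m x c] by simp
      next
        case False
        then obtain j where "i = Suc (2 * j)" by (metis oddE Suc_eq_plus1)
        then show ?thesis using True sc[of j] hom_of_simps(2)[of j m x c] by (simp add: s_def)
      qed
    next
      case False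
      then show ?thesis using R by (auto simp: hom_of_def PiE_iff extensional_def)
    qed
  qed
  ultimately show ?thesis by blast
qed

lemma card_homs_host:
  assumes m: "2 \<le> m"
  shows "card (edge_inj_homs (pattern m cyc) host) = 2 * card (trails m cyc)"
proof -
  have "bij_betw (hom_of m) (trails m cyc) {\<phi> \<in> edge_inj_homs (pattern m cyc) host. \<phi> 0 < h}"
  proof (rule bij_betw_imageI)
    show "inj_on (hom_of m) (trails m cyc)"
    proof (rule inj_onI, clarify)
      fix x c x' c' assume t: "(x, c) \<in> trails m cyc" "(x', c') \<in> trails m cyc"
        and eq: "hom_of m (x, c) = hom_of m (x', c')"
      have lt: "x i < h" "x' i < h" if "i \<le> m" for i using t that by (auto simp: trails_def PiE_iff)
      have ltc: "c i < q" "c' i < q" if "i < m" for i using t that by (auto simp: trails_def PiE_iff)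
      have x: "x j = x' j" if "j < m" for j using hom_of_simps(1)[OF that] eq by metis
      have s: "{x j, x (Suc j)} = {x' j, x' (Suc j)} \<and> c j = c' j" if "j < m" for j
      proof -
        have "code (x j) (x (Suc j)) (c j) = code (x' j) (x' (Suc j)) (c' j)"
          using hom_of_simps(2)[OF that] eq by metis
        then show ?thesis by (subst (asm) code_eq_iff) (use lt ltc that in auto)
      qed
      \<comment> \<open>\<open>hom_of\<close> does not take \<open>x m\<close> as a value. It is
        recovered as the other end of the last edge, which the last midpoint encodes.\<close>
      have "x (Suc (m - 1)) = x' (Suc (m - 1))"
        using s[of "m - 1"] x[of "m - 1"] m by (auto simp: doubleton_eq_iff)
      then have "x m = x' m" using m by simp
      then have "x j = x' j" if "j \<le> m" for j using x[of j] that by (cases "j = m") auto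
      then have "x = x'" by (intro PiE_ext[of x "{..m}" "\<lambda>_. {..<h}"]) (use t in \<open>auto simp: trails_def\<close>)
      moreover have "c = c'"
        by (rule PiE_ext[of c "{..<m}" "\<lambda>_. {..<q}"]) (use t s in \<open>auto simp: trails_def\<close>)
      ultimately show "x = x' \<and> c = c'" by simp
    qed
    show "hom_of m ` trails m cyc = {\<phi> \<in> edge_inj_homs (pattern m cyc) host. \<phi> 0 < h}"
      using hom_of_mem[OF m] hom_of_onto[OF m] by fast
  qed
  then show ?thesis unfolding card_homs_two[OF m] by (simp add: bij_betw_same_card)
qed

end

section \<open>Extraction of the number of cliques\<close>

text \<open>In the blow-up, \<open>x\<close> is copy \<open>x mod q\<close> of the coloured vertex
  \<open>x div q\<close>.\<close>

definition lift_adj :: "(nat \<Rightarrow> nat \<Rightarrow> bool) \<Rightarrow> nat \<Rightarrow> nat set \<Rightarrow> nat \<Rightarrow> nat \<Rightarrow> nat \<Rightarrow> bool" where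
  "lift_adj E k S q x y \<longleftrightarrow> adj_cols E k S (x div q) (y div q)"

lemma cols_commute: "cols k i j = cols k j i"
  by (auto simp: cols_def)

lemma subdivision_lift_adj: "(\<And>u v. E u v \<Longrightarrow> E v u) \<Longrightarrow> subdivision (lift_adj E k S q)"
  by unfold_locales (auto simp: lift_adj_def adj_cols_def cols_commute)

text \<open>Equality of two unordered pairs of copies splits into equality of the underlying edges
  and equality of the labels at endpoints with the same vertex. The ends of a step being distinct
  makes the matching of endpoints unique, so it can be read off from \<open>link\<close>.\<close>

lemma steps_eq_iff:
  assumes f: "\<And>x. x \<in> {i, Suc i, j, Suc j} \<Longrightarrow> f (Inl x) < (q :: nat)"
    and b: "b i \<noteq> b (Suc i)" "b j \<noteq> b (Suc j)"
    and x: "\<And>y. y \<in> {i, Suc i, j, Suc j} \<Longrightarrow> x y = b y * q + f (Inl y)"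
  shows "{x i, x (Suc i)} = {x j, x (Suc j)} \<and> f (Inr i) = f (Inr j) \<longleftrightarrow>
    {b i, b (Suc i)} = {b j, b (Suc j)} \<and> (\<forall>(u, v) \<in> link b (i, j). f u = f v)"
proof -
  have eq: "x y = x z \<longleftrightarrow> b y = b z \<and> f (Inl y) = f (Inl z)"
    if "y \<in> {i, Suc i, j, Suc j}" "z \<in> {i, Suc i, j, Suc j}" for y z
    unfolding x[OF that(1)] x[OF that(2)] using pair_code_inj[OF _ f[OF that(1)] f[OF that(2)], of "b y" "b z"] by auto
  have link: "(\<forall>(u, v) \<in> link b (i, j). f u = f v) \<longleftrightarrow> f (Inr i) = f (Inr j) \<and>
      (b i = b j \<longrightarrow> f (Inl i) = f (Inl j)) \<and> (b i = b (Suc j) \<longrightarrow> f (Inl i) = f (Inl (Suc j))) \<and>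
      (b (Suc i) = b j \<longrightarrow> f (Inl (Suc i)) = f (Inl j)) \<and>
      (b (Suc i) = b (Suc j) \<longrightarrow> f (Inl (Suc i)) = f (Inl (Suc j)))"
    by (auto simp: link_def)
  have e: "x i = x j \<longleftrightarrow> b i = b j \<and> f (Inl i) = f (Inl j)"
    "x i = x (Suc j) \<longleftrightarrow> b i = b (Suc j) \<and> f (Inl i) = f (Inl (Suc j))"
    "x (Suc i) = x j \<longleftrightarrow> b (Suc i) = b j \<and> f (Inl (Suc i)) = f (Inl j)"
    "x (Suc i) = x (Suc j) \<longleftrightarrow> b (Suc i) = b (Suc j) \<and> f (Inl (Suc i)) = f (Inl (Suc j))"
    by (rule eq; simp)+
  show ?thesis
    unfolding link doubleton_eq_iff e using b by auto
qed

text \<open>Division with remainder by \<open>q\<close> separates a position of the trail into a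
  vertex of the walk and a label of a position slot; the chosen parallel copy is the label of the
  step slot.\<close>

lemma card_trails:
  assumes q: "0 < q" and sym: "\<And>u v. E u v \<Longrightarrow> E v u"
  shows "card (subdivision.trails (n * k * q) q (lift_adj E k S q) m cyc) =
    (\<Sum>b\<in>bwalks E n k m cyc S. card (labels b m cyc q))"
proof -
  interpret subdivision "n * k * q" q "lift_adj E k S q" by (rule subdivision_lift_adj[OF sym])
  let ?S = "SIGMA b:bwalks E n k m cyc S. labels b m cyc q"
  let ?\<Phi> = "\<lambda>(b, f). (\<lambda>i\<in>{..m}. b i * q + f (Inl i), \<lambda>i\<in>{..<m}. f (Inr i))"
  have fP: "f (Inl i) < q" if "f \<in> labels b m cyc q" "i \<le> m" for f b i
    using that by (auto simp: labels_def slots_def PiE_iff)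
  have "bij_betw ?\<Phi> ?S (trails m cyc)"
  proof (rule bij_betw_imageI)
    show "inj_on ?\<Phi> ?S"
    proof (rule inj_onI, clarify)
      fix b f b' f'
      assume b: "b \<in> bwalks E n k m cyc S" "b' \<in> bwalks E n k m cyc S"
        and f: "f \<in> labels b m cyc q" "f' \<in> labels b' m cyc q"
        and eq: "(\<lambda>i\<in>{..m}. b i * q + f (Inl i)) = (\<lambda>i\<in>{..m}. b' i * q + f' (Inl i))"
          "(\<lambda>i\<in>{..<m}. f (Inr i)) = (\<lambda>i\<in>{..<m}. f' (Inr i))"
      have e: "b i = b' i" "f (Inl i) = f' (Inl i)" if "i \<le> m" for i
      proof -
        have "b i * q + f (Inl i) = b' i * q + f' (Inl i)" using fun_cong[OF eq(1), of i] that by simp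
        then show "b i = b' i" "f (Inl i) = f' (Inl i)"
          using pair_code_inj[OF _ fP[OF f(1) that] fP[OF f(2) that]] by blast+
      qed
      have e2: "f (Inr i) = f' (Inr i)" if "i < m" for i using fun_cong[OF eq(2), of i] that by simp
      have "b = b'" by (rule PiE_ext[of b "{..m}" "\<lambda>_. {..<n * k}"]) (use b e in \<open>auto simp: bwalks_def\<close>)
      moreover have "f = f'"
        by (rule PiE_ext[of f "slots m" "\<lambda>_. {..<q}"]) (use f e e2 in \<open>auto simp: labels_def slots_def\<close>)
      ultimately show "b = b' \<and> f = f'" by simp
    qed
    have key: "{x i, x (Suc i)} = {x j, x (Suc j)} \<and> c i = c j \<longleftrightarrow>
        (i, j) \<in> coinc b m \<and> (\<forall>(u, v) \<in> link b (i, j). f u = f v)"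
      if "i < j" "j < m" "\<And>i. i \<le> m \<Longrightarrow> f (Inl i) < q" "\<And>i. i < m \<Longrightarrow> b i \<noteq> b (Suc i)"
        "\<And>i. i \<le> m \<Longrightarrow> x i = b i * q + f (Inl i)" "\<And>i. i < m \<Longrightarrow> c i = f (Inr i)" for i j b f x c
    proof -
      have "{x i, x (Suc i)} = {x j, x (Suc j)} \<and> f (Inr i) = f (Inr j) \<longleftrightarrow>
        {b i, b (Suc i)} = {b j, b (Suc j)} \<and> (\<forall>(u, v) \<in> link b (i, j). f u = f v)"
        by (rule steps_eq_iff[where q = q]) (use that in auto)
      then show ?thesis using that(1,2,6) by (simp add: coinc_def)
    qed
    show "?\<Phi> ` ?S = trails m cyc"
    proof (intro equalityI subsetI)
      fix p assume "p \<in> ?\<Phi> ` ?S"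
      then obtain b f where b: "b \<in> bwalks E n k m cyc S" and f: "f \<in> labels b m cyc q"
        and p: "p = ?\<Phi> (b, f)" by blast
      define x where "x = (\<lambda>i\<in>{..m}. b i * q + f (Inl i))"
      define c where "c = (\<lambda>i\<in>{..<m}. f (Inr i))"
      have xi: "x i = b i * q + f (Inl i)" if "i \<le> m" for i using that by (simp add: x_def)
      have xd: "x i div q = b i" if "i \<le> m" for i using fP[OF f that] that by (simp add: x_def)
      have adj: "adj_cols E k S (b i) (b (Suc i))" if "i < m" for i using b that by (auto simp: bwalks_def)
      have bne: "b i \<noteq> b (Suc i)" if "i < m" for i using adj[OF that] by (auto simp: adj_cols_def)
      have "(x, c) \<in> trails m cyc"
        unfolding trails_def
      proof (intro CollectI case_prodI conjI allI impI)
        have "x i < n * k * q" if "i \<le> m" for i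
        proof -
          have "b i < n * k" using b that by (auto simp: bwalks_def PiE_iff)
          have "x i < Suc (b i) * q" using fP[OF f that] xi[OF that] by simp
          also have "\<dots> \<le> n * k * q" using \<open>b i < n * k\<close> by (intro mult_right_mono) auto
          finally show ?thesis .
        qed
        then show "x \<in> {..m} \<rightarrow>\<^sub>E {..<n * k * q}" by (auto simp: x_def)
        show "c \<in> {..<m} \<rightarrow>\<^sub>E {..<q}" using f by (auto simp: c_def labels_def slots_def PiE_iff)
        show "lift_adj E k S q (x i) (x (Suc i))" if "i < m" for i
          using adj[OF that] xd[of i] xd[of "Suc i"] that by (simp add: lift_adj_def)
        show "x m = x 0" if cyc
        proof -
          have "b m = b 0" using b that by (simp add: bwalks_def)
          moreover have "f (Inl m) = f (Inl 0)" using f that by (simp add: labels_def closing_def)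
          ultimately show ?thesis by (simp add: xi)
        qed
        show "\<not> ({x i, x (Suc i)} = {x j, x (Suc j)} \<and> c i = c j)" if ij: "i < j \<and> j < m" for i j
        proof -
          have "{x i, x (Suc i)} = {x j, x (Suc j)} \<and> c i = c j \<longleftrightarrow>
            (i, j) \<in> coinc b m \<and> (\<forall>(u, v) \<in> link b (i, j). f u = f v)"
            by (rule key) (use ij fP[OF f] bne xi in \<open>auto simp: c_def\<close>)
          moreover have "\<not> ((i, j) \<in> coinc b m \<and> (\<forall>(u, v) \<in> link b (i, j). f u = f v))"
            using f unfolding labels_def by blast
          ultimately show ?thesis by blast
        qed
      qed
      then show "p \<in> trails m cyc" unfolding p x_def c_def by simp
    next
      fix p assume "p \<in> trails m cyc"
      then obtain x c where p: "p = (x, c)" and t: "(x, c) \<in> trails m cyc" by (cases p) auto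
      have x: "\<And>i. i \<le> m \<Longrightarrow> x i < n * k * q" and c: "\<And>i. i < m \<Longrightarrow> c i < q"
        and ext: "x \<in> extensional {..m}" "c \<in> extensional {..<m}"
        and A: "\<And>i. i < m \<Longrightarrow> adj_cols E k S (x i div q) (x (Suc i) div q)" and cl: "cyc \<Longrightarrow> x m = x 0"
        and ne: "\<And>i j. i < j \<Longrightarrow> j < m \<Longrightarrow> \<not> ({x i, x (Suc i)} = {x j, x (Suc j)} \<and> c i = c j)"
        using t by (auto simp: trails_def PiE_iff lift_adj_def)
      define b where "b = (\<lambda>i\<in>{..m}. x i div q)"
      define f where "f = (\<lambda>z\<in>slots m. case z of Inl i \<Rightarrow> x i mod q | Inr i \<Rightarrow> c i)"
      have fl: "f (Inl i) = x i mod q" if "i \<le> m" for i using that by (auto simp: f_def slots_def)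
      have fr: "f (Inr i) = c i" if "i < m" for i using that by (auto simp: f_def slots_def)
      have xi: "x i = b i * q + f (Inl i)" if "i \<le> m" for i using that fl by (simp add: b_def)
      have bne: "b i \<noteq> b (Suc i)" if "i < m" for i using A[OF that] that by (auto simp: adj_cols_def b_def)
      have "b \<in> bwalks E n k m cyc S"
        using A cl x by (auto simp: bwalks_def b_def less_mult_imp_div_less)
      moreover have "f \<in> labels b m cyc q"
        unfolding labels_def
      proof (intro CollectI conjI ballI)
        show "f \<in> slots m \<rightarrow>\<^sub>E {..<q}" using c q by (auto simp: f_def slots_def)
        show "case p of (y, z) \<Rightarrow> f y = f z" if "p \<in> closing m cyc" for p
          using that fl cl by (auto simp: closing_def split: if_splits)
        show "\<not> (\<forall>(u, v) \<in> link b p. f u = f v)" if p: "p \<in> coinc b m" for p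
        proof -
          obtain i j where ij: "p = (i, j)" "i < j" "j < m" using p by (auto simp: coinc_def)
          have "{x i, x (Suc i)} = {x j, x (Suc j)} \<and> c i = c j \<longleftrightarrow>
            (i, j) \<in> coinc b m \<and> (\<forall>(u, v) \<in> link b (i, j). f u = f v)"
            by (rule key) (use ij q bne xi fr fl in auto)
          then show ?thesis using ne[OF ij(2,3)] p unfolding ij(1) by blast
        qed
      qed
      moreover have "p = ?\<Phi> (b, f)"
      proof -
        have "x = (\<lambda>i\<in>{..m}. b i * q + f (Inl i))"
          using xi ext(1) by (auto simp: extensional_def)
        moreover have "c = (\<lambda>i\<in>{..<m}. f (Inr i))" using fr ext(2) by (auto simp: extensional_def)
        ultimately show ?thesis unfolding p by simp
      qed
      ultimately show "p \<in> ?\<Phi> ` ?S" by blast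
    qed
  qed
  then have "card (trails m cyc) = card ?S" by (simp add: bij_betw_same_card)
  also have "\<dots> = (\<Sum>b\<in>bwalks E n k m cyc S. card (labels b m cyc q))"
  proof (rule card_SigmaI)
    show "\<forall>b\<in>bwalks E n k m cyc S. finite (labels b m cyc q)"
    proof
      fix b
      have "labels b m cyc q \<subseteq> slots m \<rightarrow>\<^sub>E {..<q}" unfolding labels_def by blast
      then show "finite (labels b m cyc q)" by (rule finite_subset) (simp add: finite_PiE)
    qed
  qed simp
  finally show ?thesis .
qed

definition trail_count :: "(nat \<Rightarrow> nat \<Rightarrow> bool) \<Rightarrow> nat \<Rightarrow> nat \<Rightarrow> nat \<Rightarrow> bool \<Rightarrow> nat \<Rightarrow> nat set \<Rightarrow> nat" where
  "trail_count E n k m cyc q S = card (edge_inj_homs (pattern m cyc)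
     (subdivision.host (n * k * q) q (lift_adj E k S q)))"

lemma trail_count_eq:
  assumes "0 < q" "\<And>u v. E u v \<Longrightarrow> E v u" "2 \<le> m"
  shows "trail_count E n k m cyc q S = 2 * (\<Sum>b\<in>bwalks E n k m cyc S. card (labels b m cyc q))"
  using subdivision.card_homs_host[OF subdivision_lift_adj[OF assms(2)] assms(3)] card_trails[OF assms(1,2)]
  by (simp add: trail_count_def)

text \<open>The factor 2 stems from the reversal of the pattern, the power of the factorial from the
  weights that clear the powers of \<open>q\<close>. The graph does not enter.\<close>

definition clique_const :: "nat \<Rightarrow> bool \<Rightarrow> int" where
  "clique_const k cyc =
     (let m = tour_len k; d = k + (k choose 2)
      in 2 * fact (2 * m + 2) ^ d * (\<Sum>w\<in>colour_walks k m cyc. coef w m cyc d))"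

lemma clique_const_nonzero: "2 \<le> k \<Longrightarrow> clique_const k cyc \<noteq> 0"
  using sum_coef_colour_walks_nonzero[of k "tour_len k" cyc] by (simp add: clique_const_def Let_def)

lemma tour_len_ge: "2 \<le> k \<Longrightarrow> 2 \<le> tour_len k"
  by (simp add: tour_len_def)

text \<open>The sum over \<open>S\<close> leaves the full walks and the sum over \<open>q\<close>
  isolates the exponent \<open>d\<close>. \<open>fact J\<close> is a common multiple of all
  \<open>q\<close> in range, so the weights are integers.\<close>

lemma clique_extraction:
  assumes k: "2 \<le> k" and sym: "\<And>u v. E u v \<Longrightarrow> E v u"
    and m: "m = tour_len k" and J: "J = 2 * m + 2" and d: "d = k + (k choose 2)"
  shows "(\<Sum>q=1..J. \<Sum>S\<in>Pow {..<k * k}. (-1) ^ (q - 1 + card ({..<k * k} - S)) *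
      int ((J choose q) * (fact J div q) ^ d * trail_count E n k m cyc q S)) =
    clique_const k cyc * int (card (ordered_cliques E n k))"
proof -
  have m2: "2 \<le> m" using tour_len_ge k m by simp
  let ?L = "\<lambda>b q. int (card (labels b m cyc q))"
  let ?W = "\<lambda>q. (-1) ^ (q - 1) * int (J choose q) * int (fact J div q) ^ d"
  have "(\<Sum>q=1..J. \<Sum>S\<in>Pow {..<k * k}. (-1) ^ (q - 1 + card ({..<k * k} - S)) *
      int ((J choose q) * (fact J div q) ^ d * trail_count E n k m cyc q S)) =
    (\<Sum>q=1..J. 2 * ?W q * (\<Sum>S\<in>Pow {..<k * k}. (-1) ^ card ({..<k * k} - S) *
      (\<Sum>b\<in>bwalks E n k m cyc S. ?L b q)))"
  proof (rule sum.cong[OF refl])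
    fix q assume "q \<in> {1..J}"
    then have "int (trail_count E n k m cyc q S) = 2 * (\<Sum>b\<in>bwalks E n k m cyc S. ?L b q)" for S
      using trail_count_eq[OF _ sym m2, where q = q and n = n and k = k and cyc = cyc and S = S] by simp
    then show "(\<Sum>S\<in>Pow {..<k * k}. (-1) ^ (q - 1 + card ({..<k * k} - S)) *
      int ((J choose q) * (fact J div q) ^ d * trail_count E n k m cyc q S)) =
      2 * ?W q * (\<Sum>S\<in>Pow {..<k * k}. (-1) ^ card ({..<k * k} - S) * (\<Sum>b\<in>bwalks E n k m cyc S. ?L b q))"
      unfolding sum_distrib_left[of "2 * ?W q"] by (intro sum.cong) (simp_all add: power_add mult_ac)
  qed
  also have "\<dots> = (\<Sum>q=1..J. 2 * ?W q * (\<Sum>b\<in>full_walks E n k m cyc. ?L b q))"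
    by (simp only: sum_bwalks_alternating)
  also have "\<dots> = 2 * (\<Sum>b\<in>full_walks E n k m cyc. \<Sum>q=1..J. ?W q * ?L b q)"
    by (subst sum.swap) (simp add: sum_distrib_left mult_ac)
  also have "(\<Sum>b\<in>full_walks E n k m cyc. \<Sum>q=1..J. ?W q * ?L b q) =
    (\<Sum>b\<in>full_walks E n k m cyc. int (fact J) ^ d * coef b m cyc d)"
  proof (rule sum.cong[OF refl])
    fix b assume b: "b \<in> full_walks E n k m cyc"
    then have "wcols k m b = {..<k * k}" "cyc \<longrightarrow> b m = b 0" by (auto simp: full_walks_def bwalks_def)
    note f = this
    show "(\<Sum>q=1..J. ?W q * ?L b q) = int (fact J) ^ d * coef b m cyc d"
    proof (rule coef_extraction[OF _ f(2) J])
      show "d \<le> nverts b m + nedges b m"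
        unfolding d using full_nverts(2)[OF k f(1)] full_nedges[OF k f(1)] by (rule add_mono)
    qed (rule dvd_fact)
  qed
  also have "\<dots> = int (fact J) ^ d * (\<Sum>b\<in>full_walks E n k m cyc. coef b m cyc d)"
    by (simp add: sum_distrib_left)
  also have "(\<Sum>b\<in>full_walks E n k m cyc. coef b m cyc d) =
      int (card (ordered_cliques E n k)) * (\<Sum>w\<in>colour_walks k m cyc. coef w m cyc d)"
    unfolding d by (rule sum_coef_full_walks[OF k sym])
  finally show ?thesis
    unfolding clique_const_def Let_def m[symmetric] J[symmetric] d[symmetric] by (simp add: mult_ac)
qed

section \<open>One loop counter for both summation indices\<close>

lemma bij_set_decode: "bij_betw set_decode {..<2 ^ N :: nat} (Pow {..<N})"
proof (rule bij_betw_byWitness[of _ set_encode])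
  show "set_decode ` {..<2 ^ N :: nat} \<subseteq> Pow {..<N}"
  proof (clarsimp simp: set_decode_def)
    fix s n :: nat assume s: "s < 2 ^ N" and o: "odd (s div 2 ^ n)"
    show "n < N"
    proof (rule ccontr)
      assume "\<not> n < N"
      then have "(2 :: nat) ^ N \<le> 2 ^ n" by (intro power_increasing) auto
      then have "s div 2 ^ n = 0" using s by (intro div_less) linarith
      then show False using o by simp
    qed
  qed
  show "set_encode ` Pow {..<N} \<subseteq> {..<2 ^ N}"
  proof clarsimp
    fix S assume S: "S \<subseteq> {..<N}"
    then have "set_encode S \<le> (\<Sum>i<N. 2 ^ i)"
      unfolding set_encode_def by (simp add: finite_subset sum_mono2)
    also have "\<dots> < 2 ^ N" by (simp add: sum_power2 atLeast0LessThan[symmetric])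
    finally show "set_encode S < 2 ^ N" .
  qed
  show "\<forall>S\<in>Pow {..<N}. set_decode (set_encode S) = S"
    by (intro ballI set_encode_inverse) (auto intro: finite_subset)
qed simp

lemma sum_div_mod:
  fixes g :: "nat \<Rightarrow> nat \<Rightarrow> 'a :: comm_monoid_add"
  assumes "0 < M"
  shows "(\<Sum>r<J * M. g (r div M) (r mod M)) = (\<Sum>i<J. \<Sum>s<M. g i s)"
proof -
  have "(\<Sum>i<J. \<Sum>s<M. g i s) = (\<Sum>(i, s)\<in>{..<J} \<times> {..<M}. g i s)" by (rule sum.cartesian_product)
  also have "\<dots> = (\<Sum>r<J * M. g (r div M) (r mod M))"
  proof (rule sum.reindex_bij_witness[of _ "\<lambda>r. (r div M, r mod M)" "\<lambda>(i, s). i * M + s"])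
    fix p assume p: "p \<in> {..<J} \<times> {..<M}"
    then obtain i s where ps: "p = (i, s)" "i < J" "s < M" by auto
    have "i * M + s < Suc i * M" using ps by simp
    also have "\<dots> \<le> J * M" using ps by (intro mult_right_mono) auto
    finally show "(case p of (i, s) \<Rightarrow> i * M + s) \<in> {..<J * M}" using ps by simp
    show "((case p of (i, s) \<Rightarrow> i * M + s) div M, (case p of (i, s) \<Rightarrow> i * M + s) mod M) = p" using ps by simp
    show "g ((case p of (i, s) \<Rightarrow> i * M + s) div M) ((case p of (i, s) \<Rightarrow> i * M + s) mod M) =
      (case p of (i, s) \<Rightarrow> g i s)" using ps by simp
  qed (use assms in \<open>auto simp: less_mult_imp_div_less\<close>)
  finally show ?thesis ..
qed

text \<open>The form evaluated by the program: quotient and remainder of \<open>r\<close> by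
  \<open>M\<close> give \<open>q - 1\<close> and a bit code of \<open>S\<close>, and the sign is a
  truth value because the machine has no negative numbers.\<close>

lemma clique_extraction_loop:
  assumes k: "2 \<le> k" and sym: "\<And>u v. E u v \<Longrightarrow> E v u"
    and m: "m = tour_len k" and J: "J = 2 * m + 2" and d: "d = k + (k choose 2)" and M: "M = 2 ^ (k * k)"
    and \<sigma>: "\<And>r. \<sigma> r \<longleftrightarrow> even (r div M + card ({..<k * k} - set_decode (r mod M)))"
    and f: "\<And>r. f r = (J choose Suc (r div M)) * (fact J div Suc (r div M)) ^ d *
      trail_count E n k m cyc (Suc (r div M)) (set_decode (r mod M))"
  shows "(\<Sum>r<J * M. if \<sigma> r then int (f r) else - int (f r)) =
    clique_const k cyc * int (card (ordered_cliques E n k))"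
proof -
  let ?g = "\<lambda>q S. (-1) ^ (q - 1 + card ({..<k * k} - S)) *
      int ((J choose q) * (fact J div q) ^ d * trail_count E n k m cyc q S)"
  have "(\<Sum>r<J * M. if \<sigma> r then int (f r) else - int (f r)) =
    (\<Sum>r<J * M. ?g (Suc (r div M)) (set_decode (r mod M)))"
    by (intro sum.cong) (simp_all add: \<sigma> f)
  also have "\<dots> = (\<Sum>i<J. \<Sum>s<M. ?g (Suc i) (set_decode s))"
    by (rule sum_div_mod[of M "\<lambda>i s. ?g (Suc i) (set_decode s)"]) (simp add: M)
  also have "\<dots> = (\<Sum>i<J. \<Sum>S\<in>Pow {..<k * k}. ?g (Suc i) S)"
    unfolding M by (intro sum.cong refl sum.reindex_bij_betw[OF bij_set_decode])
  also have "\<dots> = (\<Sum>q=1..J. \<Sum>S\<in>Pow {..<k * k}. ?g q S)"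
    by (simp add: sum.atLeast1_atMost_eq)
  also have "\<dots> = clique_const k cyc * int (card (ordered_cliques E n k))"
    by (rule clique_extraction[OF k sym m J d])
  finally show ?thesis .
qed

section \<open>A term language for programs\<close>

datatype uop = ULeft | URight | UIsNode
datatype bop = BNode | BEq | BLess | BAdd | BSub | BMul | BDiv

primrec uexp :: "uop \<Rightarrow> expr \<Rightarrow> expr" where
  "uexp ULeft = Left" | "uexp URight = Right" | "uexp UIsNode = IsNode"

primrec bexp :: "bop \<Rightarrow> expr \<Rightarrow> expr \<Rightarrow> expr" where
  "bexp BNode = MkNode" | "bexp BEq = Eq" | "bexp BLess = Less" | "bexp BAdd = Add"
| "bexp BSub = Sub" | "bexp BMul = Mul" | "bexp BDiv = Div"

primrec uval :: "uop \<Rightarrow> val \<Rightarrow> val" where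
  "uval ULeft v = left_of v" | "uval URight v = right_of v"
| "uval UIsNode v = Atom (of_bool (is_node v))"

primrec bval :: "bop \<Rightarrow> val \<Rightarrow> val \<Rightarrow> val" where
  "bval BNode v w = Node v w"
| "bval BEq v w = Atom (of_bool (v = w))"
| "bval BLess v w = Atom (of_bool (the_num v < the_num w))"
| "bval BAdd v w = Atom (the_num v + the_num w)"
| "bval BSub v w = Atom (the_num v - the_num w)"
| "bval BMul v w = Atom (the_num v * the_num w)"
| "bval BDiv v w = Atom (the_num v div the_num w)"

text \<open>Functional terms with bounded loops and oracle calls. Their values can be computed by
  rewriting, and bounds on these values yield running times of the compiled programs.\<close>

datatype ftm =
    Lev nat
  | Idx nat
  | Num nat
  | Op1 uop ftm
  | Op2 bop ftm ftm
  | Bind ftm ftm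
  | Cond ftm ftm ftm
  | Loop ftm ftm ftm
  | Len ftm
  | Ask ftm

primrec spine :: "val \<Rightarrow> nat" where
  "spine (Atom n) = 0"
| "spine (Node a b) = Suc (spine b)"

text \<open>
  The environment is a stack with the newest value at its head. \<open>Idx\<close> counts from the top,
  \<open>Lev\<close> from the bottom, so that \<open>Lev\<close> references remain valid under binders. \<open>Loop\<close> pushes
  its bound, the accumulator and the counter, in this order.
\<close>

primrec ev :: "(val \<Rightarrow> val) \<Rightarrow> ftm \<Rightarrow> val list \<Rightarrow> val" where
  "ev \<omega> (Lev i) env = rev env ! i"
| "ev \<omega> (Idx i) env = env ! i"
| "ev \<omega> (Num n) env = Atom n"
| "ev \<omega> (Op1 u t) env = uval u (ev \<omega> t env)"
| "ev \<omega> (Op2 b t1 t2) env = bval b (ev \<omega> t1 env) (ev \<omega> t2 env)"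
| "ev \<omega> (Bind t1 t2) env = ev \<omega> t2 (ev \<omega> t1 env # env)"
| "ev \<omega> (Cond c t1 t2) env = (if ev \<omega> c env \<noteq> Atom 0 then ev \<omega> t1 env else ev \<omega> t2 env)"
| "ev \<omega> (Loop n i t) env =
     rec_nat (ev \<omega> i env) (\<lambda>c acc. ev \<omega> t (Atom c # acc # ev \<omega> n env # env)) (the_num (ev \<omega> n env))"
| "ev \<omega> (Len t) env = Atom (spine (ev \<omega> t env))"
| "ev \<omega> (Ask t) env = \<omega> (ev \<omega> t env)"

text \<open>\<open>B\<close> bounds the loop counts and the sizes of constants, results of binary
  operations and oracle answers; the other constructs cannot enlarge values beyond such a bound.
  \<open>\<omega>\<close> is the answer function, each of whose answers must be permitted by the
  relation \<open>\<O>\<close>.\<close>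

primrec ok :: "(val \<Rightarrow> val \<Rightarrow> bool) \<Rightarrow> (val \<Rightarrow> val) \<Rightarrow> nat \<Rightarrow> ftm \<Rightarrow> val list \<Rightarrow> bool" where
  "ok \<O> \<omega> B (Lev i) env \<longleftrightarrow> i < length env"
| "ok \<O> \<omega> B (Idx i) env \<longleftrightarrow> i < length env"
| "ok \<O> \<omega> B (Num n) env \<longleftrightarrow> vsize (Atom n) \<le> B"
| "ok \<O> \<omega> B (Op1 u t) env \<longleftrightarrow> ok \<O> \<omega> B t env"
| "ok \<O> \<omega> B (Op2 b t1 t2) env \<longleftrightarrow> ok \<O> \<omega> B t1 env \<and> ok \<O> \<omega> B t2 env \<and>
     vsize (bval b (ev \<omega> t1 env) (ev \<omega> t2 env)) \<le> B"
| "ok \<O> \<omega> B (Bind t1 t2) env \<longleftrightarrow> ok \<O> \<omega> B t1 env \<and> ok \<O> \<omega> B t2 (ev \<omega> t1 env # env)"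
| "ok \<O> \<omega> B (Cond c t1 t2) env \<longleftrightarrow> ok \<O> \<omega> B c env \<and>
     (if ev \<omega> c env \<noteq> Atom 0 then ok \<O> \<omega> B t1 env else ok \<O> \<omega> B t2 env)"
| "ok \<O> \<omega> B (Loop n i t) env \<longleftrightarrow> ok \<O> \<omega> B n env \<and> ok \<O> \<omega> B i env \<and> the_num (ev \<omega> n env) \<le> B \<and>
     (\<forall>c < the_num (ev \<omega> n env). ok \<O> \<omega> B t (Atom c #
        rec_nat (ev \<omega> i env) (\<lambda>c acc. ev \<omega> t (Atom c # acc # ev \<omega> n env # env)) c # ev \<omega> n env # env))"
| "ok \<O> \<omega> B (Len t) env \<longleftrightarrow> ok \<O> \<omega> B t env"
| "ok \<O> \<omega> B (Ask t) env \<longleftrightarrow> ok \<O> \<omega> B t env \<and> \<O> (ev \<omega> t env) (\<omega> (ev \<omega> t env)) \<and>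
     vsize (\<omega> (ev \<omega> t env)) \<le> B"

text \<open>The result is left in register \<open>p\<close>, registers below \<open>p\<close> are
  preserved, and \<open>\<rho>\<close> lists the registers that hold the environment.\<close>

primrec comp :: "ftm \<Rightarrow> nat list \<Rightarrow> nat \<Rightarrow> com" where
  "comp (Lev i) \<rho> p = Assign p (Var (rev \<rho> ! i))"
| "comp (Idx i) \<rho> p = Assign p (Var (\<rho> ! i))"
| "comp (Num n) \<rho> p = Assign p (Const n)"
| "comp (Op1 u t) \<rho> p = Seq (comp t \<rho> p) (Assign p (uexp u (Var p)))"
| "comp (Op2 b t1 t2) \<rho> p = Seq (comp t1 \<rho> p) (Seq (comp t2 \<rho> (Suc p))
     (Assign p (bexp b (Var p) (Var (Suc p)))))"
| "comp (Bind t1 t2) \<rho> p = Seq (comp t1 \<rho> p) (Seq (comp t2 (p # \<rho>) (Suc p)) (Assign p (Var (Suc p))))"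
| "comp (Cond c t1 t2) \<rho> p = Seq (comp c \<rho> p) (If (Var p) (comp t1 \<rho> p) (comp t2 \<rho> p))"
| "comp (Loop n i t) \<rho> p = Seq (comp n \<rho> p) (Seq (comp i \<rho> (p+1)) (Seq (Assign (p+2) (Const 0))
     (Seq (While (Less (Var (p+2)) (Var p))
        (Seq (comp t ([p+2, p+1, p] @ \<rho>) (p+3))
        (Seq (Assign (p+1) (Var (p+3))) (Assign (p+2) (Add (Var (p+2)) (Const 1))))))
     (Assign p (Var (p+1))))))"
| "comp (Len t) \<rho> p = Seq (comp t \<rho> p) (Seq (Assign (p+1) (Const 0))
     (Seq (While (IsNode (Var p)) (Seq (Assign p (Right (Var p))) (Assign (p+1) (Add (Var (p+1)) (Const 1)))))
     (Assign p (Var (p+1)))))"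
| "comp (Ask t) \<rho> p = Seq (comp t \<rho> p) (Query p (Var p))"

text \<open>The exponent of \<open>B\<close> in the time bound. One extra power absorbs the constant
  overhead of a construct; \<open>Loop\<close> and \<open>Len\<close> get a second one for up to
  \<open>B\<close> rounds.\<close>

primrec expo :: "ftm \<Rightarrow> nat" where
  "expo (Lev i) = 2"
| "expo (Idx i) = 2"
| "expo (Num n) = 2"
| "expo (Op1 u t) = expo t + 1"
| "expo (Op2 b t1 t2) = expo t1 + expo t2 + 1"
| "expo (Bind t1 t2) = expo t1 + expo t2 + 1"
| "expo (Cond c t1 t2) = expo c + expo t1 + expo t2 + 1"
| "expo (Loop n i t) = expo n + expo i + expo t + 2"
| "expo (Len t) = expo t + 2"
| "expo (Ask t) = expo t + 1"

section \<open>Correctness and running time of compiled terms\<close>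

lemma floorlog_le_self: "floorlog 2 n \<le> n"
  by (rule floorlog_leI) (auto)

lemma vsize_Atom_mono: "a \<le> b \<Longrightarrow> vsize (Atom a) \<le> vsize (Atom b)"
  by (simp add: floorlog_mono)

lemma vsize_Atom_le: "vsize (Atom n) \<le> Suc n"
  using floorlog_le_self[of n] by simp

lemma vsize_Atom_pow: "n < 2 ^ b \<Longrightarrow> vsize (Atom n) \<le> Suc b"
  by (simp add: floorlog_leI)

lemma vsize_pos: "1 \<le> vsize v"
  by (cases v) auto

lemma vsize_left: "vsize (left_of v) \<le> vsize v"
  by (cases v) (simp_all add: floorlog_mono)

lemma vsize_right: "vsize (right_of v) \<le> vsize v"
  by (cases v) (simp_all add: floorlog_mono)

lemma vsize_of_bool: "vsize (Atom (of_bool b)) \<le> 2"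
  using vsize_Atom_le[of "of_bool b"] by (cases b) auto

lemma spine_less: "spine v < vsize v"
  by (induction v) auto

lemma eval_uexp [simp]: "eval (uexp u e) s = uval u (eval e s)"
  by (cases u) auto

lemma eval_bexp [simp]: "eval (bexp b e f) s = bval b (eval e s) (eval f s)"
  by (cases b) auto

lemma cost_uexp: "cost (uexp u e) s = cost e s + vsize (uval u (eval e s))"
  by (cases u) auto

lemma cost_bexp: "cost (bexp b e f) s = cost e s + cost f s + vsize (bval b (eval e s) (eval f s))"
  by (cases b) auto

lemma vsize_uval: "2 \<le> B \<Longrightarrow> vsize v \<le> B \<Longrightarrow> vsize (uval u v) \<le> B"
  using vsize_left[of v] vsize_right[of v] vsize_of_bool[of "is_node v"] by (cases u) auto

lemma expo_ge: "2 \<le> expo t"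
  by (induction t) auto

text \<open>Total correctness with a time bound, in the style of weakest preconditions: a sequential
  composition nests the judgement for its second part in the postcondition of the first.\<close>

definition reach :: "(val \<Rightarrow> val \<Rightarrow> bool) \<Rightarrow> com \<Rightarrow> state \<Rightarrow> nat \<Rightarrow> (state \<Rightarrow> bool) \<Rightarrow> bool" where
  "reach \<O> c s T Q \<longleftrightarrow> (\<exists>t s'. exec \<O> c s t s' \<and> t \<le> T \<and> Q s')"

lemma reach_Assign: "Q (s(x := eval e s)) \<Longrightarrow> 1 + cost e s \<le> T \<Longrightarrow> reach \<O> (Assign x e) s T Q"
  unfolding reach_def by (blast intro: exec.Assign)

lemma reach_Query: "\<O> (eval e s) a \<Longrightarrow> Q (s(x := a)) \<Longrightarrow> 1 + cost e s + vsize a \<le> T \<Longrightarrow>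
    reach \<O> (Query x e) s T Q"
  unfolding reach_def by (blast intro: exec.Query)

lemma reach_Seq: "reach \<O> c1 s T1 (\<lambda>s'. reach \<O> c2 s' T2 Q) \<Longrightarrow> 1 + T1 + T2 \<le> T \<Longrightarrow>
    reach \<O> (Seq c1 c2) s T Q"
proof -
  assume "reach \<O> c1 s T1 (\<lambda>s'. reach \<O> c2 s' T2 Q)" and T: "1 + T1 + T2 \<le> T"
  then obtain t1 s1 t2 s2 where "exec \<O> c1 s t1 s1" "t1 \<le> T1" "exec \<O> c2 s1 t2 s2" "t2 \<le> T2" "Q s2"
    unfolding reach_def by blast
  then show ?thesis
    unfolding reach_def using T exec.Seq[of \<O> c1 s t1 s1 c2 t2 s2]
    by (intro exI[of _ "1 + t1 + t2"] exI[of _ s2]) auto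
qed

lemma reach_If: "reach \<O> (if eval e s \<noteq> Atom 0 then c1 else c2) s T1 Q \<Longrightarrow> 1 + cost e s + T1 \<le> T \<Longrightarrow>
    reach \<O> (If e c1 c2) s T Q"
proof -
  assume "reach \<O> (if eval e s \<noteq> Atom 0 then c1 else c2) s T1 Q" and T: "1 + cost e s + T1 \<le> T"
  then obtain t s' where "exec \<O> (if eval e s \<noteq> Atom 0 then c1 else c2) s t s'" "t \<le> T1" "Q s'"
    unfolding reach_def by blast
  then show ?thesis
    unfolding reach_def using T exec.IfTrue[of e s \<O> c1 t s' c2] exec.IfFalse[of e s \<O> c2 t s' c1]
    by (intro exI[of _ "1 + cost e s + t"] exI[of _ s']) (auto split: if_splits)
qed

lemma reach_mono: "reach \<O> c s T Q \<Longrightarrow> T \<le> T' \<Longrightarrow> (\<And>s'. Q s' \<Longrightarrow> Q' s') \<Longrightarrow> reach \<O> c s T' Q'"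
  unfolding reach_def by (meson le_trans)

lemma reach_While:
  assumes body: "\<And>i s. I i s \<Longrightarrow> i < n \<Longrightarrow> eval e s \<noteq> Atom 0 \<and> cost e s \<le> C \<and> reach \<O> c s Tb (I (Suc i))"
    and exit: "\<And>s. I n s \<Longrightarrow> eval e s = Atom 0 \<and> cost e s \<le> C"
    and "I i s" "i \<le> n" "(n - i) * (1 + C + Tb) + 1 + C \<le> T"
  shows "reach \<O> (While e c) s T (I n)"
  using assms(3-5)
proof (induction "n - i" arbitrary: i s T)
  case 0
  then have "i = n" by simp
  then have "exec \<O> (While e c) s (1 + cost e s) s" "cost e s \<le> C"
    using exit[of s] 0 exec.WhileFalse[of e s \<O> c] by auto
  then show ?case unfolding reach_def using 0 \<open>i = n\<close> by fastforce
next
  case (Suc k)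
  then have i: "i < n" by simp
  then obtain t1 s1 where e: "eval e s \<noteq> Atom 0" "cost e s \<le> C" and
    s1: "exec \<O> c s t1 s1" "t1 \<le> Tb" "I (Suc i) s1"
    using body[of i s] Suc.prems unfolding reach_def by blast
  have "reach \<O> (While e c) s1 ((n - Suc i) * (1 + C + Tb) + 1 + C) (I n)"
    using Suc s1 i by (intro Suc.hyps(1)) auto
  then obtain t2 s2 where s2: "exec \<O> (While e c) s1 t2 s2" "I n s2"
    "t2 \<le> (n - Suc i) * (1 + C + Tb) + 1 + C" unfolding reach_def by blast
  have "n - i = Suc (n - Suc i)" using i by simp
  then have "1 + cost e s + t1 + t2 \<le> (n - i) * (1 + C + Tb) + 1 + C"
    using e(2) s1(2) s2(3) by simp
  then show ?case
    unfolding reach_def using exec.WhileTrue[OF e(1) s1(1) s2(1)] s2(2) Suc.prems(3) by force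
qed

definition env_at :: "nat list \<Rightarrow> nat \<Rightarrow> val list \<Rightarrow> state \<Rightarrow> bool" where
  "env_at \<rho> p env s \<longleftrightarrow> length \<rho> = length env \<and> (\<forall>i < length env. \<rho> ! i < p \<and> s (\<rho> ! i) = env ! i)"

lemma env_at_mono: "env_at \<rho> p env s \<Longrightarrow> (\<And>x. x < p \<Longrightarrow> s' x = s x) \<Longrightarrow> p \<le> p' \<Longrightarrow> env_at \<rho> p' env s'"
  unfolding env_at_def by fastforce

lemma env_at_Cons: "env_at \<rho> p env s \<Longrightarrow> x < p \<Longrightarrow> s x = v \<Longrightarrow> env_at (x # \<rho>) p (v # env) s"
  unfolding env_at_def by (auto simp: nth_Cons split: nat.split)

lemma env_at_nth: "env_at \<rho> p env s \<Longrightarrow> i < length env \<Longrightarrow> s (\<rho> ! i) = env ! i"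
  unfolding env_at_def by simp

lemma env_at_rev_nth: "env_at \<rho> p env s \<Longrightarrow> i < length env \<Longrightarrow> s (rev \<rho> ! i) = rev env ! i"
  unfolding env_at_def by (simp add: rev_nth)

lemma ok_vsize:
  assumes "ok \<O> \<omega> B t env" "\<forall>v \<in> set env. vsize v \<le> B" "2 \<le> B"
  shows "vsize (ev \<omega> t env) \<le> B"
  using assms
proof (induction t arbitrary: env)
  case (Lev i)
  then have "rev env ! i \<in> set env" by (metis length_rev nth_mem ok.simps(1) set_rev)
  then show ?case using Lev by simp
next
  case (Op1 u t)
  then show ?case using vsize_uval by simp
next
  case (Loop n i t)
  let ?a = "rec_nat (ev \<omega> i env) (\<lambda>c acc. ev \<omega> t (Atom c # acc # ev \<omega> n env # env))"
  have n: "vsize (ev \<omega> n env) \<le> B" using Loop by simp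
  have "vsize (?a c) \<le> B" if "c \<le> the_num (ev \<omega> n env)" for c
    using that
  proof (induction c)
    case 0
    then show ?case using Loop by simp
  next
    case (Suc c)
    then have c: "c < the_num (ev \<omega> n env)" by simp
    then have "ev \<omega> n env = Atom (the_num (ev \<omega> n env))" by (cases "ev \<omega> n env") auto
    then have "vsize (Atom c) \<le> B" using n vsize_Atom_mono[of c "the_num (ev \<omega> n env)"] c by auto
    then show ?case using Loop.IH(3)[of "Atom c # ?a c # ev \<omega> n env # env"] Loop.prems n c Suc by auto
  qed
  then show ?case by simp
next
  case (Len t)
  then have "vsize (ev \<omega> t env) \<le> B" by simp
  then show ?case using vsize_Atom_le[of "spine (ev \<omega> t env)"] spine_less[of "ev \<omega> t env"] by simp
qed auto


lemma pow_ge: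
  fixes B :: nat
  assumes "16 \<le> B" "2 \<le> e"
  shows "B \<le> B ^ e" "16 * B \<le> B ^ e" "256 \<le> B ^ e"
proof -
  have "B ^ 2 \<le> B ^ e" using assms by (intro power_increasing) auto
  moreover have "16 * B \<le> B ^ 2" using assms by (simp add: power2_eq_square)
  ultimately show *: "16 * B \<le> B ^ e" by simp
  then show "B \<le> B ^ e" "256 \<le> B ^ e" using assms by auto
qed

text \<open>A bound \<open>B\<close> of at least 16 turns each extra power into slack for the
  constant factors in the time bounds.\<close>

lemma pow_add_ge:
  fixes B :: nat
  assumes "16 \<le> B"
  shows "16 * B ^ a \<le> B ^ (a + b + 1)" "16 * B ^ b \<le> B ^ (a + b + 1)"
proof -
  have "B ^ a * B \<le> B ^ (a + b + 1)" "B ^ b * B \<le> B ^ (a + b + 1)"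
    using power_increasing[of "a + 1" "a + b + 1" B] power_increasing[of "b + 1" "a + b + 1" B] assms
    by (auto simp: mult.commute)
  moreover have "16 * B ^ a \<le> B ^ a * B" "16 * B ^ b \<le> B ^ b * B" using assms by auto
  ultimately show "16 * B ^ a \<le> B ^ (a + b + 1)" "16 * B ^ b \<le> B ^ (a + b + 1)" by linarith+
qed

text \<open>\<open>ok_vsize\<close> bounds every value copied or produced by \<open>B\<close>, so
  each elementary command costs a small multiple of \<open>B\<close>; the cost of subterms comes
  from the induction hypotheses.\<close>

theorem comp_correct:
  assumes "ok \<O> \<omega> B t env" "\<forall>v \<in> set env. vsize v \<le> B" "16 \<le> B" "env_at \<rho> p env s"
  shows "reach \<O> (comp t \<rho> p) s (B ^ expo t) (\<lambda>s'. s' p = ev \<omega> t env \<and> (\<forall>x < p. s' x = s x))"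
  using assms
proof (induction t arbitrary: env \<rho> p s)
  case (Lev i)
  have "vsize (ev \<omega> (Lev i) env) \<le> B" using Lev by (intro ok_vsize) auto
  then show ?case using Lev pow_ge[of B 2] by (auto intro!: reach_Assign simp: env_at_rev_nth)
next
  case (Idx i)
  have "vsize (ev \<omega> (Idx i) env) \<le> B" using Idx by (intro ok_vsize) auto
  then have "Suc (vsize (env ! i)) \<le> B ^ 2" using Idx.prems(3) pow_ge[of B 2] by simp
  then show ?case using Idx.prems by (auto intro!: reach_Assign simp: env_at_nth)
next
  case (Num n)
  then show ?case using pow_ge[of B 2] by (auto intro!: reach_Assign)
next
  case (Op1 u t)
  have v: "vsize (ev \<omega> t env) \<le> B" using Op1.prems by (intro ok_vsize[of \<O>]) auto
  then have w: "vsize (uval u (ev \<omega> t env)) \<le> B" using vsize_uval Op1.prems by auto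
  have B: "16 * B \<le> B ^ expo t" "16 * B ^ expo t \<le> B ^ expo (Op1 u t)"
    using pow_ge[OF Op1.prems(3) expo_ge] pow_add_ge[OF Op1.prems(3), of "expo t" 0] by auto
  show ?case unfolding comp.simps
  proof (rule reach_Seq[OF reach_mono[OF Op1.IH[OF _ Op1.prems(2,3,4)] le_refl]])
    show "ok \<O> \<omega> B t env" using Op1.prems by simp
    show "reach \<O> (Assign p (uexp u (Var p))) s' (3 * B)
      (\<lambda>s'. s' p = ev \<omega> (Op1 u t) env \<and> (\<forall>x<p. s' x = s x))"
      if "s' p = ev \<omega> t env \<and> (\<forall>x<p. s' x = s x)" for s'
      using that v w Op1.prems(3) by (auto intro!: reach_Assign simp: cost_uexp)
    show "1 + B ^ expo t + 3 * B \<le> B ^ expo (Op1 u t)" using B Op1.prems(3) by linarith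
  qed
next
  case (Op2 b t1 t2)
  have v1: "vsize (ev \<omega> t1 env) \<le> B" using Op2.prems by (intro ok_vsize[of \<O>]) auto
  have v2: "vsize (ev \<omega> t2 env) \<le> B" using Op2.prems by (intro ok_vsize[of \<O>]) auto
  have w: "vsize (bval b (ev \<omega> t1 env) (ev \<omega> t2 env)) \<le> B" using Op2.prems by simp
  have B: "16 * B \<le> B ^ expo t1" "16 * B ^ expo t1 \<le> B ^ expo (Op2 b t1 t2)"
    "16 * B ^ expo t2 \<le> B ^ expo (Op2 b t1 t2)"
    using pow_ge[OF Op2.prems(3) expo_ge] pow_add_ge[OF Op2.prems(3), where a = "expo t1" and b = "expo t2"] by auto
  show ?case unfolding comp.simps
  proof (rule reach_Seq[OF reach_mono[OF Op2.IH(1)[OF _ Op2.prems(2,3,4)] le_refl]])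
    show "ok \<O> \<omega> B t1 env" using Op2.prems by simp
    show "reach \<O> (Seq (comp t2 \<rho> (Suc p)) (Assign p (bexp b (Var p) (Var (Suc p))))) s'
      (1 + B ^ expo t2 + (1 + 3 * B))
      (\<lambda>s'. s' p = ev \<omega> (Op2 b t1 t2) env \<and> (\<forall>x<p. s' x = s x))"
      if s': "s' p = ev \<omega> t1 env \<and> (\<forall>x<p. s' x = s x)" for s'
    proof (rule reach_Seq[OF reach_mono[OF Op2.IH(2)[OF _ Op2.prems(2,3)] le_refl]])
      show "ok \<O> \<omega> B t2 env" using Op2.prems by simp
      show "env_at \<rho> (Suc p) env s'" using s' Op2.prems(4) by (auto intro: env_at_mono)
      show "reach \<O> (Assign p (bexp b (Var p) (Var (Suc p)))) s'' (1 + 3 * B)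
        (\<lambda>s'. s' p = ev \<omega> (Op2 b t1 t2) env \<and> (\<forall>x<p. s' x = s x))"
        if "s'' (Suc p) = ev \<omega> t2 env \<and> (\<forall>x<Suc p. s'' x = s' x)" for s''
        using that v1 v2 w s' by (auto intro!: reach_Assign simp: cost_bexp)
    qed auto
  qed (use B Op2.prems(3) in auto)
next
  case (Bind t1 t2)
  let ?v = "ev \<omega> t1 env"
  have v1: "vsize ?v \<le> B" using Bind.prems by (intro ok_vsize[of \<O>]) auto
  have v2: "vsize (ev \<omega> t2 (?v # env)) \<le> B"
    using Bind.prems v1 by (intro ok_vsize[of \<O>]) auto
  have B: "16 * B \<le> B ^ expo t1" "16 * B ^ expo t1 \<le> B ^ expo (Bind t1 t2)"
    "16 * B ^ expo t2 \<le> B ^ expo (Bind t1 t2)"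
    using pow_ge[OF Bind.prems(3) expo_ge] pow_add_ge[OF Bind.prems(3), where a = "expo t1" and b = "expo t2"] by auto
  show ?case unfolding comp.simps
  proof (rule reach_Seq[OF reach_mono[OF Bind.IH(1)[OF _ Bind.prems(2,3,4)] le_refl]])
    show "ok \<O> \<omega> B t1 env" using Bind.prems by simp
    show "reach \<O> (Seq (comp t2 (p # \<rho>) (Suc p)) (Assign p (Var (Suc p)))) s' (1 + B ^ expo t2 + (1 + B))
      (\<lambda>s'. s' p = ev \<omega> (Bind t1 t2) env \<and> (\<forall>x<p. s' x = s x))"
      if s': "s' p = ?v \<and> (\<forall>x<p. s' x = s x)" for s'
    proof (rule reach_Seq[OF reach_mono[OF Bind.IH(2)[OF _ _ Bind.prems(3)] le_refl]])
      show "ok \<O> \<omega> B t2 (?v # env)" using Bind.prems by simp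
      show "\<forall>v\<in>set (?v # env). vsize v \<le> B" using v1 Bind.prems by simp
      show "env_at (p # \<rho>) (Suc p) (?v # env) s'"
        using s' Bind.prems(4) by (auto intro!: env_at_Cons intro: env_at_mono)
      show "reach \<O> (Assign p (Var (Suc p))) s'' (1 + B)
        (\<lambda>s'. s' p = ev \<omega> (Bind t1 t2) env \<and> (\<forall>x<p. s' x = s x))"
        if "s'' (Suc p) = ev \<omega> t2 (?v # env) \<and> (\<forall>x<Suc p. s'' x = s' x)" for s''
        using that v2 s' by (auto intro!: reach_Assign)
    qed auto
  qed (use B Bind.prems(3) in auto)
next
  case (Cond c t1 t2)
  have v: "vsize (ev \<omega> c env) \<le> B" using Cond.prems by (intro ok_vsize[of \<O>]) auto
  have "16 * B ^ (expo c) \<le> B ^ (expo c + (expo t1 + expo t2) + 1)"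
    "16 * B ^ (expo t1) \<le> B ^ (expo t1 + (expo c + expo t2) + 1)"
    "16 * B ^ (expo t2) \<le> B ^ (expo t2 + (expo t1 + expo c) + 1)"
    using pow_add_ge(1)[OF Cond.prems(3)] by blast+
  then have B: "16 * B ^ expo c \<le> B ^ expo (Cond c t1 t2)" "16 * B ^ expo t1 \<le> B ^ expo (Cond c t1 t2)"
    "16 * B ^ expo t2 \<le> B ^ expo (Cond c t1 t2)" "16 * B \<le> B ^ expo c" "1 \<le> B ^ expo t1" "1 \<le> B ^ expo t2"
    using pow_ge[OF Cond.prems(3) expo_ge] Cond.prems(3) by (simp_all add: ac_simps)
  show ?case unfolding comp.simps
  proof (rule reach_Seq[OF reach_mono[OF Cond.IH(1)[OF _ Cond.prems(2,3,4)] le_refl]])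
    show "ok \<O> \<omega> B c env" using Cond.prems by simp
    show "reach \<O> (If (Var p) (comp t1 \<rho> p) (comp t2 \<rho> p)) s' (1 + B + (B ^ expo t1 + B ^ expo t2))
      (\<lambda>s'. s' p = ev \<omega> (Cond c t1 t2) env \<and> (\<forall>x<p. s' x = s x))"
      if s': "s' p = ev \<omega> c env \<and> (\<forall>x<p. s' x = s x)" for s'
    proof (rule reach_If)
      have e: "env_at \<rho> p env s'" using s' Cond.prems(4) by (auto intro: env_at_mono)
      show "reach \<O> (if eval (Var p) s' \<noteq> Atom 0 then comp t1 \<rho> p else comp t2 \<rho> p) s'
        (B ^ expo t1 + B ^ expo t2)
        (\<lambda>s'. s' p = ev \<omega> (Cond c t1 t2) env \<and> (\<forall>x<p. s' x = s x))"
      proof (cases "ev \<omega> c env = Atom 0")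
        case True
        then show ?thesis using s' Cond.prems
          by (auto intro!: reach_mono[OF Cond.IH(3)[OF _ Cond.prems(2,3) e]])
      next
        case False
        then show ?thesis using s' Cond.prems
          by (auto intro!: reach_mono[OF Cond.IH(2)[OF _ Cond.prems(2,3) e]])
      qed
    qed (use s' v in auto)
  qed (use B Cond.prems(3) in auto)
next
  case (Loop n i t)
  let ?n = "ev \<omega> n env"
  let ?N = "the_num ?n"
  let ?a = "rec_nat (ev \<omega> i env) (\<lambda>c acc. ev \<omega> t (Atom c # acc # ?n # env))"
  let ?F = "B ^ (expo n + expo i + expo t)"
  \<comment> \<open>The loop invariant: register \<open>p\<close> holds the bound,
    \<open>p+1\<close> the accumulator and \<open>p+2\<close> the counter. The body works from
    \<open>p+3\<close> on.\<close>
  let ?I = "\<lambda>c s'. s' p = ?n \<and> s' (p+1) = ?a c \<and> s' (p+2) = Atom c \<and> (\<forall>x<p. s' x = s x)"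
  note B16 = Loop.prems(3)
  have vn: "vsize ?n \<le> B" using Loop.prems by (intro ok_vsize[of \<O>]) auto
  have vi: "vsize (ev \<omega> i env) \<le> B" using Loop.prems by (intro ok_vsize[of \<O>]) auto
  have vc: "vsize (Atom c) \<le> B" if "c \<le> ?N" for c
  proof (cases ?n)
    case (Atom x)
    then show ?thesis using vn vsize_Atom_mono[of c x] that by auto
  qed (use that B16 vsize_Atom_le[of c] in auto)
  have va: "vsize (?a c) \<le> B" if "c \<le> ?N" for c
    using that
  proof (induction c)
    case 0
    then show ?case using vi by simp
  next
    case (Suc c)
    then have "vsize (ev \<omega> t (Atom c # ?a c # ?n # env)) \<le> B"
      using Loop.prems vn vc[of c] by (intro ok_vsize[of \<O>]) auto
    then show ?case by simp
  qed
  have N: "?N \<le> B" using Loop.prems by simp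
  have body: "eval (Less (Var (p+2)) (Var p)) s1 \<noteq> Atom 0 \<and> cost (Less (Var (p+2)) (Var p)) s1 \<le> 3 * B \<and>
     reach \<O> (Seq (comp t ([p+2, p+1, p] @ \<rho>) (p+3))
        (Seq (Assign (p+1) (Var (p+3))) (Assign (p+2) (Add (Var (p+2)) (Const 1))))) s1
       (B ^ expo t + 6 * B) (?I (Suc c))" if s1: "?I c s1" and c: "c < ?N" for c s1
  proof (intro conjI)
    show "eval (Less (Var (p+2)) (Var p)) s1 \<noteq> Atom 0" using s1 c by simp
    show "cost (Less (Var (p+2)) (Var p)) s1 \<le> 3 * B"
      using s1 c vn vc[of c] vsize_of_bool[of True] B16 by simp
    let ?env = "Atom c # ?a c # ?n # env"
    show "reach \<O> (Seq (comp t ([p+2, p+1, p] @ \<rho>) (p+3))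
        (Seq (Assign (p+1) (Var (p+3))) (Assign (p+2) (Add (Var (p+2)) (Const 1))))) s1
       (B ^ expo t + 6 * B) (?I (Suc c))"
    proof (rule reach_Seq[OF reach_mono[OF Loop.IH(3)[of ?env, OF _ _ B16] le_refl]])
      show "ok \<O> \<omega> B t ?env" using Loop.prems c by simp
      show "\<forall>v\<in>set ?env. vsize v \<le> B" using vn vc[of c] va[of c] c Loop.prems by auto
      show "env_at ([p+2, p+1, p] @ \<rho>) (p+3) ?env s1"
        using s1 env_at_mono[OF Loop.prems(4), of s1 "p + 3"] by (auto intro!: env_at_Cons)
      show "reach \<O> (Seq (Assign (p+1) (Var (p+3))) (Assign (p+2) (Add (Var (p+2)) (Const 1)))) s2
         (1 + (1 + B) + (1 + 3 * B)) (?I (Suc c))"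
        if s2: "s2 (p+3) = ev \<omega> t ?env \<and> (\<forall>x<p+3. s2 x = s1 x)" for s2
      proof (rule reach_Seq[of _ _ _ "1 + B" _ "1 + 3 * B"])
        have v: "vsize (ev \<omega> t ?env) \<le> B" using va[of "Suc c"] c by simp
        have v1: "vsize (Atom (Suc c)) \<le> B" using vc[of "Suc c"] c by simp
        have v2: "vsize (Atom 1) \<le> B" using vsize_Atom_le[of 1] B16 by linarith
        show "reach \<O> (Assign (p+1) (Var (p+3))) s2 (1 + B)
          (\<lambda>s'. reach \<O> (Assign (p+2) (Add (Var (p+2)) (Const 1))) s' (1 + 3 * B) (?I (Suc c)))"
        proof (rule reach_Assign)
          show "reach \<O> (Assign (p+2) (Add (Var (p+2)) (Const 1))) (s2(p+1 := eval (Var (p+3)) s2))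
            (1 + 3 * B) (?I (Suc c))"
            by (rule reach_Assign) (use s1 s2 v1 v2 vc[of c] c in auto)
        qed (use s2 v in auto)
      qed auto
    qed (use B16 in auto)
  qed
  have exit: "eval (Less (Var (p+2)) (Var p)) s1 = Atom 0 \<and> cost (Less (Var (p+2)) (Var p)) s1 \<le> 3 * B"
    if s1: "?I ?N s1" for s1
    using s1 vn vc[of ?N] vsize_of_bool[of False] B16 by simp
  have F: "B ^ expo n \<le> ?F" "B ^ expo i \<le> ?F" "B ^ expo t \<le> ?F" "B * B \<le> ?F"
  proof -
    show "B ^ expo n \<le> ?F" "B ^ expo i \<le> ?F" "B ^ expo t \<le> ?F"
      using B16 by (auto intro!: power_increasing)
    have "B ^ 2 \<le> ?F" using B16 expo_ge[of n] by (intro power_increasing) auto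
    then show "B * B \<le> ?F" by (simp add: power2_eq_square)
  qed
  have sixteen: "16 * B \<le> B * B" using B16 by simp
  have whole: "3 * ?F + B * (1 + 3 * B + (?F + 6 * B)) + 10 * B \<le> B ^ expo (Loop n i t)"
  proof -
    have "B * (1 + 3 * B + (?F + 6 * B)) \<le> B * (?F + 10 * B)" using B16 by (intro mult_left_mono) auto
    also have "\<dots> \<le> B * ?F + 10 * ?F" using F(4) by (simp add: distrib_left)
    finally have "3 * ?F + B * (1 + 3 * B + (?F + 6 * B)) + 10 * B \<le> B * ?F + 14 * ?F"
      using F(4) sixteen by linarith
    also have "\<dots> \<le> B * ?F + B * ?F" using B16 by (intro add_mono mult_right_mono) auto
    also have "\<dots> = 2 * (B * ?F)" by simp
    also have "\<dots> \<le> B * (B * ?F)" using B16 by (intro mult_right_mono) auto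
    also have "\<dots> = B ^ expo (Loop n i t)" by (simp add: power_add power2_eq_square)
    finally show ?thesis .
  qed
  let ?W = "While (Less (Var (p+2)) (Var p)) (Seq (comp t ([p+2, p+1, p] @ \<rho>) (p+3))
        (Seq (Assign (p+1) (Var (p+3))) (Assign (p+2) (Add (Var (p+2)) (Const 1)))))"
  let ?Q = "\<lambda>s'. s' p = ev \<omega> (Loop n i t) env \<and> (\<forall>x<p. s' x = s x)"
  let ?TW = "B * (1 + 3 * B + (B ^ expo t + 6 * B)) + 1 + 3 * B"
  have W: "reach \<O> ?W s1 ?TW (?I ?N)" if s1: "?I 0 s1" for s1
  proof (rule reach_While[where I = ?I and n = ?N and C = "3 * B" and Tb = "B ^ expo t + 6 * B" and i = 0,
        OF body exit s1])
    show "(?N - 0) * (1 + 3 * B + (B ^ expo t + 6 * B)) + 1 + 3 * B \<le> ?TW"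
      using N by (intro add_mono mult_right_mono) auto
  qed auto
  have last: "reach \<O> (Assign p (Var (p+1))) s1 (1 + B) ?Q" if "?I ?N s1" for s1
    using that va[of ?N] by (auto intro!: reach_Assign)
  have three: "reach \<O> (Seq ?W (Assign p (Var (p+1)))) s1 (1 + ?TW + (1 + B)) ?Q" if "?I 0 s1" for s1
    by (rule reach_Seq[OF reach_mono[OF W[OF that] le_refl last]]) auto
  have two: "reach \<O> (Seq (Assign (p+2) (Const 0)) (Seq ?W (Assign p (Var (p+1))))) s1
      (1 + 2 + (1 + ?TW + (1 + B))) ?Q"
    if "s1 p = ?n \<and> s1 (p+1) = ?a 0 \<and> (\<forall>x<p. s1 x = s x)" for s1
  proof (rule reach_Seq[of _ _ _ 2])
    show "reach \<O> (Assign (p+2) (Const 0)) s1 2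
      (\<lambda>s'. reach \<O> (Seq ?W (Assign p (Var (p+1)))) s' (1 + ?TW + (1 + B)) ?Q)"
      by (rule reach_Assign, rule three) (use that in \<open>auto simp: floorlog_eq_zero_iff\<close>)
  qed auto
  have one: "reach \<O> (Seq (comp i \<rho> (p+1)) (Seq (Assign (p+2) (Const 0)) (Seq ?W (Assign p (Var (p+1)))))) s1
      (1 + B ^ expo i + (1 + 2 + (1 + ?TW + (1 + B)))) ?Q"
    if s1: "s1 p = ?n \<and> (\<forall>x<p. s1 x = s x)" for s1
  proof (rule reach_Seq[OF reach_mono[OF Loop.IH(2)[of env, OF _ Loop.prems(2) B16] le_refl two]])
    show "ok \<O> \<omega> B i env" using Loop.prems by simp
    show "env_at \<rho> (p+1) env s1" using s1 env_at_mono[OF Loop.prems(4), of s1 "p+1"] by auto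
  qed (use s1 in auto)
  show ?case unfolding comp.simps
  proof (rule reach_Seq[OF reach_mono[OF Loop.IH(1)[of env, OF _ Loop.prems(2) B16 Loop.prems(4)] le_refl one]])
    show "ok \<O> \<omega> B n env" using Loop.prems by simp
    have "B * (1 + 3 * B + (B ^ expo t + 6 * B)) \<le> B * (1 + 3 * B + (?F + 6 * B))"
      using F(3) by (intro mult_left_mono) auto
    then show "1 + B ^ expo n + (1 + B ^ expo i + (1 + 2 + (1 + ?TW + (1 + B)))) \<le> B ^ expo (Loop n i t)"
      using whole F B16 by linarith
  qed auto
next
  case (Len t)
  let ?v = "ev \<omega> t env"
  let ?n = "spine ?v"
  let ?I = "\<lambda>c s'. s' p = (right_of ^^ c) ?v \<and> s' (p+1) = Atom c \<and> (\<forall>x<p. s' x = s x)"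
  note B16 = Len.prems(3)
  have v: "vsize ?v \<le> B" using Len.prems by (intro ok_vsize[of \<O>]) auto
  have n: "Suc ?n \<le> B" using spine_less[of ?v] v by simp
  have vc: "vsize (Atom c) \<le> B" if "c \<le> ?n" for c
    using vsize_Atom_le[of c] that n by linarith
  have vr: "vsize ((right_of ^^ c) w) \<le> vsize w" for c w
  proof (induction c)
    case (Suc c)
    then show ?case using vsize_right[of "(right_of ^^ c) w"] by simp
  qed simp
  have nd: "c \<le> spine w \<Longrightarrow> is_node ((right_of ^^ c) w) \<longleftrightarrow> c < spine w" for c w
  proof (induction w arbitrary: c)
    case (Node a b)
    then show ?case by (cases c) (auto simp del: funpow.simps simp: funpow_Suc_right)
  qed simp
  have vI: "vsize ((right_of ^^ c) ?v) \<le> B" for c using vr[of c ?v] v by simp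
  let ?W = "While (IsNode (Var p)) (Seq (Assign p (Right (Var p))) (Assign (p+1) (Add (Var (p+1)) (Const 1))))"
  let ?Q = "\<lambda>s'. s' p = ev \<omega> (Len t) env \<and> (\<forall>x<p. s' x = s x)"
  have v1: "vsize (Atom 1) \<le> B" using vsize_Atom_le[of 1] B16 by linarith
  have W: "reach \<O> ?W s1 (B * (1 + 2 * B + 6 * B) + 1 + 2 * B) (?I ?n)" if s1: "?I 0 s1" for s1
  proof (rule reach_While[where I = ?I and n = ?n and C = "2 * B" and Tb = "6 * B" and i = 0, OF _ _ s1])
    fix c s1 assume s1: "?I c s1" and c: "c < ?n"
    have c1: "vsize (Atom (Suc c)) \<le> B" using vc[of "Suc c"] c by simp
    have c2: "vsize (Atom c) \<le> B" using vc[of c] c by simp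
    show "eval (IsNode (Var p)) s1 \<noteq> Atom 0 \<and> cost (IsNode (Var p)) s1 \<le> 2 * B \<and>
      reach \<O> (Seq (Assign p (Right (Var p))) (Assign (p+1) (Add (Var (p+1)) (Const 1)))) s1 (6 * B) (?I (Suc c))"
    proof (intro conjI)
      show "eval (IsNode (Var p)) s1 \<noteq> Atom 0" using s1 nd[of c ?v] c by simp
      show "cost (IsNode (Var p)) s1 \<le> 2 * B"
        using s1 vI[of c] vsize_of_bool[of "is_node ((right_of ^^ c) ?v)"] B16 by simp
      show "reach \<O> (Seq (Assign p (Right (Var p))) (Assign (p+1) (Add (Var (p+1)) (Const 1)))) s1 (6 * B) (?I (Suc c))"
      proof (rule reach_Seq[of _ _ _ "1 + 2 * B" _ "1 + 3 * B"])
        show "reach \<O> (Assign p (Right (Var p))) s1 (1 + 2 * B)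
          (\<lambda>s'. reach \<O> (Assign (p+1) (Add (Var (p+1)) (Const 1))) s' (1 + 3 * B) (?I (Suc c)))"
        proof (rule reach_Assign)
          show "reach \<O> (Assign (p+1) (Add (Var (p+1)) (Const 1))) (s1(p := eval (Right (Var p)) s1))
            (1 + 3 * B) (?I (Suc c))"
            by (rule reach_Assign) (use s1 v1 c1 c2 in auto)
        qed (use s1 vI[of c] vI[of "Suc c"] in auto)
      qed (use B16 in auto)
    qed
  next
    fix s1 assume s1: "?I ?n s1"
    show "eval (IsNode (Var p)) s1 = Atom 0 \<and> cost (IsNode (Var p)) s1 \<le> 2 * B"
      using s1 nd[of ?n ?v] vI[of ?n] vsize_of_bool[of False] B16 by simp
  next
    show "(?n - 0) * (1 + 2 * B + 6 * B) + 1 + 2 * B \<le> B * (1 + 2 * B + 6 * B) + 1 + 2 * B"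
      using n by (intro add_mono mult_right_mono) auto
  qed auto
  have last: "reach \<O> (Assign p (Var (p+1))) s1 (1 + B) ?Q" if "?I ?n s1" for s1
    using that vc[of ?n] by (auto intro!: reach_Assign)
  let ?TW = "B * (1 + 2 * B + 6 * B) + 1 + 2 * B"
  have two: "reach \<O> (Seq ?W (Assign p (Var (p+1)))) s1 (1 + ?TW + (1 + B)) ?Q" if "?I 0 s1" for s1
    by (rule reach_Seq[OF reach_mono[OF W[OF that] le_refl last]]) auto
  have one: "reach \<O> (Seq (Assign (p+1) (Const 0)) (Seq ?W (Assign p (Var (p+1))))) s1
      (1 + 2 + (1 + ?TW + (1 + B))) ?Q"
    if "s1 p = ?v \<and> (\<forall>x<p. s1 x = s x)" for s1
  proof (rule reach_Seq[of _ _ _ 2])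
    show "reach \<O> (Assign (p+1) (Const 0)) s1 2
      (\<lambda>s'. reach \<O> (Seq ?W (Assign p (Var (p+1)))) s' (1 + ?TW + (1 + B)) ?Q)"
      by (rule reach_Assign, rule two) (use that in \<open>auto simp: floorlog_eq_zero_iff\<close>)
  qed auto
  show ?case unfolding comp.simps
  proof (rule reach_Seq[OF reach_mono[OF Len.IH[OF _ Len.prems(2) B16 Len.prems(4)] le_refl one]])
    show "ok \<O> \<omega> B t env" using Len.prems by simp
    let ?F = "B ^ expo t"
    have "B ^ 2 \<le> ?F" using B16 expo_ge[of t] by (intro power_increasing) auto
    then have F: "B * B \<le> ?F" by (simp add: power2_eq_square)
    have sixteen: "16 * B \<le> B * B" using B16 by simp
    have "1 + ?F + (1 + 2 + (1 + ?TW + (1 + B))) \<le> 16 * ?F"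
    proof -
      have "B * (1 + 2 * B + 6 * B) = B + 8 * (B * B)" by (simp add: algebra_simps)
      then show ?thesis using F sixteen B16 by linarith
    qed
    also have "\<dots> \<le> (B * B) * ?F" using sixteen B16 by (intro mult_right_mono; linarith)
    also have "\<dots> = B ^ expo (Len t)" by (simp add: power_add power2_eq_square)
    finally show "1 + ?F + (1 + 2 + (1 + ?TW + (1 + B))) \<le> B ^ expo (Len t)" .
  qed auto
next
  case (Ask t)
  let ?v = "ev \<omega> t env"
  have v: "vsize ?v \<le> B" using Ask.prems by (intro ok_vsize[of \<O>]) auto
  have B: "16 * B \<le> B ^ expo t" "16 * B ^ expo t \<le> B ^ expo (Ask t)"
    using pow_ge[OF Ask.prems(3) expo_ge] pow_add_ge[OF Ask.prems(3), of "expo t" 0] by auto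
  show ?case unfolding comp.simps
  proof (rule reach_Seq[OF reach_mono[OF Ask.IH[OF _ Ask.prems(2,3,4)] le_refl]])
    show "ok \<O> \<omega> B t env" using Ask.prems by simp
    show "reach \<O> (Query p (Var p)) s' (3 * B)
      (\<lambda>s'. s' p = ev \<omega> (Ask t) env \<and> (\<forall>x<p. s' x = s x))"
      if "s' p = ?v \<and> (\<forall>x<p. s' x = s x)" for s'
      using that v Ask.prems by (auto intro!: reach_Query[where a = "\<omega> ?v"])
    show "1 + B ^ expo t + 3 * B \<le> B ^ expo (Ask t)" using B Ask.prems(3) by linarith
  qed
qed

definition prog :: "ftm \<Rightarrow> com" where
  "prog t = Seq (comp t [0] 1) (Assign 0 (Var 1))"

corollary runs_prog:
  assumes "ok \<O> \<omega> B t [v]" "vsize v \<le> B" "16 \<le> B"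
  shows "\<exists>T \<le> B ^ (expo t + 1). runs \<O> (prog t) v (ev \<omega> t [v]) T"
proof -
  let ?s = "(\<lambda>_. Atom 0)(0 := v)"
  have w: "vsize (ev \<omega> t [v]) \<le> B" using assms by (intro ok_vsize[of \<O>]) auto
  have B: "16 * B \<le> B ^ expo t" "16 * B ^ expo t \<le> B ^ (expo t + 1)"
    using pow_ge[OF assms(3) expo_ge] pow_add_ge[OF assms(3), of "expo t" 0] by auto
  have "reach \<O> (prog t) ?s (B ^ (expo t + 1)) (\<lambda>s'. s' 0 = ev \<omega> t [v])"
    unfolding prog_def
  proof (rule reach_Seq[OF reach_mono[OF comp_correct[OF assms(1) _ assms(3)] le_refl]])
    show "\<forall>v\<in>set [v]. vsize v \<le> B" using assms by simp
    show "env_at [0] 1 [v] ?s" by (simp add: env_at_def)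
    show "reach \<O> (Assign 0 (Var 1)) s' (1 + B) (\<lambda>s'. s' 0 = ev \<omega> t [v])"
      if "s' 1 = ev \<omega> t [v] \<and> (\<forall>x<1. s' x = ?s x)" for s'
      using that w by (auto intro!: reach_Assign)
    show "1 + B ^ expo t + (1 + B) \<le> B ^ (expo t + 1)" using B assms(3) by linarith
  qed
  then show ?thesis unfolding reach_def runs_def by blast
qed

section \<open>Size bounds for terms; lists, matrices and alternating sums\<close>

lemma power_add_less:
  fixes x y :: nat
  assumes "x < 2 ^ a" "y < 2 ^ b"
  shows "x + y < 2 ^ (a + b)"
proof -
  have "(x + 1) * 1 \<le> (x + 1) * (y + 1)" by (intro mult_left_mono) auto
  have "x + y + 1 \<le> (x + 1) * (y + 1)" by (simp add: algebra_simps)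
  also have "\<dots> \<le> 2 ^ a * 2 ^ b" using assms by (intro mult_mono) auto
  finally show ?thesis by (simp add: power_add)
qed

lemma less_pow_floorlog: "x < 2 ^ floorlog 2 (x :: nat)"
  using floorlog_le_iff[of 2 x "floorlog 2 x"] by simp

lemma floorlog_add: "floorlog 2 (x + y) \<le> floorlog 2 x + floorlog 2 (y :: nat)"
  using power_add_less[OF less_pow_floorlog less_pow_floorlog] by (simp add: floorlog_leI)

lemma floorlog_mult: "floorlog 2 (x * y) \<le> floorlog 2 x + floorlog 2 (y :: nat)"
proof (rule floorlog_leI)
  show "x * y < 2 ^ (floorlog 2 x + floorlog 2 y)"
    using less_pow_floorlog[of x] less_pow_floorlog[of y]
    by (metis mult_strict_mono' power_add zero_le)
qed auto

lemma vsize_the_num: "vsize (Atom (the_num v)) \<le> vsize v"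
  by (cases v) (auto simp: floorlog_leI)

lemma vsize_bval: "vsize (bval b v w) \<le> vsize v + vsize w + 2"
proof -
  let ?x = "the_num v" and ?y = "the_num w"
  have v: "1 + floorlog 2 ?x \<le> vsize v" "1 + floorlog 2 ?y \<le> vsize w"
    using vsize_the_num[of v] vsize_the_num[of w] by auto
  show ?thesis
  proof (cases b)
    case BEq
    then show ?thesis using vsize_of_bool[of "v = w"] by simp
  next
    case BLess
    then show ?thesis using vsize_of_bool[of "?x < ?y"] by simp
  next
    case BAdd
    then show ?thesis using v floorlog_add[of ?x ?y] by simp
  next
    case BMul
    then show ?thesis using v floorlog_mult[of ?x ?y] by simp
  next
    case BSub
    then show ?thesis using v floorlog_mono[of "?x - ?y" ?x 2] by simp
  next
    case BDiv
    then show ?thesis using v floorlog_mono[of "?x div ?y" ?x 2] by simp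
  qed simp
qed

text \<open>Terms whose loops only walk along lists or halve numbers: the sizes of their values are
  bounded linearly, with the factor \<open>weight\<close>, in the sizes of the values in the environment.\<close>

primrec simple :: "(val \<Rightarrow> val) \<Rightarrow> nat \<Rightarrow> ftm \<Rightarrow> val list \<Rightarrow> bool" where
  "simple \<omega> N (Lev i) env \<longleftrightarrow> i < length env"
| "simple \<omega> N (Idx i) env \<longleftrightarrow> i < length env"
| "simple \<omega> N (Num n) env \<longleftrightarrow> True"
| "simple \<omega> N (Op1 u t) env \<longleftrightarrow> simple \<omega> N t env"
| "simple \<omega> N (Op2 b t1 t2) env \<longleftrightarrow> simple \<omega> N t1 env \<and> simple \<omega> N t2 env"
| "simple \<omega> N (Bind t1 t2) env \<longleftrightarrow> simple \<omega> N t1 env \<and> simple \<omega> N t2 (ev \<omega> t1 env # env)"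
| "simple \<omega> N (Cond c t1 t2) env \<longleftrightarrow> simple \<omega> N c env \<and>
     (ev \<omega> c env \<noteq> Atom 0 \<longrightarrow> simple \<omega> N t1 env) \<and> (ev \<omega> c env = Atom 0 \<longrightarrow> simple \<omega> N t2 env)"
| "simple \<omega> N (Loop n i t) env \<longleftrightarrow> simple \<omega> N n env \<and> simple \<omega> N i env \<and> the_num (ev \<omega> n env) \<le> N \<and>
     (t = Op1 URight (Idx 1) \<or> t = Op2 BDiv (Idx 1) (Num 2))"
| "simple \<omega> N (Len t) env \<longleftrightarrow> simple \<omega> N t env"
| "simple \<omega> N (Ask t) env \<longleftrightarrow> False"

text \<open>Factors multiply under \<open>Bind\<close> because the body sees an environment whose
  values may be larger by the factor of the bound term.\<close>

primrec weight :: "ftm \<Rightarrow> nat" where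
  "weight (Lev i) = 1"
| "weight (Idx i) = 1"
| "weight (Num n) = n + 1"
| "weight (Op1 u t) = weight t"
| "weight (Op2 b t1 t2) = weight t1 + weight t2 + 1"
| "weight (Bind t1 t2) = weight t1 * weight t2"
| "weight (Cond c t1 t2) = weight c + weight t1 + weight t2"
| "weight (Loop n i t) = weight n + weight i"
| "weight (Len t) = weight t"
| "weight (Ask t) = weight t"

lemma weight_pos: "1 \<le> weight t"
  by (induction t) auto

text \<open>The size bound and \<open>ok\<close> are proved together, since the bound for a bound
  term is what the environment of the body has to satisfy. A loop never enlarges its accumulator, as
  its body only takes a tail or halves a number.\<close>

lemma simple_ok:
  assumes "simple \<omega> N t env" "\<forall>v \<in> set env. vsize v \<le> b" "4 \<le> b"
  shows "vsize (ev \<omega> t env) \<le> weight t * b \<and> (weight t * b \<le> B \<longrightarrow> N \<le> B \<longrightarrow> ok \<O> \<omega> B t env)"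
  using assms
proof (induction t arbitrary: env b)
  case (Lev i)
  then have "rev env ! i \<in> set env" by (metis length_rev nth_mem simple.simps(1) set_rev)
  then show ?case using Lev by simp
next
  case (Num n)
  have "vsize (Atom n) \<le> (n + 1) * b"
    using vsize_Atom_le[of n] Num.prems(3) mult_le_mono[of "n + 1" "n + 1" 1 b] by simp
  then show ?case by simp
next
  case (Op1 u t)
  have "2 \<le> weight t * b" using weight_pos[of t] Op1.prems(3) mult_le_mono[of 1 "weight t" 2 b] by simp
  then show ?case using Op1.IH[OF _ Op1.prems(2,3)] Op1.prems(1) vsize_uval[of "weight t * b"] by simp
next
  case (Op2 bo t1 t2)
  have "vsize (ev \<omega> t1 env) \<le> weight t1 * b" "vsize (ev \<omega> t2 env) \<le> weight t2 * b"
    using Op2.IH(1)[OF _ Op2.prems(2,3)] Op2.IH(2)[OF _ Op2.prems(2,3)] Op2.prems(1) by simp_all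
  then have "vsize (ev \<omega> (Op2 bo t1 t2) env) \<le> weight (Op2 bo t1 t2) * b"
    using vsize_bval[of bo "ev \<omega> t1 env" "ev \<omega> t2 env"] Op2.prems(3) by (simp add: add_mult_distrib)
  then show ?case
    using Op2.IH(1)[OF _ Op2.prems(2,3)] Op2.IH(2)[OF _ Op2.prems(2,3)] Op2.prems(1)
    by (auto simp: add_mult_distrib)
next
  case (Bind t1 t2)
  have 1: "vsize (ev \<omega> t1 env) \<le> weight t1 * b \<and> (weight t1 * b \<le> B \<longrightarrow> N \<le> B \<longrightarrow> ok \<O> \<omega> B t1 env)"
    using Bind.IH(1)[OF _ Bind.prems(2,3)] Bind.prems(1) by simp
  have b: "b \<le> weight t1 * b" using weight_pos[of t1] by simp
  have 2: "vsize (ev \<omega> t2 (ev \<omega> t1 env # env)) \<le> weight t2 * (weight t1 * b) \<and>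
    (weight t2 * (weight t1 * b) \<le> B \<longrightarrow> N \<le> B \<longrightarrow> ok \<O> \<omega> B t2 (ev \<omega> t1 env # env))"
  proof (rule Bind.IH(2))
    show "simple \<omega> N t2 (ev \<omega> t1 env # env)" using Bind.prems by simp
    show "\<forall>v\<in>set (ev \<omega> t1 env # env). vsize v \<le> weight t1 * b"
      using 1 Bind.prems(2) le_trans[OF _ b] by auto
    show "4 \<le> weight t1 * b" using b Bind.prems(3) by linarith
  qed
  have 3: "weight t1 * b \<le> weight t2 * (weight t1 * b)" using weight_pos[of t2] by simp
  show ?case using 1 2 le_trans[OF 3] by (simp add: ac_simps)
next
  case (Cond c t1 t2)
  show ?case
    using Cond.IH(1)[OF _ Cond.prems(2,3)] Cond.IH(2)[OF _ Cond.prems(2,3)]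
      Cond.IH(3)[OF _ Cond.prems(2,3)] Cond.prems(1) by (auto simp: add_mult_distrib)
next
  case (Loop n i t)
  let ?a = "rec_nat (ev \<omega> i env) (\<lambda>c acc. ev \<omega> t (Atom c # acc # ev \<omega> n env # env))"
  have n: "vsize (ev \<omega> n env) \<le> weight n * b \<and> (weight n * b \<le> B \<longrightarrow> N \<le> B \<longrightarrow> ok \<O> \<omega> B n env)"
    using Loop.IH(1)[OF _ Loop.prems(2,3)] Loop.prems(1) by simp
  have i: "vsize (ev \<omega> i env) \<le> weight i * b \<and> (weight i * b \<le> B \<longrightarrow> N \<le> B \<longrightarrow> ok \<O> \<omega> B i env)"
    using Loop.IH(2)[OF _ Loop.prems(2,3)] Loop.prems(1) by simp
  have t: "t = Op1 URight (Idx 1) \<or> t = Op2 BDiv (Idx 1) (Num 2)" using Loop.prems(1) by simp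
  have half: "vsize (Atom (the_num v div 2)) \<le> vsize v" for v
    using vsize_the_num[of v] vsize_Atom_mono[of "the_num v div 2" "the_num v"] by linarith
  have a: "vsize (?a c) \<le> weight i * b" for c
  proof (induction c)
    case (Suc c)
    then show ?case using t vsize_right[of "?a c"] half[of "?a c"] by auto
  qed (use i in simp)
  have "ok \<O> \<omega> B (Loop n i t) env" if B: "weight (Loop n i t) * b \<le> B" "N \<le> B"
  proof -
    have wi: "weight i * b \<le> B" and wn: "weight n * b \<le> B" using B by (simp_all add: add_mult_distrib)
    have "1 * b \<le> weight i * b" using weight_pos[of i] by (intro mult_right_mono) auto
    then have "4 \<le> B" using wi Loop.prems(3) by linarith
    then have "vsize (Atom 2) \<le> B" using vsize_Atom_le[of 2] by linarith
    moreover have "vsize (Atom (the_num (?a c) div 2)) \<le> B" for c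
      using half[of "?a c"] a[of c] wi by linarith
    ultimately show ?thesis using t n i wi wn B Loop.prems(1) by auto
  qed
  then show ?case using a[of "the_num (ev \<omega> n env)"] by (simp add: add_mult_distrib)
next
  case (Len t)
  have "vsize (ev \<omega> t env) \<le> weight t * b \<and> (weight t * b \<le> B \<longrightarrow> N \<le> B \<longrightarrow> ok \<O> \<omega> B t env)"
    using Len.IH[OF _ Len.prems(2,3)] Len.prems(1) by simp
  then show ?case
    using vsize_Atom_le[of "spine (ev \<omega> t env)"] spine_less[of "ev \<omega> t env"] by auto
qed auto

lemma ok_simple:
  assumes "simple \<omega> N t env" "\<forall>v \<in> set env. vsize v \<le> b" "4 \<le> b" "weight t * b \<le> B" "N \<le> B"
  shows "ok \<O> \<omega> B t env"
  using simple_ok[OF assms(1-3)] assms(4,5) by blast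

lemma truth_simps [simp]:
  "Atom (of_bool P) = Atom 0 \<longleftrightarrow> \<not> P"
  "(if P then Atom (of_bool Q) else Atom 0) = Atom (of_bool (P \<and> Q))"
  "(if P then Atom 1 else Atom (of_bool Q)) = Atom (of_bool (P \<or> Q))"
  by auto

abbreviation t_and :: "ftm \<Rightarrow> ftm \<Rightarrow> ftm" where "t_and a b \<equiv> Cond a b (Num 0)"
abbreviation t_or :: "ftm \<Rightarrow> ftm \<Rightarrow> ftm" where "t_or a b \<equiv> Cond a (Num 1) b"
abbreviation t_not :: "ftm \<Rightarrow> ftm" where "t_not a \<equiv> Op2 BEq a (Num 0)"
abbreviation t_mod :: "ftm \<Rightarrow> ftm \<Rightarrow> ftm" where
  "t_mod a b \<equiv> Op2 BSub a (Op2 BMul (Op2 BDiv a b) b)"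

definition t_nth :: "ftm \<Rightarrow> ftm \<Rightarrow> ftm" where
  "t_nth i t = Op1 ULeft (Loop i t (Op1 URight (Idx 1)))"

definition t_bit :: "ftm \<Rightarrow> ftm \<Rightarrow> ftm" where
  "t_bit i t = Bind (Loop i t (Op2 BDiv (Idx 1) (Num 2))) (t_mod (Idx 0) (Num 2))"

lemma encode_list_Nil: "encode_list [] = Atom 0"
  and encode_list_Cons: "encode_list (x # xs) = Node x (encode_list xs)"
  by (simp_all add: encode_list_def)

lemma spine_encode_list [simp]: "spine (encode_list xs) = length xs"
  by (induction xs) (auto simp: encode_list_Nil encode_list_Cons)

lemma rec_right: "i \<le> length xs \<Longrightarrow>
    rec_nat (encode_list xs) (\<lambda>_ acc. right_of acc) i = encode_list (drop i xs)"
proof (induction i)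
  case (Suc i)
  then have "drop i xs = xs ! i # drop (Suc i) xs" by (metis Cons_nth_drop_Suc Suc_le_eq)
  then show ?case using Suc by (simp add: encode_list_Cons)
qed simp

lemma ev_nth:
  "ev \<omega> i env = Atom n \<Longrightarrow> ev \<omega> t env = encode_list xs \<Longrightarrow> n < length xs \<Longrightarrow>
    ev \<omega> (t_nth i t) env = xs ! n"
  by (simp add: t_nth_def rec_right flip: Cons_nth_drop_Suc) (simp add: encode_list_Cons)

lemma simple_nth [simp]:
  "simple \<omega> N (t_nth i t) env \<longleftrightarrow> simple \<omega> N i env \<and> simple \<omega> N t env \<and> the_num (ev \<omega> i env) \<le> N"
  by (auto simp: t_nth_def)

lemma rec_half: "rec_nat (Atom x) (\<lambda>_ acc. Atom (the_num acc div 2)) i = Atom (x div 2 ^ i)"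
  by (induction i) (auto simp: div_mult2_eq[symmetric] mult.commute)

lemma ev_bit [simp]:
  "ev \<omega> i env = Atom n \<Longrightarrow> ev \<omega> t env = Atom x \<Longrightarrow>
    ev \<omega> (t_bit i t) env = Atom (of_bool (n \<in> set_decode x))"
  by (simp add: t_bit_def rec_half set_decode_def minus_div_mult_eq_mod mod_2_eq_odd)

lemma simple_bit [simp]:
  "simple \<omega> N (t_bit i t) env \<longleftrightarrow> simple \<omega> N i env \<and> simple \<omega> N t env \<and> the_num (ev \<omega> i env) \<le> N"
  by (auto simp: t_bit_def)

lemma weight_bit [simp]: "weight (t_bit i t) = (weight i + weight t) * 11"
  by (simp add: t_bit_def)

text \<open>In the body of \<open>t_list\<close> the index of the list is \<open>Idx 0\<close>; the accumulated suffix is kept in \<open>Idx 2\<close>.\<close>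

definition t_list :: "ftm \<Rightarrow> ftm \<Rightarrow> ftm" where
  "t_list n t = Loop n (Num 0) (Bind (Op2 BSub (Op2 BSub (Idx 2) (Num 1)) (Idx 0)) (Op2 BNode t (Idx 2)))"

text \<open>Lists grow at the front, so round \<open>c\<close> of the loop has to supply the entry
  with index \<open>n - 1 - c\<close>.\<close>

lemma rec_list:
  assumes "\<And>i c acc. i < n \<Longrightarrow> g (Atom i) (Atom c) acc = f i"
  shows "c \<le> n \<Longrightarrow> rec_nat (Atom 0) (\<lambda>c acc. Node (g (Atom (n - 1 - c)) (Atom c) acc) acc) c =
    encode_list (map f [n - c..<n])"
proof (induction c)
  case (Suc c)
  then have "[n - Suc c..<n] = (n - Suc c) # [n - c..<n]"
    by (metis Suc_diff_Suc Suc_le_eq diff_less upt_conv_Cons zero_less_Suc less_le_trans)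
  then show ?case using Suc assms by (simp add: encode_list_Cons)
qed (simp add: encode_list_Nil)

lemma ev_list:
  assumes n: "ev \<omega> n env = Atom N"
    and t: "\<And>i c acc. i < N \<Longrightarrow> ev \<omega> t (Atom i # Atom c # acc # Atom N # env) = f i"
  shows "ev \<omega> (t_list n t) env = encode_list (map f [0..<N])"
  using rec_list[of N "\<lambda>i c acc. ev \<omega> t (i # c # acc # Atom N # env)" f N] t
  by (simp add: t_list_def n)

lemma vsize_encode_list: "\<forall>x \<in> set xs. vsize x \<le> b \<Longrightarrow> vsize (encode_list xs) \<le> length xs * (b + 1) + 1"
  by (induction xs) (auto simp: encode_list_Nil encode_list_Cons floorlog_eq_zero_iff)

lemma ok_list:
  assumes n: "ev \<omega> n env = Atom N" "ok \<O> \<omega> B n env"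
    and t: "\<And>i c acc. i < N \<Longrightarrow> ev \<omega> t (Atom i # Atom c # acc # Atom N # env) = f i"
    and ok: "\<And>i c acc. i < N \<Longrightarrow> c < N \<Longrightarrow> vsize acc \<le> N * (b + 1) + 1 \<Longrightarrow>
      ok \<O> \<omega> B t (Atom i # Atom c # acc # Atom N # env)"
    and b: "\<And>i. i < N \<Longrightarrow> vsize (f i) \<le> b" and B: "N * (b + 1) + 1 \<le> B" "3 \<le> B" "Suc N \<le> B"
  shows "ok \<O> \<omega> B (t_list n t) env"
proof -
  let ?a = "rec_nat (Atom 0) (\<lambda>c acc. Node (ev \<omega> t (Atom (N - 1 - c) # Atom c # acc # Atom N # env)) acc)"
  have a: "?a c = encode_list (map f [N - c..<N])" if "c \<le> N" for c
    using rec_list[of N "\<lambda>i c acc. ev \<omega> t (i # c # acc # Atom N # env)" f c] t that by simp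
  have va: "vsize (?a c) \<le> N * (b + 1) + 1" if "c \<le> N" for c
  proof -
    have "vsize (?a c) \<le> length (map f [N - c..<N]) * (b + 1) + 1"
      unfolding a[OF that] using b by (intro vsize_encode_list) auto
    also have "\<dots> \<le> N * (b + 1) + 1" using that by (intro add_mono mult_right_mono) auto
    finally show ?thesis .
  qed
  have "ok \<O> \<omega> B t (Atom (N - 1 - c) # Atom c # ?a c # Atom N # env)" if "c < N" for c
    using that va[of c] by (intro ok) auto
  moreover have "vsize (Node (ev \<omega> t (Atom (N - 1 - c) # Atom c # ?a c # Atom N # env)) (?a c)) \<le> B"
    if "c < N" for c
    using va[of "Suc c"] that B by simp
  moreover have "vsize (Atom x) \<le> B" if "x \<le> N" for x
    using vsize_Atom_le[of x] that B by linarith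
  moreover have "vsize (Atom 0) \<le> B" "vsize (Atom (Suc 0)) \<le> B"
    using vsize_Atom_le[of 0] vsize_Atom_le[of "Suc 0"] B by linarith+
  ultimately show ?thesis
    using n B by (simp add: t_list_def)
qed


definition mat :: "nat \<Rightarrow> (nat \<Rightarrow> nat \<Rightarrow> bool) \<Rightarrow> val" where
  "mat n f = encode_list (map (\<lambda>i. encode_list (map (\<lambda>j. Atom (of_bool (f i j))) [0..<n])) [0..<n])"

lemma vsize_row: "vsize (encode_list (map (\<lambda>j. Atom (of_bool (f j))) [0..<n])) \<le> 3 * n + 1"
proof -
  have "vsize (encode_list (map (\<lambda>j. Atom (of_bool (f j))) [0..<n])) \<le>
      length (map (\<lambda>j. Atom (of_bool (f j))) [0..<n]) * (2 + 1) + 1"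
    by (rule vsize_encode_list) (use vsize_of_bool in auto)
  then show ?thesis by simp
qed

lemma vsize_mat: "vsize (mat n f) \<le> n * (3 * n + 2) + 1"
proof -
  have "vsize (mat n f) \<le>
      length (map (\<lambda>i. encode_list (map (\<lambda>j. Atom (of_bool (f i j))) [0..<n])) [0..<n]) * (3 * n + 1 + 1) + 1"
    unfolding mat_def by (rule vsize_encode_list) (use vsize_row in auto)
  then show ?thesis by simp
qed

lemma le_vsize_encode_list: "length xs \<le> vsize (encode_list xs)"
  by (induction xs) (auto simp: encode_list_Nil encode_list_Cons)

lemma le_vsize_mat: "n \<le> vsize (mat n f)"
  using le_vsize_encode_list[of "map (\<lambda>i. encode_list (map (\<lambda>j. Atom (of_bool (f i j))) [0..<n])) [0..<n]"]
  by (simp add: mat_def)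

lemma ev_mat:
  assumes "ev \<omega> A env = mat n f" "ev \<omega> ti env = Atom i" "ev \<omega> tj env = Atom j" "i < n" "j < n"
  shows "ev \<omega> (t_nth tj (t_nth ti A)) env = Atom (of_bool (f i j))"
  using assms by (auto simp: mat_def ev_nth[of \<omega> tj env j _ "map (\<lambda>j. Atom (of_bool (f i j))) [0..<n]"]
      ev_nth[of \<omega> ti env i A "map (\<lambda>i. encode_list (map (\<lambda>j. Atom (of_bool (f i j))) [0..<n])) [0..<n]"])

text \<open>Each of the two nested \<open>t_list\<close> pushes bound, accumulator, counter and
  index. Above an environment of length \<open>e\<close>, the row index is therefore at level
  \<open>e + 3\<close> and the column index at level \<open>e + 7\<close>.\<close>

definition t_graph :: "nat \<Rightarrow> ftm \<Rightarrow> ftm" where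
  "t_graph l t = t_list (Lev l) (t_list (Lev l) t)"

lemma rev_Cons_nth [simp]: "l < length env \<Longrightarrow> rev (x # env) ! l = rev env ! l"
  by (simp add: nth_append)

lemma ev_graph:
  assumes l: "l < length env" "rev env ! l = Atom n"
    and t: "\<And>i j c d a b. i < n \<Longrightarrow> j < n \<Longrightarrow>
      ev \<omega> t ([Atom j, Atom c, a, Atom n, Atom i, Atom d, b, Atom n] @ env) = Atom (of_bool (f i j))"
  shows "ev \<omega> (t_graph l t) env = mat n f"
  unfolding t_graph_def mat_def
proof (rule ev_list)
  fix i d b assume "i < n"
  then show "ev \<omega> (t_list (Lev l) t) (Atom i # Atom d # b # Atom n # env) =
    encode_list (map (\<lambda>j. Atom (of_bool (f i j))) [0..<n])"
    using l t by (intro ev_list) (auto simp del: rev.simps)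
qed (use l in auto)

lemma ok_graph:
  assumes l: "l < length env" "rev env ! l = Atom n"
    and t: "\<And>i j c d a b. i < n \<Longrightarrow> j < n \<Longrightarrow>
      ev \<omega> t ([Atom j, Atom c, a, Atom n, Atom i, Atom d, b, Atom n] @ env) = Atom (of_bool (f i j))"
    and s: "\<And>i j c d a b. i < n \<Longrightarrow> j < n \<Longrightarrow> c < n \<Longrightarrow> d < n \<Longrightarrow>
      simple \<omega> B t ([Atom j, Atom c, a, Atom n, Atom i, Atom d, b, Atom n] @ env)"
    and b: "\<forall>v\<in>set env. vsize v \<le> b" "n * (3 * n + 2) + 4 \<le> b" and B: "weight t * b \<le> B"
  shows "ok \<O> \<omega> B (t_graph l t) env"
  unfolding t_graph_def
proof (rule ok_list)
  have "b \<le> B" using B weight_pos[of t] mult_le_mono1[of 1 "weight t" b] by linarith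
  then have bB: "n * (3 * n + 2) + 4 \<le> B" using b by linarith
  have n: "vsize (Atom x) \<le> b" if "x \<le> n" for x
    using vsize_Atom_le[of x] that b(2) by (cases n) auto
  have ev1: "ev \<omega> (t_list (Lev l) t) (Atom i # Atom d # b # Atom n # env) =
    encode_list (map (\<lambda>j. Atom (of_bool (f i j))) [0..<n])" if "i < n" for i d b
    using that l t by (intro ev_list) (auto simp del: rev.simps)
  show "ev \<omega> (t_list (Lev l) t) (Atom i # Atom d # b # Atom n # env) =
    encode_list (map (\<lambda>j. Atom (of_bool (f i j))) [0..<n])" if "i < n" for i d b
    using ev1[OF that] .
  show "vsize (encode_list (map (\<lambda>j. Atom (of_bool (f i j))) [0..<n])) \<le> 3 * n + 1" for i
    by (rule vsize_row)
  have nB: "3 \<le> B" "Suc n \<le> B" using bB by (simp, cases n, auto)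
  show "n * (3 * n + 1 + 1) + 1 \<le> B" using bB by simp
  show "3 \<le> B" "Suc n \<le> B" using nB .
  fix i d acc assume i: "i < n" "d < n" and acc: "vsize acc \<le> n * (3 * n + 1 + 1) + 1"
  show "ok \<O> \<omega> B (t_list (Lev l) t) (Atom i # Atom d # acc # Atom n # env)"
  proof (rule ok_list)
    show "ev \<omega> t (Atom j # Atom c # a # Atom n # Atom i # Atom d # acc # Atom n # env) =
      Atom (of_bool (f i j))" if "j < n" for j c a
      using t[OF i(1) that] by simp
    show "vsize (Atom (of_bool (f i j))) \<le> 2" for j by (rule vsize_of_bool)
    show "3 \<le> B" "Suc n \<le> B" using nB .
    show "n * (2 + 1) + 1 \<le> B" using bB by (cases n) auto
    fix j c a assume j: "j < n" "c < n" and a: "vsize a \<le> n * (2 + 1) + 1"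
    have "\<forall>v\<in>set ([Atom j, Atom c, a, Atom n, Atom i, Atom d, acc, Atom n] @ env). vsize v \<le> b"
    proof -
      have "vsize a \<le> b" using a b(2) by (cases n) auto
      moreover have "vsize acc \<le> b" using acc b(2) by simp
      ultimately show ?thesis using n[of n] n[of i] n[of j] n[of c] n[of d] i j b(1) by auto
    qed
    moreover have "4 \<le> b" using b(2) by linarith
    ultimately have "ok \<O> \<omega> B t ([Atom j, Atom c, a, Atom n, Atom i, Atom d, acc, Atom n] @ env)"
      using s[OF i(1) j(1) j(2) i(2)] B by (intro ok_simple[where N = B and b = b]) auto
    then show "ok \<O> \<omega> B t (Atom j # Atom c # a # Atom n # Atom i # Atom d # acc # Atom n # env)" by simp
  qed (use l in \<open>auto simp del: rev.simps\<close>)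
qed (use l in auto)

text \<open>In the bodies of \<open>t_alt\<close> the summation index is the counter of the loop; the summand has been
  pushed when the sign is computed.\<close>

definition t_alt :: "ftm \<Rightarrow> ftm \<Rightarrow> ftm \<Rightarrow> ftm" where
  "t_alt n s x = Bind (Loop n (Op2 BNode (Num 0) (Num 0)) (Bind x (Cond s
      (Op2 BNode (Op2 BAdd (Op1 ULeft (Idx 2)) (Idx 0)) (Op1 URight (Idx 2)))
      (Op2 BNode (Op1 ULeft (Idx 2)) (Op2 BAdd (Op1 URight (Idx 2)) (Idx 0))))))
    (Op2 BAdd (Op2 BSub (Op1 ULeft (Idx 0)) (Op1 URight (Idx 0)))
      (Op2 BSub (Op1 URight (Idx 0)) (Op1 ULeft (Idx 0))))"

text \<open>Subtraction is truncated, so positive and negative terms are collected separately in the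
  two components of a pair.\<close>

lemma rec_alt:
  assumes "\<And>c acc. c < n \<Longrightarrow> x (Atom c) acc = Atom (f c)"
    "\<And>c acc v. c < n \<Longrightarrow> s v (Atom c) acc = Atom (of_bool (\<sigma> c))"
  shows "c \<le> n \<Longrightarrow> rec_nat (Node (Atom 0) (Atom 0)) (\<lambda>c acc.
      if s (x (Atom c) acc) (Atom c) acc \<noteq> Atom 0
      then Node (Atom (the_num (left_of acc) + the_num (x (Atom c) acc))) (right_of acc)
      else Node (left_of acc) (Atom (the_num (right_of acc) + the_num (x (Atom c) acc)))) c =
    Node (Atom (\<Sum>i<c. if \<sigma> i then f i else 0)) (Atom (\<Sum>i<c. if \<sigma> i then 0 else f i))"
  by (induction c) (use assms in auto)

text \<open>With truncated subtraction, the sum of both differences of \<open>?P\<close> and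
  \<open>?M\<close> is the absolute value of the integer difference. The lost sign is harmless, as
  only quotients of two such values with a common factor are used.\<close>

lemma ev_alt:
  assumes n: "ev \<omega> n env = Atom N"
    and x: "\<And>c acc. c < N \<Longrightarrow> ev \<omega> x (Atom c # acc # Atom N # env) = Atom (f c)"
    and s: "\<And>c acc v. c < N \<Longrightarrow> ev \<omega> s (v # Atom c # acc # Atom N # env) = Atom (of_bool (\<sigma> c))"
  shows "ev \<omega> (t_alt n s x) env = Atom (nat \<bar>\<Sum>c<N. (if \<sigma> c then int (f c) else - int (f c))\<bar>)"
proof -
  let ?P = "\<Sum>i<N. if \<sigma> i then f i else 0" and ?M = "\<Sum>i<N. if \<sigma> i then 0 else f i"
  have "(\<Sum>c<N. (if \<sigma> c then int (f c) else - int (f c))) = int ?P - int ?M"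
    by (simp add: of_nat_sum flip: sum_subtractf) (rule sum.cong, auto)
  then have "nat \<bar>\<Sum>c<N. (if \<sigma> c then int (f c) else - int (f c))\<bar> = (?P - ?M) + (?M - ?P)"
    by linarith
  then show ?thesis
    using rec_alt[of N "\<lambda>c acc. ev \<omega> x (c # acc # Atom N # env)" f
        "\<lambda>v c acc. ev \<omega> s (v # c # acc # Atom N # env)" \<sigma> N] x s
    by (simp add: t_alt_def n cong: if_cong)
qed

lemma ok_alt:
  assumes n: "ev \<omega> n env = Atom N" "ok \<O> \<omega> B n env"
    and x: "\<And>c acc. c < N \<Longrightarrow> ev \<omega> x (Atom c # acc # Atom N # env) = Atom (f c)"
    and s: "\<And>c acc v. c < N \<Longrightarrow> ev \<omega> s (v # Atom c # acc # Atom N # env) = Atom (of_bool (\<sigma> c))"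
    and f: "\<And>c. c < N \<Longrightarrow> f c < 2 ^ e"
    and okx: "\<And>c acc. c < N \<Longrightarrow> vsize acc \<le> 2 * (N + e) + 3 \<Longrightarrow> ok \<O> \<omega> B x (Atom c # acc # Atom N # env)"
    and oks: "\<And>c acc v. c < N \<Longrightarrow> vsize acc \<le> 2 * (N + e) + 3 \<Longrightarrow> vsize v \<le> Suc e \<Longrightarrow>
      ok \<O> \<omega> B s (v # Atom c # acc # Atom N # env)"
    and B: "4 * (N + e) + 6 \<le> B"
  shows "ok \<O> \<omega> B (t_alt n s x) env"
proof -
  let ?P = "\<lambda>c. \<Sum>i<c. if \<sigma> i then f i else 0" and ?M = "\<lambda>c. \<Sum>i<c. if \<sigma> i then 0 else f i"
  note r = rec_alt[of N "\<lambda>c acc. ev \<omega> x (c # acc # Atom N # env)" f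
        "\<lambda>v c acc. ev \<omega> s (v # c # acc # Atom N # env)" \<sigma>, OF x s]
  \<comment> \<open>At most \<open>N\<close> summands, each below \<open>2 ^ e\<close>, and
    \<open>N < 2 ^ N\<close>.\<close>
  have lt: "(\<Sum>i<c. g i) < 2 ^ (N + e)" if "c \<le> N" "\<And>i. g i \<le> f i" for c g
  proof -
    have "(\<Sum>i<c. g i) \<le> (\<Sum>i<c. 2 ^ e)"
      using that f by (intro sum_mono) (metis lessThan_iff less_imp_le less_le_trans le_trans)
    also have "\<dots> \<le> N * 2 ^ e" using that by simp
    also have "\<dots> < 2 ^ N * 2 ^ e" by simp
    finally show ?thesis by (simp add: power_add)
  qed
  have P: "vsize (Atom (?P c)) \<le> Suc (N + e)" and M: "vsize (Atom (?M c)) \<le> Suc (N + e)" if "c \<le> N" for c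
    using that by (intro vsize_Atom_pow lt; simp)+
  have D: "vsize (Atom (?P N - ?M N)) \<le> Suc (N + e)" "vsize (Atom (?M N - ?P N)) \<le> Suc (N + e)"
    using P[of N] M[of N] vsize_Atom_mono[of "?P N - ?M N" "?P N"] vsize_Atom_mono[of "?M N - ?P N" "?M N"]
    by linarith+
  have D': "vsize (Atom (?P N - ?M N + (?M N - ?P N))) \<le> 2 * Suc (N + e)"
    using D vsize_bval[of BAdd "Atom (?P N - ?M N)" "Atom (?M N - ?P N)"]
      floorlog_add[of "?P N - ?M N" "?M N - ?P N"] by simp
  have zero: "vsize (Atom 0) = 1" by (simp add: floorlog_eq_zero_iff)
  have fc: "vsize (Atom (f c)) \<le> Suc e" if "c < N" for c using f[OF that] by (rule vsize_Atom_pow)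
  have 1: "vsize (Node (Atom (?P c)) (Atom (?M c))) \<le> 2 * (N + e) + 3" if "c \<le> N" for c
    using P[OF that] M[OF that] by simp
  have N: "N \<le> B" using B by simp
  have 2: "vsize (Atom (?P c + f c)) \<le> Suc (N + e)" if "c < N" "\<sigma> c" for c
    using P[of "Suc c"] that by simp
  have 3: "vsize (Atom (?M c + f c)) \<le> Suc (N + e)" if "c < N" "\<not> \<sigma> c" for c
    using M[of "Suc c"] that by simp
  let ?b = "Bind x (Cond s
      (Op2 BNode (Op2 BAdd (Op1 ULeft (Idx 2)) (Idx 0)) (Op1 URight (Idx 2)))
      (Op2 BNode (Op1 ULeft (Idx 2)) (Op2 BAdd (Op1 URight (Idx 2)) (Idx 0))))"
  have acc: "rec_nat (ev \<omega> (Op2 BNode (Num 0) (Num 0)) env)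
      (\<lambda>c acc. ev \<omega> ?b (Atom c # acc # ev \<omega> n env # env)) c = Node (Atom (?P c)) (Atom (?M c))"
    if "c \<le> N" for c
    using r[OF _ _ that] n by (simp cong: if_cong)
  have okb: "ok \<O> \<omega> B ?b (Atom c # Node (Atom (?P c)) (Atom (?M c)) # Atom N # env)" if c: "c < N" for c
  proof -
    have A: "vsize (Node (Atom (?P c)) (Atom (?M c))) \<le> 2 * (N + e) + 3" using 1[of c] c by simp
    have "vsize (Atom (?P c + f c)) \<le> B" if "\<sigma> c" using 2[OF c that] B by (simp del: vsize.simps)
    moreover have "vsize (Atom (?M c + f c)) \<le> B" if "\<not> \<sigma> c" using 3[OF c that] B by (simp del: vsize.simps)
    moreover have "vsize (Node (Atom (?P c + f c)) (Atom (?M c))) \<le> B" if "\<sigma> c"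
      using 2[OF c that] M[of c] c B by (simp del: vsize.simps(1))
    moreover have "vsize (Node (Atom (?P c)) (Atom (?M c + f c))) \<le> B" if "\<not> \<sigma> c"
      using 3[OF c that] P[of c] c B by (simp del: vsize.simps(1))
    ultimately show ?thesis
      using okx[OF c A] oks[OF c A fc[OF c]] x[OF c] s[OF c] by (simp del: vsize.simps)
  qed
  have evl: "ev \<omega> (Loop n (Op2 BNode (Num 0) (Num 0)) ?b) env = Node (Atom (?P N)) (Atom (?M N))"
    using acc[of N] n by (simp only: ev.simps(8) val.case the_num.simps le_refl)
  have okl: "ok \<O> \<omega> B (Loop n (Op2 BNode (Num 0) (Num 0)) ?b) env"
  proof (unfold ok.simps(8), intro conjI allI impI)
    fix c assume "c < the_num (ev \<omega> n env)"
    then have c: "c < N" using n by simp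
    show "ok \<O> \<omega> B ?b (Atom c # rec_nat (ev \<omega> (Op2 BNode (Num 0) (Num 0)) env)
      (\<lambda>c acc. ev \<omega> ?b (Atom c # acc # ev \<omega> n env # env)) c # ev \<omega> n env # env)"
      unfolding n(1) acc[OF less_imp_le[OF c], unfolded n(1)] by (rule okb[OF c])
  qed (use n N zero B in auto)
  show ?thesis
    unfolding t_alt_def ok.simps(6) evl using okl D D' B
    by (simp only: ok.simps ev.simps) (auto simp del: vsize.simps)
qed

section \<open>Computability without time bounds\<close>

primrec scoped :: "nat \<Rightarrow> ftm \<Rightarrow> bool" where
  "scoped d (Lev i) \<longleftrightarrow> i < d"
| "scoped d (Idx i) \<longleftrightarrow> i < d"
| "scoped d (Num n) \<longleftrightarrow> True"
| "scoped d (Op1 u t) \<longleftrightarrow> scoped d t"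
| "scoped d (Op2 b t1 t2) \<longleftrightarrow> scoped d t1 \<and> scoped d t2"
| "scoped d (Bind t1 t2) \<longleftrightarrow> scoped d t1 \<and> scoped (Suc d) t2"
| "scoped d (Cond c t1 t2) \<longleftrightarrow> scoped d c \<and> scoped d t1 \<and> scoped d t2"
| "scoped d (Loop n i t) \<longleftrightarrow> scoped d n \<and> scoped d i \<and> scoped (d + 3) t"
| "scoped d (Len t) \<longleftrightarrow> scoped d t"
| "scoped d (Ask t) \<longleftrightarrow> False"

text \<open>The bound may depend on the environment, so it can be assembled from the values that
  actually occur; for a loop, the bounds of all its rounds are added up.\<close>

lemma scoped_ok: "scoped (length env) t \<Longrightarrow> \<exists>B0. \<forall>B\<ge>B0. ok \<O> \<omega> B t env"
proof (induction t arbitrary: env)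
  case (Op1 u t)
  then show ?case by simp
next
  case (Op2 b t1 t2)
  then obtain B1 B2 where "\<forall>B\<ge>B1. ok \<O> \<omega> B t1 env" "\<forall>B\<ge>B2. ok \<O> \<omega> B t2 env"
    by (metis scoped.simps(5))
  then show ?case
    by (intro exI[of _ "B1 + B2 + vsize (bval b (ev \<omega> t1 env) (ev \<omega> t2 env))"]) auto
next
  case (Bind t1 t2)
  then obtain B1 where B1: "\<forall>B\<ge>B1. ok \<O> \<omega> B t1 env" by (metis scoped.simps(6))
  have "scoped (length (ev \<omega> t1 env # env)) t2" using Bind.prems by simp
  then obtain B2 where "\<forall>B\<ge>B2. ok \<O> \<omega> B t2 (ev \<omega> t1 env # env)" using Bind.IH(2) by blast
  then show ?case using B1 by (intro exI[of _ "B1 + B2"]) auto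
next
  case (Cond c t1 t2)
  then obtain B0 B1 B2 where "\<forall>B\<ge>B0. ok \<O> \<omega> B c env" "\<forall>B\<ge>B1. ok \<O> \<omega> B t1 env" "\<forall>B\<ge>B2. ok \<O> \<omega> B t2 env"
    by (metis scoped.simps(7))
  then show ?case by (intro exI[of _ "B0 + B1 + B2"]) auto
next
  case (Loop n i t)
  let ?n = "ev \<omega> n env"
  let ?env = "\<lambda>c. Atom c # rec_nat (ev \<omega> i env) (\<lambda>c acc. ev \<omega> t (Atom c # acc # ?n # env)) c # ?n # env"
  obtain B1 B2 where B12: "\<forall>B\<ge>B1. ok \<O> \<omega> B n env" "\<forall>B\<ge>B2. ok \<O> \<omega> B i env"
    using Loop by (metis scoped.simps(8))
  have "\<exists>B0. \<forall>B\<ge>B0. ok \<O> \<omega> B t (?env c)" for c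
    using Loop.prems by (intro Loop.IH(3)) (simp add: eval_nat_numeral)
  then obtain F where F: "\<And>c B. B \<ge> F c \<Longrightarrow> ok \<O> \<omega> B t (?env c)" by metis
  have "F c \<le> (\<Sum>c<the_num ?n. F c)" if "c < the_num ?n" for c
    using that by (intro member_le_sum) auto
  then have "ok \<O> \<omega> B t (?env c)" if "c < the_num ?n" "(\<Sum>c<the_num ?n. F c) \<le> B" for c B
    using that F le_trans by blast
  then show ?case
    using B12 by (intro exI[of _ "B1 + B2 + the_num ?n + (\<Sum>c<the_num ?n. F c)"]) auto
next
  case (Num n)
  then show ?case by (intro exI[of _ "vsize (Atom n)"]) auto
qed auto

text \<open>\<open>computable\<close> asks for a halting run on each input only, so a size bound
  depending on \<open>n\<close> is good enough.\<close>

lemma computable_term: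
  assumes "scoped 1 t" "\<And>n. ev (\<lambda>_. Atom 0) t [Atom n] = Atom (f n)"
  shows "computable f"
  unfolding computable_def
proof (intro exI allI)
  fix n
  obtain B0 where B0: "\<forall>B\<ge>B0. ok no_oracle (\<lambda>_. Atom 0) B t [Atom n]"
    using scoped_ok[of "[Atom n]" t no_oracle "\<lambda>_. Atom 0"] assms(1) by auto
  let ?B = "B0 + vsize (Atom n) + 16"
  have "\<exists>T\<le>?B ^ (expo t + 1). runs no_oracle (prog t) (Atom n) (ev (\<lambda>_. Atom 0) t [Atom n]) T"
    using B0 by (intro runs_prog) auto
  then show "runs no_oracle (prog t) (Atom n) (Atom (f n)) (SOME T. runs no_oracle (prog t) (Atom n) (Atom (f n)) T)"
    using assms(2) by (metis someI_ex)
qed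

section \<open>Powers, factorials and binomial coefficients as terms\<close>

definition t_pow :: "ftm \<Rightarrow> ftm \<Rightarrow> ftm" where
  "t_pow x e = Loop e (Num 1) (Op2 BMul (Idx 1) x)"

lemma rec_pow: "rec_nat (Atom 1) (\<lambda>_ acc. Atom (the_num acc * x)) c = Atom (x ^ c)"
  by (induction c) auto

lemma ev_pow:
  assumes "ev \<omega> e env = Atom n" "\<And>c acc. ev \<omega> x (c # acc # Atom n # env) = Atom a"
  shows "ev \<omega> (t_pow x e) env = Atom (a ^ n)"
  using rec_pow[of a n] by (simp add: t_pow_def assms)

lemma power_le_two_power:
  fixes a :: nat
  assumes "a \<le> 2 ^ f"
  shows "a ^ n \<le> 2 ^ (f * n)"
  using power_mono[OF assms, of n] by (simp add: power_mult)

lemma ok_pow: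
  assumes e: "ev \<omega> e env = Atom n" "ok \<O> \<omega> B e env"
    and x: "\<And>c acc. ev \<omega> x (c # acc # Atom n # env) = Atom a"
      "\<And>c acc. ok \<O> \<omega> B x (c # acc # Atom n # env)"
    and B: "a \<le> 2 ^ f" "(f + 1) * n + 4 \<le> B"
  shows "ok \<O> \<omega> B (t_pow x e) env"
proof -
  have "vsize (Atom (a ^ c)) \<le> B" if "c \<le> n" for c
  proof -
    have "a ^ c < 2 ^ Suc (f * n)"
      using power_le_two_power[OF B(1), of c] power_increasing[of "f * c" "Suc (f * n)" "2 :: nat"] that
        power_strict_increasing[of "f * c" "Suc (f * n)" "2 :: nat"]
      by (meson le_imp_less_Suc le_less_trans mult_le_mono2 one_less_numeral_iff semiring_norm(76))
    then have "vsize (Atom (a ^ c)) \<le> Suc (Suc (f * n))" by (rule vsize_Atom_pow)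
    then show ?thesis using B(2) by simp
  qed
  from this[of "Suc _"] show ?thesis
    using e x B rec_pow[of a] vsize_Atom_le[of 1] by (simp add: t_pow_def Suc_le_eq mult.commute)
qed

definition t_fact :: "ftm \<Rightarrow> ftm" where
  "t_fact n = Loop n (Num 1) (Op2 BMul (Idx 1) (Op2 BAdd (Idx 0) (Num 1)))"

lemma rec_fact: "rec_nat (Atom 1) (\<lambda>c acc. Atom (the_num acc * (c + 1))) c = Atom (fact c)"
  by (induction c) (auto simp: algebra_simps)

lemma ev_fact: "ev \<omega> n env = Atom N \<Longrightarrow> ev \<omega> (t_fact n) env = Atom (fact N)"
  using rec_fact[of N] by (simp add: t_fact_def)

lemma fact_le_two_power: "fact n \<le> (2 :: nat) ^ (n * n)"
proof -
  have "fact n \<le> n ^ n" using fact_le_power[of n, where 'a = nat] by simp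
  also have "\<dots> \<le> (2 ^ n) ^ n" by (intro power_mono) auto
  finally show ?thesis by (simp add: power_mult)
qed

lemma ok_fact:
  assumes n: "ev \<omega> n env = Atom N" "ok \<O> \<omega> B n env" and B: "N * N + N + 4 \<le> B"
  shows "ok \<O> \<omega> B (t_fact n) env"
proof -
  have 1: "vsize (Atom (fact c)) \<le> B" if "c \<le> N" for c
  proof -
    have "fact c \<le> (fact N :: nat)" using that by (rule fact_mono)
    also have "\<dots> < 2 ^ Suc (N * N)"
      using fact_le_two_power[of N] by (rule le_less_trans) simp
    finally have "vsize (Atom (fact c)) \<le> Suc (Suc (N * N))" by (rule vsize_Atom_pow)
    then show ?thesis using B by simp
  qed
  have 2: "vsize (Atom (Suc c)) \<le> B" if "c < N" for c
    using vsize_Atom_le[of "Suc c"] that B by linarith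
  have 3: "fact c * Suc c = fact (Suc c)" for c by (simp add: algebra_simps)
  show ?thesis
    using n 1 2 B rec_fact vsize_Atom_le[of 1]
    by (simp add: t_fact_def Suc_le_eq 3 del: mult_Suc_right fact_Suc vsize.simps)
qed

definition t_choose :: "ftm \<Rightarrow> ftm \<Rightarrow> ftm" where
  "t_choose n k = Loop k (Num 1)
     (Op2 BDiv (Op2 BMul (Idx 1) (Op2 BSub n (Idx 0))) (Op2 BAdd (Idx 0) (Num 1)))"

text \<open>Makes every division in the loop of \<open>t_choose\<close> exact.\<close>

lemma choose_step: "(n choose c) * (n - c) = (n choose Suc c) * Suc c"
  using binomial_absorption[of c n] binomial_absorb_comp[of n c]
  by (simp add: mult.commute)

lemma rec_choose: "rec_nat (Atom 1) (\<lambda>c acc. Atom (the_num acc * (n - c) div (c + 1))) c = Atom (n choose c)"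
proof (induction c)
  case (Suc c)
  then show ?case using choose_step[of n c] by (simp del: mult_Suc_right)
qed simp

lemma ev_choose:
  assumes "ev \<omega> k env = Atom q" "\<And>c acc. ev \<omega> n (c # acc # Atom q # env) = Atom N"
  shows "ev \<omega> (t_choose n k) env = Atom (N choose q)"
  using rec_choose[of N q] by (simp add: t_choose_def assms)

lemma binomial_le_two_power: "n choose k \<le> 2 ^ n"
  using binomial_le_pow2 by blast

lemma ok_choose:
  assumes "ev \<omega> k env = Atom q" "ok \<O> \<omega> B k env"
    and x: "\<And>c acc. ev \<omega> n (c # acc # Atom q # env) = Atom N"
      "\<And>c acc. ok \<O> \<omega> B n (c # acc # Atom q # env)"
    and B: "2 * N + q + 6 \<le> B"
  shows "ok \<O> \<omega> B (t_choose n k) env"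
proof -
  have lt: "N choose c < 2 ^ Suc N" for c using binomial_le_two_power[of N c] by (rule le_less_trans) simp
  have 1: "vsize (Atom (N choose c)) \<le> B" for c
    using vsize_Atom_pow[OF lt[of c]] B by linarith
  have 2: "vsize (Atom (Suc c)) \<le> B" if "c < q" for c
    using vsize_Atom_le[of "Suc c"] that B by linarith
  have 3: "vsize (Atom (N - c)) \<le> B" for c
    using vsize_Atom_le[of "N - c"] B by linarith
  have 4: "vsize (Atom ((N choose c) * (N - c))) \<le> B" for c
  proof -
    have "N - c \<le> N" by simp
    also have "N < 2 ^ N" by simp
    finally have "(N choose c) * (N - c) < 2 ^ Suc N * 2 ^ N"
      using lt[of c] by (intro mult_strict_mono') auto
    then have "(N choose c) * (N - c) < 2 ^ (Suc N + N)" by (simp only: power_add)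
    then have "vsize (Atom ((N choose c) * (N - c))) \<le> Suc (Suc N + N)" by (rule vsize_Atom_pow)
    then show ?thesis using B by linarith
  qed
  have 5: "(N choose c) * (N - c) div Suc c = N choose Suc c" for c
    using choose_step[of N c] by (simp del: mult_Suc_right)
  show ?thesis
    using assms 1 2 3 4 rec_choose[of N] vsize_Atom_le[of 1]
    by (simp add: t_choose_def 5 del: vsize.simps)
qed

section \<open>Membership\<close>

definition adj_graph :: "nat \<Rightarrow> (nat \<Rightarrow> nat \<Rightarrow> bool) \<Rightarrow> nat graph" where
  "adj_graph n f = \<lparr>verts = {0..<n}, edges = {{i, j} |i j. i < n \<and> j < n \<and> f i j}\<rparr>"

lemma adj_graph_simps [simp]:
  "verts (adj_graph n f) = {0..<n}"
  "edges (adj_graph n f) = {{i, j} |i j. i < n \<and> j < n \<and> f i j}"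
  by (simp_all add: adj_graph_def)

lemma adj_graph_edge:
  assumes "\<And>i j. f i j \<Longrightarrow> f j i" "i < n" "j < n"
  shows "{i, j} \<in> edges (adj_graph n f) \<longleftrightarrow> f i j"
  using assms by (auto simp: doubleton_eq_iff)

lemma input_adj_graph:
  assumes "\<And>i. \<not> f i i"
  shows "input_graph (adj_graph n f)"
  unfolding input_graph_def simple_graph_def
proof (intro conjI)
  show "edges (adj_graph n f) \<subseteq> {{u, v} |u v. u \<in> verts (adj_graph n f) \<and> v \<in> verts (adj_graph n f) \<and> u \<noteq> v}"
  proof
    fix e assume "e \<in> edges (adj_graph n f)"
    then obtain i j where "e = {i, j}" "i < n" "j < n" "f i j" by auto
    then show "e \<in> {{u, v} |u v. u \<in> verts (adj_graph n f) \<and> v \<in> verts (adj_graph n f) \<and> u \<noteq> v}"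
      using assms by (intro CollectI exI[of _ i] exI[of _ j]) auto
  qed
qed auto

lemma encode_graph_mat:
  assumes "verts G = {0..<n}" "\<And>i j. i < n \<Longrightarrow> j < n \<Longrightarrow> {i, j} \<in> edges G \<longleftrightarrow> f i j"
  shows "encode_graph G = mat n f"
proof -
  have "encode_graph G = mat n (\<lambda>i j. {i, j} \<in> edges G)"
    by (simp add: encode_graph_def mat_def assms(1))
  also have "\<dots> = mat n f"
    unfolding mat_def using assms(2) by (intro arg_cong[of _ _ encode_list] map_cong refl) simp_all
  finally show ?thesis .
qed

lemma encode_adj_graph: "(\<And>i j. f i j \<Longrightarrow> f j i) \<Longrightarrow> encode_graph (adj_graph n f) = mat n f"
  by (intro encode_graph_mat adj_graph_edge) auto

lemma spine_mat [simp]: "spine (mat n f) = n"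
  by (simp add: mat_def)

lemma input_graphE:
  assumes "input_graph G"
  obtains n where "verts G = {0..<n}" "edges G \<subseteq> {{u, v} |u v. u < n \<and> v < n \<and> u \<noteq> v}"
    "encode_graph G = mat n (\<lambda>i j. {i, j} \<in> edges G)"
proof -
  obtain n where n: "verts G = {0..<n}" using assms by (auto simp: input_graph_def)
  then have e: "edges G \<subseteq> {{u, v} |u v. u < n \<and> v < n \<and> u \<noteq> v}"
    using assms by (simp add: input_graph_def simple_graph_def)
  have "encode_graph G = mat n (\<lambda>i j. {i, j} \<in> edges G)" by (rule encode_graph_mat[OF n refl])
  with n e show ?thesis by (rule that)
qed

definition part :: "nat \<Rightarrow> nat \<Rightarrow> nat" where "part n z = z div (n * n)"
text \<open>The outer \<open>mod h\<close> makes \<open>p\<close> and \<open>p + h * h\<close> name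
  the same pair, which yields two parts per pair.\<close>

definition src :: "nat \<Rightarrow> nat \<Rightarrow> nat" where "src h p = p div h mod h"
definition tgt :: "nat \<Rightarrow> nat \<Rightarrow> nat" where "tgt h p = p mod h"
definition fst_im :: "nat \<Rightarrow> nat \<Rightarrow> nat" where "fst_im n z = z mod (n * n) div n"
definition snd_im :: "nat \<Rightarrow> nat \<Rightarrow> nat" where "snd_im n z = z mod (n * n) mod n"

text \<open>A vertex with part \<open>p\<close> asserts that \<open>src p\<close> and \<open>tgt p\<close> are mapped to \<open>fst_im\<close> and \<open>snd_im\<close>.
  There are two parts for every pair of vertices of \<open>H\<close>, so that also for a single vertex
  no inconsistent assertion forms a clique.\<close>

definition consistent :: "(nat \<Rightarrow> nat \<Rightarrow> bool) \<Rightarrow> (nat \<Rightarrow> nat \<Rightarrow> bool) \<Rightarrow> nat \<Rightarrow> nat \<Rightarrow> nat \<Rightarrow> nat \<Rightarrow> nat \<Rightarrow> nat \<Rightarrow> nat \<Rightarrow> nat \<Rightarrow> bool" where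
  "consistent A B x y u v x' y' u' v' \<longleftrightarrow>
     (x = y \<longrightarrow> u = v) \<and> (A x y \<longrightarrow> B u v) \<and> (x' = y' \<longrightarrow> u' = v') \<and> (A x' y' \<longrightarrow> B u' v') \<and>
     (x = x' \<longrightarrow> u = u') \<and> (x = y' \<longrightarrow> u = v') \<and> (y = x' \<longrightarrow> v = u') \<and> (y = y' \<longrightarrow> v = v') \<and>
     (A x y \<longrightarrow> A x' y' \<longrightarrow> (u = u' \<and> v = v') \<or> (u = v' \<and> v = u') \<longrightarrow> (x = x' \<and> y = y') \<or> (x = y' \<and> y = x'))"

definition compatible :: "(nat \<Rightarrow> nat \<Rightarrow> bool) \<Rightarrow> (nat \<Rightarrow> nat \<Rightarrow> bool) \<Rightarrow> nat \<Rightarrow> nat \<Rightarrow> nat \<Rightarrow> nat \<Rightarrow> bool" where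
  "compatible A B h n z z' \<longleftrightarrow> part n z \<noteq> part n z' \<and>
     consistent A B (src h (part n z)) (tgt h (part n z)) (fst_im n z) (snd_im n z)
       (src h (part n z')) (tgt h (part n z')) (fst_im n z') (snd_im n z')"

lemma compatible_sym: "compatible A B h n z z' \<Longrightarrow> compatible A B h n z' z"
  unfolding compatible_def consistent_def by (elim conjE) (intro conjI impI; metis)

text \<open>Compatible vertices lie in different parts and there are \<open>K\<close> parts, so a
  clique of size \<open>K\<close> chooses exactly one assertion in each. The assertions for the
  pairs \<open>(x, x)\<close> define a map, consistency makes all other assertions agree with it,
  and its being an edge-injective homomorphism is what the remaining conditions of
  \<open>consistent\<close> express.\<close>

lemma card_cliques_compatible:
  assumes H: "verts H = {0..<h}" "edges H \<subseteq> {{u, v} |u v. u < h \<and> v < h \<and> u \<noteq> v}" "1 \<le> h"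
    and G: "verts G = {0..<n}"
  defines "A \<equiv> \<lambda>x y. {x, y} \<in> edges H" and "B \<equiv> \<lambda>x y. {x, y} \<in> edges G" and "K \<equiv> 2 * (h * h)"
  shows "card (cliques K (adj_graph (K * (n * n)) (compatible A B h n))) = card (edge_inj_homs H G)"
proof -
  let ?X = "adj_graph (K * (n * n)) (compatible A B h n)"
  let ?P = "\<lambda>\<phi> p. p * (n * n) + (\<phi> (src h p) * n + \<phi> (tgt h p))"
  have h: "0 < h" using H by simp
  have K: "2 \<le> K" using h mult_le_mono[of 1 h 1 h] unfolding K_def by simp
  have st: "src h p < h" "tgt h p < h" for p using h by (simp_all add: src_def tgt_def)
  have pair: "src h (x * h + y) = x" "tgt h (x * h + y) = y" "x * h + y < K" if "x < h" "y < h" for x y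
  proof -
    show "src h (x * h + y) = x" "tgt h (x * h + y) = y" using that by (simp_all add: src_def tgt_def)
    have "x * h + y < Suc x * h" using that by simp
    also have "\<dots> \<le> h * h" using that by (intro mult_right_mono) auto
    finally show "x * h + y < K" by (simp add: K_def)
  qed
  have im: "fst_im n z < n" "snd_im n z < n" if "0 < n" for z
    using that by (simp_all add: fst_im_def snd_im_def less_mult_imp_div_less)
  have dec: "part n (p * (n * n) + (u * n + v)) = p" "fst_im n (p * (n * n) + (u * n + v)) = u"
    "snd_im n (p * (n * n) + (u * n + v)) = v" if "u < n" "v < n" for p u v
  proof -
    have "u * n + v < Suc u * n" using that by simp
    also have "\<dots> \<le> n * n" using that by (intro mult_right_mono) auto
    finally have lt: "u * n + v < n * n" .
    then show "part n (p * (n * n) + (u * n + v)) = p" using that by (simp add: part_def)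
    have "(p * (n * n) + (u * n + v)) mod (n * n) = u * n + v" using lt by simp
    then show "fst_im n (p * (n * n) + (u * n + v)) = u" "snd_im n (p * (n * n) + (u * n + v)) = v"
      using that unfolding fst_im_def snd_im_def by simp_all
  qed
  have enc: "part n z * (n * n) + (fst_im n z * n + snd_im n z) = z" for z
    unfolding part_def fst_im_def snd_im_def by (simp add: div_mult_mod_eq)
  have edge: "{z, z'} \<in> edges ?X \<longleftrightarrow> compatible A B h n z z'" if "z < K * (n * n)" "z' < K * (n * n)" for z z'
    by (rule adj_graph_edge[OF compatible_sym that])
  have "bij_betw (\<lambda>\<phi>. ?P \<phi> ` {..<K}) (edge_inj_homs H G) (cliques K ?X)"
  proof (rule bij_betw_imageI)
    have lt: "\<phi> x < n" if "\<phi> \<in> edge_inj_homs H G" "x < h" for \<phi> x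
      using that H G by (auto simp: edge_inj_homs_def homs_def PiE_iff)
    have decP: "part n (?P \<phi> p) = p" "fst_im n (?P \<phi> p) = \<phi> (src h p)" "snd_im n (?P \<phi> p) = \<phi> (tgt h p)"
      if "\<phi> \<in> edge_inj_homs H G" for \<phi> p
      using dec[OF lt[OF that st(1)] lt[OF that st(2)]] by auto
    show "inj_on (\<lambda>\<phi>. ?P \<phi> ` {..<K}) (edge_inj_homs H G)"
    proof (rule inj_onI)
      fix \<phi> \<psi> assume p: "\<phi> \<in> edge_inj_homs H G" "\<psi> \<in> edge_inj_homs H G" and eq: "?P \<phi> ` {..<K} = ?P \<psi> ` {..<K}"
      show "\<phi> = \<psi>"
      proof (rule PiE_ext[of \<phi> "{0..<h}" "\<lambda>_. {0..<n}"])
        fix x assume "x \<in> {0..<h}"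
        then have x: "x < h" by simp
        have "?P \<phi> (x * h + x) \<in> ?P \<psi> ` {..<K}" using pair(3)[OF x x] unfolding eq[symmetric] by blast
        then obtain p' where p': "?P \<phi> (x * h + x) = ?P \<psi> p'" by blast
        have "p' = x * h + x" using arg_cong[OF p', of "part n"] unfolding decP[OF p(1)] decP[OF p(2)] by simp
        then show "\<phi> x = \<psi> x"
          using arg_cong[OF p', of "fst_im n"] unfolding decP[OF p(1)] decP[OF p(2)] by (simp add: pair(1)[OF x x])
      qed (use p H G in \<open>auto simp: edge_inj_homs_def homs_def\<close>)
    qed
    show "(\<lambda>\<phi>. ?P \<phi> ` {..<K}) ` edge_inj_homs H G = cliques K ?X"
    proof (intro equalityI subsetI)
      fix S assume "S \<in> (\<lambda>\<phi>. ?P \<phi> ` {..<K}) ` edge_inj_homs H G"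
      then obtain \<phi> where \<phi>: "\<phi> \<in> edge_inj_homs H G" and S: "S = ?P \<phi> ` {..<K}" by blast
      have hom: "\<And>x y. A x y \<Longrightarrow> B (\<phi> x) (\<phi> y)" and inj: "inj_on (\<lambda>e. \<phi> ` e) (edges H)"
        using \<phi> by (auto simp: edge_inj_homs_def homs_def A_def B_def)
      have Plt: "?P \<phi> p < K * (n * n)" if "p < K" for p
      proof -
        have "\<phi> (src h p) * n + \<phi> (tgt h p) < Suc (\<phi> (src h p)) * n" using lt[OF \<phi> st(2)] by simp
        also have "\<dots> \<le> n * n" using lt[OF \<phi> st(1)] by (intro mult_right_mono) (auto simp: Suc_le_eq)
        finally have "?P \<phi> p < Suc p * (n * n)" by simp
        also have "\<dots> \<le> K * (n * n)" using that by (intro mult_right_mono) auto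
        finally show ?thesis .
      qed
      have comp: "compatible A B h n (?P \<phi> p) (?P \<phi> p')" if "p \<noteq> p'" for p p'
        unfolding compatible_def decP[OF \<phi>] consistent_def
      proof (intro conjI impI)
        assume 1: "A (src h p) (tgt h p)" "A (src h p') (tgt h p')"
          and 2: "\<phi> (src h p) = \<phi> (src h p') \<and> \<phi> (tgt h p) = \<phi> (tgt h p') \<or>
            \<phi> (src h p) = \<phi> (tgt h p') \<and> \<phi> (tgt h p) = \<phi> (src h p')"
        have "\<phi> ` {src h p, tgt h p} = \<phi> ` {src h p', tgt h p'}"
          using 2 unfolding image_insert image_empty doubleton_eq_iff .
        then have "{src h p, tgt h p} = {src h p', tgt h p'}" using inj_onD[OF inj] 1 unfolding A_def by blast
        then show "src h p = src h p' \<and> tgt h p = tgt h p' \<or> src h p = tgt h p' \<and> tgt h p = src h p'"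
          unfolding doubleton_eq_iff .
      qed (use that hom in auto)
      have inj: "inj_on (?P \<phi>) {..<K}"
        by (rule inj_on_inverseI[of _ "part n"]) (rule decP(1)[OF \<phi>])
      show "S \<in> cliques K ?X"
        unfolding cliques_def
      proof (intro CollectI conjI ballI impI)
        show "S \<subseteq> verts ?X" using Plt by (auto simp: S)
        show "card S = K" unfolding S using card_image[OF inj] by simp
        fix z z' assume "z \<in> S" "z' \<in> S" "z \<noteq> z'"
        then obtain p p' where p: "p < K" "p' < K" "p \<noteq> p'" "z = ?P \<phi> p" "z' = ?P \<phi> p'" unfolding S by blast
        then show "{z, z'} \<in> edges ?X" using edge[OF Plt[OF p(1)] Plt[OF p(2)]] comp by simp
      qed
    next
      fix S assume S: "S \<in> cliques K ?X"
      have cl: "compatible A B h n z z'" if "z \<in> S" "z' \<in> S" "z \<noteq> z'" for z z'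
      proof -
        have "z < K * (n * n)" "z' < K * (n * n)" using S that by (auto simp: cliques_def)
        moreover have "{z, z'} \<in> edges ?X" using S that unfolding cliques_def by blast
        ultimately show ?thesis using edge by blast
      qed
      have finS: "finite S" "card S = K" using S by (auto simp: cliques_def intro: finite_subset)
      have n: "0 < n"
      proof (rule ccontr)
        assume "\<not> 0 < n"
        then have "S = {}" using S by (auto simp: cliques_def)
        then show False using finS K by simp
      qed
      have injS: "inj_on (part n) S" using cl by (intro inj_onI) (auto simp: compatible_def)
      have "part n z < K" if "z \<in> S" for z
        using S that n by (auto simp: cliques_def part_def intro!: less_mult_imp_div_less)
      then have "part n ` S \<subseteq> {..<K}" by auto
      then have partS: "part n ` S = {..<K}"
        using card_image[OF injS] finS by (intro card_subset_eq) auto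
      define s where "s = inv_into S (part n)"
      have s: "s p \<in> S" "part n (s p) = p" if "p < K" for p
        using that partS unfolding s_def by (auto intro: inv_into_into f_inv_into_f)
      have sc: "consistent A B (src h p) (tgt h p) (fst_im n (s p)) (snd_im n (s p))
          (src h p') (tgt h p') (fst_im n (s p')) (snd_im n (s p'))" if "p < K" "p' < K" "p \<noteq> p'" for p p'
      proof -
        have "s p \<noteq> s p'" using s(2)[OF that(1)] s(2)[OF that(2)] that(3) by metis
        then have "compatible A B h n (s p) (s p')" using cl s that by blast
        then show ?thesis unfolding compatible_def s(2)[OF that(1)] s(2)[OF that(2)] by blast
      qed
      \<comment> \<open>The conditions on a single assertion are tested only together with a second
        one; 0 or 1 supplies another part, as \<open>K\<close> is at least 2.\<close>
      have valid: "(src h p = tgt h p \<longrightarrow> fst_im n (s p) = snd_im n (s p)) \<and>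
          (A (src h p) (tgt h p) \<longrightarrow> B (fst_im n (s p)) (snd_im n (s p)))" if "p < K" for p
      proof -
        have "(if p = 0 then 1 else 0) < K" "p \<noteq> (if p = 0 then 1 else 0)" using K by auto
        from sc[OF that this] show ?thesis unfolding consistent_def by blast
      qed
      \<comment> \<open>The image of \<open>x\<close> is read off from the diagonal pair, whose code
        is \<open>x * h + x\<close>.\<close>
      define \<phi> where "\<phi> = (\<lambda>x\<in>{0..<h}. fst_im n (s (x * h + x)))"
      have \<phi>x: "\<phi> x = fst_im n (s (x * h + x))" if "x < h" for x using that by (simp add: \<phi>_def)
      have comps: "fst_im n (s p) = \<phi> (src h p)" "snd_im n (s p) = \<phi> (tgt h p)" if p: "p < K" for p
      proof -
        let ?x = "src h p" and ?y = "tgt h p"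
        note px = pair[OF st(1) st(1), of p p] and py = pair[OF st(2) st(2), of p p]
        show "fst_im n (s p) = \<phi> ?x"
        proof (cases "p = ?x * h + ?x")
          case True
          then show ?thesis using \<phi>x[OF st(1), of p] by simp
        next
          case False
          from sc[OF p px(3) False] show ?thesis unfolding consistent_def px \<phi>x[OF st(1)] by blast
        qed
        show "snd_im n (s p) = \<phi> ?y"
        proof (cases "p = ?y * h + ?y")
          case True
          then have "src h p = tgt h p" using py by metis
          then show ?thesis using valid[OF p] True \<phi>x[OF st(2), of p] by simp
        next
          case False
          from sc[OF p py(3) False] show ?thesis unfolding consistent_def py \<phi>x[OF st(2)] by blast
        qed
      qed
      have sP: "s p = ?P \<phi> p" if "p < K" for p
        using enc[of "s p"] unfolding s(2)[OF that] comps[OF that] by simp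
      have SP: "S = ?P \<phi> ` {..<K}"
      proof -
        have "s ` {..<K} = S" unfolding s_def partS[symmetric] by (rule inv_into_image_cancel[OF injS subset_refl, unfolded]) 
        then show ?thesis using sP by force
      qed
      have AB: "B (\<phi> x) (\<phi> y)" if "A x y" "x < h" "y < h" for x y
        using valid[OF pair(3)[OF that(2,3)]] comps[OF pair(3)[OF that(2,3)]] that(1)
        unfolding pair(1,2)[OF that(2,3)] by simp
      have Alt: "x < h \<and> y < h" if "A x y" for x y
      proof -
        have "{x, y} \<in> {{u, v} |u v. u < h \<and> v < h \<and> u \<noteq> v}" using that H(2) unfolding A_def by (rule rev_subsetD)
        then obtain u v where "{x, y} = {u, v}" "u < h" "v < h" by blast
        then show ?thesis by (auto simp: doubleton_eq_iff)
      qed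
      have "\<phi> \<in> edge_inj_homs H G"
        unfolding edge_inj_homs_def homs_def
      proof (intro CollectI conjI allI impI)
        show "\<phi> \<in> verts H \<rightarrow>\<^sub>E verts G" using im[OF n] H G by (auto simp: \<phi>_def)
        show "{\<phi> u, \<phi> v} \<in> edges G" if "{u, v} \<in> edges H" for u v
          using AB[of u v] Alt[of u v] that unfolding A_def B_def by blast
        show "inj_on (\<lambda>e. \<phi> ` e) (edges H)"
        proof (rule inj_onI, rule ccontr)
          fix e e' assume e: "e \<in> edges H" "e' \<in> edges H" "\<phi> ` e = \<phi> ` e'" "e \<noteq> e'"
          obtain x y where xy: "e = {x, y}" "x < h" "y < h" using e(1) H(2) by blast
          obtain x' y' where xy': "e' = {x', y'}" "x' < h" "y' < h" using e(2) H(2) by blast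
          have ne: "x * h + y \<noteq> x' * h + y'"
            using pair(1,2)[OF xy(2,3)] pair(1,2)[OF xy'(2,3)] e(4) xy(1) xy'(1) by metis
          have ee: "\<phi> x = \<phi> x' \<and> \<phi> y = \<phi> y' \<or> \<phi> x = \<phi> y' \<and> \<phi> y = \<phi> x'"
            using e(3) unfolding xy(1) xy'(1) image_insert image_empty doubleton_eq_iff .
          from sc[OF pair(3)[OF xy(2,3)] pair(3)[OF xy'(2,3)] ne]
          have "(x = x' \<and> y = y') \<or> (x = y' \<and> y = x')"
            using ee e(1,2) unfolding consistent_def pair(1,2)[OF xy(2,3)] pair(1,2)[OF xy'(2,3)]
              comps[OF pair(3)[OF xy(2,3)]] comps[OF pair(3)[OF xy'(2,3)]] A_def xy(1) xy'(1) by blast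
          then show False using e(4) unfolding xy(1) xy'(1) by (auto simp: doubleton_eq_iff)
        qed
      qed
      then show "S \<in> (\<lambda>\<phi>. ?P \<phi> ` {..<K}) ` edge_inj_homs H G" using SP by blast
    qed
  qed
  then show ?thesis by (simp add: bij_betw_same_card)
qed

abbreviation t_imp :: "ftm \<Rightarrow> ftm \<Rightarrow> ftm" where "t_imp a b \<equiv> Cond a b (Num 1)"
abbreviation t_eq :: "nat \<Rightarrow> nat \<Rightarrow> ftm" where "t_eq a b \<equiv> Op2 BEq (Lev a) (Lev b)"

lemma ev_and:
  "ev \<omega> a env = Atom (of_bool P) \<Longrightarrow> ev \<omega> b env = Atom (of_bool Q) \<Longrightarrow>
    ev \<omega> (t_and a b) env = Atom (of_bool (P \<and> Q))"
  by simp

lemma ev_or: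
  "ev \<omega> a env = Atom (of_bool P) \<Longrightarrow> ev \<omega> b env = Atom (of_bool Q) \<Longrightarrow>
    ev \<omega> (t_or a b) env = Atom (of_bool (P \<or> Q))"
  by simp

lemma ev_imp:
  "ev \<omega> a env = Atom (of_bool P) \<Longrightarrow> ev \<omega> b env = Atom (of_bool Q) \<Longrightarrow>
    ev \<omega> (t_imp a b) env = Atom (of_bool (P \<longrightarrow> Q))"
  by simp

lemma ev_not: "ev \<omega> a env = Atom (of_bool P) \<Longrightarrow> ev \<omega> (t_not a) env = Atom (of_bool (\<not> P))"
  by simp

lemma ev_eq:
  "ev \<omega> a env = Atom x \<Longrightarrow> ev \<omega> b env = Atom y \<Longrightarrow> ev \<omega> (Op2 BEq a b) env = Atom (of_bool (x = y))"
  by simp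

lemma simple_Cond:
  "simple \<omega> N c env \<Longrightarrow> simple \<omega> N t1 env \<Longrightarrow> simple \<omega> N t2 env \<Longrightarrow> simple \<omega> N (Cond c t1 t2) env"
  by simp

text \<open>Levels: 2 the matrix of \<open>G\<close>; 16 and 22 the two parts; 18 to 21 source,
  target and their asserted images for the first vertex, 24 to 27 the same for the second; 28 and 29
  whether the two pairs are edges of \<open>H\<close>.\<close>

definition t_consistent :: ftm where
  "t_consistent =
    t_and (t_not (t_eq 16 22)) (
    t_and (t_imp (t_eq 18 19) (t_eq 20 21)) (
    t_and (t_imp (Lev 28) (t_nth (Lev 21) (t_nth (Lev 20) (Lev 2)))) (
    t_and (t_imp (t_eq 24 25) (t_eq 26 27)) (
    t_and (t_imp (Lev 29) (t_nth (Lev 27) (t_nth (Lev 26) (Lev 2)))) (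
    t_and (t_imp (t_eq 18 24) (t_eq 20 26)) (
    t_and (t_imp (t_eq 18 25) (t_eq 20 27)) (
    t_and (t_imp (t_eq 19 24) (t_eq 21 26)) (
    t_and (t_imp (t_eq 19 25) (t_eq 21 27))
    (t_imp (Lev 28) (t_imp (Lev 29)
      (t_imp (t_or (t_and (t_eq 20 26) (t_eq 21 27)) (t_and (t_eq 20 27) (t_eq 21 26)))
        (t_or (t_and (t_eq 18 24) (t_eq 19 25)) (t_and (t_eq 18 25) (t_eq 19 24))))))))))))))"

text \<open>Pushes the levels 15 to 29 from the row index at level 10 and the column index at level
  14. Levels 1, 3 and 4 hold the matrix of \<open>H\<close>, \<open>h\<close> and \<open>n\<close>;
  level 15 is \<open>n * n\<close>.\<close>

definition t_compatible :: ftm where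
  "t_compatible =
    Bind (Op2 BMul (Lev 4) (Lev 4)) (
    Bind (Op2 BDiv (Lev 10) (Lev 15)) (
    Bind (t_mod (Lev 10) (Lev 15)) (
    Bind (t_mod (Op2 BDiv (Lev 16) (Lev 3)) (Lev 3)) (
    Bind (t_mod (Lev 16) (Lev 3)) (
    Bind (Op2 BDiv (Lev 17) (Lev 4)) (
    Bind (t_mod (Lev 17) (Lev 4)) (
    Bind (Op2 BDiv (Lev 14) (Lev 15)) (
    Bind (t_mod (Lev 14) (Lev 15)) (
    Bind (t_mod (Op2 BDiv (Lev 22) (Lev 3)) (Lev 3)) (
    Bind (t_mod (Lev 22) (Lev 3)) (
    Bind (Op2 BDiv (Lev 23) (Lev 4)) (
    Bind (t_mod (Lev 23) (Lev 4)) (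
    Bind (t_nth (Lev 19) (t_nth (Lev 18) (Lev 1))) (
    Bind (t_nth (Lev 25) (t_nth (Lev 24) (Lev 1)))
    t_consistent))))))))))))))"

lemma ev_consistent:
  assumes "rev env ! 16 = Atom p" "rev env ! 22 = Atom p'"
    "rev env ! 18 = Atom x" "rev env ! 19 = Atom y" "rev env ! 20 = Atom u" "rev env ! 21 = Atom v"
    "rev env ! 24 = Atom x'" "rev env ! 25 = Atom y'" "rev env ! 26 = Atom u'" "rev env ! 27 = Atom v'"
    "rev env ! 28 = Atom (of_bool (A x y))" "rev env ! 29 = Atom (of_bool (A x' y'))"
    "rev env ! 2 = mat n B" "u < n" "v < n" "u' < n" "v' < n"
  shows "ev \<omega> t_consistent env = Atom (of_bool (p \<noteq> p' \<and> consistent A B x y u v x' y' u' v'))"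
proof -
  have l: "ev \<omega> (Lev i) env = z" if "rev env ! i = z" for i z using that by simp
  have B: "ev \<omega> (t_nth (Lev 21) (t_nth (Lev 20) (Lev 2))) env = Atom (of_bool (B u v))"
    "ev \<omega> (t_nth (Lev 27) (t_nth (Lev 26) (Lev 2))) env = Atom (of_bool (B u' v'))"
    by (rule ev_mat; use assms in simp)+
  have "ev \<omega> t_consistent env = Atom (of_bool (p \<noteq> p' \<and>
     (x = y \<longrightarrow> u = v) \<and> (A x y \<longrightarrow> B u v) \<and> (x' = y' \<longrightarrow> u' = v') \<and> (A x' y' \<longrightarrow> B u' v') \<and>
     (x = x' \<longrightarrow> u = u') \<and> (x = y' \<longrightarrow> u = v') \<and> (y = x' \<longrightarrow> v = u') \<and> (y = y' \<longrightarrow> v = v') \<and>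
     (A x y \<longrightarrow> A x' y' \<longrightarrow> (u = u' \<and> v = v') \<or> (u = v' \<and> v = u') \<longrightarrow> (x = x' \<and> y = y') \<or> (x = y' \<and> y = x'))))"
    unfolding t_consistent_def by (intro ev_and ev_or ev_imp ev_not ev_eq l B assms)
  then show ?thesis by (simp only: consistent_def)
qed

lemma simple_consistent:
  assumes "30 \<le> length env" "the_num (rev env ! 20) \<le> M" "the_num (rev env ! 21) \<le> M"
    "the_num (rev env ! 26) \<le> M" "the_num (rev env ! 27) \<le> M"
  shows "simple \<omega> M t_consistent env"
  unfolding t_consistent_def using assms by (intro simple_Cond) simp_all

lemma ev_compatible:
  assumes h: "0 < h" and n: "i < K * (n * n)" "j < K * (n * n)"
    and env: "env = [Atom j, c, a, N, Atom i, d, b, N, N, k', Atom n, Atom h, mat n B, mat h A, v]"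
  shows "ev \<omega> t_compatible env = Atom (of_bool (compatible A B h n i j))"
    and "n \<le> M \<Longrightarrow> h \<le> M \<Longrightarrow> simple \<omega> M t_compatible env"
proof -
  have n0: "0 < n" using n by (cases n) auto
  have lt: "src h p < h" "tgt h p < h" "fst_im n z < n" "snd_im n z < n" for z p
    using h n0 by (simp_all add: src_def tgt_def fst_im_def snd_im_def less_mult_imp_div_less)
  let ?p = "part n i" and ?p' = "part n j"
  let ?e1 = "Atom (snd_im n i) # Atom (fst_im n i) # Atom (tgt h ?p) # Atom (src h ?p) #
    Atom (i mod (n * n)) # Atom ?p # Atom (n * n) # env"
  let ?e2 = "Atom (snd_im n j) # Atom (fst_im n j) # Atom (tgt h ?p') # Atom (src h ?p') #
    Atom (j mod (n * n)) # Atom ?p' # ?e1"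
  have m1: "ev \<omega> (t_nth (Lev 19) (t_nth (Lev 18) (Lev 1))) ?e2 = Atom (of_bool (A (src h ?p) (tgt h ?p)))"
    by (rule ev_mat[where n = h and f = A]) (simp_all add: lt env)
  have m2: "ev \<omega> (t_nth (Lev 25) (t_nth (Lev 24) (Lev 1))) (w # ?e2) =
      Atom (of_bool (A (src h ?p') (tgt h ?p')))" for w
    by (rule ev_mat[where n = h and f = A]) (simp_all add: lt env)
  have c: "ev \<omega> t_consistent (w' # w # ?e2) = Atom (of_bool (compatible A B h n i j))"
    if "w = Atom (of_bool (A (src h ?p) (tgt h ?p)))" "w' = Atom (of_bool (A (src h ?p') (tgt h ?p')))" for w w'
    unfolding compatible_def
    by (rule ev_consistent[where n = n]) (use that in \<open>simp_all add: lt env\<close>)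
  show "ev \<omega> t_compatible env = Atom (of_bool (compatible A B h n i j))"
    using c[OF m1 m2] unfolding t_compatible_def
    by (simp add: env minus_div_mult_eq_mod part_def src_def tgt_def fst_im_def snd_im_def)
  show "simple \<omega> M t_compatible env" if "n \<le> M" "h \<le> M"
  proof -
    have le: "src h p \<le> M" "tgt h p \<le> M" "fst_im n z \<le> M" "snd_im n z \<le> M" for z p
      using lt(1,2)[of p] lt(3,4)[of z] that by linarith+
    have "simple \<omega> M t_consistent (w' # w # ?e2)" for w w'
      by (rule simple_consistent) (simp_all add: le env)
    then show ?thesis
      using le(1,2)[of ?p] le(1,2)[of ?p'] unfolding t_compatible_def
      by (simp add: env minus_div_mult_eq_mod part_def src_def tgt_def fst_im_def snd_im_def)
  qed
qed

definition t_member :: ftm where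
  "t_member = Bind (Op1 ULeft (Lev 0)) (Bind (Op1 URight (Lev 0)) (Bind (Len (Lev 1)) (Bind (Len (Lev 2))
    (Bind (Op2 BMul (Num 2) (Op2 BMul (Lev 3) (Lev 3)))
    (Bind (Op2 BMul (Lev 5) (Op2 BMul (Lev 4) (Lev 4)))
    (Op2 BNode (t_graph 6 t_compatible) (Lev 5)))))))"

text \<open>With \<open>s\<close> the size of the input, the compatibility graph has at most
  \<open>2 * s ^ 4\<close> vertices, and its matrix has size at most \<open>16 * s ^ 8 + 1\<close>.
  This is the origin of \<open>20 * s ^ 8\<close>; the weight accounts for the entries of the
  matrix.\<close>

lemma member_run:
  assumes h: "0 < h" and v: "v = Node (mat h A) (mat n B)" and K: "K = 2 * (h * h)"
    and b: "b = 20 * vsize v ^ 8" and M: "M = (weight t_compatible + 20) * b"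
  shows "ev \<omega> t_member [v] = Node (mat (K * (n * n)) (compatible A B h n)) (Atom K)"
    and "ok \<O> \<omega> M t_member [v]" and "vsize v \<le> M" and "16 \<le> M"
proof -
  let ?N = "K * (n * n)" and ?s = "vsize v"
  let ?env = "[Atom ?N, Atom K, Atom n, Atom h, mat n B, mat h A, v]"
  have ev: "ev \<omega> t_compatible ([Atom j, Atom c, a, Atom ?N, Atom i, Atom d, a', Atom ?N] @ ?env) =
      Atom (of_bool (compatible A B h n i j))" if "i < ?N" "j < ?N" for i j c d a a'
    by (rule ev_compatible(1)[OF h that]) simp
  have g: "ev \<omega> (t_graph 6 t_compatible) ?env = mat ?N (compatible A B h n)"
    by (rule ev_graph) (use ev in simp_all)
  show "ev \<omega> t_member [v] = Node (mat ?N (compatible A B h n)) (Atom K)"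
    using g by (simp add: t_member_def v K)
  have s1: "1 \<le> ?s" by (rule vsize_pos)
  have hs: "Suc h \<le> ?s" "Suc n \<le> ?s" "vsize (mat h A) \<le> ?s" "vsize (mat n B) \<le> ?s"
    using le_vsize_mat[of h A] le_vsize_mat[of n B] by (simp_all add: v)
  have p: "?s \<le> ?s ^ 8" "?s ^ 2 \<le> ?s ^ 8" "?s ^ 4 \<le> ?s ^ 8" "1 \<le> ?s ^ 8"
    using s1 power_increasing[of 1 8 ?s] power_increasing[of 2 8 ?s] power_increasing[of 4 8 ?s] by auto
  have hh: "h * h \<le> ?s ^ 2" "n * n \<le> ?s ^ 2" using hs by (simp_all add: power2_eq_square mult_le_mono)
  then have "?N \<le> 2 * ?s ^ 2 * ?s ^ 2" unfolding K by (intro mult_le_mono) auto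
  then have N4: "?N \<le> 2 * ?s ^ 4" by (simp add: power2_eq_square power4_eq_xxxx)
  have s24: "?s ^ 2 \<le> ?s ^ 4" "?s \<le> ?s ^ 4" "1 \<le> ?s ^ 4"
    using s1 power_increasing[of 1 4 ?s] power_increasing[of 2 4 ?s] by auto
  have "3 * ?N + 2 \<le> 3 * (2 * ?s ^ 4) + 2 * ?s ^ 4" using N4 s24(3) by linarith
  with N4 have "?N * (3 * ?N + 2) \<le> (2 * ?s ^ 4) * (3 * (2 * ?s ^ 4) + 2 * ?s ^ 4)" by (rule mult_le_mono)
  also have "\<dots> = 16 * ?s ^ 8" by (simp add: algebra_simps flip: power_add)
  finally have Nb: "?N * (3 * ?N + 2) + 4 \<le> b" using p b by linarith
  have b4: "20 \<le> b" using p b by linarith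
  have bM: "20 * b \<le> M" "weight t_compatible * b \<le> M" unfolding M by (simp_all add: add_mult_distrib)
  have at: "vsize (Atom x) \<le> b" if "x \<le> 2 * ?s ^ 4" for x
    using vsize_Atom_le[of x] that p b by linarith
  have K2: "K \<le> 2 * ?s ^ 4" using hh s24 unfolding K by linarith
  have sizes: "vsize (Atom h) \<le> b" "vsize (Atom n) \<le> b" "vsize (Atom K) \<le> b" "vsize (Atom ?N) \<le> b"
    "vsize (Atom (h * h)) \<le> b" "vsize (Atom (n * n)) \<le> b" "vsize (Atom 2) \<le> b"
    by (rule at; use hs hh s24 K2 N4 in linarith)+
  have env: "\<forall>w\<in>set ?env. vsize w \<le> b" using sizes hs p b by (auto simp del: vsize.simps)
  have okg: "ok \<O> \<omega> M (t_graph 6 t_compatible) ?env"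
  proof (rule ok_graph[OF _ _ ev _ env Nb bM(2)])
    have le: "n \<le> M" "h \<le> M" using hs p b bM by linarith+
    fix i j c d a a' assume "i < ?N" "j < ?N"
    from ev_compatible(2)[OF h this _ le]
    show "simple \<omega> M t_compatible ([Atom j, Atom c, a, Atom ?N, Atom i, Atom d, a', Atom ?N] @ ?env)" by simp
  qed simp_all
  have sz: "vsize (Node (mat ?N (compatible A B h n)) (Atom K)) \<le> M"
    using vsize_mat[of ?N "compatible A B h n"] Nb sizes(3) bM(1) b4 by (simp del: vsize.simps(1))
  have M': "vsize (Atom h) \<le> M" "vsize (Atom n) \<le> M" "vsize (Atom K) \<le> M" "vsize (Atom ?N) \<le> M"
    "vsize (Atom (h * h)) \<le> M" "vsize (Atom (n * n)) \<le> M" "vsize (Atom 2) \<le> M"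
    using sizes bM(1) by linarith+
  show "ok \<O> \<omega> M t_member [v]"
    using okg g sz M' by (simp add: t_member_def v K del: vsize.simps)
  show "vsize v \<le> M" "16 \<le> M" using p b bM b4 by linarith+
qed

lemma computable_const: "computable (\<lambda>_. c)"
  by (rule computable_term[of "Num c"]) simp_all

lemma computable_twice_square: "computable (\<lambda>k. 2 * (k * k))"
  by (rule computable_term[of "Op2 BMul (Num 2) (Op2 BMul (Lev 0) (Lev 0))"]) simp_all

theorem count_edge_inj_in_sharp_W1:
  assumes ne: "\<And>H. H \<in> \<H> \<Longrightarrow> verts H \<noteq> {}"
  shows "in_sharp_W1 (count_edge_inj \<H>)"
  unfolding in_sharp_W1_def fpt_parsimonious_reducible_def
proof (intro exI conjI ballI)
  let ?e = "expo t_member + 1" and ?w = "(weight t_compatible + 20) * 20"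
  show "computable (\<lambda>_. ?w ^ ?e)" by (rule computable_const)
  show "computable (\<lambda>k. 2 * (k * k))" by (rule computable_twice_square)
  fix x assume "x \<in> instances (count_edge_inj \<H>)"
  then obtain H G where x: "x = (H, G)" "H \<in> \<H>" "input_graph H" "input_graph G"
    by (auto simp: count_edge_inj_def)
  obtain h where H: "verts H = {0..<h}" "edges H \<subseteq> {{u, v} |u v. u < h \<and> v < h \<and> u \<noteq> v}"
    "encode_graph H = mat h (\<lambda>i j. {i, j} \<in> edges H)" using x(3) by (rule input_graphE)
  obtain n where G: "verts G = {0..<n}" "encode_graph G = mat n (\<lambda>i j. {i, j} \<in> edges G)"
    using x(4) by (rule input_graphE)
  have h: "0 < h" using ne[OF x(2)] H(1) by (cases h) auto
  let ?A = "\<lambda>i j. {i, j} \<in> edges H" and ?B = "\<lambda>i j. {i, j} \<in> edges G"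
  define K where "K = 2 * (h * h)"
  let ?y = "(adj_graph (K * (n * n)) (compatible ?A ?B h n), K)"
  show "\<exists>y\<in>instances count_cliques. param count_cliques y \<le> 2 * (param (count_edge_inj \<H>) x * param (count_edge_inj \<H>) x) \<and>
      solution count_cliques y = solution (count_edge_inj \<H>) x \<and>
      (\<exists>t\<le>?w ^ ?e * vsize (encode (count_edge_inj \<H>) x) ^ (8 * ?e).
        runs no_oracle (prog t_member) (encode (count_edge_inj \<H>) x) (encode count_cliques y) t)"
  proof (intro bexI[of _ ?y] conjI)
    have "input_graph (adj_graph (K * (n * n)) (compatible ?A ?B h n))"
      by (rule input_adj_graph) (simp add: compatible_def)
    then show "?y \<in> instances count_cliques" by (simp add: count_cliques_def)
    show "param count_cliques ?y \<le> 2 * (param (count_edge_inj \<H>) x * param (count_edge_inj \<H>) x)"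
      by (simp add: count_cliques_def count_edge_inj_def x(1) H(1) K_def)
    show "solution count_cliques ?y = solution (count_edge_inj \<H>) x"
      using card_cliques_compatible[OF H(1,2) _ G(1)] h
      by (simp add: count_cliques_def count_edge_inj_def x(1) K_def Suc_le_eq)
    define v where "v = Node (mat h ?A) (mat n ?B)"
    have enc: "encode (count_edge_inj \<H>) x = v"
      by (simp add: count_edge_inj_def x(1) H(3) G(2) v_def)
    have enc': "encode count_cliques ?y = Node (mat (K * (n * n)) (compatible ?A ?B h n)) (Atom K)"
      using encode_adj_graph[of "compatible ?A ?B h n", OF compatible_sym] by (simp add: count_cliques_def)
    define M where "M = (weight t_compatible + 20) * (20 * vsize v ^ 8)"
    note run = member_run[OF h v_def K_def refl M_def]
    obtain T where "T \<le> M ^ ?e" "runs no_oracle (prog t_member) v (ev (\<lambda>_. Atom 0) t_member [v]) T"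
      using runs_prog[OF run(2-4)] by blast
    moreover have "M ^ ?e = ?w ^ ?e * vsize v ^ (8 * ?e)"
      unfolding M_def by (simp only: power_mult_distrib power_mult mult.assoc)
    ultimately show "\<exists>t\<le>?w ^ ?e * vsize (encode (count_edge_inj \<H>) x) ^ (8 * ?e).
        runs no_oracle (prog t_member) (encode (count_edge_inj \<H>) x) (encode count_cliques ?y) t"
      unfolding enc enc' run(1) by auto
  qed
qed

section \<open>Hardness\<close>

text \<open>The levels of the environment of the reduction are: \<open>0\<close> the input, \<open>1\<close> the clique size \<open>k\<close>,
  \<open>2\<close> the number of steps \<open>m\<close>, \<open>3\<close> \<open>J\<close>, \<open>4\<close> \<open>d\<close>, \<open>5\<close> \<open>M = 2 ^ (k * k)\<close>, \<open>6\<close> \<open>fact J\<close>, \<open>7\<close> \<open>2 * m\<close>,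
  \<open>8\<close> the pattern, \<open>9\<close> an adjacency matrix, \<open>10\<close> its dimension; \<open>11\<close> to \<open>13\<close> the loop over \<open>r\<close>; \<open>14\<close> \<open>q\<close>,
  \<open>15\<close> the set of colours, \<open>16\<close> \<open>h = n * k * q\<close>, \<open>17\<close> the number of vertices of the host, \<open>21\<close> and \<open>25\<close> the
  row and the column of its matrix. The sign is computed with the summand at level \<open>14\<close>.\<close>

definition t_inc_test :: "nat \<Rightarrow> nat \<Rightarrow> ftm" where
  "t_inc_test z w =
    t_and (Op2 BLess (Lev z) (Lev 16)) (
    t_and (t_not (Op2 BLess (Lev w) (Lev 16))) (
    t_and (Op2 BLess (Lev 27) (Lev 28)) (
    t_and (t_or (t_eq z 27) (t_eq z 28)) (
    t_and (t_not (t_eq 31 32)) (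
    t_and (t_bit (Op2 BAdd (Op2 BMul (Lev 31) (Lev 1)) (Lev 31)) (Lev 15)) (
    t_and (t_bit (Op2 BAdd (Op2 BMul (Lev 32) (Lev 1)) (Lev 32)) (Lev 15)) (
    t_and (t_bit (Op2 BAdd (Op2 BMul (Lev 31) (Lev 1)) (Lev 32)) (Lev 15)) (
    t_and (t_bit (Op2 BAdd (Op2 BMul (Lev 32) (Lev 1)) (Lev 31)) (Lev 15))
    (t_nth (Op2 BDiv (Lev 30) (Lev 1)) (t_nth (Op2 BDiv (Lev 29) (Lev 1)) (Lev 9)))))))))))"

text \<open>Decodes the midpoint candidate \<open>w\<close>. Level 26 is its offset without the
  label, 27 and 28 the two ends in the blow-up, 29 and 30 the coloured vertices of which they are
  copies, 31 and 32 the colours of these.\<close>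

definition t_inc :: "nat \<Rightarrow> nat \<Rightarrow> ftm" where
  "t_inc z w =
    Bind (Op2 BDiv (Op2 BSub (Lev w) (Lev 16)) (Lev 14)) (
    Bind (Op2 BDiv (Lev 26) (Lev 16)) (
    Bind (t_mod (Lev 26) (Lev 16)) (
    Bind (Op2 BDiv (Lev 27) (Lev 14)) (
    Bind (Op2 BDiv (Lev 28) (Lev 14)) (
    Bind (t_mod (Lev 29) (Lev 1)) (
    Bind (t_mod (Lev 30) (Lev 1))
    (t_inc_test z w)))))))"

definition t_host :: ftm where
  "t_host = t_or (t_inc 21 25) (t_inc 25 21)"

lemma ev_less:
  "ev \<omega> a env = Atom x \<Longrightarrow> ev \<omega> b env = Atom y \<Longrightarrow> ev \<omega> (Op2 BLess a b) env = Atom (of_bool (x < y))"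
  by simp

lemma ev_inc_test:
  assumes "rev env ! z = Atom z'" "rev env ! w = Atom w'" "rev env ! 16 = Atom h" "rev env ! 15 = Atom s"
    "rev env ! 1 = Atom k" "rev env ! 9 = mat n E"
    "rev env ! 27 = Atom l" "rev env ! 28 = Atom r" "rev env ! 29 = Atom \<beta>" "rev env ! 30 = Atom \<gamma>"
    "rev env ! 31 = Atom i" "rev env ! 32 = Atom j" "\<beta> div k < n" "\<gamma> div k < n"
  shows "ev \<omega> (t_inc_test z w) env = Atom (of_bool (z' < h \<and> \<not> w' < h \<and> l < r \<and> (z' = l \<or> z' = r) \<and>
    i \<noteq> j \<and> cols k i j \<subseteq> set_decode s \<and> E (\<beta> div k) (\<gamma> div k)))"
proof -
  have l: "ev \<omega> (Lev a) env = x" if "rev env ! a = x" for a x using that by simp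
  have E: "ev \<omega> (t_nth (Op2 BDiv (Lev 30) (Lev 1)) (t_nth (Op2 BDiv (Lev 29) (Lev 1)) (Lev 9))) env =
      Atom (of_bool (E (\<beta> div k) (\<gamma> div k)))"
    by (rule ev_mat; use assms in simp)
  have bit: "ev \<omega> (t_bit (Op2 BAdd (Op2 BMul (Lev a) (Lev 1)) (Lev b)) (Lev 15)) env =
      Atom (of_bool (x * k + y \<in> set_decode s))" if "rev env ! a = Atom x" "rev env ! b = Atom y" for a b x y
    by (rule ev_bit) (use assms that in simp_all)
  have "ev \<omega> (t_inc_test z w) env = Atom (of_bool (z' < h \<and> \<not> w' < h \<and> l < r \<and> (z' = l \<or> z' = r) \<and>
    i \<noteq> j \<and> i * k + i \<in> set_decode s \<and> j * k + j \<in> set_decode s \<and> i * k + j \<in> set_decode s \<and>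
    j * k + i \<in> set_decode s \<and> E (\<beta> div k) (\<gamma> div k)))"
    unfolding t_inc_test_def by (intro ev_and ev_or ev_not ev_eq ev_less bit E l assms)
  then show ?thesis by (simp only: cols_def insert_subset empty_subsetI conj_assoc simp_thms)
qed

lemma simple_inc_test:
  assumes "33 \<le> length env" "z < 33" "w < 33"
    "the_num (rev env ! 29) div the_num (rev env ! 1) \<le> M" "the_num (rev env ! 30) div the_num (rev env ! 1) \<le> M"
    "\<And>a b. a \<in> {31, 32} \<Longrightarrow> b \<in> {31, 32} \<Longrightarrow>
      the_num (rev env ! a) * the_num (rev env ! 1) + the_num (rev env ! b) \<le> M"
  shows "simple \<omega> M (t_inc_test z w) env"
  unfolding t_inc_test_def using assms by (intro simple_Cond) simp_all

lemma ev_inc: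
  assumes len: "length env = 26" and f: "rev env ! z = Atom z'" "rev env ! w = Atom w'"
    "rev env ! 16 = Atom (n * k * q)" "rev env ! 15 = Atom s" "rev env ! 14 = Atom q"
    "rev env ! 1 = Atom k" "rev env ! 9 = mat n E" "z < 26" "w < 26"
    and sym: "\<And>u v. E u v \<Longrightarrow> E v u"
    and w: "w' < n * k * q + n * k * q * (n * k * q) * q"
  shows "ev \<omega> (t_inc z w) env =
      Atom (of_bool (subdivision.inc (n * k * q) q (lift_adj E k (set_decode s) q) z' w'))"
    and "n \<le> M \<Longrightarrow> k * k \<le> M \<Longrightarrow> simple \<omega> M (t_inc z w) env"
proof -
  interpret subdivision "n * k * q" q "lift_adj E k (set_decode s) q" by (rule subdivision_lift_adj[OF sym])
  let ?h = "n * k * q"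
  have k1: "rev env ! Suc 0 = Atom k" using f by simp
  have pos: "0 < n" "0 < k" "0 < q" using w by (auto intro: Nat.gr0I)
  have lh: "lo w' < ?h" "hi w' < ?h"
  proof -
    have "w' - ?h < ?h * (?h * q)" using w pos by (cases "w' < ?h") (auto simp: ac_simps)
    then have "w' - ?h < ?h * ?h * q" by (simp add: ac_simps)
    then have "(w' - ?h) div q < ?h * ?h" by (simp add: less_mult_imp_div_less)
    then show "lo w' < ?h" by (simp add: lo_def less_mult_imp_div_less)
    show "hi w' < ?h" using pos by (simp add: hi_def)
  qed
  have vk: "x div q div k < n" if "x < ?h" for x
    using that by (intro less_mult_imp_div_less) (simp add: less_mult_imp_div_less)
  let ?e = "Atom (hi w' div q mod k) # Atom (lo w' div q mod k) # Atom (hi w' div q) # Atom (lo w' div q) #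
    Atom (hi w') # Atom (lo w') # Atom ((w' - ?h) div q) # env"
  have t: "ev \<omega> (t_inc_test z w) ?e = Atom (of_bool (inc z' w'))"
    by (subst ev_inc_test[where z' = z' and w' = w' and h = ?h and s = s and k = k and n = n and E = E and
        l = "lo w'" and r = "hi w'" and \<beta> = "lo w' div q" and \<gamma> = "hi w' div q" and
        i = "lo w' div q mod k" and j = "hi w' div q mod k"])
      (use f len lh vk in \<open>auto simp: nth_append inc_def lift_adj_def adj_cols_def not_less\<close>)
  show "ev \<omega> (t_inc z w) env = Atom (of_bool (inc z' w'))"
    using t unfolding t_inc_def
    by (simp add: f k1 len nth_append minus_div_mult_eq_mod lo_def hi_def)
  show "simple \<omega> M (t_inc z w) env" if M: "n \<le> M" "k * k \<le> M"
  proof -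
    have c: "x mod k * k + y mod k \<le> M" for x y
    proof -
      have "x mod k * k + y mod k < Suc (x mod k) * k" using pos by simp
      also have "\<dots> \<le> k * k" using pos by (intro mult_right_mono) (auto simp: Suc_le_eq)
      finally show ?thesis using M by linarith
    qed
    have "lo w' div q div k \<le> M" "hi w' div q div k \<le> M" using vk[OF lh(1)] vk[OF lh(2)] M by linarith+
    then have "simple \<omega> M (t_inc_test z w) ?e"
      using f len c by (intro simple_inc_test) (auto simp: nth_append)
    then show ?thesis
      unfolding t_inc_def by (simp add: f k1 len nth_append minus_div_mult_eq_mod lo_def hi_def)
  qed
qed

lemma ev_host:
  assumes len: "length env = 26" and f: "rev env ! 21 = Atom i" "rev env ! 25 = Atom j"
    "rev env ! 16 = Atom (n * k * q)" "rev env ! 15 = Atom s" "rev env ! 14 = Atom q"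
    "rev env ! 1 = Atom k" "rev env ! 9 = mat n E"
    and sym: "\<And>u v. E u v \<Longrightarrow> E v u"
    and w: "i < n * k * q + n * k * q * (n * k * q) * q" "j < n * k * q + n * k * q * (n * k * q) * q"
  defines "inc \<equiv> subdivision.inc (n * k * q) q (lift_adj E k (set_decode s) q)"
  shows "ev \<omega> t_host env = Atom (of_bool (inc i j \<or> inc j i))"
    and "n \<le> M \<Longrightarrow> k * k \<le> M \<Longrightarrow> simple \<omega> M t_host env"
proof -
  note 1 = ev_inc[OF len f(1,2,3-7) _ _ sym w(2), folded inc_def]
  note 2 = ev_inc[OF len f(2,1,3-7) _ _ sym w(1), folded inc_def]
  show "ev \<omega> t_host env = Atom (of_bool (inc i j \<or> inc j i))"
    unfolding t_host_def by (rule ev_or[OF 1(1) 2(1)]) simp_all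
  show "n \<le> M \<Longrightarrow> k * k \<le> M \<Longrightarrow> simple \<omega> M t_host env"
    unfolding t_host_def by (intro simple_Cond 1(2) 2(2)) simp_all
qed

definition t_pattern :: "bool \<Rightarrow> ftm" where
  "t_pattern cyc = t_or (Op2 BEq (Lev 15) (Op2 BAdd (Lev 11) (Num 1)))
    (t_or (Op2 BEq (Lev 11) (Op2 BAdd (Lev 15) (Num 1)))
    (t_and (Num (of_bool cyc))
      (t_or (t_and (Op2 BEq (Op2 BAdd (Lev 11) (Num 1)) (Lev 7)) (Op2 BEq (Lev 15) (Num 0)))
        (t_and (Op2 BEq (Op2 BAdd (Lev 15) (Num 1)) (Lev 7)) (Op2 BEq (Lev 11) (Num 0))))))"

definition pattern_adj :: "nat \<Rightarrow> bool \<Rightarrow> nat \<Rightarrow> nat \<Rightarrow> bool" where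
  "pattern_adj m cyc i j \<longleftrightarrow> j = Suc i \<or> i = Suc j \<or>
     (cyc \<and> ((Suc i = 2 * m \<and> j = 0) \<or> (Suc j = 2 * m \<and> i = 0)))"

lemma encode_pattern: "encode_graph (pattern m cyc) = mat (2 * m) (pattern_adj m cyc)"
proof (rule encode_graph_mat)
  fix i j assume ij: "i < 2 * m" "j < 2 * m"
  show "{i, j} \<in> edges (pattern m cyc) \<longleftrightarrow> pattern_adj m cyc i j"
  proof
    assume "{i, j} \<in> edges (pattern m cyc)"
    from pattern_edge_cases[OF this] show "pattern_adj m cyc i j"
      using ij by (auto simp: doubleton_eq_iff pattern_adj_def)
  next
    assume "pattern_adj m cyc i j"
    then consider "j = Suc i" | "i = Suc j" | cyc "i = 2 * m - 1" "j = 0" | cyc "j = 2 * m - 1" "i = 0"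
      unfolding pattern_adj_def by fastforce
    then show "{i, j} \<in> edges (pattern m cyc)"
      using ij by cases (auto simp: insert_commute)
  qed
qed simp

lemma ev_t_pattern:
  assumes "rev env ! 15 = Atom j" "rev env ! 11 = Atom i" "rev env ! 7 = Atom (2 * m)"
  shows "ev \<omega> (t_pattern cyc) env = Atom (of_bool (pattern_adj m cyc i j))"
proof -
  have l: "ev \<omega> (Lev a) env = x" if "rev env ! a = x" for a x using that by simp
  have s: "ev \<omega> (Op2 BAdd (Lev a) (Num 1)) env = Atom (Suc x)" if "rev env ! a = Atom x" for a x
    using that by simp
  have c: "ev \<omega> (Num (of_bool cyc)) env = Atom (of_bool cyc)" "ev \<omega> (Num 0) env = Atom 0" by simp_all
  show ?thesis
    unfolding t_pattern_def pattern_adj_def by (intro ev_and ev_or ev_eq l s c assms)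
qed

lemma simple_t_pattern: "16 \<le> length env \<Longrightarrow> simple \<omega> M (t_pattern cyc) env"
  unfolding t_pattern_def by (intro simple_Cond) simp_all

text \<open>The counter \<open>r\<close> encodes the number \<open>q = r div M + 1\<close> of copies and the set \<open>r mod M\<close> of colours.\<close>

definition t_sign :: ftm where
  "t_sign = Bind (t_mod (Lev 13) (Lev 5)) (
    Bind (Loop (Op2 BMul (Lev 1) (Lev 1)) (Num 0) (Op2 BAdd (Idx 1) (Op2 BSub (Num 1) (t_bit (Idx 0) (Lev 15))))) (
    Bind (Op2 BAdd (Op2 BDiv (Lev 13) (Lev 5)) (Lev 16))
    (t_not (t_mod (Lev 17) (Num 2)))))"

definition t_summand :: ftm where
  "t_summand = Bind (Op2 BAdd (Op2 BDiv (Lev 13) (Lev 5)) (Num 1)) (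
    Bind (t_mod (Lev 13) (Lev 5)) (
    Bind (Op2 BMul (Op2 BMul (Lev 10) (Lev 1)) (Lev 14)) (
    Bind (Op2 BAdd (Lev 16) (Op2 BMul (Op2 BMul (Lev 16) (Lev 16)) (Lev 14)))
    (Op2 BMul (Op2 BMul (t_choose (Lev 3) (Lev 14)) (t_pow (Op2 BDiv (Lev 6) (Lev 14)) (Lev 4)))
      (Ask (Op2 BNode (Lev 8) (t_graph 17 t_host)))))))"

definition t_value :: ftm where
  "t_value = t_alt (Op2 BMul (Lev 3) (Lev 5)) t_sign t_summand"

lemma rec_zeros: "rec_nat (Atom 0) (\<lambda>c acc. Atom (the_num acc + (1 - of_bool (c \<in> S)))) c =
    Atom (card ({..<c} - S))"
proof (induction c)
  case (Suc c)
  have "{..<Suc c} - S = (if c \<in> S then {..<c} - S else insert c ({..<c} - S))" by (auto simp: lessThan_Suc)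
  then show ?case using Suc by simp
qed simp

lemma ev_sign:
  assumes env: "env = [v, Atom r, acc, lm, N, A, H, mm, Z, Atom M, d, J, m, Atom k, w]"
  shows "ev \<omega> t_sign env = Atom (of_bool (even (r div M + card ({..<k * k} - set_decode (r mod M)))))"
    and "\<forall>v\<in>set env. vsize v \<le> b \<Longrightarrow> k * k + 4 \<le> b \<Longrightarrow> 100 * b \<le> B \<Longrightarrow> ok \<O> \<omega> B t_sign env"
proof -
  let ?s = "Atom (r mod M)" and ?z = "Atom (card ({..<k * k} - set_decode (r mod M)))"
  let ?b = "Op2 BAdd (Idx 1) (Op2 BSub (Num 1) (t_bit (Idx 0) (Lev 15)))"
  let ?e = "\<lambda>c. Atom c # Atom (card ({..<c} - set_decode (r mod M))) # Atom (k * k) # ?s # env"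
  have bit: "ev \<omega> (t_bit (Idx 0) (Lev 15)) (Atom c # acc # l # ?s # env) = Atom (of_bool (c \<in> set_decode (r mod M)))"
    for c acc l by (rule ev_bit) (simp_all add: env)
  have z: "rec_nat (Atom 0) (\<lambda>c acc. ev \<omega> ?b (Atom c # acc # Atom (k * k) # ?s # env)) c =
      Atom (card ({..<c} - set_decode (r mod M)))" for c
    using rec_zeros[of "set_decode (r mod M)" c] bit by simp
  have n: "ev \<omega> (Op2 BMul (Lev 1) (Lev 1)) (?s # env) = Atom (k * k)" by (simp add: env)
  have loop: "ev \<omega> (Loop (Op2 BMul (Lev 1) (Lev 1)) (Num 0) ?b) (?s # env) = ?z"
    by (simp only: ev.simps(8) n the_num.simps ev.simps(3) z)
  have md: "ev \<omega> (t_mod (Lev 13) (Lev 5)) env = ?s" by (simp add: env minus_div_mult_eq_mod)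
  show "ev \<omega> t_sign env = Atom (of_bool (even (r div M + card ({..<k * k} - set_decode (r mod M)))))"
    unfolding t_sign_def using loop
    by (simp add: env minus_div_mult_eq_mod mod_2_eq_odd del: ev.simps(8))
  assume e: "\<forall>v\<in>set env. vsize v \<le> b" and b: "k * k + 4 \<le> b" "100 * b \<le> B"
  have at: "vsize (Atom x) \<le> b" if "x \<le> k * k" for x using vsize_Atom_le[of x] that b by linarith
  have card: "card ({..<c} - set_decode (r mod M)) \<le> c" for c
    using card_mono[of "{..<c}" "{..<c} - set_decode (r mod M)"] by simp
  have "vsize (Atom r) \<le> b" using e by (simp add: env del: vsize.simps)
  then have s: "vsize ?s \<le> b" using vsize_Atom_mono[of "r mod M" r] by simp
  have wb: "w * b \<le> B" if "w \<le> 100" for w using mult_le_mono1[OF that, of b] b by linarith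
  have len: "length env = 15" by (simp add: env)
  have 1: "ok \<O> \<omega> B (t_mod (Lev 13) (Lev 5)) env"
    by (rule ok_simple[where N = B and b = b]) (use e b wb[of 7] in \<open>simp_all add: env del: vsize.simps\<close>)
  have 2: "ok \<O> \<omega> B (Loop (Op2 BMul (Lev 1) (Lev 1)) (Num 0) ?b) (?s # env)"
  proof -
    have "ok \<O> \<omega> B ?b (?e c)" if c: "c < k * k" for c
      by (rule ok_simple[where N = B and b = b])
        (use e s b c wb[of 27] at[of c] at[of "k * k"] at[OF order.trans[OF card[of c] less_imp_le[OF c]]] in \<open>simp_all add: len del: vsize.simps\<close>)
    then show ?thesis
      using at[of "k * k"] at[of 0] b n z
      by (simp add: len del: ev.simps(5) vsize.simps) (simp add: env)
  qed
  have 3: "ok \<O> \<omega> B (Bind (Op2 BAdd (Op2 BDiv (Lev 13) (Lev 5)) (Lev 16)) (t_not (t_mod (Lev 17) (Num 2))))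
      (?z # ?s # env)"
    by (rule ok_simple[where N = B and b = b])
      (use e s b wb[of 60] at[OF card[of "k * k"]] in \<open>simp_all add: len del: vsize.simps\<close>)
  show "ok \<O> \<omega> B t_sign env"
    using 1 2 3 unfolding t_sign_def by (simp only: ok.simps(6) md loop simp_thms)
qed

text \<open>Counting all maps into the host is enough: the answer then has at most
  \<open>N * (2 * m) + 1\<close> binary digits.\<close>

lemma trail_count_le:
  assumes "\<And>u v. E u v \<Longrightarrow> E v u" and N: "N = n * k * q + n * k * q * (n * k * q) * q"
  shows "trail_count E n k m cyc q S \<le> 2 ^ (N * (2 * m))"
proof -
  interpret subdivision "n * k * q" q "lift_adj E k S q" by (rule subdivision_lift_adj[OF assms(1)])
  have sz: "size = N" by (simp add: size_def N)
  have "trail_count E n k m cyc q S \<le> card ({0..<2 * m} \<rightarrow>\<^sub>E {0..<N})"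
    unfolding trail_count_def edge_inj_homs_def homs_def
    by (rule card_mono) (auto simp: finite_PiE host_def sz)
  also have "\<dots> = N ^ (2 * m)" by (simp add: card_PiE)
  also have "\<dots> \<le> 2 ^ (N * (2 * m))" by (rule power_le_two_power) simp
  finally show ?thesis .
qed

text \<open>The evaluation of one alternating sum, for an arbitrary graph \<open>E\<close>, so that
  it can be used for \<open>G\<close> and for the complete graph. \<open>L\<close> bounds all input
  quantities, including the number \<open>J * M\<close> of queries. A host has at most
  \<open>2 * L ^ 7\<close> vertices, so its matrix has size of order \<open>L ^ 14\<close>; the
  exponent 18 leaves room for constants.\<close>

locale extraction =
  fixes \<O> :: "val \<Rightarrow> val \<Rightarrow> bool" and \<omega> :: "val \<Rightarrow> val" and B L n k m J d M :: nat and cyc :: bool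
    and E :: "nat \<Rightarrow> nat \<Rightarrow> bool" and v0 :: val
  assumes E_sym: "E u v \<Longrightarrow> E v u" and k: "2 \<le> k" and m: "m = tour_len k" and J: "J = 2 * m + 2"
    and d: "d = k + (k choose 2)" and M: "M = 2 ^ (k * k)"
    and queries: "input_graph X \<Longrightarrow> \<O> (Node (encode_graph (pattern m cyc)) (encode_graph X))
        (\<omega> (Node (encode_graph (pattern m cyc)) (encode_graph X)))"
      "input_graph X \<Longrightarrow> \<omega> (Node (encode_graph (pattern m cyc)) (encode_graph X)) =
        Atom (card (edge_inj_homs (pattern m cyc) X))"
    and L: "100 \<le> L" "k * k \<le> L" "2 * m \<le> L" "J \<le> L" "d \<le> L" "M \<le> L" "J * M \<le> L" "n \<le> L" "vsize v0 \<le> L"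
    and B: "100 * L ^ 18 \<le> B" "weight t_host * L ^ 18 \<le> B"
begin

abbreviation "env \<equiv> [Atom n, mat n E, mat (2 * m) (pattern_adj m cyc), Atom (2 * m), Atom (fact J), Atom M,
  Atom d, Atom J, Atom m, Atom k, v0]"

abbreviation "summand r \<equiv> (J choose Suc (r div M)) * (fact J div Suc (r div M)) ^ d *
  trail_count E n k m cyc (Suc (r div M)) (set_decode (r mod M))"

text \<open>A constant factor up to 100 is paid for by one more power of \<open>L\<close>.\<close>

lemma L_le: "c * L ^ i \<le> L ^ j" if "c \<le> 100" "i < j"
proof -
  have "c * L ^ i \<le> L * L ^ i" using that L by (intro mult_right_mono) auto
  also have "\<dots> = L ^ Suc i" by simp
  also have "\<dots> \<le> L ^ j" using that L by (intro power_increasing) auto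
  finally show ?thesis .
qed

lemma B_le: "c * L ^ 18 \<le> B" if "c \<le> 100"
  using mult_le_mono1[OF that, of "L ^ 18"] B by linarith

lemma vsize_Atom_L:
  assumes "x \<le> 2 * L ^ 7"
  shows "vsize (Atom x) \<le> L ^ 18"
  using assms vsize_Atom_le[of x] L_le[of 2 7 8, simplified] L_le[of 2 8 18, simplified] L_le[of 1 0 8, simplified] by linarith

lemma vsize_mat_L: "x \<le> 2 * L ^ 7 \<Longrightarrow> x * (3 * x + 2) + 4 \<le> L ^ 18"
proof -
  assume x: "x \<le> 2 * L ^ 7"
  have 1: "1 \<le> L ^ 7" using L by simp
  have "3 * x + 2 \<le> 8 * L ^ 7" using x 1 by linarith
  with x have "x * (3 * x + 2) \<le> 2 * L ^ 7 * (8 * L ^ 7)" by (rule mult_le_mono)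
  also have "\<dots> = 16 * L ^ 14" by (simp flip: power_add)
  finally show ?thesis using L_le[of 20 14 18, simplified] one_le_power[of L 14] L by linarith
qed

lemma le_L7: "x \<le> L \<Longrightarrow> x \<le> 2 * L ^ 7"
  using L_le[of 1 1 7, simplified] by simp

lemma vsize_fact_J: "vsize (Atom (fact J)) \<le> L ^ 18"
proof -
  have "fact J < (2 :: nat) ^ Suc (J * J)" using fact_le_two_power[of J] by (rule le_less_trans) simp
  then have "vsize (Atom (fact J)) \<le> Suc (Suc (J * J))" by (rule vsize_Atom_pow)
  also have "\<dots> \<le> 4 * L ^ 2" using mult_le_mono[OF L(4) L(4)] one_le_power[of L 2] L(1) unfolding power2_eq_square by linarith
  finally show ?thesis using L_le[of 4 2 18, simplified] by linarith
qed

lemma vsize_env: "\<forall>v\<in>set env. vsize v \<le> L ^ 18"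
proof -
  have "m \<le> L" "k \<le> L" using L(2,3) k mult_le_mono1[of 1 k k] by linarith+
  then have "vsize (Atom x) \<le> L ^ 18" if "x \<in> {n, 2 * m, M, d, J, m, k}" for x
    using that L by (intro vsize_Atom_L le_L7) auto
  moreover have "vsize (mat x f) \<le> L ^ 18" if "x \<in> {n, 2 * m}" for x f
    using vsize_mat[of x f] vsize_mat_L[OF le_L7, of x] that L by fastforce
  moreover have "vsize v0 \<le> L ^ 18" using L L_le[of 1 1 18, simplified] by simp
  ultimately show ?thesis using vsize_fact_J by (simp del: vsize.simps)
qed

context
  fixes r q h N :: nat and acc :: val
  assumes r: "r < J * M" and q: "q = Suc (r div M)" and h: "h = n * k * q" and N: "N = h + h * h * q"
begin

abbreviation "S \<equiv> set_decode (r mod M)"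
abbreviation "env' \<equiv> [Atom r, acc, Atom (J * M)] @ env"
abbreviation "env4 \<equiv> [Atom N, Atom h, Atom (r mod M), Atom q] @ env'"

lemma bounds: "q \<le> L" "h \<le> L ^ 3" "N \<le> 2 * L ^ 7" "r \<le> L"
proof -
  have "r div M < J" using r by (simp add: less_mult_imp_div_less)
  then show q: "q \<le> L" using L(4) q by simp
  have "k \<le> L" using L(2) k mult_le_mono1[of 1 k k] by linarith
  then have "h \<le> L * L * L" unfolding h using q L by (intro mult_le_mono) auto
  then show h: "h \<le> L ^ 3" by (simp add: power3_eq_cube)
  have "h * h * q \<le> L ^ 3 * L ^ 3 * L" by (intro mult_le_mono q h)
  also have "\<dots> = L ^ (3 + 3 + 1)" by (simp only: power_add power_one_right)
  finally have "h * h * q \<le> L ^ 7" by simp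
  then show "N \<le> 2 * L ^ 7" using h L_le[of 1 3 7, simplified] N by simp
  show "r \<le> L" using r L(7) by simp
qed

lemma summand_lt: "summand r < 2 ^ Suc (J + J * J * d + N * (2 * m))"
proof -
  have "fact J div q \<le> 2 ^ (J * J)" using fact_le_two_power[of J] div_le_dividend[of "fact J" q] by linarith
  then have "(fact J div q) ^ d \<le> 2 ^ (J * J * d)" by (rule power_le_two_power)
  moreover have "trail_count E n k m cyc q S \<le> 2 ^ (N * (2 * m))"
    by (rule trail_count_le) (erule E_sym, simp add: N h)
  ultimately have "summand r \<le> 2 ^ J * 2 ^ (J * J * d) * 2 ^ (N * (2 * m))"
    unfolding q[symmetric] by (intro mult_le_mono binomial_le_two_power)
  then have "summand r \<le> 2 ^ (J + J * J * d + N * (2 * m))" by (simp only: power_add)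
  then show ?thesis by (rule le_less_trans) simp
qed

text \<open>The dominant term is \<open>N * (2 * m)\<close>, which is at most
  \<open>2 * L ^ 8\<close>.\<close>

lemma bits: "Suc (J + J * J * d + N * (2 * m)) \<le> L ^ 10"
proof -
  have "N * (2 * m) \<le> 2 * L ^ 7 * L" by (intro mult_le_mono bounds L)
  moreover have "J * J * d \<le> L * L * L" by (intro mult_le_mono L)
  moreover have "L * L * L = L ^ 3" "2 * L ^ 7 * L = 2 * L ^ 8" by (simp_all add: eval_nat_numeral add_mult_distrib)
  ultimately show ?thesis using L_le[of 6 8 10, simplified] L_le[of 1 3 8, simplified] L_le[of 1 1 8, simplified] L(1,4) L_le[of 1 0 8, simplified] by linarith
qed

lemma graph_body:
  assumes "i < N" "j < N"
  defines "inc \<equiv> subdivision.inc h q (lift_adj E k S q)"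
  shows "ev \<omega> t_host ([Atom j, Atom c, a, Atom N, Atom i, Atom d', b, Atom N] @ env4) = Atom (of_bool (inc i j \<or> inc j i))"
    and "simple \<omega> B t_host ([Atom j, Atom c, a, Atom N, Atom i, Atom d', b, Atom N] @ env4)"
proof -
  note 1 = ev_host[where env = "[Atom j, Atom c, a, Atom N, Atom i, Atom d', b, Atom N] @ env4" and i = i and j = j
    and n = n and k = k and q = q and s = "r mod M" and E = E, folded h, folded N, folded inc_def]
  show "ev \<omega> t_host ([Atom j, Atom c, a, Atom N, Atom i, Atom d', b, Atom N] @ env4) = Atom (of_bool (inc i j \<or> inc j i))"
    by (rule 1(1)) (erule E_sym | simp add: assms(1,2))+
  have "n \<le> B" "k * k \<le> B" using L L_le[of 1 1 18, simplified] B by simp_all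
  then show "simple \<omega> B t_host ([Atom j, Atom c, a, Atom N, Atom i, Atom d', b, Atom N] @ env4)"
    by - (rule 1(2); (erule E_sym | simp add: assms(1,2)))
qed

lemma ev_query:
  "ev \<omega> (Op2 BNode (Lev 8) (t_graph 17 t_host)) env4 =
    Node (encode_graph (pattern m cyc)) (encode_graph (subdivision.host h q (lift_adj E k S q)))"
proof -
  interpret subdivision h q "lift_adj E k S q" by (rule subdivision_lift_adj) (rule E_sym)
  have "encode_graph host = mat N (\<lambda>i j. inc i j \<or> inc j i)"
    by (rule encode_graph_mat) (simp add: host_def size_def N, simp add: edges_host size_def N)
  moreover have "ev \<omega> (t_graph 17 t_host) env4 = mat N (\<lambda>i j. inc i j \<or> inc j i)"
    by (rule ev_graph) (use graph_body(1) in simp_all)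
  ultimately show ?thesis by (simp add: encode_pattern)
qed

lemma ev_summand: "ev \<omega> t_summand env' = Atom (summand r)"
  and ok_summand: "vsize acc \<le> L ^ 18 \<Longrightarrow> ok \<O> \<omega> B t_summand env'"
proof -
  let ?X = "subdivision.host h q (lift_adj E k S q)"
  interpret subdivision h q "lift_adj E k S q" by (rule subdivision_lift_adj) (rule E_sym)
  note orc = queries[OF input_graph_host]
  have e1: "ev \<omega> (Op2 BAdd (Op2 BDiv (Lev 13) (Lev 5)) (Num 1)) env' = Atom q" by (simp add: q)
  have e2: "ev \<omega> (t_mod (Lev 13) (Lev 5)) (Atom q # env') = Atom (r mod M)" by (simp add: minus_div_mult_eq_mod)
  have e3: "ev \<omega> (Op2 BMul (Op2 BMul (Lev 10) (Lev 1)) (Lev 14)) (Atom (r mod M) # Atom q # env') = Atom h" by (simp add: h)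
  have e4: "ev \<omega> (Op2 BAdd (Lev 16) (Op2 BMul (Op2 BMul (Lev 16) (Lev 16)) (Lev 14)))
      (Atom h # Atom (r mod M) # Atom q # env') = Atom N" by (simp add: N)
  have C: "ev \<omega> (t_choose (Lev 3) (Lev 14)) env4 = Atom (J choose q)" by (rule ev_choose) simp_all
  have P: "ev \<omega> (t_pow (Op2 BDiv (Lev 6) (Lev 14)) (Lev 4)) env4 = Atom ((fact J div q) ^ d)"
    by (rule ev_pow) simp_all
  have A: "ev \<omega> (Ask (Op2 BNode (Lev 8) (t_graph 17 t_host))) env4 = Atom (trail_count E n k m cyc q S)"
    unfolding ev.simps(10) ev_query by (simp add: orc trail_count_def flip: h)
  show "ev \<omega> t_summand env' = Atom (summand r)"
    unfolding t_summand_def ev.simps(6) e1 e2 e3 e4 using C P A by (simp flip: q)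
  assume acc: "vsize acc \<le> L ^ 18"
  have sz: "vsize (Atom (J * M)) \<le> L ^ 18" "vsize (Atom r) \<le> L ^ 18" "vsize (Atom q) \<le> L ^ 18"
    "vsize (Atom (r mod M)) \<le> L ^ 18" "vsize (Atom h) \<le> L ^ 18" "vsize (Atom N) \<le> L ^ 18"
    by (rule vsize_Atom_L; use L bounds L_le[of 1 3 7, simplified] L_le[of 1 1 7, simplified] mod_less_eq_dividend[of r M] in linarith)+
  have env': "\<forall>v\<in>set env'. vsize v \<le> L ^ 18" using acc sz vsize_env by (simp del: vsize.simps)
  have env4: "\<forall>v\<in>set env4. vsize v \<le> L ^ 18" using sz env' by (simp del: vsize.simps)
  have L18: "4 \<le> L ^ 18" "L ^ 18 \<le> B" using L_le[of 4 0 18, simplified] B_le[of 1] by simp_all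
  have o1: "ok \<O> \<omega> B (Op2 BAdd (Op2 BDiv (Lev 13) (Lev 5)) (Num 1)) env'"
    by (rule ok_simple[where N = B, OF _ env' L18(1)]) (use B_le[of 6] in simp_all)
  have o2: "ok \<O> \<omega> B (t_mod (Lev 13) (Lev 5)) (Atom q # env')"
    by (rule ok_simple[where N = B and b = "L ^ 18"]) (use B_le[of 7] env' sz L18 in \<open>simp_all del: vsize.simps\<close>)
  have o3: "ok \<O> \<omega> B (Op2 BMul (Op2 BMul (Lev 10) (Lev 1)) (Lev 14)) (Atom (r mod M) # Atom q # env')"
    by (rule ok_simple[where N = B and b = "L ^ 18"]) (use B_le[of 5] env' sz L18 in \<open>simp_all del: vsize.simps\<close>)
  have o4: "ok \<O> \<omega> B (Op2 BAdd (Lev 16) (Op2 BMul (Op2 BMul (Lev 16) (Lev 16)) (Lev 14)))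
      (Atom h # Atom (r mod M) # Atom q # env')"
    by (rule ok_simple[where N = B and b = "L ^ 18"]) (use B_le[of 7] env' sz L18 in \<open>simp_all del: vsize.simps\<close>)
  note bits = bits[folded numeral_eq_Suc]
  have big: "x \<le> 50 * L ^ 10 \<Longrightarrow> x \<le> B" for x using L_le[of 50 10 18, simplified] L18 by linarith
  have Z: "fact J div q \<le> fact J" by (rule div_le_dividend)
  have oC: "ok \<O> \<omega> B (t_choose (Lev 3) (Lev 14)) env4"
  proof (rule ok_choose)
    show "2 * J + q + 6 \<le> B" using bounds(1) L(1,4) L_le[of 1 1 10, simplified] by (intro big) simp
  qed simp_all
  have oP: "ok \<O> \<omega> B (t_pow (Op2 BDiv (Lev 6) (Lev 14)) (Lev 4)) env4"
  proof (rule ok_pow)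
    show "fact J div q \<le> 2 ^ (J * J)" using Z fact_le_two_power[of J] by linarith
    have "(J * J + 1) * d \<le> J * J * d + L" using L(5) by simp
    then show "(J * J + 1) * d + 4 \<le> B" using bits L(1) L_le[of 1 1 10, simplified] by (intro big) simp
    show "ok \<O> \<omega> B (Op2 BDiv (Lev 6) (Lev 14)) (c # acc # Atom d # env4)" for c acc
      using vsize_fact_J vsize_Atom_mono[OF Z] L18 by (simp del: vsize.simps)
  qed simp_all
  have oG: "ok \<O> \<omega> B (t_graph 17 t_host) env4"
    by (rule ok_graph[where f = "\<lambda>i j. inc i j \<or> inc j i", OF _ _ _ _ env4 vsize_mat_L[OF bounds(3)] B(2)])
      (simp, simp, rule graph_body(1), assumption+, rule graph_body(2))
  have small: "vsize (Atom x) \<le> B" if "x \<le> 2 ^ (J + J * J * d + N * (2 * m))" for x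
  proof -
    have "x < 2 ^ Suc (J + J * J * d + N * (2 * m))" using that by (rule le_less_trans) simp
    then have "vsize (Atom x) \<le> Suc (Suc (J + J * J * d + N * (2 * m)))" by (rule vsize_Atom_pow)
    also have "\<dots> \<le> 50 * L ^ 10" using bits L_le[of 1 0 10, simplified] by linarith
    finally show ?thesis by (rule big)
  qed
  have t: "(J choose q) * (fact J div q) ^ d \<le> 2 ^ J * 2 ^ (J * J * d)"
    "trail_count E n k m cyc q S \<le> 2 ^ (N * (2 * m))"
  proof -
    have "fact J div q \<le> 2 ^ (J * J)" using Z fact_le_two_power[of J] by linarith
    then show "(J choose q) * (fact J div q) ^ d \<le> 2 ^ J * 2 ^ (J * J * d)"
      by (intro mult_le_mono binomial_le_two_power power_le_two_power)
    show "trail_count E n k m cyc q S \<le> 2 ^ (N * (2 * m))"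
      by (rule trail_count_le) (erule E_sym, simp add: N h)
  qed
  have oA: "ok \<O> \<omega> B (Ask (Op2 BNode (Lev 8) (t_graph 17 t_host))) env4"
  proof -
    have g: "ev \<omega> (t_graph 17 t_host) env4 = encode_graph ?X"
      using ev_query unfolding ev.simps(5) bval.simps val.inject by (rule conjunct2)
    have H: "ev \<omega> (Lev 8) env4 = encode_graph (pattern m cyc)" by (simp add: encode_pattern)
    have "encode_graph ?X = mat N (\<lambda>i j. inc i j \<or> inc j i)"
      by (rule encode_graph_mat) (simp add: host_def size_def N, simp add: edges_host size_def N)
    then have "vsize (encode_graph ?X) \<le> L ^ 18"
      using vsize_mat[of N "\<lambda>i j. inc i j \<or> inc j i"] vsize_mat_L[OF bounds(3)] by simp
    moreover have "vsize (encode_graph (pattern m cyc)) \<le> L ^ 18" using vsize_env by (simp add: encode_pattern)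
    ultimately have "vsize (Node (encode_graph (pattern m cyc)) (encode_graph ?X)) \<le> B"
      using L18(1) B_le[of 3] by simp
    moreover have "vsize (Atom (card (edge_inj_homs (pattern m cyc) ?X))) \<le> B"
      using order.trans[OF t(2) power_increasing[OF le_add2]]
      by (intro small) (simp add: trail_count_def flip: h)
    ultimately show ?thesis
      unfolding ok.simps(10) ev_query ok.simps(5) bval.simps g H
      using orc oG by (simp del: vsize.simps)
  qed
  have "(J choose q) * (fact J div q) ^ d * trail_count E n k m cyc q S \<le>
      2 ^ J * 2 ^ (J * J * d) * 2 ^ (N * (2 * m))" by (intro mult_le_mono t)
  then have "vsize (Atom ((J choose q) * (fact J div q) ^ d * trail_count E n k m cyc q S)) \<le> B"
    by (intro small) (simp add: power_add)
  moreover have "vsize (Atom ((J choose q) * (fact J div q) ^ d)) \<le> B"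
  proof (rule small)
    show "(J choose q) * (fact J div q) ^ d \<le> 2 ^ (J + J * J * d + N * (2 * m))"
      using t(1) mult_le_mono[OF t(1) one_le_power[of "2 :: nat" "N * (2 * m)"]] by (simp add: power_add)
  qed
  ultimately have "ok \<O> \<omega> B (Op2 BMul (Op2 BMul (t_choose (Lev 3) (Lev 14)) (t_pow (Op2 BDiv (Lev 6) (Lev 14)) (Lev 4)))
      (Ask (Op2 BNode (Lev 8) (t_graph 17 t_host)))) env4"
    unfolding ok.simps(5) ev.simps(5) bval.simps C P A the_num.simps using oC oP oA by simp
  then show "ok \<O> \<omega> B t_summand env'"
    unfolding t_summand_def ok.simps(6) e1 e2 e3 e4 using o1 o2 o3 o4 by simp
qed

end

abbreviation "sign r \<equiv> even (r div M + card ({..<k * k} - set_decode (r mod M)))"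

lemma ev_value: "ev \<omega> t_value env = Atom (nat \<bar>clique_const k cyc * int (card (ordered_cliques E n k))\<bar>)"
  and ok_value: "ok \<O> \<omega> B t_value env"
proof -
  have n: "ev \<omega> (Op2 BMul (Lev 3) (Lev 5)) env = Atom (J * M)" by simp
  have x: "ev \<omega> t_summand (Atom c # acc # Atom (J * M) # env) = Atom (summand c)" if "c < J * M" for c acc
    using ev_summand[OF that refl refl refl, of acc] by simp
  have s: "ev \<omega> t_sign (v # Atom c # acc # Atom (J * M) # env) = Atom (of_bool (sign c))" for v c acc
    by (rule ev_sign(1)) simp
  have "(\<Sum>r<J * M. if sign r then int (summand r) else - int (summand r)) =
      clique_const k cyc * int (card (ordered_cliques E n k))"
    by (rule clique_extraction_loop[OF k _ m J d M refl refl]) (erule E_sym)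
  then show "ev \<omega> t_value env = Atom (nat \<bar>clique_const k cyc * int (card (ordered_cliques E n k))\<bar>)"
    using ev_alt[where s = t_sign and f = summand and \<sigma> = sign, OF n x s] by (simp only: t_value_def)
  have pow: "L \<le> L ^ 10" "12 * L ^ 10 \<le> L ^ 18" "1 \<le> L ^ 10" "4 \<le> L ^ 18" "L ^ 18 \<le> B" "5 * L ^ 18 \<le> B"
    using L_le[of 1 1 10] L_le[of 12 10 18] L_le[of 1 0 10] L_le[of 4 0 18] B_le[of 1] B_le[of 5] by simp_all
  have acc: "vsize acc \<le> L ^ 18" if "vsize acc \<le> 2 * (J * M + L ^ 10) + 3" for acc
    using that pow L(7) by simp
  show "ok \<O> \<omega> B t_value env"
    unfolding t_value_def
  proof (rule ok_alt[OF n _ x s])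
    show "ok \<O> \<omega> B (Op2 BMul (Lev 3) (Lev 5)) env"
      by (rule ok_simple[OF _ vsize_env pow(4)]) (use pow in simp_all)
    show "4 * (J * M + L ^ 10) + 6 \<le> B" using L(7) pow by simp
    show "summand c < 2 ^ L ^ 10" if c: "c < J * M" for c
      using summand_lt[OF c refl refl refl]
        power_increasing[OF bits[OF c refl refl refl], of "2 :: nat"] by linarith
    fix c acc assume c: "c < J * M" and a: "vsize acc \<le> 2 * (J * M + L ^ 10) + 3"
    show "ok \<O> \<omega> B t_summand (Atom c # acc # Atom (J * M) # env)"
      using ok_summand[OF c refl refl refl acc[OF a]] by simp
    fix v assume v: "vsize v \<le> Suc (L ^ 10)"
    show "ok \<O> \<omega> B t_sign (v # Atom c # acc # Atom (J * M) # env)"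
    proof (rule ev_sign(2)[OF refl])
      have "vsize (Atom c) \<le> L ^ 18" "vsize (Atom (J * M)) \<le> L ^ 18"
        using c L by (intro vsize_Atom_L le_L7; simp)+
      moreover have "vsize v \<le> L ^ 18" using v pow by linarith
      ultimately show "\<forall>v\<in>set (v # Atom c # acc # Atom (J * M) # env). vsize v \<le> L ^ 18"
        using vsize_env acc[OF a] by (simp del: vsize.simps)
      show "k * k + 4 \<le> L ^ 18" using L(1,2) pow by linarith
      show "100 * L ^ 18 \<le> B" by (rule B)
    qed
  qed
qed

end

text \<open>Dividend and divisor are the same sum, for \<open>G\<close> and for the complete graph
  on \<open>k\<close> vertices. Each branch first pushes a matrix and its dimension, so
  \<open>t_value\<close> finds them at levels 9 and 10 in both. The divisor counts
  \<open>fact k\<close> ordered cliques, so the quotient counts unordered ones.\<close>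

definition t_main :: "bool \<Rightarrow> ftm" where
  "t_main cyc =
    Bind (Op2 BAdd (Op2 BMul (Num 2) (Op2 BSub (Lev 1) (Num 1)))
      (Op2 BMul (Num 3) (Op2 BMul (Op2 BSub (Lev 1) (Num 1)) (Op2 BSub (Lev 1) (Num 2))))) (
    Bind (Op2 BAdd (Op2 BMul (Num 2) (Lev 2)) (Num 2)) (
    Bind (Op2 BAdd (Lev 1) (Op2 BDiv (Op2 BMul (Lev 1) (Op2 BSub (Lev 1) (Num 1))) (Num 2))) (
    Bind (t_pow (Num 2) (Op2 BMul (Lev 1) (Lev 1))) (
    Bind (t_fact (Lev 3)) (
    Bind (Op2 BMul (Num 2) (Lev 2)) (
    Bind (t_graph 7 (t_pattern cyc)) (
    Op2 BDiv
      (Bind (Op1 ULeft (Lev 0)) (Bind (Len (Lev 9)) t_value))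
      (Bind (t_graph 1 (t_not (t_eq 12 16))) (Bind (Lev 1) t_value)))))))))"

text \<open>The extraction works for \<open>2 \<le> k\<close>. Below that, the answer is 1 for
  \<open>k = 0\<close> and the number of vertices, read off as the number of matrix rows, for
  \<open>k = 1\<close>.\<close>

definition t_hard :: "bool \<Rightarrow> ftm" where
  "t_hard cyc = Bind (Op1 URight (Lev 0)) (Cond (Op2 BLess (Lev 1) (Num 2))
     (Cond (Lev 1) (Len (Op1 ULeft (Lev 0))) (Num 1)) (t_main cyc))"

lemma card_ordered_cliques_complete: "card (ordered_cliques (\<noteq>) k k) = fact k"
proof -
  let ?K = "adj_graph k (\<noteq>)"
  have e: "{u, v} \<in> edges ?K \<longleftrightarrow> u \<noteq> v" if "u < k" "v < k" for u v
    by (rule adj_graph_edge[OF _ that]) simp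
  have "ordered_cliques (\<noteq>) k k = ordered_cliques (\<lambda>u v. {u, v} \<in> edges ?K) k k"
    unfolding ordered_cliques_def
  proof (rule Collect_cong, rule conj_cong[OF refl])
    fix v assume "v \<in> {..<k} \<rightarrow>\<^sub>E {..<k}"
    then have "v i < k" if "i < k" for i using that by auto
    then show "(\<forall>i<k. \<forall>j<k. i \<noteq> j \<longrightarrow> v i \<noteq> v j) \<longleftrightarrow> (\<forall>i<k. \<forall>j<k. i \<noteq> j \<longrightarrow> {v i, v j} \<in> edges ?K)"
      using e by simp
  qed
  moreover have "card (ordered_cliques (\<lambda>u v. {u, v} \<in> edges ?K) k k) = fact k * card (cliques k ?K)"
    by (rule card_ordered_cliques) auto
  moreover have "cliques k ?K = {{0..<k}}"
  proof (intro equalityI subsetI)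
    fix S assume "S \<in> cliques k ?K"
    then have "S \<subseteq> {0..<k}" "card S = k" by (auto simp: cliques_def)
    then have "S = {0..<k}" by (intro card_subset_eq) auto
    then show "S \<in> {{0..<k}}" by simp
  next
    fix S assume "S \<in> {{0..<k}}"
    then show "S \<in> cliques k ?K" using e by (auto simp del: adj_graph_simps(2) simp: cliques_def)
  qed
  ultimately show ?thesis by simp
qed

lemma (in extraction) t_main_correct:
  assumes v0: "v0 = Node (mat n E) (Atom k)"
  shows "ev \<omega> (t_main cyc) [Atom k, v0] = Atom (card (ordered_cliques E n k) div fact k)"
    and "ok \<O> \<omega> B (t_main cyc) [Atom k, v0]"
proof -
  have kL: "k \<le> L" using L(2) k mult_le_mono1[of 1 k k] by linarith
  \<comment> \<open>The same pattern, bounds and oracle serve for the complete graph, whose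
    dimension \<open>k\<close> is at most \<open>L\<close>.\<close>
  interpret K: extraction \<O> \<omega> B L k k m J d M cyc "(\<noteq>)" v0
    by unfold_locales (use k m J d M queries L B kL in auto)
  let ?H = "mat (2 * m) (pattern_adj m cyc)"
  let ?e' = "[Atom (2 * m), Atom (fact J), Atom M, Atom d, Atom J, Atom m, Atom k, v0]"
  let ?e = "?H # ?e'"
  let ?c = "clique_const k cyc"
  let ?t1 = "Op2 BAdd (Op2 BMul (Num 2) (Op2 BSub (Lev 1) (Num 1)))
      (Op2 BMul (Num 3) (Op2 BMul (Op2 BSub (Lev 1) (Num 1)) (Op2 BSub (Lev 1) (Num 2))))"
  let ?t2 = "Op2 BAdd (Op2 BMul (Num 2) (Lev 2)) (Num 2)"
  let ?t3 = "Op2 BAdd (Lev 1) (Op2 BDiv (Op2 BMul (Lev 1) (Op2 BSub (Lev 1) (Num 1))) (Num 2))"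
  let ?t4 = "t_pow (Num 2) (Op2 BMul (Lev 1) (Lev 1))"
  let ?t6 = "Op2 BMul (Num 2) (Lev 2)"
  let ?p = "Bind (Op1 ULeft (Lev 0)) (Bind (Len (Lev 9)) t_value)"
  let ?r = "Bind (t_graph 1 (t_not (t_eq 12 16))) (Bind (Lev 1) t_value)"
  have e1: "ev \<omega> ?t1 [Atom k, v0] = Atom m" by (simp add: m tour_len_def)
  have e2: "ev \<omega> ?t2 [Atom m, Atom k, v0] = Atom J" by (simp add: J)
  have e3: "ev \<omega> ?t3 [Atom J, Atom m, Atom k, v0] = Atom d" by (simp add: d choose_two)
  have e4: "ev \<omega> ?t4 [Atom d, Atom J, Atom m, Atom k, v0] = Atom M" unfolding M by (rule ev_pow) simp_all
  have e5: "ev \<omega> (t_fact (Lev 3)) [Atom M, Atom d, Atom J, Atom m, Atom k, v0] = Atom (fact J)" by (rule ev_fact) simp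
  have e6: "ev \<omega> ?t6 [Atom (fact J), Atom M, Atom d, Atom J, Atom m, Atom k, v0] = Atom (2 * m)" by simp
  have pt: "ev \<omega> (t_pattern cyc) ([Atom j, Atom c, a, Atom (2 * m), Atom i, Atom d', b, Atom (2 * m)] @ ?e') =
      Atom (of_bool (pattern_adj m cyc i j))" for i j c d' a b
    by (rule ev_t_pattern) simp_all
  have e7: "ev \<omega> (t_graph 7 (t_pattern cyc)) ?e' = ?H"
    by (rule ev_graph[OF _ _ pt]) simp_all
  have kt: "ev \<omega> (t_not (t_eq 12 16)) ([Atom j, Atom c, a, Atom k, Atom i, Atom d', b, Atom k] @ ?e) =
      Atom (of_bool (i \<noteq> j))" for i j c d' a b
    by simp
  have e8: "ev \<omega> (t_graph 1 (t_not (t_eq 12 16))) ?e = mat k (\<noteq>)"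
    by (rule ev_graph[OF _ _ kt]) simp_all
  have e: "ev \<omega> ?p ?e = Atom (nat \<bar>?c * int (card (ordered_cliques E n k))\<bar>)"
      "ev \<omega> ?r ?e = Atom (nat \<bar>?c * int (fact k)\<bar>)"
    using ev_value K.ev_value e8 by (simp_all add: v0 card_ordered_cliques_complete)
  \<comment> \<open>The common factor cancels from the quotient without ever being computed; this is
    where its being nonzero enters.\<close>
  have "nat \<bar>?c\<bar> \<noteq> 0" using clique_const_nonzero[OF k] by simp
  then have div: "nat \<bar>?c * int x\<bar> div nat \<bar>?c * int y\<bar> = x div y" for x y
    by (simp add: abs_mult nat_mult_distrib)
  show "ev \<omega> (t_main cyc) [Atom k, v0] = Atom (card (ordered_cliques E n k) div fact k)"
    unfolding t_main_def ev.simps(6) e1 e2 e3 e4 e5 e6 e7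
    by (simp only: ev.simps(5) e bval.simps the_num.simps div)
  have env: "\<forall>v\<in>set ?e. vsize v \<le> L ^ 18" using vsize_env by (simp del: vsize.simps)
  note simple = ok_simple[where N = B and b = "L ^ 18"]
  have b: "4 \<le> L ^ 18" using L_le[of 4 0 18] by simp
  have big: "x \<le> 50 * L ^ 10 \<Longrightarrow> x \<le> B" for x using L_le[of 50 10 18] B_le[of 1] by simp
  have L2: "L * L \<le> L ^ 10" using L_le[of 1 2 10] by (simp add: power2_eq_square)
  have L1: "100 \<le> L ^ 10" "L \<le> L ^ 10" using L_le[of 100 0 10] L_le[of 1 1 10] by simp_all
  have o1: "ok \<O> \<omega> B ?t1 [Atom k, v0]"
    by (rule simple) (use env b B_le[of 30] in \<open>simp_all del: vsize.simps\<close>)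
  have o2: "ok \<O> \<omega> B ?t2 [Atom m, Atom k, v0]"
    by (rule simple) (use env b B_le[of 30] in \<open>simp_all del: vsize.simps\<close>)
  have o3: "ok \<O> \<omega> B ?t3 [Atom J, Atom m, Atom k, v0]"
    by (rule simple) (use env b B_le[of 30] in \<open>simp_all del: vsize.simps\<close>)
  have o4: "ok \<O> \<omega> B ?t4 [Atom d, Atom J, Atom m, Atom k, v0]"
  proof (rule ok_pow)
    show "ev \<omega> (Op2 BMul (Lev 1) (Lev 1)) [Atom d, Atom J, Atom m, Atom k, v0] = Atom (k * k)" by simp
    show "ok \<O> \<omega> B (Op2 BMul (Lev 1) (Lev 1)) [Atom d, Atom J, Atom m, Atom k, v0]"
      by (rule simple) (use env b B_le[of 30] in \<open>simp_all del: vsize.simps\<close>)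
    show "(2 :: nat) \<le> 2 ^ 1" by simp
    show "(1 + 1) * (k * k) + 4 \<le> B" using L(2) L1 by (intro big) simp
    show "ok \<O> \<omega> B (Num 2) env" for env using vsize_Atom_le[of 2] big[of 3] L1 by simp
  qed simp_all
  have o5: "ok \<O> \<omega> B (t_fact (Lev 3)) [Atom M, Atom d, Atom J, Atom m, Atom k, v0]"
  proof (rule ok_fact)
    show "J * J + J + 4 \<le> B" using mult_le_mono[OF L(4) L(4)] L(4) L1 L2 by (intro big) simp
  qed simp_all
  have o6: "ok \<O> \<omega> B ?t6 [Atom (fact J), Atom M, Atom d, Atom J, Atom m, Atom k, v0]"
    by (rule simple) (use env b B_le[of 30] in \<open>simp_all del: vsize.simps\<close>)
  have o7: "ok \<O> \<omega> B (t_graph 7 (t_pattern cyc)) ?e'"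
  proof (rule ok_graph[OF _ _ pt])
    show "simple \<omega> B (t_pattern cyc) ([Atom j, Atom c, a, Atom (2 * m), Atom i, Atom d', b, Atom (2 * m)] @ ?e')"
      for i j c d' a b by (rule simple_t_pattern) simp
    show "\<forall>v\<in>set ?e'. vsize v \<le> L ^ 18" using env by (simp del: vsize.simps)
    show "2 * m * (3 * (2 * m) + 2) + 4 \<le> L ^ 18" by (rule vsize_mat_L[OF le_L7[OF L(3)]])
    have "weight (t_pattern cyc) \<le> 100" unfolding t_pattern_def by simp
    then show "weight (t_pattern cyc) * L ^ 18 \<le> B" by (rule B_le)
  qed simp_all
  have o8: "ok \<O> \<omega> B (t_graph 1 (t_not (t_eq 12 16))) ?e"
  proof (rule ok_graph[OF _ _ kt])
    show "\<forall>v\<in>set ?e. vsize v \<le> L ^ 18" by (rule env)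
    show "k * (3 * k + 2) + 4 \<le> L ^ 18" by (rule vsize_mat_L[OF le_L7[OF kL]])
    show "weight (t_not (t_eq 12 16)) * L ^ 18 \<le> B" by (rule B_le) simp
  qed simp_all
  have "ok \<O> \<omega> B ?p ?e" using ok_value by (simp add: v0)
  moreover have "ok \<O> \<omega> B ?r ?e" using K.ok_value o8 e8 by simp
  moreover have "vsize (Atom (card (ordered_cliques E n k) div fact k)) \<le> B"
  proof -
    have "card (ordered_cliques E n k) \<le> card ({..<k} \<rightarrow>\<^sub>E {..<n})"
      unfolding ordered_cliques_def by (rule card_mono) (auto simp: finite_PiE)
    also have "\<dots> = n ^ k" by (simp add: card_PiE)
    also have "\<dots> \<le> 2 ^ (n * k)" by (rule power_le_two_power) simp
    finally have "card (ordered_cliques E n k) div fact k \<le> 2 ^ (n * k)" using div_le_dividend order.trans by blast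
    then have "card (ordered_cliques E n k) div fact k < 2 ^ Suc (n * k)" by (rule le_less_trans) simp
    then have "vsize (Atom (card (ordered_cliques E n k) div fact k)) \<le> Suc (Suc (n * k))" by (rule vsize_Atom_pow)
    also have "\<dots> \<le> B" using mult_le_mono[OF L(8) kL] L1 L2 by (intro big) simp
    finally show ?thesis .
  qed
  ultimately have "ok \<O> \<omega> B (Op2 BDiv ?p ?r) ?e"
    unfolding ok.simps(5) e bval.simps the_num.simps div by simp
  then show "ok \<O> \<omega> B (t_main cyc) [Atom k, v0]"
    unfolding t_main_def ok.simps(6) e1 e2 e3 e4 e5 e6
    using o1 o2 o3 o4 o5 o6 o7 e7 by simp
qed

lemma computable_tour_len: "computable (\<lambda>k. 2 * tour_len k)"
  by (rule computable_term[of "Op2 BMul (Num 2) (Op2 BAdd (Op2 BMul (Num 2) (Op2 BSub (Lev 0) (Num 1)))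
      (Op2 BMul (Num 3) (Op2 BMul (Op2 BSub (Lev 0) (Num 1)) (Op2 BSub (Lev 0) (Num 2)))))"])
    (simp_all add: tour_len_def)

text \<open>The factor of the running time that depends on \<open>k\<close>: the bound
  \<open>B\<close> of the reduction without the powers of the input size, raised to the exponent of
  the program.\<close>

lemma computable_time_bound: "computable (\<lambda>k. (W * (100 * (k + 1) ^ 2 * 2 ^ (k * k)) ^ 18) ^ e)"
proof (rule computable_term)
  let ?k = "Op2 BAdd (Lev 0) (Num 1)"
  let ?L = "Op2 BMul (Op2 BMul (Num 100) (Op2 BMul ?k ?k)) (t_pow (Num 2) (Op2 BMul (Lev 0) (Lev 0)))"
  let ?t = "t_pow (Op2 BMul (Num W) (t_pow ?L (Num 18))) (Num e)"
  show "scoped 1 ?t" by (simp add: t_pow_def)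
  fix k
  have p: "ev \<omega> (t_pow (Num 2) (Op2 BMul (Lev 0) (Lev 0))) env = Atom (2 ^ (k * k))"
    if "env \<noteq> []" "last env = Atom k" for \<omega> env
    using that by (intro ev_pow) (simp_all add: rev_nth last_conv_nth)
  have L: "ev \<omega> ?L env = Atom (100 * (k + 1) ^ 2 * 2 ^ (k * k))" if "env \<noteq> []" "last env = Atom k" for \<omega> env
    using p[OF that] that by (simp add: rev_nth last_conv_nth power2_eq_square)
  have "ev \<omega> (t_pow ?L (Num 18)) env = Atom ((100 * (k + 1) ^ 2 * 2 ^ (k * k)) ^ 18)"
    if "env \<noteq> []" "last env = Atom k" for \<omega> env
    by (rule ev_pow) (simp, rule L, use that in simp_all)
  then show "ev (\<lambda>_. Atom 0) ?t [Atom k] = Atom ((W * (100 * (k + 1) ^ 2 * 2 ^ (k * k)) ^ 18) ^ e)"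
    by (intro ev_pow) simp_all
qed

text \<open>All queries for a given \<open>k\<close> use the one pattern with
  \<open>2 * tour_len k\<close> vertices, which bounds their parameter. The number of queries and
  the factor \<open>2 ^ (k * k)\<close> depend on \<open>k\<close> alone.\<close>

theorem count_edge_inj_sharp_W1_hard:
  assumes pattern: "\<And>m. 2 \<le> m \<Longrightarrow> pattern m cyc \<in> \<H>"
  shows "sharp_W1_hard (count_edge_inj \<H>)"
  unfolding sharp_W1_hard_def fpt_turing_reducible_def
proof (rule exI, rule exI, rule exI, rule exI, intro conjI ballI)
  let ?e = "expo (t_hard cyc) + 1" and ?W = "weight t_host + 100"
  let ?f = "\<lambda>k. (?W * (100 * (k + 1) ^ 2 * 2 ^ (k * k)) ^ 18) ^ ?e"
  show "computable ?f" by (rule computable_time_bound)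
  show "computable (\<lambda>k. 2 * tour_len k)" by (rule computable_tour_len)
  fix x assume "x \<in> instances count_cliques"
  then obtain G k where x: "x = (G, k)" "input_graph G" by (auto simp: count_cliques_def)
  obtain n where G: "verts G = {0..<n}" "edges G \<subseteq> {{u, v} |u v. u < n \<and> v < n \<and> u \<noteq> v}"
    "encode_graph G = mat n (\<lambda>i j. {i, j} \<in> edges G)" using x(2) by (rule input_graphE)
  define E where "E = (\<lambda>i j. {i, j} \<in> edges G)"
  define v where "v = Node (mat n E) (Atom k)"
  define \<O> where "\<O> = oracle_for (count_edge_inj \<H>) (2 * tour_len k)"
  define \<omega> where "\<omega> = (\<lambda>v. SOME a. \<O> v a)"
  \<comment> \<open>The factor in \<open>k\<close> dominates \<open>J * M\<close>, because
    \<open>tour_len k \<le> 3 * (k * k)\<close> gives \<open>J \<le> 10 * (k + 1) ^ 2\<close>; the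
    input size covers \<open>n\<close>.\<close>
  define L where "L = 100 * (k + 1) ^ 2 * 2 ^ (k * k) * vsize v"
  define B where "B = ?W * L ^ 18"
  have s: "1 \<le> vsize v" by (rule vsize_pos)
  have L1: "100 * (k + 1) ^ 2 * 2 ^ (k * k) \<le> L" using s unfolding L_def by simp
  have kk: "100 * (k + 1) ^ 2 \<le> L" using order.trans[OF _ L1, of "100 * (k + 1) ^ 2"] by simp
  have L100: "100 \<le> L" using kk one_le_power[of "k + 1" 2] by linarith
  have vL: "vsize v \<le> L" unfolding L_def by simp
  have L18: "L \<le> L ^ 18" using L100 by (intro self_le_power) auto
  have B100: "100 * L ^ 18 \<le> B" "weight t_host * L ^ 18 \<le> B" unfolding B_def by simp_all
  have irr: "{u} \<notin> edges G" for u using G(2) by (auto simp: doubleton_eq_iff)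
  have "ev \<omega> (t_hard cyc) [v] = Atom (card (cliques k G)) \<and> ok \<O> \<omega> B (t_hard cyc) [v]"
  proof (cases "k < 2")
    case True
    have 2: "vsize (Atom y) \<le> B" if "y \<le> 2" for y
      using vsize_Atom_le[of y] that L100 L18 B100 by linarith
    have "cliques 1 G = (\<lambda>u. {u}) ` {0..<n}" by (auto simp: cliques_def G(1) card_1_singleton_iff)
    then have c1: "card (cliques 1 G) = n" by (simp add: card_image)
    have "cliques 0 G = {{}}" by (auto simp: cliques_def G(1) dest: finite_subset)
    then have c0: "card (cliques 0 G) = 1" by simp
    from True consider "k = 0" | "k = 1" by linarith
    then show ?thesis
      using c0 c1 2 by cases (simp_all add: t_hard_def v_def del: vsize.simps)
  next
    case False
    then have k: "2 \<le> k" by simp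
    let ?m = "tour_len k" let ?H = "pattern ?m cyc"
    have H: "?H \<in> \<H>" "input_graph ?H"
      using tour_len_ge[OF k] by (auto intro: pattern input_graph_pattern)
    \<comment> \<open>The encoding of input graphs is injective, so a query determines its instance
      and the choice in \<open>\<omega>\<close> yields the intended count.\<close>
    have det: "\<O> (Node (encode_graph ?H) (encode_graph X)) a \<longleftrightarrow> a = Atom (card (edge_inj_homs ?H X))"
      if X: "input_graph X" for X a
    proof
      assume "\<O> (Node (encode_graph ?H) (encode_graph X)) a"
      then obtain H' X' where y: "input_graph H'" "input_graph X'" "encode_graph ?H = encode_graph H'"
        "encode_graph X = encode_graph X'" "a = Atom (card (edge_inj_homs H' X'))"
        by (auto simp: \<O>_def oracle_for_def count_edge_inj_def)
      have "?H = H'" "X = X'"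
        using inj_onD[OF inj_on_encode_graph y(3)] inj_onD[OF inj_on_encode_graph y(4)] y H X by auto
      then show "a = Atom (card (edge_inj_homs ?H X))" using y by simp
    next
      assume "a = Atom (card (edge_inj_homs ?H X))"
      then show "\<O> (Node (encode_graph ?H) (encode_graph X)) a"
        unfolding \<O>_def oracle_for_def using H X
        by (intro bexI[of _ "(?H, X)"]) (simp_all add: count_edge_inj_def)
    qed
    have \<omega>: "\<omega> (Node (encode_graph ?H) (encode_graph X)) = Atom (card (edge_inj_homs ?H X))"
      if "input_graph X" for X
      unfolding \<omega>_def det[OF that] by simp
    let ?J = "2 * ?m + 2" and ?d = "k + (k choose 2)" and ?M = "2 ^ (k * k) :: nat"
    have ks: "(k + 1) ^ 2 = k * k + 2 * k + 1" by (simp add: power2_eq_square)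
    have m: "?m \<le> 3 * (k * k)"
    proof -
      obtain i where "k = i + 2" using k by (metis le_add_diff_inverse2)
      then have "(k - 1) * (k - 2) + 2 * (k - 1) = (k - 1) * k" by (simp add: algebra_simps)
      then have "?m \<le> 3 * ((k - 1) * k)" unfolding tour_len_def by linarith
      also have "\<dots> \<le> 3 * (k * k)" by simp
      finally show ?thesis .
    qed
    then have J: "?J \<le> 10 * (k + 1) ^ 2" unfolding ks by simp
    have d: "?d \<le> k + k * k"
      using div_le_dividend[of "k * (k - 1)" 2] mult_le_mono2[OF diff_le_self[of k 1], of k]
      unfolding choose_two by linarith
    have JM: "?J * ?M \<le> 10 * (k + 1) ^ 2 * ?M" using J by (rule mult_le_mono1)
    interpret extraction \<O> \<omega> B L n k ?m ?J ?d ?M cyc E v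
    proof
      show "E u w \<Longrightarrow> E w u" for u w by (simp add: E_def insert_commute)
      show "?M \<le> L" using order.trans[OF _ L1, of ?M] by simp
      show "?J * ?M \<le> L" using order.trans[OF JM order.trans[OF _ L1]] by simp
      show "n \<le> L" using le_vsize_mat[of n E] vL by (simp add: v_def)
    qed (use k \<omega> det L100 vL B100 J m d kk ks in simp_all)
    have "ev \<omega> (t_main cyc) [Atom k, v] = Atom (card (cliques k G))"
      using t_main_correct(1)[OF v_def] card_ordered_cliques[OF _ G(1) irr, of k] by (simp add: G(1) flip: E_def)
    moreover have "vsize (Atom 2) \<le> B" "vsize (Atom 0) \<le> B"
      using vsize_Atom_le[of 2] vsize_Atom_le[of 0] L100 L18 B100 by linarith+
    ultimately show ?thesis
      using t_main_correct(2)[OF v_def] k by (simp add: t_hard_def v_def del: vsize.simps)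
  qed
  then have run: "ev \<omega> (t_hard cyc) [v] = Atom (card (cliques k G))" and ok: "ok \<O> \<omega> B (t_hard cyc) [v]" by simp_all
  have "vsize v \<le> B" "16 \<le> B" using vL L100 L18 B100 by linarith+
  then obtain T where "T \<le> B ^ ?e" "runs \<O> (prog (t_hard cyc)) v (ev \<omega> (t_hard cyc) [v]) T"
    using runs_prog[OF ok] by blast
  moreover have "B ^ ?e = ?f k * vsize v ^ (18 * ?e)"
    unfolding B_def L_def by (simp only: power_mult_distrib power_mult mult.assoc)
  moreover have "encode count_cliques x = v" "param count_cliques x = k" "solution count_cliques x = card (cliques k G)"
    by (simp_all add: x count_cliques_def v_def E_def G(3))
  ultimately show "\<exists>t\<le>?f (param count_cliques x) * vsize (encode count_cliques x) ^ (18 * ?e).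
      runs (oracle_for (count_edge_inj \<H>) (2 * tour_len (param count_cliques x))) (prog (t_hard cyc))
        (encode count_cliques x) (Atom (solution count_cliques x)) t"
    unfolding run by (auto simp: \<O>_def)
qed

theorem theorem5:
  shows "sharp_W1_complete (count_edge_inj {H. is_path H}) \<and>
         sharp_W1_complete (count_edge_inj {H. is_cycle H})"
  unfolding sharp_W1_complete_def
proof (intro conjI)
  show "in_sharp_W1 (count_edge_inj {H. is_path H})"
    by (rule count_edge_inj_in_sharp_W1) (auto simp: is_path_def)
  show "in_sharp_W1 (count_edge_inj {H. is_cycle H})"
    by (rule count_edge_inj_in_sharp_W1) (auto simp: is_cycle_def)
  show "sharp_W1_hard (count_edge_inj {H. is_path H})"
    by (rule count_edge_inj_sharp_W1_hard[of False]) (auto intro: is_path_pattern)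
  show "sharp_W1_hard (count_edge_inj {H. is_cycle H})"
    by (rule count_edge_inj_sharp_W1_hard[of True]) (auto intro: is_cycle_pattern)
qed

end
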